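(* Let $n\ge2$ and let $\Omega\subset\mathbb{R}^n$ be a bounded Lipschitz domain with boundary $\Gamma$. Then for $0<s<1$ and $0<p,q\le\infty$, $$\operatorname{Tr}\mathbf{B}^{s+\frac1p}_{p,q}(\Omega)=\mathbf{B}^s_{p,q}(\Gamma).$$
   Context: Notation: $\mathbb{N}_0=\{0,1,2,\dots\}$. For $j\in\mathbb{N}_0$, $m\in\mathbb{Z}^n$, $Q_{j,m}$ is the cube in $\mathbb{R}^n$ with sides parallel to the axes, centre $2^{-j}m$, side length $2^{-j+1}$; $dQ_{j,m}$ is the concentric cube with side length $d$ times as large. $[s]$ is the integer part of $s$. Besov spaces on domains. Let $\Omega\subset\mathbb{R}^n$ be a domain ($\Omega=\mathbb{R}^n$ allowed), $s>0$, $0<p,q\le\infty$. For complex $\lambda=\{\lambda_{j,m}\}$ put $\|\lambda|b^s_{p,q}(\Omega)\|=\big(\sum_{j=0}^\infty2^{j(s-n/p)q}(\sum_{m:\,Q_{j,m}\cap\Omega\ne\emptyset}|\lambda_{j,m}|^p)^{q/p}\big)^{1/q}$ (usual modification for $\infty$). Fix $d>1$ and $K\in\mathbb{N}_0$, $K\ge1+[s]$. A $K$-atom located at $Q_{j,m}$ is a $C^K$ function $a:\mathbb{R}^n\to\mathbb{C}$ with $\operatorname{supp}a\subset dQ_{j,m}$ and $|D^\alpha a|\le2^{|\alpha|j}$ for $|\alpha|\le K$. $\mathbf{B}^s_{p,q}(\Omega)$ is the set of $f\in L_p(\Omega)$ with $f=\sum_{j}\sum_{m:\,Q_{j,m}\cap\Omega\neq\emptyset}\lambda_{j,m}a_{j,m}$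 (convergence in $L_p(\Omega)$), $a_{j,m}$ $K$-atoms located at $Q_{j,m}$, $\|\lambda|b^s_{p,q}(\Omega)\|<\infty$; its quasi-norm is the infimum of $\|\lambda|b^s_{p,q}(\Omega)\|$ over all such representations. It is independent of $d,K$ up to equivalence, and equals the space of restrictions to $\Omega$ of elements of $\mathbf{B}^s_{p,q}(\mathbb{R}^n)$ with the quotient quasi-norm. Lipschitz domains. A Lipschitz diffeomorphism is a one-to-one map $\Phi$ of $\mathbb{R}^n$ onto itself with Lipschitz components and $|\Phi(x)-\Phi(y)|\sim|x-y|$ for $|x-y|\le1$. A bounded domain $\Omega\subset\mathbb{R}^n$ is a Lipschitz domain if its boundary $\Gamma=\partial\Omega$ is covered by finitely many open balls $K_1,\dots,K_N$, $K_j\cap\Gamma\ne\emptyset$, and there are Lipschitz diffeomorphisms $\psi^{(j)}$ with $\psi^{(j)}(K_j\cap\Omega)\subset\mathbb{R}^n_+=\{x_n>0\}$ and $\psi^{(j)}(K_j\cap\Gamma)\subset\mathbb{R}^{n-1}$ (identified with $\mathbb{R}^{n-1}\times\{0\}$). Let $K_0$ be an inner domain, $\overline{K_0}\subset\Omega$, $\Omega\subset K_0\cup\bigcup_{j=1}^NK_j$, and let $\{\varphi_j\}_{j=0}^N$ be smooth non-negative functions, $\operatorname{supp}\varphi_j\subset K_j$, $\sum_{j=0}^N\varphi_j=1$ on $\overline\Omega$. $\Gamma$ carries the surface measure $d\sigma$, used to define $L_p(\Gamma)$. Besov spaces on $\Gamma$ ($n\ge2$, $0<s<1$, $0<p,q\le\infty$).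 Put $W_j=\psi^{(j)}(\Gamma\cap K_j)\subset\mathbb{R}^{n-1}$ and, for $f\in L_p(\Gamma)$, $g_j=(\varphi_jf)\circ(\psi^{(j)})^{-1}$ on $W_j$. Then $\mathbf{B}^s_{p,q}(\Gamma)=\{f\in L_p(\Gamma): g_j\in\mathbf{B}^s_{p,q}(W_j),\ j=1,\dots,N\}$ with quasi-norm $\sum_{j=1}^N\|g_j|\mathbf{B}^s_{p,q}(W_j)\|$, where $W_j$ is regarded as a domain in $\mathbb{R}^{n-1}$ (equivalently, extend $g_j$ by zero and use $\mathbf{B}^s_{p,q}(\mathbb{R}^{n-1})$). Up to equivalence this does not depend on the choice of $\varphi_j,\psi^{(j)}$. Trace. Let $\mathcal{S}(\Omega)$ be the restrictions to $\Omega$ of Schwartz functions on $\mathbb{R}^n$; for $\varphi\in\mathcal{S}(\Omega)$, $\operatorname{Tr}\varphi=\varphi|_\Gamma$. For $p,q<\infty$, $\mathcal{S}(\Omega)$ is dense in $\mathbf{B}^{s}_{p,q}(\Omega)$, and if $\|\operatorname{Tr}\varphi|Y(\Gamma)\|\le c\|\varphi|\mathbf{B}^{s}_{p,q}(\Omega)\|$ for all $\varphi\in\mathcal{S}(\Omega)$ (with $Y(\Gamma)$ a space $\mathbf{B}^{\sigma}_{u,v}(\Gamma)$ or $L_u(\Gamma)$), then $\operatorname{Tr}:\mathbf{B}^s_{p,q}(\Omega)\to Y(\Gamma)$ is defined by completion. If $p=\infty$ the functions are continuous and $\operatorname{Tr}$ is taken pointwise; if $q=\infty$ (and $s>1/p$),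 $\operatorname{Tr}$ is the restriction to $\mathbf{B}^s_{p,\infty}(\Omega)$ of $\operatorname{Tr}$ on $\mathbf{B}^{s-\varepsilon}_{p,1}(\Omega)$ with $s-\varepsilon>1/p$. $\operatorname{Tr}X=Y$ means that $Y$ is the image of $X$ under $\operatorname{Tr}$. *)

theory Defs
  imports "HOL-Probability.Essential_Supremum"
begin

text \<open>
  Euclidean space of dimension n is an arbitrary type of class \<open>euclidean_space\<close>, with the
  coordinates given by \<open>Basis\<close>. For the domain it is the product \<open>'a \<times> real\<close>, so that
  n = DIM('a) + 1 \<open>\<ge>\<close> 2, the last coordinate is \<open>snd\<close>, and the hyperplane of dimension n - 1
  (points with \<open>snd x = 0\<close>) is \<open>'a\<close>. The indices p, q in (0, \<open>\<infinity>\<close>] are nonzero elements of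
  \<open>ennreal\<close>, where 1 / \<open>\<infinity>\<close> = 0.

  Elements of the spaces are represented by total functions. All the sets of functions below depend
  only on the values on the underlying set, and only up to null sets.
\<close>


section \<open>Lebesgue and sequence spaces with quasi-norms in [0, \<open>\<infinity>\<close>]\<close>

definition epow :: "ennreal \<Rightarrow> real \<Rightarrow> ennreal" where
  "epow x r = (if x = top then top else ennreal (enn2real x powr r))"

definition lp_norm :: "ennreal \<Rightarrow> 'b measure \<Rightarrow> ('b \<Rightarrow> complex) \<Rightarrow> ennreal" where
  "lp_norm p M f =
     (if p = top then esssup M (\<lambda>x. ennreal (norm (f x)))
      else epow (\<integral>\<^sup>+ x. ennreal (norm (f x) powr enn2real p) \<partial>M) (1 / enn2real p))"

definition lp_space :: "ennreal \<Rightarrow> 'b measure \<Rightarrow> ('b \<Rightarrow> complex) set" where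
  "lp_space p M = {f \<in> borel_measurable M. lp_norm p M f < top}"

definition ell_norm :: "ennreal \<Rightarrow> 'i set \<Rightarrow> ('i \<Rightarrow> ennreal) \<Rightarrow> ennreal" where
  "ell_norm p I u =
     (if p = top then (SUP i\<in>I. u i)
      else epow (\<Sum>\<^sub>\<infinity>i\<in>I. epow (u i) (enn2real p)) (1 / enn2real p))"


section \<open>Smooth functions\<close>

definition pderivative ::
  "'b::euclidean_space \<Rightarrow> ('b \<Rightarrow> 'c::real_normed_vector) \<Rightarrow> 'b \<Rightarrow> 'c" where
  "pderivative b f = (\<lambda>x. frechet_derivative f (at x) b)"

text \<open>
  The derivatives \<open>D\<^sup>\<alpha>\<close> are indexed by lists of basis vectors (the directions of the successive
  partial derivatives) instead of multi-indices; the length of the list is \<open>\<bar>\<alpha>\<bar>\<close>. For functions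
  of class \<open>C\<^sup>k\<close> and lists of length at most k the order in the list is irrelevant.
\<close>

fun iterated_pderivative ::
  "'b::euclidean_space list \<Rightarrow> ('b \<Rightarrow> 'c::real_normed_vector) \<Rightarrow> 'b \<Rightarrow> 'c" where
  "iterated_pderivative [] f = f"
| "iterated_pderivative (b # bs) f = iterated_pderivative bs (pderivative b f)"

fun C_k :: "nat \<Rightarrow> ('b::euclidean_space \<Rightarrow> 'c::real_normed_vector) \<Rightarrow> bool" where
  "C_k 0 f \<longleftrightarrow> continuous_on UNIV f"
| "C_k (Suc k) f \<longleftrightarrow>
     (\<forall>x. f differentiable (at x)) \<and> (\<forall>b\<in>Basis. C_k k (pderivative b f))"

definition smooth :: "('b::euclidean_space \<Rightarrow> 'c::real_normed_vector) \<Rightarrow> bool" where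
  "smooth f \<longleftrightarrow> (\<forall>k. C_k k f)"

definition supp :: "('b::topological_space \<Rightarrow> 'c::zero) \<Rightarrow> 'b set" where
  "supp f = closure {x. f x \<noteq> 0}"

definition schwartz :: "('b::euclidean_space \<Rightarrow> complex) \<Rightarrow> bool" where
  "schwartz f \<longleftrightarrow> smooth f \<and>
     (\<forall>(l::nat) bs. set bs \<subseteq> Basis \<longrightarrow>
        bounded (range (\<lambda>x. (1 + norm x) ^ l * norm (iterated_pderivative bs f x))))"


section \<open>Besov spaces on open sets\<close>

definition int_lattice :: "'b::euclidean_space set" where
  "int_lattice = {m. \<forall>b\<in>Basis. m \<bullet> b \<in> \<int>}"

text \<open>The cube \<open>d Q\<^bsub>j,m\<^esub>\<close>: centre \<open>2\<^sup>-\<^sup>j m\<close> and side length \<open>d 2\<^sup>-\<^sup>j\<^sup>+\<^sup>1\<close>.\<close>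

definition cube :: "real \<Rightarrow> nat \<Rightarrow> 'b::euclidean_space \<Rightarrow> 'b set" where
  "cube d j m = {x. \<forall>b\<in>Basis. \<bar>x \<bullet> b - m \<bullet> b / 2 ^ j\<bar> \<le> d / 2 ^ j}"

definition cubes_meeting :: "'b::euclidean_space set \<Rightarrow> nat \<Rightarrow> 'b set" where
  "cubes_meeting \<Omega> j = {m \<in> int_lattice. cube 1 j m \<inter> \<Omega> \<noteq> {}}"

definition atom :: "real \<Rightarrow> nat \<Rightarrow> nat \<Rightarrow> 'b::euclidean_space \<Rightarrow> ('b \<Rightarrow> complex) \<Rightarrow> bool" where
  "atom d k j m a \<longleftrightarrow> C_k k a \<and> supp a \<subseteq> cube d j m \<and>
     (\<forall>bs x. set bs \<subseteq> Basis \<and> length bs \<le> k \<longrightarrow>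
        norm (iterated_pderivative bs a x) \<le> 2 ^ (length bs * j))"

definition b_norm ::
  "real \<Rightarrow> ennreal \<Rightarrow> ennreal \<Rightarrow> 'b::euclidean_space set \<Rightarrow> (nat \<Rightarrow> 'b \<Rightarrow> complex) \<Rightarrow> ennreal" where
  "b_norm s p q \<Omega> coef = ell_norm q UNIV
     (\<lambda>j. ennreal (2 powr (real j * (s - real DIM('b) * enn2real (1 / p)))) *
          ell_norm p (cubes_meeting \<Omega> j) (\<lambda>m. ennreal (norm (coef j m))))"

text \<open>
  \<open>f = \<Sum>\<^sub>j \<Sum>\<^sub>m \<lambda>\<^bsub>j,m\<^esub> a\<^bsub>j,m\<^esub>\<close> with convergence in \<open>L\<^sub>p(\<Omega>)\<close>. For fixed j the sum over m
  is finite at each point (and a finite sum if \<open>\<Omega>\<close> is bounded), so it is taken pointwise.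
\<close>

definition atomic_representation ::
  "real \<Rightarrow> nat \<Rightarrow> ennreal \<Rightarrow> 'b::euclidean_space set \<Rightarrow> ('b \<Rightarrow> complex) \<Rightarrow>
   (nat \<Rightarrow> 'b \<Rightarrow> complex) \<Rightarrow> (nat \<Rightarrow> 'b \<Rightarrow> 'b \<Rightarrow> complex) \<Rightarrow> bool" where
  "atomic_representation d k p \<Omega> f coef a \<longleftrightarrow>
     (\<forall>j. \<forall>m\<in>cubes_meeting \<Omega> j. atom d k j m (a j m)) \<and>
     (\<lambda>J. lp_norm p (lebesgue_on \<Omega>)
            (\<lambda>x. f x - (\<Sum>j<J. \<Sum>\<^sub>\<infinity>m\<in>cubes_meeting \<Omega> j. coef j m * a j m x)))
       \<longlonglongrightarrow> 0"

definition besov_norm ::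
  "real \<Rightarrow> nat \<Rightarrow> real \<Rightarrow> ennreal \<Rightarrow> ennreal \<Rightarrow> 'b::euclidean_space set \<Rightarrow> ('b \<Rightarrow> complex) \<Rightarrow> ennreal"
  where
  "besov_norm d k s p q \<Omega> f =
     Inf {b_norm s p q \<Omega> coef | coef a. atomic_representation d k p \<Omega> f coef a}"

definition besov ::
  "real \<Rightarrow> nat \<Rightarrow> real \<Rightarrow> ennreal \<Rightarrow> ennreal \<Rightarrow> 'b::euclidean_space set \<Rightarrow> ('b \<Rightarrow> complex) set" where
  "besov d k s p q \<Omega> = {f \<in> lp_space p (lebesgue_on \<Omega>).
     \<exists>coef a. atomic_representation d k p \<Omega> f coef a \<and> b_norm s p q \<Omega> coef < top}"


section \<open>Bounded Lipschitz domains\<close>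

definition lipschitz_diffeo :: "('b::euclidean_space \<Rightarrow> 'b) \<Rightarrow> bool" where
  "lipschitz_diffeo \<Phi> \<longleftrightarrow> bij \<Phi> \<and>
     (\<forall>b\<in>Basis. \<exists>L. L-lipschitz_on UNIV (\<lambda>x. \<Phi> x \<bullet> b)) \<and>
     (\<exists>c>0. \<exists>C>0. \<forall>x y. norm (x - y) \<le> 1 \<longrightarrow>
        c * norm (x - y) \<le> norm (\<Phi> x - \<Phi> y) \<and> norm (\<Phi> x - \<Phi> y) \<le> C * norm (x - y))"

text \<open>The balls \<open>K j\<close> and the diffeomorphisms \<open>\<psi> j\<close> are those with index 1, ..., N.\<close>

definition lipschitz_atlas ::
  "('a::euclidean_space \<times> real) set \<Rightarrow> nat \<Rightarrow> (nat \<Rightarrow> ('a \<times> real) set) \<Rightarrow>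
   (nat \<Rightarrow> 'a \<times> real \<Rightarrow> 'a \<times> real) \<Rightarrow> bool" where
  "lipschitz_atlas \<Omega> N K \<psi> \<longleftrightarrow>
     frontier \<Omega> \<subseteq> (\<Union>j\<in>{1..N}. K j) \<and>
     (\<forall>j\<in>{1..N}. (\<exists>c r. K j = ball c r) \<and> K j \<inter> frontier \<Omega> \<noteq> {} \<and>
        lipschitz_diffeo (\<psi> j) \<and>
        \<psi> j ` (K j \<inter> \<Omega>) \<subseteq> {x. snd x > 0} \<and>
        \<psi> j ` (K j \<inter> frontier \<Omega>) \<subseteq> {x. snd x = 0})"

text \<open>A domain is a nonempty open set; connectedness is not required.\<close>

definition bounded_lipschitz_domain :: "('a::euclidean_space \<times> real) set \<Rightarrow> bool" where
  "bounded_lipschitz_domain \<Omega> \<longleftrightarrow> open \<Omega> \<and> \<Omega> \<noteq> {} \<and> bounded \<Omega> \<and>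
     (\<exists>N K \<psi>. lipschitz_atlas \<Omega> N K \<psi>)"

text \<open>Here \<open>K 0\<close> is the inner domain.\<close>

definition resolution_of_unity ::
  "'b::euclidean_space set \<Rightarrow> nat \<Rightarrow> (nat \<Rightarrow> 'b set) \<Rightarrow> (nat \<Rightarrow> 'b \<Rightarrow> real) \<Rightarrow> bool" where
  "resolution_of_unity \<Omega> N K \<phi> \<longleftrightarrow>
     open (K 0) \<and> closure (K 0) \<subseteq> \<Omega> \<and> \<Omega> \<subseteq> (\<Union>j\<le>N. K j) \<and>
     (\<forall>j\<le>N. smooth (\<phi> j) \<and> (\<forall>x. \<phi> j x \<ge> 0) \<and> supp (\<phi> j) \<subseteq> K j) \<and>
     (\<forall>x\<in>closure \<Omega>. (\<Sum>j\<le>N. \<phi> j x) = 1)"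


section \<open>Surface measure\<close>

text \<open>
  The surface measure on a Lipschitz boundary in dimension n is the Hausdorff measure of dimension
  n - 1, normalized so that it agrees with Lebesgue measure on hyperplanes. It lives on the
  Caratheodory measurable sets and is therefore complete.
\<close>

definition hausdorff_premeasure :: "nat \<Rightarrow> real \<Rightarrow> 'b::metric_space set \<Rightarrow> ennreal" where
  "hausdorff_premeasure r \<delta> A =
     (INF U \<in> {U :: nat \<Rightarrow> 'b set. A \<subseteq> (\<Union>i. U i) \<and> (\<forall>i. bounded (U i) \<and> diameter (U i) \<le> \<delta>)}.
        \<Sum>i. ennreal (unit_ball_vol (real r) * (diameter (U i) / 2) ^ r))"

definition hausdorff_outer_measure :: "nat \<Rightarrow> 'b::metric_space set \<Rightarrow> ennreal" where
  "hausdorff_outer_measure r A = (SUP \<delta>\<in>{0<..}. hausdorff_premeasure r \<delta> A)"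

definition hausdorff_measure :: "nat \<Rightarrow> 'b::metric_space measure" where
  "hausdorff_measure r =
     measure_of UNIV (lambda_system UNIV UNIV (hausdorff_outer_measure r)) (hausdorff_outer_measure r)"

definition surface_measure :: "'b::euclidean_space set \<Rightarrow> 'b measure" where
  "surface_measure \<Gamma> = restrict_space (hausdorff_measure (DIM('b) - 1)) \<Gamma>"


section \<open>Besov spaces on the boundary\<close>

definition chart_image ::
  "('a::euclidean_space \<times> real) set \<Rightarrow> (nat \<Rightarrow> ('a \<times> real) set) \<Rightarrow>
   (nat \<Rightarrow> 'a \<times> real \<Rightarrow> 'a \<times> real) \<Rightarrow> nat \<Rightarrow> 'a set" where
  "chart_image \<Omega> K \<psi> j = {y. (y, 0) \<in> \<psi> j ` (frontier \<Omega> \<inter> K j)}"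

definition local_part ::
  "(nat \<Rightarrow> 'a::euclidean_space \<times> real \<Rightarrow> 'a \<times> real) \<Rightarrow> (nat \<Rightarrow> 'a \<times> real \<Rightarrow> real) \<Rightarrow>
   ('a \<times> real \<Rightarrow> complex) \<Rightarrow> nat \<Rightarrow> 'a \<Rightarrow> complex" where
  "local_part \<psi> \<phi> f j = (\<lambda>y. let x = inv (\<psi> j) (y, 0) in complex_of_real (\<phi> j x) * f x)"

definition besov_boundary ::
  "real \<Rightarrow> nat \<Rightarrow> real \<Rightarrow> ennreal \<Rightarrow> ennreal \<Rightarrow> ('a::euclidean_space \<times> real) set \<Rightarrow> nat \<Rightarrow>
   (nat \<Rightarrow> ('a \<times> real) set) \<Rightarrow> (nat \<Rightarrow> 'a \<times> real \<Rightarrow> 'a \<times> real) \<Rightarrow> (nat \<Rightarrow> 'a \<times> real \<Rightarrow> real) \<Rightarrow>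
   ('a \<times> real \<Rightarrow> complex) set" where
  "besov_boundary d k s p q \<Omega> N K \<psi> \<phi> = {f \<in> lp_space p (surface_measure (frontier \<Omega>)).
     \<forall>j\<in>{1..N}. local_part \<psi> \<phi> f j \<in> besov d k s p q (chart_image \<Omega> K \<psi> j)}"


section \<open>Traces\<close>

definition schwartz_approximation ::
  "real \<Rightarrow> nat \<Rightarrow> real \<Rightarrow> ennreal \<Rightarrow> ennreal \<Rightarrow> 'b::euclidean_space set \<Rightarrow> ('b \<Rightarrow> complex) \<Rightarrow>
   (nat \<Rightarrow> 'b \<Rightarrow> complex) \<Rightarrow> bool" where
  "schwartz_approximation d k s p q \<Omega> f u \<longleftrightarrow>
     (\<forall>i. schwartz (u i)) \<and> (\<lambda>i. besov_norm d k s p q \<Omega> (\<lambda>x. u i x - f x)) \<longlonglongrightarrow> 0"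

text \<open>
  Extension of the restriction map \<open>u \<mapsto> u|\<^sub>\<Gamma>\<close> by continuity, from \<open>\<S>(\<Omega>)\<close> with the quasi-norm of
  \<open>B\<^sup>s\<^bsub>p,q\<^esub>(\<Omega>)\<close> to \<open>L\<^sub>p(\<Gamma>)\<close>. Taking \<open>L\<^sub>p(\<Gamma>)\<close> as target, and not one of the
  Besov spaces on \<open>\<Gamma>\<close> embedded in it, does not change the trace: limits in \<open>L\<^sub>p(\<Gamma>)\<close> are unique.
\<close>

definition trace_by_completion ::
  "real \<Rightarrow> nat \<Rightarrow> real \<Rightarrow> ennreal \<Rightarrow> ennreal \<Rightarrow> 'b::euclidean_space set \<Rightarrow>
   ('b \<Rightarrow> complex) \<Rightarrow> ('b \<Rightarrow> complex) \<Rightarrow> bool" where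
  "trace_by_completion d k s p q \<Omega> f g \<longleftrightarrow>
     (\<exists>u. schwartz_approximation d k s p q \<Omega> f u) \<and>
     (\<forall>u. schwartz_approximation d k s p q \<Omega> f u \<longrightarrow>
        (\<lambda>i. lp_norm p (surface_measure (frontier \<Omega>)) (\<lambda>x. u i x - g x)) \<longlonglongrightarrow> 0)"

definition pointwise_trace ::
  "'b::euclidean_space set \<Rightarrow> ('b \<Rightarrow> complex) \<Rightarrow> ('b \<Rightarrow> complex) \<Rightarrow> bool" where
  "pointwise_trace \<Omega> f g \<longleftrightarrow>
     (\<exists>F. continuous_on (closure \<Omega>) F \<and> (AE x in lebesgue_on \<Omega>. f x = F x) \<and>
        (AE x in surface_measure (frontier \<Omega>). g x = F x))"

text \<open>\<open>has_trace d k s p q \<Omega> f g\<close>: g represents Tr f, for f in \<open>B\<^sup>s\<^bsub>p,q\<^esub>(\<Omega>)\<close>.\<close>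

definition has_trace ::
  "real \<Rightarrow> nat \<Rightarrow> real \<Rightarrow> ennreal \<Rightarrow> ennreal \<Rightarrow> 'b::euclidean_space set \<Rightarrow>
   ('b \<Rightarrow> complex) \<Rightarrow> ('b \<Rightarrow> complex) \<Rightarrow> bool" where
  "has_trace d k s p q \<Omega> f g \<longleftrightarrow>
     f \<in> besov d k s p q \<Omega> \<and> g \<in> lp_space p (surface_measure (frontier \<Omega>)) \<and>
     (if p = top then pointwise_trace \<Omega> f g
      else if q = top then
        \<exists>\<epsilon>>0. s - \<epsilon> > enn2real (1 / p) \<and> trace_by_completion d k (s - \<epsilon>) p 1 \<Omega> f g
      else trace_by_completion d k s p q \<Omega> f g)"

text \<open>
  \<open>Tr B\<^sup>s\<^bsub>p,q\<^esub>(\<Omega>) = Y\<close>: the trace is defined on the whole space, is unique up to null sets of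
  \<open>\<Gamma>\<close>, and its image is Y.
\<close>

definition trace_image_eq ::
  "real \<Rightarrow> nat \<Rightarrow> real \<Rightarrow> ennreal \<Rightarrow> ennreal \<Rightarrow> 'b::euclidean_space set \<Rightarrow>
   ('b \<Rightarrow> complex) set \<Rightarrow> bool" where
  "trace_image_eq d k s p q \<Omega> Y \<longleftrightarrow>
     (\<forall>f\<in>besov d k s p q \<Omega>. \<exists>g. has_trace d k s p q \<Omega> f g) \<and>
     (\<forall>f g g'. has_trace d k s p q \<Omega> f g \<and> has_trace d k s p q \<Omega> f g' \<longrightarrow>
        (AE x in surface_measure (frontier \<Omega>). g x = g' x)) \<and>
     {g. \<exists>f\<in>besov d k s p q \<Omega>. has_trace d k s p q \<Omega> f g} = Y"

end

theory Submission
  imports Defs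
begin

text \<open>
  Let \<open>f\<^sub>j\<close> be the part of level j of an atomic representation of f, and let n be the dimension of
  the domain. The proof rests on two facts about such series.

  \<^emph>\<open>Convergence on surfaces.\<close> The atoms of one level have bounded overlap and supports of size
  \<open>2\<^sup>-\<^sup>j\<close>. If the measure of balls of radius r on a surface is at most \<open>C r\<^bsup>n-1\<^esup>\<close>, then the
  \<open>L\<^sub>p\<close> norm of \<open>f\<^sub>j\<close> on it is at most \<open>c 2\<^bsup>-js\<^esup>\<close> times the norm of the coefficients, because
  \<open>(s + 1/p) - n/p = s - (n-1)/p\<close> (\<open>majorant_qnorm\<close>). So the series converges geometrically in
  \<open>L\<^sub>p(\<Gamma>)\<close>, and its sum is the natural candidate for the trace. For \<open>p < 1\<close> the geometric decay
  replaces the triangle inequality (\<open>qnorm_geometric_suminf\<close>). The constants are the same on all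
  surfaces parallel to \<open>\<Gamma>\<close> in a chart. By Fubini an identity \<open>u = \<Sum> f\<^sub>j\<close> that holds almost
  everywhere in the domain holds on almost every parallel surface, and if u is continuous it carries
  over to \<open>\<Gamma>\<close> in the limit of height 0 (\<open>trace_consistent\<close>). Applied to \<open>u - f\<close> with u a
  Schwartz function, this bounds the distance of \<open>u\<close> and \<open>\<Sum> f\<^sub>j\<close> in \<open>L\<^sub>p(\<Gamma>)\<close> by the Besov norm of
  \<open>u - f\<close> (\<open>trace_estimate\<close>). Hence the trace by completion is the sum of the series on \<open>\<Gamma>\<close>,
  whatever the representation; Schwartz functions approximate f when \<open>q < \<infinity>\<close>
  (\<open>schwartz_approximation_exists\<close>), and \<open>q = \<infinity>\<close> is reduced to this by lowering the smoothness.

  \<^emph>\<open>Lipschitz atoms suffice.\<close> In a chart of \<open>\<Gamma>\<close>, restrictions of smooth atoms are only Lipschitz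
  functions. The theorem \<open>reexpansion\<close> turns a sum of such Lipschitz atoms into a sum of smooth ones:
  sample the partial sum up to level l at one point of each cube of level l, interpolate the values
  with a smooth partition of unity, and take the differences of consecutive interpolants. The
  coefficients of level l are then at most \<open>\<Sum>\<^sub>j 2\<^sup>j\<^sup>-\<^sup>l \<bar>\<lambda>\<^sub>j\<bar>\<close>, summed over \<open>j \<le> l\<close> and the cubes of
  level j nearby. The factor \<open>2\<^sup>j\<^sup>-\<^sup>l\<close> comes from the Lipschitz condition and beats the growth
  \<open>2\<^bsup>(l-j)s\<^esup>\<close> of the weights, as \<open>s < 1\<close>. What enters the count of cubes is the dimension n - 1 of the
  set of parameters, and not the dimensions of the spaces in which the old and the new atoms live; so
  the exponent \<open>s - (n-1)/p\<close> of the weights is the same for atoms in \<open>\<real>\<^sup>n\<^sup>-\<^sup>1\<close> and for atoms in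
  \<open>\<real>\<^sup>n\<close> sampled on \<open>\<Gamma>\<close>.

  Reading this from \<open>\<real>\<^sup>n\<close> to the chart domain shows that traces belong to \<open>\<^bold>B\<^sup>s\<^bsub>p,q\<^esub>(\<Gamma>)\<close>
  (\<open>trace_in_besov_boundary\<close>). Reading it from the chart domain to \<open>\<real>\<^sup>n\<close> produces smooth atoms in
  \<open>\<real>\<^sup>n\<close> whose sum restricts to a given local part \<open>\<phi>\<^sub>r g\<close>; after multiplication by a cutoff these
  extensions are added over r (\<open>trace_extension\<close>).
\<close>


section \<open>Quasi-norms of [0, \<open>\<infinity>\<close>]-valued functions\<close>

lemma epow_ennreal: "0 \<le> a \<Longrightarrow> epow (ennreal a) r = ennreal (a powr r)"
  by (simp add: epow_def)

lemma epow_0 [simp]: "epow 0 r = 0"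
  by (simp add: epow_def)

lemma epow_top [simp]: "epow top r = top"
  by (simp add: epow_def)

lemma epow_mono: "x \<le> y \<Longrightarrow> 0 \<le> r \<Longrightarrow> epow x r \<le> epow y r"
  unfolding epow_def
  by (auto intro!: ennreal_leI powr_mono2 simp: enn2real_mono less_top top_unique)

lemma epow_epow_inverse: "0 < r \<Longrightarrow> epow (epow x r) (1 / r) = x"
  by (cases x) (auto simp: epow_ennreal powr_powr)

lemma epow_inverse_epow: "0 < r \<Longrightarrow> epow (epow x (1 / r)) r = x"
  by (cases x) (auto simp: epow_ennreal powr_powr)

lemma epow_mult: "epow (x * y) r = epow x r * epow y r"
proof (cases "x = 0 \<or> y = 0")
  case True
  then show ?thesis by auto
next
  case False
  show ?thesis
  proof (cases "x = top \<or> y = top")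
    case True
    with False have "epow x r \<noteq> 0" "epow y r \<noteq> 0"
      by (auto simp: epow_def enn2real_eq_0_iff)
    with True False show ?thesis
      by (auto simp: ennreal_mult_eq_top_iff ennreal_top_mult ennreal_mult_top)
  next
    case F: False
    then obtain a b where "x = ennreal a" "y = ennreal b" "0 \<le> a" "0 \<le> b"
      by (metis ennreal_cases)
    then show ?thesis
      by (simp add: epow_ennreal ennreal_mult[symmetric] powr_mult)
  qed
qed

lemma epow_le_iff: "0 < r \<Longrightarrow> epow x (1 / r) \<le> y \<longleftrightarrow> x \<le> epow y r"
  using epow_mono[of "epow x (1 / r)" y r] epow_mono[of x "epow y r" "1 / r"]
  by (auto simp: epow_epow_inverse epow_inverse_epow)

lemma epow_eq_0_iff: "epow x r = 0 \<longleftrightarrow> x = 0"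
  by (cases x) (auto simp: epow_ennreal)

lemma epow_less_top_iff: "epow x r < top \<longleftrightarrow> x < top"
  by (cases x) (auto simp: epow_ennreal)

lemma borel_measurable_epow [measurable]:
  "u \<in> borel_measurable M \<Longrightarrow> (\<lambda>x. epow (u x) r) \<in> borel_measurable M"
proof -
  assume [measurable]: "u \<in> borel_measurable M"
  have "Measurable.pred M (\<lambda>x. u x = top)" by measurable
  then show ?thesis unfolding epow_def by measurable
qed

text \<open>The common form of \<open>lp_norm\<close> and, on counting measures, of \<open>ell_norm\<close>.\<close>

definition qnorm :: "ennreal \<Rightarrow> 'b measure \<Rightarrow> ('b \<Rightarrow> ennreal) \<Rightarrow> ennreal" where
  "qnorm p M u =
     (if p = top then esssup M u
      else epow (\<integral>\<^sup>+ x. epow (u x) (enn2real p) \<partial>M) (1 / enn2real p))"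

lemma lp_norm_eq_qnorm: "lp_norm p M f = qnorm p M (\<lambda>x. ennreal (norm (f x)))"
  by (simp add: lp_norm_def qnorm_def epow_ennreal)

lemma enn2real_index_pos: "0 < p \<Longrightarrow> p \<noteq> top \<Longrightarrow> 0 < enn2real p"
  by (simp add: enn2real_positive_iff less_top)

lemma enn2real_one_div: "p \<noteq> top \<Longrightarrow> 0 < p \<Longrightarrow> enn2real (1 / p) = 1 / enn2real p"
  by (cases p) (auto simp: divide_ennreal simp del: ennreal_1 simp flip: ennreal_1)

text \<open>Removes the exponent \<open>1/p\<close>, so that estimates become estimates of integrals.\<close>

lemma qnorm_le_iff:
  assumes "0 < p" "p \<noteq> top"
  shows "qnorm p M u \<le> T \<longleftrightarrow> (\<integral>\<^sup>+ x. epow (u x) (enn2real p) \<partial>M) \<le> epow T (enn2real p)"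
  using assms by (simp add: qnorm_def epow_le_iff enn2real_index_pos)

lemma qnorm_mono_AE:
  assumes "0 < p" "AE x in M. u x \<le> v x" "u \<in> borel_measurable M"
  shows "qnorm p M u \<le> qnorm p M v"
proof (cases "p = top")
  case True
  then show ?thesis using assms by (simp add: qnorm_def esssup_AE_mono)
next
  case False
  have "(\<integral>\<^sup>+ x. epow (u x) (enn2real p) \<partial>M) \<le> (\<integral>\<^sup>+ x. epow (v x) (enn2real p) \<partial>M)"
    using assms(2) by (intro nn_integral_mono_AE) (auto elim!: eventually_mono intro!: epow_mono)
  with False show ?thesis by (auto simp: qnorm_def intro!: epow_mono)
qed

lemma qnorm_cong_AE:
  assumes "0 < p" "AE x in M. u x = v x" "u \<in> borel_measurable M" "v \<in> borel_measurable M"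
  shows "qnorm p M u = qnorm p M v"
proof (rule antisym)
  have "AE x in M. u x \<le> v x" "AE x in M. v x \<le> u x"
    using assms(2) by (auto elim: eventually_mono)
  then show "qnorm p M u \<le> qnorm p M v" "qnorm p M v \<le> qnorm p M u"
    using assms by (auto intro: qnorm_mono_AE)
qed

lemma qnorm_top_le_iff:
  assumes "u \<in> borel_measurable M"
  shows "qnorm top M u \<le> T \<longleftrightarrow> (AE x in M. u x \<le> T)"
proof
  assume "qnorm top M u \<le> T"
  with esssup_AE[of u M] show "AE x in M. u x \<le> T"
    by (auto simp: qnorm_def elim!: eventually_mono)
qed (use assms in \<open>auto simp: qnorm_def\<close>)

lemma qnorm_cmult_le:
  assumes "0 < p" "u \<in> borel_measurable M"
  shows "qnorm p M (\<lambda>x. c * u x) \<le> c * qnorm p M u"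
proof (cases "p = top")
  case True
  have "AE x in M. c * u x \<le> c * qnorm top M u"
    using esssup_AE[of u M] by (auto simp: qnorm_def elim!: eventually_mono intro: mult_left_mono)
  then show ?thesis using True assms by (subst True) (simp add: qnorm_top_le_iff)
next
  case False
  let ?P = "enn2real p"
  have P: "0 < ?P" using assms False by (simp add: enn2real_index_pos)
  have "(\<integral>\<^sup>+ x. epow (c * u x) ?P \<partial>M) = epow c ?P * (\<integral>\<^sup>+ x. epow (u x) ?P \<partial>M)"
    using assms(2) by (simp add: epow_mult nn_integral_cmult)
  also have "\<dots> = epow (c * qnorm p M u) ?P"
    using False P by (simp add: epow_mult qnorm_def epow_inverse_epow)
  finally show ?thesis using False assms(1) by (simp add: qnorm_le_iff)
qed

lemma AE_of_qnorm_eq_0: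
  assumes "0 < p" "u \<in> borel_measurable M" "qnorm p M u = 0"
  shows "AE x in M. u x = 0"
proof (cases "p = top")
  case True
  then show ?thesis using assms qnorm_top_le_iff[of u M 0] by simp
next
  case False
  then have "(\<integral>\<^sup>+ x. epow (u x) (enn2real p) \<partial>M) = 0"
    using qnorm_le_iff[of p M u 0] assms by simp
  then have "AE x in M. epow (u x) (enn2real p) = 0"
    using assms by (subst (asm) nn_integral_0_iff_AE) auto
  then show ?thesis by (simp add: epow_eq_0_iff)
qed

lemma AE_of_qnorm_less_top:
  assumes "0 < p" "u \<in> borel_measurable M" "qnorm p M u < top"
  shows "AE x in M. u x < top"
proof (cases "p = top")
  case True
  have "AE x in M. u x \<le> qnorm top M u"
    using esssup_AE[of u M] by (simp add: qnorm_def)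
  then show ?thesis using assms(3) True by (auto elim!: eventually_mono)
next
  case False
  then have "(\<integral>\<^sup>+ x. epow (u x) (enn2real p) \<partial>M) \<noteq> top"
    using assms by (auto simp: qnorm_def epow_less_top_iff)
  then have "AE x in M. epow (u x) (enn2real p) \<noteq> top"
    using assms(2) by (intro nn_integral_noteq_infinite[simplified infinity_ennreal_def]) auto
  then show ?thesis by (auto elim!: eventually_mono simp: epow_def less_top split: if_splits)
qed

lemma qnorm_Fatou:
  fixes r :: "nat \<Rightarrow> 'b \<Rightarrow> real"
  assumes "0 < p" "p \<noteq> top"
    and [measurable]: "\<And>i. r i \<in> borel_measurable M"
    and nonneg: "\<And>i x. 0 \<le> r i x"
    and lim: "AE x in M. (\<lambda>i. r i x) \<longlonglongrightarrow> l x"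
    and le: "\<And>i. qnorm p M (\<lambda>x. ennreal (r i x)) \<le> T"
  shows "qnorm p M (\<lambda>x. ennreal (l x)) \<le> T"
proof -
  let ?P = "enn2real p"
  have P: "0 < ?P" using assms by (simp add: enn2real_index_pos)
  have "(\<integral>\<^sup>+ x. epow (ennreal (l x)) ?P \<partial>M) \<le> (\<integral>\<^sup>+ x. liminf (\<lambda>i. epow (ennreal (r i x)) ?P) \<partial>M)"
  proof (rule nn_integral_mono_AE)
    show "AE x in M. epow (ennreal (l x)) ?P \<le> liminf (\<lambda>i. epow (ennreal (r i x)) ?P)"
      using lim
    proof eventually_elim
      case (elim x)
      have l0: "0 \<le> l x" using elim nonneg by (intro LIMSEQ_le_const[OF elim]) auto
      have "(\<lambda>i. ennreal (r i x powr ?P)) \<longlonglongrightarrow> ennreal (l x powr ?P)"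
        using P nonneg by (intro tendsto_ennrealI tendsto_powr'[OF elim tendsto_const]) (auto intro!: always_eventually)
      then have "(\<lambda>i. epow (ennreal (r i x)) ?P) \<longlonglongrightarrow> epow (ennreal (l x)) ?P"
        using nonneg l0 by (simp add: epow_ennreal)
      then show ?case by (simp add: lim_imp_Liminf)
    qed
  qed
  also have "\<dots> \<le> liminf (\<lambda>i. \<integral>\<^sup>+ x. epow (ennreal (r i x)) ?P \<partial>M)"
    by (rule nn_integral_liminf) measurable
  also have "\<dots> \<le> epow T ?P"
    using le assms(1,2) by (intro Liminf_le always_eventually) (simp_all add: qnorm_le_iff)
  finally show ?thesis using assms(1,2) by (simp add: qnorm_le_iff)
qed

text \<open>
  Summation of geometrically decaying terms replaces the triangle inequality, which fails for
  \<open>p < 1\<close>. With \<open>w = \<Sum>\<^sub>k 2\<^bsup>k\<delta>p/2\<^esup> u\<^sub>k\<^sup>p\<close> every term satisfies \<open>u\<^sub>k \<le> 2\<^bsup>-k\<delta>/2\<^esup> w\<^bsup>1/p\<^esup>\<close>, so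
  that \<open>(\<Sum>\<^sub>k u\<^sub>k)\<^sup>p \<le> C w\<close>, and w can be integrated term by term for every p.
\<close>

lemma suminf_powr_ennreal:
  assumes "0 < \<delta>"
  shows "\<exists>C>0. (\<Sum>k. ennreal (2 powr - (real k * \<delta>))) = ennreal C"
proof -
  have eq: "2 powr - (real k * \<delta>) = (2 powr - \<delta>) ^ k" for k
    by (simp add: powr_realpow[symmetric] powr_powr mult.commute)
  have lt: "2 powr - \<delta> < (1::real)" using assms by (simp add: powr_less_one)
  have sm: "summable (\<lambda>k. (2 powr - \<delta>) ^ k :: real)" using lt by (simp add: summable_geometric)
  have "(\<Sum>k. ennreal (2 powr - (real k * \<delta>))) = ennreal (\<Sum>k. (2 powr - \<delta>) ^ k)"
    unfolding eq using sm by (intro suminf_ennreal_eq) (auto simp: summable_sums)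
  moreover have "0 < (\<Sum>k. (2 powr - \<delta>) ^ k)" using sm by (intro suminf_pos) auto
  ultimately show ?thesis by blast
qed

lemma qnorm_geometric_suminf:
  assumes p: "0 < p" and \<delta>: "0 < \<delta>"
  obtains C where "C > 0" "\<And>M (u :: nat \<Rightarrow> 'b \<Rightarrow> ennreal) T.
    (\<forall>k. u k \<in> borel_measurable M) \<Longrightarrow>
    (\<forall>k. qnorm p M (u k) \<le> ennreal (2 powr - (real k * \<delta>)) * T) \<Longrightarrow>
    qnorm p M (\<lambda>x. \<Sum>k. u k x) \<le> ennreal C * T"
proof (cases "p = top")
  case True
  obtain C where C: "C > 0" "(\<Sum>k. ennreal (2 powr - (real k * \<delta>))) = ennreal C"
    using suminf_powr_ennreal[OF \<delta>] by metis
  show ?thesis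
  proof (rule that[OF C(1)])
    fix M and u :: "nat \<Rightarrow> 'b \<Rightarrow> ennreal" and T
    assume meas [rule_format, measurable]: "\<forall>k. u k \<in> borel_measurable M"
      and le: "\<forall>k. qnorm p M (u k) \<le> ennreal (2 powr - (real k * \<delta>)) * T"
    have "AE x in M. \<forall>k. u k x \<le> ennreal (2 powr - (real k * \<delta>)) * T"
      using le True by (subst AE_all_countable) (metis qnorm_top_le_iff meas)
    then have "AE x in M. (\<Sum>k. u k x) \<le> ennreal C * T"
    proof eventually_elim
      case (elim x)
      then have "(\<Sum>k. u k x) \<le> (\<Sum>k. ennreal (2 powr - (real k * \<delta>)) * T)"
        by (intro suminf_le) auto
      then show ?case using C by simp
    qed
    then show "qnorm p M (\<lambda>x. \<Sum>k. u k x) \<le> ennreal C * T"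
      unfolding True by (subst qnorm_top_le_iff) measurable
  qed
next
  case False
  let ?P = "enn2real p"
  have P: "0 < ?P" using p False by (simp add: enn2real_index_pos)
  obtain C1 where C1: "C1 > 0" "(\<Sum>k. ennreal (2 powr - (real k * (\<delta> / 2)))) = ennreal C1"
    using suminf_powr_ennreal[of "\<delta> / 2"] \<delta> by (metis half_gt_zero)
  obtain C2 where C2: "C2 > 0" "(\<Sum>k. ennreal (2 powr - (real k * (\<delta> * ?P / 2)))) = ennreal C2"
    using suminf_powr_ennreal[of "\<delta> * ?P / 2"] \<delta> P by (metis half_gt_zero mult_pos_pos)
  define C where "C = C1 * C2 powr (1 / ?P)"
  show ?thesis
  proof (rule that)
    show "C > 0" using C1 C2 by (simp add: C_def)
    fix M and u :: "nat \<Rightarrow> 'b \<Rightarrow> ennreal" and T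
    assume meas [rule_format, measurable]: "\<forall>k. u k \<in> borel_measurable M"
      and le: "\<forall>k. qnorm p M (u k) \<le> ennreal (2 powr - (real k * \<delta>)) * T"
    define w where "w x = (\<Sum>k. ennreal (2 powr (real k * (\<delta> * ?P / 2))) * epow (u k x) ?P)" for x
    have u_le: "u k x \<le> ennreal (2 powr - (real k * (\<delta> / 2))) * epow (w x) (1 / ?P)" for k x
    proof -
      have 1: "(\<Sum>i\<in>{k}. ennreal (2 powr (real i * (\<delta> * ?P / 2))) * epow (u i x) ?P) \<le> w x"
        unfolding w_def by (intro sum_le_suminf) auto
      have "epow (u k x) ?P
          = ennreal (2 powr - (real k * (\<delta> * ?P / 2))) *
              (ennreal (2 powr (real k * (\<delta> * ?P / 2))) * epow (u k x) ?P)"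
        by (simp add: mult.assoc[symmetric] ennreal_mult[symmetric] powr_add[symmetric])
      also have "\<dots> \<le> ennreal (2 powr - (real k * (\<delta> * ?P / 2))) * w x"
        using 1 by (intro mult_left_mono) auto
      finally have "epow (epow (u k x) ?P) (1 / ?P) \<le>
          epow (ennreal (2 powr - (real k * (\<delta> * ?P / 2))) * w x) (1 / ?P)"
        using P by (intro epow_mono) auto
      then show ?thesis
        using P by (simp add: epow_epow_inverse epow_mult epow_ennreal powr_powr)
    qed
    have sum_le: "(\<Sum>k. u k x) \<le> ennreal C1 * epow (w x) (1 / ?P)" for x
    proof -
      have "(\<Sum>k. u k x) \<le> (\<Sum>k. ennreal (2 powr - (real k * (\<delta> / 2))) * epow (w x) (1 / ?P))"
        by (intro suminf_le u_le) auto
      then show ?thesis using C1 by simp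
    qed
    have int_le: "(\<integral>\<^sup>+ x. epow (u k x) ?P \<partial>M) \<le> ennreal (2 powr - (real k * \<delta> * ?P)) * epow T ?P" for k
      using le p False by (simp add: qnorm_le_iff epow_mult epow_ennreal powr_powr)
    have "(\<integral>\<^sup>+ x. epow (\<Sum>k. u k x) ?P \<partial>M) \<le> (\<integral>\<^sup>+ x. ennreal (C1 powr ?P) * w x \<partial>M)"
    proof (rule nn_integral_mono)
      fix x
      have "epow (\<Sum>k. u k x) ?P \<le> epow (ennreal C1 * epow (w x) (1 / ?P)) ?P"
        using P by (intro epow_mono sum_le) auto
      then show "epow (\<Sum>k. u k x) ?P \<le> ennreal (C1 powr ?P) * w x"
        using P C1 by (simp add: epow_mult epow_inverse_epow epow_ennreal)
    qed
    also have "\<dots> = ennreal (C1 powr ?P) *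
        (\<Sum>k. ennreal (2 powr (real k * (\<delta> * ?P / 2))) * (\<integral>\<^sup>+ x. epow (u k x) ?P \<partial>M))"
      unfolding w_def by (simp add: nn_integral_cmult nn_integral_suminf)
    also have "\<dots> \<le> ennreal (C1 powr ?P) *
        (\<Sum>k. ennreal (2 powr - (real k * (\<delta> * ?P / 2))) * epow T ?P)"
    proof (intro mult_left_mono suminf_le)
      fix k
      have "ennreal (2 powr (real k * (\<delta> * ?P / 2))) * (\<integral>\<^sup>+ x. epow (u k x) ?P \<partial>M) \<le>
          ennreal (2 powr (real k * (\<delta> * ?P / 2))) *
            (ennreal (2 powr - (real k * \<delta> * ?P)) * epow T ?P)"
        by (intro mult_left_mono int_le) auto
      also have "\<dots> = ennreal (2 powr - (real k * (\<delta> * ?P / 2))) * epow T ?P"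
        by (simp add: mult.assoc[symmetric] ennreal_mult[symmetric] powr_add[symmetric])
          (simp add: field_simps)
      finally show "ennreal (2 powr (real k * (\<delta> * ?P / 2))) * (\<integral>\<^sup>+ x. epow (u k x) ?P \<partial>M) \<le>
          ennreal (2 powr - (real k * (\<delta> * ?P / 2))) * epow T ?P" .
    qed auto
    also have "\<dots> = epow (ennreal C * T) ?P"
      using C1 C2 P
      by (simp add: C_def epow_mult epow_ennreal powr_powr powr_mult ennreal_mult mult.assoc)
    finally show "qnorm p M (\<lambda>x. \<Sum>k. u k x) \<le> ennreal C * T"
      using p False by (simp add: qnorm_le_iff)
  qed
qed

text \<open>
  The quasi-triangle inequality is the estimate for geometric series applied to the series with the two terms u
  and v.
\<close>

lemma qnorm_add_le:
  assumes p: "0 < p"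
  obtains C where "C > 0" "\<And>M (u :: 'b \<Rightarrow> ennreal) v.
    u \<in> borel_measurable M \<Longrightarrow> v \<in> borel_measurable M \<Longrightarrow>
    qnorm p M (\<lambda>x. u x + v x) \<le> ennreal C * (qnorm p M u + qnorm p M v)"
proof -
  obtain C where C: "C > 0" and C_le: "\<And>M (u :: nat \<Rightarrow> 'b \<Rightarrow> ennreal) T.
    (\<forall>k. u k \<in> borel_measurable M) \<Longrightarrow>
    (\<forall>k. qnorm p M (u k) \<le> ennreal (2 powr - (real k * 1)) * T) \<Longrightarrow>
    qnorm p M (\<lambda>x. \<Sum>k. u k x) \<le> ennreal C * T"
    by (rule qnorm_geometric_suminf[OF p zero_less_one]) (rule that)
  have zero: "qnorm p M (\<lambda>x. 0) = 0" for M :: "'b measure"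
    using qnorm_cmult_le[OF p, of "\<lambda>x. 0" M 0] by simp
  show ?thesis
  proof (rule that)
    show "2 * C > 0" using C by simp
    fix M :: "'b measure" and u v :: "'b \<Rightarrow> ennreal"
    assume [measurable]: "u \<in> borel_measurable M" "v \<in> borel_measurable M"
    define w where "w k = (if k = 0 then u else if k = 1 then v else (\<lambda>x. 0))" for k :: nat
    let ?T = "ennreal 2 * (qnorm p M u + qnorm p M v)"
    have "qnorm p M (\<lambda>x. \<Sum>k. w k x) \<le> ennreal C * ?T"
    proof (intro C_le allI)
      show "w k \<in> borel_measurable M" for k by (simp add: w_def)
      show "qnorm p M (w k) \<le> ennreal (2 powr - (real k * 1)) * ?T" for k
      proof -
        consider "k = 0" | "k = 1" | "k > 1" by linarith
        then show ?thesis
        proof cases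
          case 1
          have "qnorm p M u \<le> 1 * (qnorm p M u + qnorm p M v)" by simp
          also have "\<dots> \<le> ennreal 2 * (qnorm p M u + qnorm p M v)"
            by (intro mult_right_mono) auto
          finally show ?thesis using 1 by (simp add: w_def)
        next
          case 2
          have "ennreal (2 powr - 1) * ?T = ennreal (2 powr - 1 * 2) * (qnorm p M u + qnorm p M v)"
            by (simp only: mult.assoc[symmetric]) (subst ennreal_mult[symmetric], auto)
          then have "ennreal (2 powr - 1) * ?T = qnorm p M u + qnorm p M v"
            by (simp add: powr_minus)
          then show ?thesis using 2 by (simp add: w_def)
        next
          case 3
          then show ?thesis by (simp add: w_def zero)
        qed
      qed
    qed
    also have "(\<lambda>x. \<Sum>k. w k x) = (\<lambda>x. u x + v x)"
    proof
      fix x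
      have "(\<Sum>k. w k x) = (\<Sum>k\<in>{0,1}. w k x)" by (rule suminf_finite) (auto simp: w_def)
      then show "(\<Sum>k. w k x) = u x + v x" by (simp add: w_def)
    qed
    also have "ennreal C * ?T = ennreal (2 * C) * (qnorm p M u + qnorm p M v)"
      using C by (simp add: ennreal_mult mult_ac)
    finally show "qnorm p M (\<lambda>x. u x + v x) \<le> ennreal (2 * C) * (qnorm p M u + qnorm p M v)" .
  qed
qed

lemma esssup_count_space: "esssup (count_space I) u = (SUP i\<in>I. u i :: ennreal)"
proof -
  have "esssup (count_space I) u = Inf {z. \<forall>x\<in>I. u x \<le> z}"
    by (subst esssup_eq_AE) (auto simp: AE_count_space)
  also have "\<dots> = (SUP i\<in>I. u i)"
    by (auto intro!: antisym Inf_lower Inf_greatest SUP_upper SUP_least)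
  finally show ?thesis .
qed

lemma ell_norm_finite: "finite I \<Longrightarrow> ell_norm p I u = qnorm p (count_space I) u"
  by (simp add: ell_norm_def qnorm_def esssup_count_space nn_integral_count_space_finite)

lemma ell_norm_nat: "ell_norm p UNIV u = qnorm p (count_space UNIV) (u :: nat \<Rightarrow> ennreal)"
proof -
  have "infsum v UNIV = suminf v" for v :: "nat \<Rightarrow> ennreal"
  proof -
    have "(v has_sum infsum v UNIV) UNIV"
      by (intro has_sum_infsum nonneg_summable_on_complete) auto
    from has_sum_imp_sums[OF this] show ?thesis by (simp add: sums_iff)
  qed
  then show ?thesis
    by (simp add: ell_norm_def qnorm_def esssup_count_space nn_integral_count_space_nat)
qed

lemma ell_norm_le_ell_norm_UNIV: "0 < q \<Longrightarrow> u j \<le> ell_norm q UNIV (u :: nat \<Rightarrow> ennreal)"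
proof (cases "q = top")
  case False
  assume q: "0 < q"
  let ?Q = "enn2real q"
  have "epow (u j) ?Q \<le> (\<Sum>i. epow (u i) ?Q)"
    using sum_le_suminf[of "\<lambda>i. epow (u i) ?Q" "{j}"] by simp
  also have "\<dots> \<le> epow (ell_norm q UNIV u) ?Q"
    using qnorm_le_iff[of q "count_space UNIV" u "ell_norm q UNIV u"] q False
    by (simp add: ell_norm_nat nn_integral_count_space_nat)
  finally have "epow (epow (u j) ?Q) (1 / ?Q) \<le> epow (epow (ell_norm q UNIV u) ?Q) (1 / ?Q)"
    by (rule epow_mono) simp
  then show ?thesis using epow_epow_inverse[OF enn2real_index_pos[OF q False]] by simp
qed (auto simp: ell_norm_def intro: SUP_upper)

text \<open>
  The basic estimate for sums of atoms: at most A of the supports meet at a point, so that the p-th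
  power of the sum is at most \<open>A\<^sup>p\<close> times the sum of the p-th powers.
\<close>

lemma qnorm_overlap_le:
  assumes p: "0 < p" and fin: "finite I"
    and card: "\<And>x. x \<in> space M \<Longrightarrow> card {m \<in> I. R x m} \<le> A"
    and sets: "\<And>m. m \<in> I \<Longrightarrow> {x \<in> space M. R x m} \<in> sets M"
    and le: "\<And>m. m \<in> I \<Longrightarrow> emeasure M {x \<in> space M. R x m} \<le> ennreal B"
    and B: "0 < B"
  shows "qnorm p M (\<lambda>x. \<Sum>m\<in>{m \<in> I. R x m}. u m)
    \<le> ennreal (real A * B powr enn2real (1 / p)) * ell_norm p I u"
proof -
  have sum_eq: "(\<Sum>m\<in>{m \<in> I. R x m}. v m) = (\<Sum>m\<in>I. v m * indicator {x \<in> space M. R x m} x)"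
    if "x \<in> space M" for x and v :: "'a \<Rightarrow> ennreal"
    using fin that by (auto simp: sum.inter_filter intro!: sum.cong)
  have meas [measurable]: "(\<lambda>x. \<Sum>m\<in>{m \<in> I. R x m}. v m) \<in> borel_measurable M" for v :: "'a \<Rightarrow> ennreal"
    using sets by (subst measurable_cong[OF sum_eq]) auto
  show ?thesis
  proof (cases "p = top")
    case True
    have "(\<Sum>m\<in>{m \<in> I. R x m}. u m) \<le> ennreal (real A) * ell_norm top I u" if "x \<in> space M" for x
    proof -
      have "(\<Sum>m\<in>{m \<in> I. R x m}. u m) \<le> of_nat (card {m \<in> I. R x m}) * ell_norm top I u"
        by (rule sum_bounded_above) (auto simp: ell_norm_def intro!: SUP_upper)
      also have "\<dots> \<le> of_nat A * ell_norm top I u"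
        using card[OF that] by (intro mult_right_mono) auto
      finally show ?thesis by (simp add: ennreal_of_nat_eq_real_of_nat)
    qed
    then show ?thesis unfolding True
      using B by (subst qnorm_top_le_iff) (auto intro!: AE_I2)
  next
    case False
    let ?P = "enn2real p"
    have P: "0 < ?P" using p False by (simp add: enn2real_index_pos)
    have pow_le: "epow (\<Sum>m\<in>{m \<in> I. R x m}. u m) ?P
        \<le> ennreal (real A powr ?P) * (\<Sum>m\<in>{m \<in> I. R x m}. epow (u m) ?P)" if x: "x \<in> space M" for x
    proof (cases "{m \<in> I. R x m} = {}")
      case True
      then show ?thesis by (simp only: sum.empty epow_0) simp
    next
      case ne: False
      let ?N = "{m \<in> I. R x m}"
      have finN: "finite ?N" using fin by simp
      have "Max (u ` ?N) \<in> u ` ?N" using finN ne by (intro Max_in) auto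
      then obtain m0 where m0: "m0 \<in> ?N" "u m0 = Max (u ` ?N)" by auto
      have "(\<Sum>m\<in>?N. u m) \<le> of_nat (card ?N) * u m0"
        using finN m0 by (intro sum_bounded_above) auto
      also have "\<dots> \<le> of_nat A * u m0"
        using card[OF x] by (intro mult_right_mono) auto
      finally have "epow (\<Sum>m\<in>?N. u m) ?P \<le> epow (ennreal (real A) * u m0) ?P"
        using P by (intro epow_mono) (auto simp: ennreal_of_nat_eq_real_of_nat)
      also have "\<dots> = ennreal (real A powr ?P) * epow (u m0) ?P"
        by (simp add: epow_mult epow_ennreal)
      also have "\<dots> \<le> ennreal (real A powr ?P) * (\<Sum>m\<in>?N. epow (u m) ?P)"
        using finN m0 by (intro mult_left_mono member_le_sum) auto
      finally show ?thesis .
    qed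
    have "(\<integral>\<^sup>+ x. epow (\<Sum>m\<in>{m \<in> I. R x m}. u m) ?P \<partial>M) \<le>
        (\<integral>\<^sup>+ x. ennreal (real A powr ?P) *
           (\<Sum>m\<in>I. epow (u m) ?P * indicator {x \<in> space M. R x m} x) \<partial>M)"
      using pow_le by (intro nn_integral_mono) (simp add: sum_eq)
    also have "\<dots> = ennreal (real A powr ?P) *
        (\<Sum>m\<in>I. epow (u m) ?P * emeasure M {x \<in> space M. R x m})"
      using sets by (simp add: nn_integral_cmult nn_integral_sum nn_integral_cmult_indicator)
    also have "\<dots> \<le> ennreal (real A powr ?P) * (\<Sum>m\<in>I. epow (u m) ?P * ennreal B)"
      using le by (intro mult_left_mono sum_mono) auto
    also have "\<dots> = epow (ennreal (real A * B powr enn2real (1 / p)) * ell_norm p I u) ?P"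
    proof -
      have "epow (ell_norm p I u) ?P = (\<Sum>m\<in>I. epow (u m) ?P)"
        using False P fin by (simp add: ell_norm_def epow_inverse_epow)
      then show ?thesis
        using B P p False
        by (simp add: epow_mult epow_ennreal powr_mult powr_powr enn2real_one_div ennreal_mult
            sum_distrib_left[symmetric] mult_ac)
    qed
    finally show ?thesis using p False by (simp add: qnorm_le_iff)
  qed
qed

text \<open>
  The form in which geometric decay is used for series of complex functions: it gives absolute convergence
  almost everywhere and the rate of convergence in \<open>L\<^sub>p\<close>.
\<close>

lemma lp_norm_suminf_le:
  assumes p: "0 < p" and \<sigma>: "0 < \<sigma>"
  obtains C where "C > 0" "\<And>M (H :: nat \<Rightarrow> 'b \<Rightarrow> complex) V T J.
    (\<forall>j. H j \<in> borel_measurable M) \<Longrightarrow> (\<forall>j. V j \<in> borel_measurable M) \<Longrightarrow>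
    (\<forall>j. \<forall>x\<in>space M. ennreal (norm (H j x)) \<le> V j x) \<Longrightarrow>
    (\<forall>j. qnorm p M (V j) \<le> ennreal (2 powr - (real j * \<sigma>)) * T) \<Longrightarrow> T < top \<Longrightarrow>
    (AE x in M. summable (\<lambda>j. norm (H j x))) \<and>
    lp_norm p M (\<lambda>x. (\<Sum>j. H j x) - (\<Sum>j<J. H j x))
            \<le> ennreal (C * 2 powr - (real J * \<sigma>)) * T"
proof -
  obtain C where C: "C > 0" and C_le: "\<And>M (u :: nat \<Rightarrow> 'b \<Rightarrow> ennreal) T.
    (\<forall>k. u k \<in> borel_measurable M) \<Longrightarrow>
    (\<forall>k. qnorm p M (u k) \<le> ennreal (2 powr - (real k * \<sigma>)) * T) \<Longrightarrow>
    qnorm p M (\<lambda>x. \<Sum>k. u k x) \<le> ennreal C * T"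
    by (rule qnorm_geometric_suminf[OF p \<sigma>]) (rule that)
  show ?thesis
  proof (rule that[OF C], rule conjI)
    fix M and H :: "nat \<Rightarrow> 'b \<Rightarrow> complex" and V T and J :: nat
    assume H [rule_format, measurable]: "\<forall>j. H j \<in> borel_measurable M"
      and V [rule_format, measurable]: "\<forall>j. V j \<in> borel_measurable M"
      and HV [rule_format]: "\<forall>j. \<forall>x\<in>space M. ennreal (norm (H j x)) \<le> V j x"
      and le [rule_format]: "\<forall>j. qnorm p M (V j) \<le> ennreal (2 powr - (real j * \<sigma>)) * T"
      and T: "T < top"
    have tail: "qnorm p M (\<lambda>x. \<Sum>k. V (J + k) x) \<le> ennreal (C * 2 powr - (real J * \<sigma>)) * T" for J
    proof -
      have "qnorm p M (\<lambda>x. \<Sum>k. V (J + k) x) \<le> ennreal C * (ennreal (2 powr - (real J * \<sigma>)) * T)"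
      proof (intro C_le allI)
        fix k
        show "qnorm p M (V (J + k)) \<le>
            ennreal (2 powr - (real k * \<sigma>)) * (ennreal (2 powr - (real J * \<sigma>)) * T)"
        proof -
          have "2 powr - (real (J + k) * \<sigma>) = 2 powr - (real k * \<sigma>) * 2 powr - (real J * \<sigma>)"
            by (simp add: powr_add[symmetric] algebra_simps)
          then show ?thesis
            using le[of "J + k"] by (simp add: ennreal_mult mult.assoc)
        qed
      qed measurable
      then show ?thesis using C by (simp add: ennreal_mult mult.assoc)
    qed
    have "qnorm p M (\<lambda>x. \<Sum>k. V k x) \<le> ennreal C * T" using tail[of 0] by simp
    also have "\<dots> < top" using T by (simp add: ennreal_mult_less_top)
    finally have "AE x in M. (\<Sum>k. V k x) < top" using p by (intro AE_of_qnorm_less_top) auto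
    then have fin: "AE x in M. x \<in> space M \<and> (\<Sum>k. V k x) < top" using AE_space by eventually_elim simp
    have sm: "summable (\<lambda>j. norm (H j x))" if "x \<in> space M" "(\<Sum>k. V k x) < top" for x
    proof (rule summable_suminf_not_top)
      have "(\<Sum>j. ennreal (norm (H j x))) \<le> (\<Sum>k. V k x)"
        using HV that by (intro suminf_le) auto
      then show "(\<Sum>j. ennreal (norm (H j x))) \<noteq> top" using that by (auto simp: top_unique)
    qed auto
    show "AE x in M. summable (\<lambda>j. norm (H j x))"
      using fin by eventually_elim (auto intro: sm)
    have "AE x in M. ennreal (norm ((\<Sum>j. H j x) - (\<Sum>j<J. H j x))) \<le> (\<Sum>k. V (J + k) x)"
      using fin
    proof eventually_elim
      case (elim x)
      have s: "summable (\<lambda>j. norm (H j x))" using elim sm by auto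
      then have s': "summable (\<lambda>j. H j x)" by (rule summable_norm_cancel)
      have sJ: "summable (\<lambda>k. norm (H (k + J) x))" using s by (rule summable_ignore_initial_segment)
      have "(\<Sum>j. H j x) - (\<Sum>j<J. H j x) = (\<Sum>k. H (k + J) x)"
        using suminf_split_initial_segment[OF s', of J] by simp
      also have "norm \<dots> \<le> (\<Sum>k. norm (H (k + J) x))" by (rule summable_norm[OF sJ])
      finally have "ennreal (norm ((\<Sum>j. H j x) - (\<Sum>j<J. H j x))) \<le> ennreal (\<Sum>k. norm (H (k + J) x))"
        by (rule ennreal_leI)
      also have "\<dots> = (\<Sum>k. ennreal (norm (H (k + J) x)))"
        using sJ by (intro suminf_ennreal2[symmetric]) auto
      also have "\<dots> \<le> (\<Sum>k. V (J + k) x)"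
        using HV elim by (intro suminf_le) (auto simp: add.commute)
      finally show ?case .
    qed
    then have "lp_norm p M (\<lambda>x. (\<Sum>j. H j x) - (\<Sum>j<J. H j x)) \<le> qnorm p M (\<lambda>x. \<Sum>k. V (J + k) x)"
      unfolding lp_norm_eq_qnorm using p by (intro qnorm_mono_AE) auto
    also note tail
    finally show "lp_norm p M (\<lambda>x. (\<Sum>j. H j x) - (\<Sum>j<J. H j x))
        \<le> ennreal (C * 2 powr - (real J * \<sigma>)) * T" .
  qed
qed

lemma lp_norm_add_le:
  assumes p: "0 < p"
  obtains C where "C > 0" "\<And>M (f :: 'b \<Rightarrow> complex) g.
    f \<in> borel_measurable M \<Longrightarrow> g \<in> borel_measurable M \<Longrightarrow>
    lp_norm p M (\<lambda>x. f x + g x) \<le> ennreal C * (lp_norm p M f + lp_norm p M g)"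
proof -
  obtain C where C: "C > 0" and C_le: "\<And>M (u :: 'b \<Rightarrow> ennreal) v.
    u \<in> borel_measurable M \<Longrightarrow> v \<in> borel_measurable M \<Longrightarrow>
    qnorm p M (\<lambda>x. u x + v x) \<le> ennreal C * (qnorm p M u + qnorm p M v)"
    by (rule qnorm_add_le[OF p]) (rule that)
  show ?thesis
  proof (rule that[OF C])
    fix M and f g :: "'b \<Rightarrow> complex"
    assume [measurable]: "f \<in> borel_measurable M" "g \<in> borel_measurable M"
    have "lp_norm p M (\<lambda>x. f x + g x) \<le> qnorm p M (\<lambda>x. ennreal (norm (f x)) + ennreal (norm (g x)))"
      unfolding lp_norm_eq_qnorm
      by (intro qnorm_mono_AE p AE_I2) (auto simp: ennreal_plus[symmetric] norm_triangle_ineq simp del: ennreal_plus)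
    also have "\<dots> \<le> ennreal C * (lp_norm p M f + lp_norm p M g)"
      unfolding lp_norm_eq_qnorm by (rule C_le) auto
    finally show "lp_norm p M (\<lambda>x. f x + g x) \<le> ennreal C * (lp_norm p M f + lp_norm p M g)" .
  qed
qed

lemma lp_norm_minus_commute: "lp_norm p M (\<lambda>x. f x - g x) = lp_norm p M (\<lambda>x. g x - f x)"
  by (simp add: lp_norm_eq_qnorm norm_minus_commute)

lemma AE_eq_of_lp_limits:
  assumes p: "0 < p"
    and [measurable]: "f \<in> borel_measurable M" "g \<in> borel_measurable M" "\<And>i. u i \<in> borel_measurable M"
    and f: "(\<lambda>i. lp_norm p M (\<lambda>x. f x - u i x)) \<longlonglongrightarrow> 0"
    and g: "(\<lambda>i. lp_norm p M (\<lambda>x. g x - u i x)) \<longlonglongrightarrow> 0"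
  shows "AE x in M. f x = (g x :: complex)"
proof -
  obtain C where C: "C > 0" and C_le: "\<And>M (f :: 'a \<Rightarrow> complex) g.
    f \<in> borel_measurable M \<Longrightarrow> g \<in> borel_measurable M \<Longrightarrow>
    lp_norm p M (\<lambda>x. f x + g x) \<le> ennreal C * (lp_norm p M f + lp_norm p M g)"
    by (rule lp_norm_add_le[OF p]) (rule that)
  have "lp_norm p M (\<lambda>x. f x - g x) \<le>
      ennreal C * (lp_norm p M (\<lambda>x. f x - u i x) + lp_norm p M (\<lambda>x. g x - u i x))" for i
    using C_le[of "\<lambda>x. f x - u i x" M "\<lambda>x. u i x - g x"] by (simp add: lp_norm_minus_commute[of p M g])
  moreover have lim: "(\<lambda>i. ennreal C * (lp_norm p M (\<lambda>x. f x - u i x) + lp_norm p M (\<lambda>x. g x - u i x)))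
      \<longlonglongrightarrow> ennreal C * (0 + 0)"
    by (intro ennreal_tendsto_cmult tendsto_add f g) auto
  ultimately have "lp_norm p M (\<lambda>x. f x - g x) \<le> 0"
    using LIMSEQ_le_const[OF lim] by auto
  then have "AE x in M. ennreal (norm (f x - g x)) = 0"
    by (intro AE_of_qnorm_eq_0[OF p]) (auto simp: lp_norm_eq_qnorm)
  then show ?thesis by (auto elim!: eventually_mono)
qed


section \<open>Functions of class \<open>C\<^sup>k\<close> and their partial derivatives\<close>

lemma pderivative_eq: "(f has_derivative f') (at x) \<Longrightarrow> pderivative b f x = f' b"
  unfolding pderivative_def using frechet_derivative_at by metis

lemma pderivative_add:
  assumes "f differentiable at x" "g differentiable at x"
  shows "pderivative b (\<lambda>x. f x + g x) x = pderivative b f x + pderivative b g x"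
  using assms unfolding frechet_derivative_works
  by (subst pderivative_eq[OF has_derivative_add]) (auto simp: pderivative_def)

lemma pderivative_mult:
  fixes f g :: "_ \<Rightarrow> 'c::real_normed_algebra"
  assumes "f differentiable at x" "g differentiable at x"
  shows "pderivative b (\<lambda>x. f x * g x) x = f x * pderivative b g x + pderivative b f x * g x"
  using assms unfolding frechet_derivative_works
  by (subst pderivative_eq[OF has_derivative_mult]) (auto simp: pderivative_def)

lemma pderivative_const: "pderivative b (\<lambda>x. c) = (\<lambda>x. 0)"
  by (rule ext, subst pderivative_eq[OF has_derivative_const]) auto

lemma pderivative_linear:
  assumes "bounded_linear T" "f differentiable at x"
  shows "pderivative b (\<lambda>x. T (f x)) x = T (pderivative b f x)"
  using assms(2) unfolding frechet_derivative_works
  by (subst pderivative_eq[OF bounded_linear.has_derivative[OF assms(1)]]) (auto simp: pderivative_def)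

lemma differentiable_linear:
  "bounded_linear T \<Longrightarrow> f differentiable at x \<Longrightarrow> (\<lambda>x. T (f x)) differentiable at x"
  unfolding differentiable_def by (blast intro: bounded_linear.has_derivative)

lemma C_k_imp_continuous: "C_k k f \<Longrightarrow> continuous_on UNIV f"
  by (cases k) (auto intro!: differentiable_imp_continuous_on simp: differentiable_on_def
      differentiable_at_withinI)

lemma C_k_Suc_imp: "C_k (Suc k) f \<Longrightarrow> C_k k f"
proof (induction k arbitrary: f)
  case 0
  then show ?case using C_k_imp_continuous[OF 0] by simp
qed auto

lemma C_k_mono: "C_k k f \<Longrightarrow> l \<le> k \<Longrightarrow> C_k l f"
  by (induction k) (auto simp: le_Suc_eq dest: C_k_Suc_imp simp del: C_k.simps)

lemma C_k_add: "C_k k f \<Longrightarrow> C_k k g \<Longrightarrow> C_k k (\<lambda>x. f x + g x)"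
proof (induction k arbitrary: f g)
  case (Suc k)
  then have "pderivative b (\<lambda>x. f x + g x) = (\<lambda>x. pderivative b f x + pderivative b g x)" for b
    by (auto simp: pderivative_add)
  with Suc show ?case by auto
qed (auto intro: continuous_intros)

lemma C_k_const: "C_k k (\<lambda>x. c)"
  by (induction k arbitrary: c) (auto simp: pderivative_const)

lemma C_k_linear: "bounded_linear T \<Longrightarrow> C_k k f \<Longrightarrow> C_k k (\<lambda>x. T (f x))"
proof (induction k arbitrary: f)
  case (Suc k)
  then have "pderivative b (\<lambda>x. T (f x)) = (\<lambda>x. T (pderivative b f x))" for b
    by (auto simp: pderivative_linear)
  moreover have "(\<lambda>x. T (f x)) differentiable at x" for x
    using Suc.prems by (auto intro: differentiable_linear)
  ultimately show ?case using Suc by auto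
qed (auto intro: bounded_linear.continuous_on)

lemma C_k_scaleR: "C_k k f \<Longrightarrow> C_k k (\<lambda>x. c *\<^sub>R f x)"
  by (rule C_k_linear[OF bounded_linear_scaleR_right])

lemma C_k_diff: "C_k k f \<Longrightarrow> C_k k g \<Longrightarrow> C_k k (\<lambda>x. f x - g x)"
  using C_k_add[of k f "\<lambda>x. (-1) *\<^sub>R g x"] C_k_scaleR[of k g "-1"] by simp

lemma C_k_sum: "(\<And>i. i \<in> I \<Longrightarrow> C_k k (f i)) \<Longrightarrow> C_k k (\<lambda>x. \<Sum>i\<in>I. f i x)"
  by (induction I rule: infinite_finite_induct) (auto intro: C_k_add C_k_const)

lemma C_k_mult:
  fixes f g :: "_ \<Rightarrow> 'c::real_normed_algebra"
  shows "C_k k f \<Longrightarrow> C_k k g \<Longrightarrow> C_k k (\<lambda>x. f x * g x)"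
proof (induction k arbitrary: f g)
  case (Suc k)
  then have "pderivative b (\<lambda>x. f x * g x) = (\<lambda>x. f x * pderivative b g x + pderivative b f x * g x)" for b
    by (auto simp: pderivative_mult)
  with Suc show ?case by (auto intro!: C_k_add Suc.IH C_k_Suc_imp[OF Suc.prems(1)] C_k_Suc_imp[OF Suc.prems(2)])
qed (auto intro: continuous_intros)

lemma C_k_prod:
  fixes f :: "'i \<Rightarrow> _ \<Rightarrow> 'c::{real_normed_algebra,comm_ring_1}"
  shows "(\<And>i. i \<in> I \<Longrightarrow> C_k k (f i)) \<Longrightarrow> C_k k (\<lambda>x. \<Prod>i\<in>I. f i x)"
  by (induction I rule: infinite_finite_induct) (auto intro: C_k_mult C_k_const)

lemma pderivative_affine:
  fixes f :: "'b::euclidean_space \<Rightarrow> 'c::real_normed_vector"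
  assumes "\<And>x. f differentiable at x"
  shows "pderivative b (\<lambda>x. f (r *\<^sub>R x + c)) x = r *\<^sub>R pderivative b f (r *\<^sub>R x + c)"
proof -
  let ?D = "frechet_derivative f (at (r *\<^sub>R x + c))"
  have D: "(f has_derivative ?D) (at (r *\<^sub>R x + c))"
    using assms frechet_derivative_works by blast
  have "((\<lambda>x. f (r *\<^sub>R x + c)) has_derivative (\<lambda>h. ?D (r *\<^sub>R h))) (at x)"
    by (rule has_derivative_compose[where f = "\<lambda>x. r *\<^sub>R x + c" and g = f and g' = ?D])
      (auto intro!: derivative_eq_intros D)
  from pderivative_eq[OF this] show ?thesis
    using linear_scale[OF has_derivative_linear[OF D]] by (simp add: pderivative_def)
qed

lemma differentiable_affine:
  "f differentiable at (r *\<^sub>R x + c) \<Longrightarrow> (\<lambda>x. f (r *\<^sub>R x + c)) differentiable at x"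
  using differentiable_chain_at[of "\<lambda>x. r *\<^sub>R x + c" x f] by (simp add: o_def)

lemma C_k_affine:
  "C_k k f \<Longrightarrow> C_k k (\<lambda>x. f (r *\<^sub>R x + c))"
proof (induction k arbitrary: f)
  case 0
  then show ?case
    by (auto intro!: continuous_on_compose2[of UNIV f] continuous_intros)
next
  case (Suc k)
  have d: "(\<lambda>x. f (r *\<^sub>R x + c)) differentiable at x" for x
    using Suc.prems by (intro differentiable_affine) auto
  have "pderivative b (\<lambda>x. f (r *\<^sub>R x + c)) = (\<lambda>x. r *\<^sub>R pderivative b f (r *\<^sub>R x + c))" for b
    using Suc.prems by (auto simp: pderivative_affine)
  with Suc d show ?case by (auto intro!: C_k_scaleR)
qed

text \<open>The tensor products below are built from functions of one coordinate.\<close>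

lemma C_k_of_real_inner:
  fixes f :: "real \<Rightarrow> 'c::real_normed_vector" and b :: "'b::euclidean_space"
  shows "C_k k f \<Longrightarrow> C_k k (\<lambda>x. f (x \<bullet> b))"
proof (induction k arbitrary: f)
  case 0
  then show ?case
    by (auto intro!: continuous_on_compose2[of UNIV f] continuous_intros)
next
  case (Suc k)
  have d: "(\<lambda>x. f (x \<bullet> b)) differentiable at x" for x
    using Suc.prems differentiable_chain_at[of "\<lambda>x. x \<bullet> b" x f]
    by (simp add: o_def bounded_linear_imp_differentiable bounded_linear_inner_left)
  have "pderivative i (\<lambda>x. f (x \<bullet> b)) = (\<lambda>x. (i \<bullet> b) *\<^sub>R pderivative 1 f (x \<bullet> b))" for i
  proof
    fix x
    let ?D = "frechet_derivative f (at (x \<bullet> b))"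
    have D: "(f has_derivative ?D) (at (x \<bullet> b))"
      using Suc.prems frechet_derivative_works by auto
    have "((\<lambda>x. f (x \<bullet> b)) has_derivative (\<lambda>h. ?D (h \<bullet> b))) (at x)"
      by (rule has_derivative_compose[where f = "\<lambda>x. x \<bullet> b" and g = f and g' = ?D])
        (auto intro!: derivative_eq_intros D)
    from pderivative_eq[OF this] show "pderivative i (\<lambda>x. f (x \<bullet> b)) x = (i \<bullet> b) *\<^sub>R pderivative 1 f (x \<bullet> b)"
      using linear_scale[OF has_derivative_linear[OF D], of "i \<bullet> b" 1] by (simp add: pderivative_def)
  qed
  with Suc d show ?case by (auto intro!: C_k_scaleR)
qed

text \<open>
  A function and its derivatives up to order k obey the bounds of an atom of level j, up to the
  factor A. The localization to a cube is kept apart.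
\<close>

definition C_k_bound ::
  "nat \<Rightarrow> nat \<Rightarrow> real \<Rightarrow> ('b::euclidean_space \<Rightarrow> 'c::real_normed_vector) \<Rightarrow> bool" where
  "C_k_bound k j A f \<longleftrightarrow> C_k k f \<and>
     (\<forall>bs x. set bs \<subseteq> Basis \<and> length bs \<le> k \<longrightarrow>
        norm (iterated_pderivative bs f x) \<le> A * 2 ^ (length bs * j))"

lemma atom_iff: "atom d k j m a \<longleftrightarrow> C_k_bound k j 1 a \<and> supp a \<subseteq> cube d j m"
  by (auto simp: atom_def C_k_bound_def)

lemma C_k_bound_0: "C_k_bound 0 j A f \<longleftrightarrow> continuous_on UNIV f \<and> (\<forall>x. norm (f x) \<le> A)"
  by (auto simp: C_k_bound_def)

text \<open>The recursive form, which makes the closure properties inductions on k.\<close>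

lemma C_k_bound_Suc:
  "C_k_bound (Suc k) j A f \<longleftrightarrow> (\<forall>x. f differentiable at x) \<and> (\<forall>x. norm (f x) \<le> A) \<and>
     (\<forall>b\<in>Basis. C_k_bound k j (A * 2 ^ j) (pderivative b f))"
  (is "?L \<longleftrightarrow> ?R")
proof
  assume L: ?L
  have "C_k_bound k j (A * 2 ^ j) (pderivative b f)" if b: "b \<in> Basis" for b
    unfolding C_k_bound_def
  proof (intro conjI allI impI)
    show "C_k k (pderivative b f)" using L b by (auto simp: C_k_bound_def)
    fix bs and x
    assume bs: "set bs \<subseteq> (Basis :: 'a set) \<and> length bs \<le> k"
    then have "norm (iterated_pderivative (b # bs) f x) \<le> A * 2 ^ (length (b # bs) * j)"
      using L b unfolding C_k_bound_def by (metis insert_subset length_Cons list.simps(15) not_less_eq_eq)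
    then show "norm (iterated_pderivative bs (pderivative b f) x) \<le> A * 2 ^ j * 2 ^ (length bs * j)"
      by (simp add: power_add mult_ac)
  qed
  moreover have "norm (f x) \<le> A" for x
    using L[unfolded C_k_bound_def, THEN conjunct2, rule_format, of "[]"] by simp
  ultimately show ?R using L by (auto simp: C_k_bound_def)
next
  assume R: ?R
  show ?L
    unfolding C_k_bound_def
  proof (intro conjI allI impI)
    show "C_k (Suc k) f" using R by (auto simp: C_k_bound_def)
    fix bs and x
    assume bs: "set bs \<subseteq> (Basis :: 'a set) \<and> length bs \<le> Suc k"
    show "norm (iterated_pderivative bs f x) \<le> A * 2 ^ (length bs * j)"
    proof (cases bs)
      case (Cons b bs')
      then have "norm (iterated_pderivative bs' (pderivative b f) x) \<le> A * 2 ^ j * 2 ^ (length bs' * j)"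
        using R bs by (auto simp: C_k_bound_def)
      then show ?thesis using Cons by (simp add: power_add mult_ac)
    qed (use R in auto)
  qed
qed

lemma C_k_bound_norm: "C_k_bound k j A f \<Longrightarrow> norm (f x) \<le> A"
  by (cases k) (auto simp: C_k_bound_0 C_k_bound_Suc)

lemma C_k_bound_C_k: "C_k_bound k j A f \<Longrightarrow> C_k k f"
  by (simp add: C_k_bound_def)

lemma C_k_bound_nonneg: "C_k_bound k j A f \<Longrightarrow> 0 \<le> A"
  by (meson C_k_bound_norm norm_ge_zero order_trans)

lemma C_k_bound_mono:
  assumes f: "C_k_bound k i A f" and "A \<le> B" "i \<le> j" "l \<le> k"
  shows "C_k_bound l j B f"
  unfolding C_k_bound_def
proof (intro conjI allI impI)
  show "C_k l f" using assms by (auto simp: C_k_bound_def intro: C_k_mono)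
  fix bs and x
  assume bs: "set bs \<subseteq> (Basis :: 'a set) \<and> length bs \<le> l"
  then have "norm (iterated_pderivative bs f x) \<le> A * 2 ^ (length bs * i)"
    using assms by (auto simp: C_k_bound_def)
  also have "\<dots> \<le> B * 2 ^ (length bs * j)"
    using assms C_k_bound_nonneg[OF f] by (intro mult_mono power_increasing) auto
  finally show "norm (iterated_pderivative bs f x) \<le> B * 2 ^ (length bs * j)" .
qed

lemma C_k_bound_add:
  "C_k_bound k j A f \<Longrightarrow> C_k_bound k j B g \<Longrightarrow> C_k_bound k j (A + B) (\<lambda>x. f x + g x)"
proof (induction k arbitrary: f g A B)
  case 0
  then show ?case by (auto simp: C_k_bound_0 intro!: continuous_intros norm_triangle_mono)
next
  case (Suc k)
  have "pderivative b (\<lambda>x. f x + g x) = (\<lambda>x. pderivative b f x + pderivative b g x)" for b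
    using Suc.prems by (auto simp: pderivative_add C_k_bound_Suc)
  with Suc show ?case by (auto simp: C_k_bound_Suc distrib_right intro!: norm_triangle_mono)
qed

lemma C_k_bound_const_0: "0 \<le> A \<Longrightarrow> C_k_bound k j A (\<lambda>x. 0)"
  by (induction k arbitrary: A) (auto simp: C_k_bound_0 C_k_bound_Suc pderivative_const)

lemma C_k_bound_sum:
  "(\<And>i. i \<in> I \<Longrightarrow> C_k_bound k j (A i) (f i)) \<Longrightarrow> C_k_bound k j (\<Sum>i\<in>I. A i) (\<lambda>x. \<Sum>i\<in>I. f i x)"
  by (induction I rule: infinite_finite_induct) (auto intro: C_k_bound_add C_k_bound_const_0)

lemma C_k_bound_linear:
  assumes T: "bounded_linear T" and le: "\<And>x. norm (T x) \<le> c * norm x" and c: "0 \<le> c"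
  shows "C_k_bound k j A f \<Longrightarrow> C_k_bound k j (c * A) (\<lambda>x. T (f x))"
proof (induction k arbitrary: f A)
  case 0
  then show ?case
    using c by (auto simp: C_k_bound_0 intro!: bounded_linear.continuous_on[OF T] order_trans[OF le] mult_left_mono)
next
  case (Suc k)
  have "pderivative b (\<lambda>x. T (f x)) = (\<lambda>x. T (pderivative b f x))" for b
    using Suc.prems by (auto simp: pderivative_linear[OF T] C_k_bound_Suc)
  moreover have "(\<lambda>x. T (f x)) differentiable at x" for x
    using Suc.prems T by (auto intro: differentiable_linear simp: C_k_bound_Suc)
  moreover have "norm (T (f x)) \<le> c * A" for x
    using c C_k_bound_norm[OF Suc.prems] by (intro order_trans[OF le] mult_left_mono) auto
  moreover have "C_k_bound k j (c * A * 2 ^ j) (\<lambda>x. T (pderivative b f x))" if "b \<in> Basis" for b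
    using Suc.IH[of "A * 2 ^ j" "pderivative b f"] Suc.prems that by (auto simp: C_k_bound_Suc mult_ac)
  ultimately show ?case by (auto simp: C_k_bound_Suc)
qed

lemma C_k_bound_cmult:
  fixes f :: "_ \<Rightarrow> 'c::real_normed_algebra"
  shows "C_k_bound k j A f \<Longrightarrow> C_k_bound k j (norm c * A) (\<lambda>x. c * f x)"
  by (rule C_k_bound_linear[OF bounded_linear_mult_right]) (auto simp: norm_mult_ineq)

text \<open>Each of the k applications of the product rule doubles the number of terms.\<close>

lemma C_k_bound_mult:
  fixes f g :: "_ \<Rightarrow> 'c::real_normed_algebra"
  shows "C_k_bound k j A f \<Longrightarrow> C_k_bound k j B g \<Longrightarrow> C_k_bound k j (2 ^ k * A * B) (\<lambda>x. f x * g x)"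
proof (induction k arbitrary: f g A B)
  case 0
  then have "0 \<le> A" "0 \<le> B" by (auto dest: C_k_bound_nonneg)
  with 0 show ?case
    by (auto simp: C_k_bound_0 intro!: continuous_intros order_trans[OF norm_mult_ineq] mult_mono)
next
  case (Suc k)
  have nn: "0 \<le> A" "0 \<le> B" using Suc.prems by (auto dest: C_k_bound_nonneg)
  have eq: "pderivative b (\<lambda>x. f x * g x) = (\<lambda>x. f x * pderivative b g x + pderivative b f x * g x)" for b
    using Suc.prems by (auto simp: pderivative_mult C_k_bound_Suc)
  have f: "C_k_bound k j A f" and g: "C_k_bound k j B g"
    using Suc.prems by (auto intro: C_k_bound_mono)
  have "C_k_bound k j (2 ^ Suc k * A * B * 2 ^ j) (pderivative b (\<lambda>x. f x * g x))" if b: "b \<in> Basis" for b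
  proof -
    have "C_k_bound k j (2 ^ k * A * (B * 2 ^ j) + 2 ^ k * (A * 2 ^ j) * B)
        (\<lambda>x. f x * pderivative b g x + pderivative b f x * g x)"
      using Suc.prems b by (intro C_k_bound_add Suc.IH f g) (auto simp: C_k_bound_Suc)
    then show ?thesis unfolding eq by (simp add: algebra_simps)
  qed
  moreover have "norm (f x * g x) \<le> 2 ^ Suc k * A * B" for x
  proof -
    have "norm (f x * g x) \<le> 1 * (A * B)"
      using C_k_bound_norm[OF f] C_k_bound_norm[OF g] nn
      by (auto intro!: order_trans[OF norm_mult_ineq] mult_mono)
    also have "\<dots> \<le> 2 ^ Suc k * (A * B)"
      using nn by (intro mult_right_mono mult_nonneg_nonneg one_le_power) simp_all
    finally show ?thesis by (simp add: mult_ac)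
  qed
  ultimately show ?case using Suc.prems by (auto simp: C_k_bound_Suc)
qed

lemma C_k_bound_dilation:
  "C_k_bound k 0 A f \<Longrightarrow> C_k_bound k j A (\<lambda>x. f (2 ^ j *\<^sub>R x - m))"
proof (induction k arbitrary: f A)
  case 0
  then show ?case
    by (auto simp: C_k_bound_0 intro!: continuous_on_compose2[of UNIV f] continuous_intros)
next
  case (Suc k)
  have d: "(\<lambda>x. f (2 ^ j *\<^sub>R x - m)) differentiable at x" for x
    using Suc.prems differentiable_affine[of f "2 ^ j" x "- m"] by (auto simp: C_k_bound_Suc)
  have eq: "pderivative b (\<lambda>x. f (2 ^ j *\<^sub>R x - m)) = (\<lambda>x. 2 ^ j *\<^sub>R pderivative b f (2 ^ j *\<^sub>R x - m))" for b
    using Suc.prems pderivative_affine[of f b "2 ^ j" "- m"] by (auto simp: C_k_bound_Suc)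
  have "C_k_bound k j (2 ^ j * A) (\<lambda>x. 2 ^ j *\<^sub>R pderivative b f (2 ^ j *\<^sub>R x - m))" if "b \<in> Basis" for b
    using Suc.prems that
    by (intro C_k_bound_linear[OF bounded_linear_scaleR_right] Suc.IH) (auto simp: C_k_bound_Suc)
  with d show ?case using Suc.prems by (auto simp: C_k_bound_Suc eq mult_ac)
qed

lemma supp_subset_iff: "closed S \<Longrightarrow> supp f \<subseteq> S \<longleftrightarrow> (\<forall>x. f x \<noteq> 0 \<longrightarrow> x \<in> S)"
  unfolding supp_def using closure_minimal[of "{x. f x \<noteq> 0}" S] closure_subset[of "{x. f x \<noteq> 0}"] by auto

lemma supp_pderivative: "supp (pderivative b f) \<subseteq> supp f"
proof -
  have "pderivative b f x = 0" if "x \<notin> supp f" for x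
  proof -
    have "((\<lambda>x. 0) has_derivative (\<lambda>h. 0)) (at x)" by simp
    then have "(f has_derivative (\<lambda>h. 0)) (at x)"
    proof (rule has_derivative_transform_within_open)
      show "open (- supp f)" "x \<in> - supp f" using that by (auto simp: supp_def)
      show "0 = f y" if "y \<in> - supp f" for y
        using that closure_subset[of "{x. f x \<noteq> 0}"] by (auto simp: supp_def)
    qed
    then show ?thesis by (rule pderivative_eq)
  qed
  then show ?thesis by (subst supp_subset_iff) (auto simp: supp_def)
qed

text \<open>Up to a constant, such a function obeys the bounds of an atom of level 0.\<close>

lemma C_k_compact_supp_bounded:
  assumes "C_k k f" "compact (supp f)"
  obtains A where "0 < A" "C_k_bound k 0 A f"
proof -
  have "\<exists>A. C_k_bound k 0 A f"
    using assms
  proof (induction k arbitrary: f)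
    case 0
    then have cont: "continuous_on UNIV f" by simp
    have "bounded (f ` supp f)"
      using 0 by (intro compact_imp_bounded compact_continuous_image) (auto intro: continuous_on_subset)
    then obtain A where A: "\<And>x. x \<in> supp f \<Longrightarrow> norm (f x) \<le> A" by (auto simp: bounded_iff)
    have "norm (f x) \<le> max A 0" for x
      using A[of x] closure_subset[of "{x. f x \<noteq> 0}"] by (cases "f x = 0") (auto simp: supp_def)
    with cont show ?case by (auto simp: C_k_bound_0)
  next
    case (Suc k)
    have ex: "\<exists>A. C_k_bound k 0 A (pderivative b f)" if "b \<in> Basis" for b
    proof (rule Suc.IH)
      show "C_k k (pderivative b f)" using Suc.prems that by simp
      have "supp (pderivative b f) = supp f \<inter> supp (pderivative b f)" using supp_pderivative by blast
      then show "compact (supp (pderivative b f))"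
        using compact_Int_closed[OF Suc.prems(2), of "supp (pderivative b f)"] by (simp add: supp_def)
    qed
    then obtain A where A: "\<And>b. b \<in> Basis \<Longrightarrow> C_k_bound k 0 (A b) (pderivative b f)" by metis
    obtain A0 where A0: "C_k_bound k 0 A0 f" using Suc.IH[of f] Suc.prems C_k_Suc_imp by blast
    define B where "B = \<bar>A0\<bar> + (\<Sum>b\<in>Basis. \<bar>A b\<bar>)"
    have "A b \<le> B" if "b \<in> Basis" for b
      using member_le_sum[of b Basis "\<lambda>b. \<bar>A b\<bar>"] that by (auto simp: B_def)
    then have "C_k_bound k 0 B (pderivative b f)" if "b \<in> Basis" for b
      using A[OF that] that by (auto intro: C_k_bound_mono)
    moreover have "norm (f x) \<le> B" for x
    proof -
      have "0 \<le> (\<Sum>b\<in>Basis. \<bar>A b\<bar>)" by (intro sum_nonneg) auto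
      then show ?thesis using C_k_bound_norm[OF A0, of x] unfolding B_def by linarith
    qed
    ultimately show ?case using Suc.prems by (auto simp: C_k_bound_Suc intro!: exI[of _ B])
  qed
  then obtain A where "C_k_bound k 0 A f" by blast
  then have "0 < max A 1" "C_k_bound k 0 (max A 1) f" by (auto intro: C_k_bound_mono)
  then show thesis by (rule that)
qed

lemma C_k_bound_lipschitz:
  fixes f :: "'b::euclidean_space \<Rightarrow> 'c::real_normed_vector"
  assumes "C_k_bound k j A f" "1 \<le> k"
  shows "norm (f x - f y) \<le> real DIM('b) * A * 2 ^ j * norm (x - y)"
proof -
  obtain k' where k: "k = Suc k'" using assms(2) by (cases k) auto
  have "f differentiable at z" for z
    using assms(1) by (simp add: k C_k_bound_Suc)
  then have d: "(f has_derivative frechet_derivative f (at z)) (at z)" for z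
    using frechet_derivative_works by metis
  have "onorm (frechet_derivative f (at z)) \<le> real DIM('b) * A * 2 ^ j" for z
  proof (rule onorm_le)
    fix h :: 'b
    let ?D = "frechet_derivative f (at z)"
    have lin: "linear ?D" using d has_derivative_linear by blast
    have "?D h = ?D (\<Sum>b\<in>Basis. (h \<bullet> b) *\<^sub>R b)" by (simp add: euclidean_representation)
    also have "\<dots> = (\<Sum>b\<in>Basis. (h \<bullet> b) *\<^sub>R ?D b)"
      by (simp add: linear_sum[OF lin] linear_scale[OF lin])
    also have "norm \<dots> \<le> (\<Sum>b\<in>(Basis::'b set). norm h * (A * 2 ^ j))"
    proof (rule sum_norm_le)
      fix b :: 'b assume b: "b \<in> Basis"
      then have "norm (pderivative b f z) \<le> A * 2 ^ j"
        using assms(1) by (intro C_k_bound_norm[of k' j]) (auto simp: k C_k_bound_Suc)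
      then show "norm ((h \<bullet> b) *\<^sub>R ?D b) \<le> norm h * (A * 2 ^ j)"
        using Basis_le_norm[OF b, of h] by (auto simp: pderivative_def intro!: mult_mono)
    qed
    finally show "norm (?D h) \<le> real DIM('b) * A * 2 ^ j * norm h" by (simp add: mult_ac)
  qed
  then show ?thesis
    by (intro differentiable_bound[OF convex_UNIV, of f "\<lambda>z. frechet_derivative f (at z)"])
      (use d in \<open>simp_all\<close>)
qed


section \<open>A smooth partition of unity on the integer lattice\<close>

text \<open>
  The function \<open>exp (-1/t) / t\<^sup>m\<close>, continued by 0 to \<open>t \<le> 0\<close>: this family is closed under
  differentiation up to linear combinations, which makes smoothness at 0 an induction.
\<close>

definition flat_exp :: "nat \<Rightarrow> real \<Rightarrow> real" where
  "flat_exp m t = (if t > 0 then exp (- (1 / t)) / t ^ m else 0)"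

lemma flat_exp_has_derivative:
  "(flat_exp m has_real_derivative flat_exp (m + 2) t - real m * flat_exp (m + 1) t) (at t)"
proof -
  consider "t > 0" | "t < 0" | "t = 0" by linarith
  then show ?thesis
  proof cases
    case 1
    have "((\<lambda>t. exp (- (1 / t)) / t ^ m) has_real_derivative flat_exp (m + 2) t - real m * flat_exp (m + 1) t) (at t)"
      using 1 by (cases m, auto intro!: derivative_eq_intros simp: flat_exp_def divide_simps power2_eq_square algebra_simps,
        metis Suc_pred gr0I power_Suc)
    then show ?thesis
      by (rule DERIV_cong_ev[THEN iffD1, rotated -1])
        (use 1 in \<open>auto simp: flat_exp_def intro!: eventually_mono[OF eventually_nhds_in_open[of "{0<..}"]]\<close>)
  next
    case 2
    have "((\<lambda>t. 0) has_real_derivative flat_exp (m + 2) t - real m * flat_exp (m + 1) t) (at t)"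
      using 2 by (auto simp: flat_exp_def)
    then show ?thesis
      by (rule DERIV_cong_ev[THEN iffD1, rotated -1])
        (use 2 in \<open>auto simp: flat_exp_def intro!: eventually_mono[OF eventually_nhds_in_open[of "{..<0}"]]\<close>)
  next
    case 3
    have "((\<lambda>h. inverse h ^ (m + 1) / exp (inverse h)) \<longlongrightarrow> (0::real)) (at_right 0)"
      by (rule filterlim_compose[OF tendsto_power_div_exp_0 filterlim_inverse_at_top_right])
    then have "((\<lambda>h. (flat_exp m h - flat_exp m 0) / (h - 0)) \<longlongrightarrow> 0) (at_right 0)"
      by (rule Lim_transform_eventually)
        (auto simp: flat_exp_def eventually_at_right_field exp_minus field_simps intro!: exI[of _ 1])
    moreover have "((\<lambda>h. (flat_exp m h - flat_exp m 0) / (h - 0)) \<longlongrightarrow> 0) (at_left 0)"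
      by (rule Lim_transform_eventually[OF tendsto_const])
        (auto simp: flat_exp_def eventually_at_left_field intro!: exI[of _ "-1"])
    ultimately have "(flat_exp m has_real_derivative 0) (at 0)"
      by (simp add: has_field_derivative_iff filterlim_split_at)
    then show ?thesis using 3 by (simp add: flat_exp_def)
  qed
qed

lemma pderivative_real:
  fixes f :: "real \<Rightarrow> real"
  shows "(f has_real_derivative D) (at t) \<Longrightarrow> pderivative 1 f t = D"
  unfolding has_field_derivative_def by (simp add: pderivative_eq[of f "(*) D" t 1])

lemma C_k_Suc_real:
  fixes f :: "real \<Rightarrow> real"
  assumes "\<And>t. (f has_real_derivative g t) (at t)" "C_k k g"
  shows "C_k (Suc k) f"
proof -
  have "pderivative 1 f = g" using pderivative_real[OF assms(1)] by auto
  moreover have "f differentiable at t" for t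
    using assms(1)[of t] unfolding has_field_derivative_def differentiable_def by blast
  ultimately show ?thesis using assms(2) by simp
qed

lemma C_k_flat_exp: "C_k k (flat_exp m)"
proof (induction k arbitrary: m)
  case 0
  have "continuous_on UNIV (flat_exp m)"
    using flat_exp_has_derivative by (intro continuous_at_imp_continuous_on ballI DERIV_isCont) auto
  then show ?case by simp
next
  case (Suc k)
  show ?case
    using C_k_diff[OF Suc.IH[of "m + 2"] C_k_scaleR[OF Suc.IH[of "m + 1"], of "real m"]]
    by (intro C_k_Suc_real[OF flat_exp_has_derivative]) simp
qed

definition bump :: "real \<Rightarrow> real" where
  "bump t = flat_exp 0 t * flat_exp 0 (1 - t)"

lemma C_k_bump: "C_k k bump"
  using C_k_mult[OF C_k_flat_exp[of k 0] C_k_affine[OF C_k_flat_exp[of k 0], of "-1" 1]]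
  by (simp add: bump_def[abs_def])

text \<open>
  The primitive climbs from 0 to a constant between 0 and 1; the difference of two translates of it is a bump.
\<close>

definition bump_primitive :: "real \<Rightarrow> real" where
  "bump_primitive u = interval_lebesgue_integral lborel (ereal 0) (ereal u) bump"

lemma bump_primitive_has_derivative: "(bump_primitive has_real_derivative bump t) (at t)"
proof -
  let ?a = "min 0 t - 1" and ?b = "max 0 t + 1"
  have "(bump_primitive has_vector_derivative bump t) (at t within {?a..?b})"
    unfolding bump_primitive_def[abs_def]
  proof (rule interval_integral_FTC2)
    show "continuous_on {?a..?b} bump"
      using C_k_bump[of 0] by (auto intro: continuous_on_subset)
  qed auto
  then have "(bump_primitive has_vector_derivative bump t) (at t)"
    using at_within_Icc_at[of ?a t ?b] by simp
  then show ?thesis by (simp add: has_real_derivative_iff_has_vector_derivative)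
qed

lemma bump_primitive_const:
  assumes "\<And>t. a \<le> t \<Longrightarrow> t \<le> b \<Longrightarrow> bump t = 0" "a \<le> b"
  shows "bump_primitive a = bump_primitive b"
proof (cases "a = b")
  case False
  have "continuous_on {a..b} bump_primitive"
    using bump_primitive_has_derivative by (intro continuous_at_imp_continuous_on ballI DERIV_isCont) auto
  moreover have "DERIV bump_primitive x :> 0" if "a < x" "x < b" for x
    using bump_primitive_has_derivative[of x] assms(1)[of x] that by simp
  ultimately show ?thesis
    using DERIV_isconst_end[of a b bump_primitive] False assms(2) by auto
qed auto

lemma bump_primitive_nonpos: "t \<le> 0 \<Longrightarrow> bump_primitive t = 0"
  using bump_primitive_const[of t 0] by (auto simp: bump_def flat_exp_def bump_primitive_def)

lemma bump_primitive_ge_1: "1 \<le> t \<Longrightarrow> bump_primitive t = bump_primitive 1"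
  using bump_primitive_const[of 1 t] by (auto simp: bump_def flat_exp_def)

lemma bump_primitive_1_pos: "0 < bump_primitive 1"
proof -
  obtain z where "0 < z" "z < 1" "bump_primitive 1 - bump_primitive 0 = (1 - 0) * bump z"
    using MVT2[of 0 1 bump_primitive bump] bump_primitive_has_derivative by auto
  then show ?thesis by (simp add: bump_primitive_nonpos bump_def flat_exp_def)
qed

definition hat :: "real \<Rightarrow> real" where
  "hat t = (bump_primitive (t + 1) - bump_primitive t) / bump_primitive 1"

lemma C_k_bump_primitive: "C_k k bump_primitive"
  using C_k_Suc_real[OF bump_primitive_has_derivative C_k_bump] C_k_Suc_imp by blast

lemma C_k_hat: "C_k k hat"
  using C_k_scaleR[OF C_k_diff[OF C_k_affine[OF C_k_bump_primitive, of k 1 1] C_k_bump_primitive],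
      of "inverse (bump_primitive 1)"]
  by (simp add: hat_def[abs_def] divide_inverse mult.commute)

lemma hat_eq_0: "1 \<le> \<bar>t\<bar> \<Longrightarrow> hat t = 0"
  by (cases "1 \<le> t") (auto simp: hat_def bump_primitive_nonpos bump_primitive_ge_1[of t] bump_primitive_ge_1[of "t + 1"])

text \<open>The sum over all integers telescopes, and only the two integers next to t contribute.\<close>

lemma sum_hat: "(\<Sum>i\<in>{\<lfloor>t\<rfloor>, \<lfloor>t\<rfloor> + 1}. hat (t - real_of_int i)) = 1"
proof -
  define f where "f = t - real_of_int \<lfloor>t\<rfloor>"
  have f: "0 \<le> f" "f < 1" unfolding f_def by linarith+
  have "(\<Sum>i\<in>{\<lfloor>t\<rfloor>, \<lfloor>t\<rfloor> + 1}. hat (t - real_of_int i)) = hat f + hat (f - 1)"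
    by (simp add: f_def algebra_simps)
  also have "\<dots> = (bump_primitive (f + 1) - bump_primitive (f - 1)) / bump_primitive 1"
    by (simp add: hat_def add_divide_distrib[symmetric])
  also have "\<dots> = 1"
    using f bump_primitive_1_pos by (simp add: bump_primitive_nonpos bump_primitive_ge_1[of "f + 1"])
  finally show ?thesis .
qed

definition lattice_bump :: "'b::euclidean_space \<Rightarrow> complex" where
  "lattice_bump x = complex_of_real (\<Prod>b\<in>Basis. hat (x \<bullet> b))"

lemma C_k_lattice_bump: "C_k k lattice_bump"
  unfolding lattice_bump_def
  by (intro C_k_linear[OF bounded_linear_of_real] C_k_prod C_k_of_real_inner C_k_hat)

lemma lattice_bump_nonzero:
  assumes "lattice_bump x \<noteq> 0" "b \<in> Basis"
  shows "\<bar>x \<bullet> b\<bar> < 1"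
proof (rule ccontr)
  assume "\<not> \<bar>x \<bullet> b\<bar> < 1"
  then have "hat (x \<bullet> b) = 0" by (simp add: hat_eq_0)
  then have "(\<Prod>b\<in>Basis. hat (x \<bullet> b)) = 0" using assms(2) by (intro prod_zero) auto
  then show False using assms(1) by (simp add: lattice_bump_def)
qed

text \<open>
  The sum over the lattice of a product of functions of the coordinates is the product of the one-dimensional
  sums.
\<close>

lemma sum_lattice_bump:
  fixes x :: "'b::euclidean_space"
  assumes "finite I" "I \<subseteq> int_lattice"
    and "\<And>m. m \<in> int_lattice \<Longrightarrow> lattice_bump (x - m) \<noteq> 0 \<Longrightarrow> m \<in> I"
  shows "(\<Sum>m\<in>I. lattice_bump (x - m)) = 1"
proof -
  define F where "F b = {\<lfloor>x \<bullet> b\<rfloor>, \<lfloor>x \<bullet> b\<rfloor> + 1}" for b :: 'b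
  define vec where "vec g = (\<Sum>b\<in>Basis. real_of_int (g b) *\<^sub>R b)" for g :: "'b \<Rightarrow> int"
  define J where "J = vec ` (PiE Basis F)"
  have vec: "vec g \<bullet> b = real_of_int (g b)" if "b \<in> Basis" for g b
    using that by (simp add: vec_def inner_sum_left inner_Basis if_distrib cong: if_cong)
  have inj: "inj_on vec (PiE Basis F)"
  proof (rule inj_onI)
    fix g h assume gh: "g \<in> PiE Basis F" "h \<in> PiE Basis F" "vec g = vec h"
    show "g = h"
    proof (rule PiE_ext[OF gh(1,2)])
      fix b :: 'b assume "b \<in> Basis"
      then have "real_of_int (g b) = real_of_int (h b)" using gh(3) vec by metis
      then show "g b = h b" by simp
    qed
  qed
  have fin: "finite (PiE Basis F)" by (intro finite_PiE) (auto simp: F_def)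
  have J_lattice: "J \<subseteq> int_lattice" by (auto simp: J_def int_lattice_def vec)
  have mem_J: "m \<in> J" if m: "m \<in> int_lattice" "lattice_bump (x - m) \<noteq> 0" for m
  proof -
    define g where "g = (\<lambda>b\<in>Basis. \<lfloor>m \<bullet> b\<rfloor>)"
    have gb: "real_of_int (g b) = m \<bullet> b" if "b \<in> Basis" for b
      using m that by (auto simp: g_def int_lattice_def)
    have "g b \<in> F b" if "b \<in> Basis" for b
      using lattice_bump_nonzero[OF m(2) that] gb[OF that] by (simp add: F_def inner_diff_left) linarith
    then have "g \<in> PiE Basis F" by (auto simp: g_def)
    moreover have "vec g = m"
      by (rule euclidean_eqI) (simp add: vec gb)
    ultimately show ?thesis by (auto simp: J_def)
  qed
  have "(\<Sum>m\<in>J. lattice_bump (x - m)) = (\<Sum>g\<in>PiE Basis F. lattice_bump (x - vec g))"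
    unfolding J_def by (subst sum.reindex[OF inj]) simp
  also have "\<dots> = complex_of_real (\<Sum>g\<in>PiE Basis F. \<Prod>b\<in>Basis. hat (x \<bullet> b - real_of_int (g b)))"
    unfolding lattice_bump_def of_real_sum
    by (intro sum.cong refl arg_cong[of _ _ complex_of_real] prod.cong) (auto simp: inner_diff_left vec)
  also have "(\<Sum>g\<in>PiE Basis F. \<Prod>b\<in>Basis. hat (x \<bullet> b - real_of_int (g b)))
      = (\<Prod>b\<in>Basis. \<Sum>i\<in>F b. hat (x \<bullet> b - real_of_int i))"
    by (rule prod_sum_PiE[symmetric]) (auto simp: F_def)
  also have "\<dots> = 1" unfolding F_def by (simp only: sum_hat) simp
  finally have "(\<Sum>m\<in>J. lattice_bump (x - m)) = 1" by simp
  moreover have "(\<Sum>m\<in>I. lattice_bump (x - m)) = (\<Sum>m\<in>J. lattice_bump (x - m))"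
  proof (rule sum.mono_neutral_cong)
    show "finite J" using fin by (simp add: J_def)
    show "finite I" by fact
    show "lattice_bump (x - m) = 0" if "m \<in> J - I" for m using that assms(3) J_lattice by blast
    show "lattice_bump (x - m) = 0" if "m \<in> I - J" for m using that assms(2) mem_J by blast
  qed auto
  ultimately show ?thesis by simp
qed

lemma lattice_points_near:
  fixes c :: "'b::euclidean_space"
  assumes "0 \<le> R"
  shows "finite {m \<in> int_lattice. \<forall>b\<in>Basis. \<bar>m \<bullet> b - c \<bullet> b\<bar> \<le> R}"
    and "real (card {m \<in> int_lattice. \<forall>b\<in>Basis. \<bar>m \<bullet> b - c \<bullet> b\<bar> \<le> R}) \<le> (2 * R + 1) ^ DIM('b)"
proof -
  let ?S = "{m \<in> int_lattice. \<forall>b\<in>Basis. \<bar>m \<bullet> b - c \<bullet> b\<bar> \<le> R}"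
  define F where "F b = {\<lceil>c \<bullet> b - R\<rceil>..\<lfloor>c \<bullet> b + R\<rfloor>}" for b :: 'b
  define G where "G m = (\<lambda>b\<in>Basis. \<lfloor>m \<bullet> b\<rfloor>)" for m :: 'b
  have inj: "inj_on G ?S"
  proof (rule inj_onI, rule euclidean_eqI)
    fix m m' b :: 'b assume a: "m \<in> ?S" "m' \<in> ?S" "G m = G m'" "b \<in> Basis"
    then have "\<lfloor>m \<bullet> b\<rfloor> = \<lfloor>m' \<bullet> b\<rfloor>" unfolding G_def by (metis restrict_apply')
    moreover have "m \<bullet> b \<in> \<int>" "m' \<bullet> b \<in> \<int>" using a by (auto simp: int_lattice_def)
    ultimately show "m \<bullet> b = m' \<bullet> b" by (auto elim!: Ints_cases)
  qed
  have sub: "G ` ?S \<subseteq> PiE Basis F"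
  proof (rule image_subsetI)
    fix m assume m: "m \<in> ?S"
    have "\<lfloor>m \<bullet> b\<rfloor> \<in> F b" if b: "b \<in> Basis" for b
    proof -
      obtain i where "m \<bullet> b = real_of_int i"
        using m b by (auto simp: int_lattice_def elim!: Ints_cases)
      moreover have "\<bar>m \<bullet> b - c \<bullet> b\<bar> \<le> R" using m b by auto
      ultimately show ?thesis
        by (simp add: F_def ceiling_le_iff le_floor_iff abs_le_iff)
    qed
    then show "G m \<in> PiE Basis F" by (auto simp: G_def)
  qed
  have finP: "finite (PiE Basis F)" by (intro finite_PiE) (auto simp: F_def)
  show fin: "finite ?S" using finite_imageD[OF finite_subset[OF sub finP] inj] .
  have "card ?S \<le> card (PiE Basis F)"
    using card_inj_on_le[OF inj sub finP] .
  also have "\<dots> = (\<Prod>b\<in>Basis. card (F b))" by (simp add: card_PiE)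
  finally have "real (card ?S) \<le> real (\<Prod>b\<in>(Basis::'b set). card (F b))"
    by (simp only: of_nat_le_iff)
  also have "\<dots> = (\<Prod>b\<in>(Basis::'b set). real (card (F b)))"
    by simp
  also have "\<dots> \<le> (\<Prod>b\<in>(Basis::'b set). 2 * R + 1)"
  proof (rule prod_mono)
    fix b :: 'b assume "b \<in> Basis"
    have "real (card (F b)) \<le> 2 * R + 1"
      using assms unfolding F_def by (simp add: of_nat_nat) linarith
    then show "0 \<le> real (card (F b)) \<and> real (card (F b)) \<le> 2 * R + 1" by simp
  qed
  finally show "real (card ?S) \<le> (2 * R + 1) ^ DIM('b)" by simp
qed

lemma lattice_points_in_ball:
  fixes c :: "'b::euclidean_space"
  assumes "0 \<le> R"
  shows "finite {m \<in> int_lattice. norm (m - c) \<le> R}"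
    and "real (card {m \<in> int_lattice. norm (m - c) \<le> R}) \<le> (2 * R + 1) ^ DIM('b)"
proof -
  have sub: "{m \<in> int_lattice. norm (m - c) \<le> R} \<subseteq> {m \<in> int_lattice. \<forall>b\<in>Basis. \<bar>m \<bullet> b - c \<bullet> b\<bar> \<le> R}"
    using Basis_le_norm by (auto simp: inner_diff_left[symmetric] intro: order_trans)
  show "finite {m \<in> int_lattice. norm (m - c) \<le> R}"
    using finite_subset[OF sub lattice_points_near(1)[OF assms]] .
  have "real (card {m \<in> int_lattice. norm (m - c) \<le> R})
      \<le> real (card {m \<in> int_lattice. \<forall>b\<in>Basis. \<bar>m \<bullet> b - c \<bullet> b\<bar> \<le> R})"
    using card_mono[OF lattice_points_near(1)[OF assms] sub] by simp
  also have "\<dots> \<le> (2 * R + 1) ^ DIM('b)" by (rule lattice_points_near(2)[OF assms])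
  finally show "real (card {m \<in> int_lattice. norm (m - c) \<le> R}) \<le> (2 * R + 1) ^ DIM('b)" .
qed


section \<open>Mollification\<close>

text \<open>
  Q is a box that contains the support of one of the two factors, so that only integrals of continuous functions
  over boxes occur.
\<close>

definition conv ::
  "'b::euclidean_space set \<Rightarrow> ('b \<Rightarrow> complex) \<Rightarrow> real \<Rightarrow> ('b \<Rightarrow> complex) \<Rightarrow> 'b \<Rightarrow> complex" where
  "conv Q A \<epsilon> w x = integral Q (\<lambda>y. A y * w (x - \<epsilon> *\<^sub>R y))"

lemma conv_integrable:
  fixes A w :: "'b::euclidean_space \<Rightarrow> complex"
  assumes "continuous_on UNIV A" "continuous_on UNIV w"
  shows "(\<lambda>y. A y * w (x - \<epsilon> *\<^sub>R y)) integrable_on cbox a b"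
proof -
  have "continuous_on (cbox a b) (\<lambda>y. w (x - \<epsilon> *\<^sub>R y))"
    by (rule continuous_on_compose2[OF assms(2)]) (auto intro!: continuous_intros)
  moreover have "continuous_on (cbox a b) A" using assms(1) by (rule continuous_on_subset) simp
  ultimately show ?thesis by (intro integrable_continuous continuous_on_mult)
qed

lemma conv_continuous:
  fixes A w :: "'b::euclidean_space \<Rightarrow> complex"
  assumes "continuous_on UNIV A" "continuous_on UNIV w"
  shows "continuous_on UNIV (conv (cbox a b) A \<epsilon> w)"
proof -
  have "continuous_on (UNIV \<times> cbox a b) (\<lambda>(x, t). A t * w (x - \<epsilon> *\<^sub>R t))"
    unfolding case_prod_beta
    by (intro continuous_intros continuous_on_compose2[OF assms(2)] continuous_on_compose2[OF assms(1)]) auto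
  then show ?thesis
    unfolding conv_def[abs_def] by (rule integral_continuous_on_param)
qed

text \<open>
  Differentiation under the integral sign. The derivative of w is written as a bounded linear map that depends
  continuously on the point.
\<close>

lemma conv_derivative:
  fixes w :: "'b::euclidean_space \<Rightarrow> complex"
  assumes A: "continuous_on UNIV A" and w: "C_k (Suc k) w"
  shows "conv (cbox a b) A \<epsilon> w differentiable at x"
    and "i \<in> Basis \<Longrightarrow> pderivative i (conv (cbox a b) A \<epsilon> w) x = conv (cbox a b) A \<epsilon> (pderivative i w) x"
proof -
  define D where "D z = (\<Sum>i\<in>Basis. blinfun_scaleR_left (pderivative i w z) o\<^sub>L blinfun_inner_left i)"
    for z :: 'b
  define fx where "fx x t = blinfun_mult_right (A t) o\<^sub>L D (x - \<epsilon> *\<^sub>R t)" for x t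
  have wd: "(w has_derivative frechet_derivative w (at z)) (at z)" for z
  proof -
    have "w differentiable at z" using w by simp
    then show ?thesis by (simp add: frechet_derivative_works)
  qed
  have D_apply: "blinfun_apply (D z) h = frechet_derivative w (at z) h" for z h
  proof -
    have lin: "linear (frechet_derivative w (at z))" using wd by (rule has_derivative_linear)
    have "frechet_derivative w (at z) h = frechet_derivative w (at z) (\<Sum>i\<in>Basis. (h \<bullet> i) *\<^sub>R i)"
      by (simp add: euclidean_representation)
    also have "\<dots> = (\<Sum>i\<in>Basis. (h \<bullet> i) *\<^sub>R frechet_derivative w (at z) i)"
      by (simp add: linear_sum[OF lin] linear_scale[OF lin])
    finally show ?thesis by (simp add: D_def blinfun.sum_left pderivative_def)
  qed
  have cont_D: "continuous_on UNIV D"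
    unfolding D_def
  proof (intro continuous_on_sum)
    fix i :: 'b assume "i \<in> Basis"
    then have "continuous_on UNIV (pderivative i w)" using w by (auto intro: C_k_imp_continuous)
    then show "continuous_on UNIV (\<lambda>z. blinfun_scaleR_left (pderivative i w z) o\<^sub>L blinfun_inner_left i)"
      by (intro bounded_bilinear.continuous_on[OF bounded_bilinear_blinfun_compose] continuous_intros
          bounded_linear.continuous_on[OF bounded_linear_blinfun_scaleR_left])
  qed
  have cont_fx: "continuous_on (UNIV \<times> cbox a b) (\<lambda>(x, t). fx x t)"
    unfolding fx_def case_prod_beta
    by (intro bounded_bilinear.continuous_on[OF bounded_bilinear_blinfun_compose]
        bounded_linear.continuous_on[OF bounded_linear_blinfun_mult_right]
        continuous_on_compose2[OF cont_D] continuous_on_compose2[OF A] continuous_intros) auto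
  have der: "((\<lambda>x. A t * w (x - \<epsilon> *\<^sub>R t)) has_derivative blinfun_apply (fx x t)) (at x within UNIV)" for x t
  proof -
    have "((\<lambda>x. x - \<epsilon> *\<^sub>R t) has_derivative (\<lambda>h. h)) (at x)"
      by (auto intro!: derivative_eq_intros)
    then have "((\<lambda>x. w (x - \<epsilon> *\<^sub>R t)) has_derivative frechet_derivative w (at (x - \<epsilon> *\<^sub>R t))) (at x)"
      using has_derivative_compose[where f = "\<lambda>x. x - \<epsilon> *\<^sub>R t" and f' = "\<lambda>h. h" and g = w
          and g' = "frechet_derivative w (at (x - \<epsilon> *\<^sub>R t))" and x = x and s = UNIV, OF _ wd]
      by blast
    from has_derivative_mult_right[OF this, of "A t"] show ?thesis
      by (simp add: fx_def D_apply[abs_def] blinfun_compose.rep_eq o_def)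
  qed
  have main: "(conv (cbox a b) A \<epsilon> w has_derivative integral (cbox a b) (fx x)) (at x within UNIV)" for x
    unfolding conv_def[abs_def]
  proof (rule leibniz_rule[OF der _ cont_fx])
    show "(\<lambda>y. A y * w (x - \<epsilon> *\<^sub>R y)) integrable_on cbox a b" for x
      using w by (intro conv_integrable A C_k_imp_continuous)
  qed auto
  then show "conv (cbox a b) A \<epsilon> w differentiable at x" by (auto simp: differentiable_def)
  assume i: "i \<in> Basis"
  have int: "fx x integrable_on cbox a b"
    by (intro integrable_continuous continuous_on_compose2[OF cont_fx, of _ "\<lambda>t. (x, t)", simplified] continuous_intros) auto
  have "pderivative i (conv (cbox a b) A \<epsilon> w) x = integral (cbox a b) (fx x) i"
    using main[of x] by (intro pderivative_eq) simp
  also have "\<dots> = integral (cbox a b) (\<lambda>t. fx x t i)" by (rule blinfun_apply_integral[OF int])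
  also have "\<dots> = conv (cbox a b) A \<epsilon> (pderivative i w) x"
    by (simp add: conv_def fx_def D_apply pderivative_def)
  finally show "pderivative i (conv (cbox a b) A \<epsilon> w) x = conv (cbox a b) A \<epsilon> (pderivative i w) x" .
qed

lemma C_k_conv:
  assumes "continuous_on UNIV A"
  shows "C_k k w \<Longrightarrow> C_k k (conv (cbox a b) A \<epsilon> w)"
proof (induction k arbitrary: w)
  case 0
  then show ?case using assms by (simp add: conv_continuous)
next
  case (Suc k)
  have "pderivative i (conv (cbox a b) A \<epsilon> w) = conv (cbox a b) A \<epsilon> (pderivative i w)" if "i \<in> Basis" for i
    using conv_derivative(2)[OF assms Suc.prems that] by auto
  moreover have "conv (cbox a b) A \<epsilon> w differentiable at x" for x
    using conv_derivative(1)[OF assms Suc.prems] by auto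
  ultimately show ?case using Suc by auto
qed

lemma uniformly_continuous_compact_supp:
  fixes v :: "'b::euclidean_space \<Rightarrow> 'c::real_normed_vector"
  assumes "continuous_on UNIV v" "compact (supp v)" "0 < \<eta>"
  obtains \<delta> where "0 < \<delta>" "\<And>x y. norm (x - y) \<le> \<delta> \<Longrightarrow> norm (v x - v y) \<le> \<eta>"
proof -
  obtain R where R: "\<And>x. x \<in> supp v \<Longrightarrow> norm x \<le> R"
    using compact_imp_bounded[OF assms(2)] by (auto simp: bounded_iff)
  have out: "v x = 0" if "norm x > R" for x
    using R[of x] that closure_subset[of "{x. v x \<noteq> 0}"] by (force simp: supp_def)
  have "uniformly_continuous_on (cball 0 (R + 1)) v"
    using assms(1) by (intro compact_uniformly_continuous) (auto intro: continuous_on_subset)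
  then obtain d where d: "0 < d"
    "\<And>x y. x \<in> cball 0 (R + 1) \<Longrightarrow> y \<in> cball 0 (R + 1) \<Longrightarrow> dist y x < d \<Longrightarrow> dist (v y) (v x) < \<eta>"
    using assms(3) unfolding uniformly_continuous_on_def by metis
  show thesis
  proof (rule that[of "min (d / 2) 1"])
    show "0 < min (d / 2) 1" using d by simp
    fix x y :: 'b assume xy: "norm (x - y) \<le> min (d / 2) 1"
    show "norm (v x - v y) \<le> \<eta>"
    proof (cases "norm x \<le> R + 1 \<and> norm y \<le> R + 1")
      case True
      then have "dist (v x) (v y) < \<eta>" using d(1) xy by (intro d(2)) (auto simp: dist_norm)
      then show ?thesis by (simp add: dist_norm)
    next
      case False
      have "norm x \<le> norm y + norm (x - y)" "norm y \<le> norm x + norm (x - y)"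
        using norm_triangle_sub norm_triangle_sub[of y x] by (auto simp: norm_minus_commute)
      then have "norm x > R" "norm y > R" using False xy by auto
      then show ?thesis using out assms(3) by simp
    qed
  qed
qed

text \<open>The mollifier: \<open>lattice_bump\<close>, normalized to integral 1.\<close>

definition mollifier :: "'b::euclidean_space \<Rightarrow> real" where
  "mollifier y = (\<Prod>b\<in>Basis. hat (y \<bullet> b)) / integral (cbox (-One) One) (\<lambda>y::'b. \<Prod>b\<in>Basis. hat (y \<bullet> b))"

lemma hat_nonneg: "0 \<le> hat t"
proof -
  have nn: "0 \<le> bump t" for t by (auto simp: bump_def flat_exp_def)
  have "bump_primitive t \<le> bump_primitive (t + 1)"
    using DERIV_nonneg_imp_nondecreasing[of t "t + 1" bump_primitive] bump_primitive_has_derivative nn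
    by (meson less_add_one less_imp_le)
  then show ?thesis using bump_primitive_1_pos by (simp add: hat_def)
qed

lemma prod_hat_continuous: "continuous_on S (\<lambda>y::'b::euclidean_space. \<Prod>b\<in>Basis. hat (y \<bullet> b))"
proof (rule continuous_on_prod)
  show "continuous_on S (\<lambda>y. hat (y \<bullet> b))" for b :: 'b
    by (rule continuous_on_compose2[OF C_k_imp_continuous[OF C_k_hat[of 0]]])
      (auto intro!: continuous_intros)
qed

lemma prod_hat_integral_pos:
  "0 < integral (cbox (-One) One) (\<lambda>y::'b::euclidean_space. \<Prod>b\<in>Basis. hat (y \<bullet> b))" (is "0 < ?I")
proof -
  let ?f = "\<lambda>y::'b. \<Prod>b\<in>Basis. hat (y \<bullet> b)"
  have nn: "0 \<le> ?f y" for y by (intro prod_nonneg) (auto intro: hat_nonneg)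
  have "?I \<noteq> 0"
  proof
    assume "?I = 0"
    then have "(?f has_integral 0) (cbox (-One) One)"
      using integrable_integral[OF integrable_continuous[OF prod_hat_continuous]] by metis
    then have "?f 0 = 0"
      by (rule has_integral_0_cbox_imp_0[OF prod_hat_continuous nn])
        (auto simp: box_eq_empty mem_box)
    moreover have "hat 0 = 1"
      using bump_primitive_1_pos by (simp add: hat_def bump_primitive_nonpos)
    ultimately show False by simp
  qed
  moreover have "0 \<le> ?I" using nn by (intro integral_nonneg integrable_continuous prod_hat_continuous) auto
  ultimately show ?thesis by simp
qed

lemma mollifier_nonneg: "0 \<le> mollifier y"
  unfolding mollifier_def using prod_hat_integral_pos
  by (intro divide_nonneg_pos prod_nonneg) (auto intro: hat_nonneg)

lemma mollifier_continuous: "continuous_on S mollifier"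
  unfolding mollifier_def[abs_def] using prod_hat_integral_pos[where 'b='a]
  by (intro continuous_on_divide[OF prod_hat_continuous continuous_on_const]) auto

lemma mollifier_integral: "integral (cbox (-One) One) mollifier = 1"
  unfolding mollifier_def[abs_def] using prod_hat_integral_pos[where 'b='a] by simp

lemma mollifier_eq: "\<exists>c. \<forall>y. complex_of_real (mollifier y) = c * lattice_bump y"
  unfolding mollifier_def lattice_bump_def
  by (rule exI[of _ "1 / complex_of_real (integral (cbox (-One) One) (\<lambda>y::'a. \<Prod>b\<in>Basis. hat (y \<bullet> b)))"])
    simp

lemma C_k_mollifier: "C_k k (\<lambda>y. complex_of_real (mollifier y))"
proof -
  obtain c where "\<And>y. complex_of_real (mollifier y) = c * lattice_bump (y::'a)" using mollifier_eq by blast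
  then show ?thesis using C_k_linear[OF bounded_linear_mult_right C_k_lattice_bump] by simp
qed

lemma mollifier_nonzero: "mollifier y \<noteq> 0 \<Longrightarrow> y \<in> cbox (-One) One"
proof -
  assume y: "mollifier y \<noteq> 0"
  obtain c where "\<And>y. complex_of_real (mollifier y) = c * lattice_bump (y::'a)" using mollifier_eq by blast
  then have "lattice_bump y \<noteq> 0" using y by (metis mult_zero_right of_real_eq_0_iff)
  then have "\<bar>y \<bullet> b\<bar> < 1" if "b \<in> Basis" for b using lattice_bump_nonzero that by blast
  then show ?thesis by (auto simp: mem_box abs_less_iff intro!: less_imp_le)
qed

abbreviation mollify :: "real \<Rightarrow> ('b::euclidean_space \<Rightarrow> complex) \<Rightarrow> 'b \<Rightarrow> complex" where
  "mollify \<equiv> conv (cbox (-One) One) (\<lambda>y. complex_of_real (mollifier y))"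

text \<open>
  Derivatives commute with mollification, so the estimate for k + 1 is the estimate for k applied to the
  function and its partial derivatives. For k = 0 it is uniform continuity.
\<close>

lemma mollify_close:
  fixes v :: "'b::euclidean_space \<Rightarrow> complex"
  shows "C_k k v \<Longrightarrow> compact (supp v) \<Longrightarrow> 0 < \<eta> \<Longrightarrow>
    \<exists>\<epsilon>0>0. \<forall>\<epsilon>. 0 < \<epsilon> \<and> \<epsilon> \<le> \<epsilon>0 \<longrightarrow> C_k_bound k 0 \<eta> (\<lambda>x. mollify \<epsilon> v x - v x)"
proof (induction k arbitrary: v)
  case 0
  then have cont: "continuous_on UNIV v" by simp
  obtain \<delta> where \<delta>: "0 < \<delta>" "\<And>x y. norm (x - y) \<le> \<delta> \<Longrightarrow> norm (v x - v y) \<le> \<eta>"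
    using uniformly_continuous_compact_supp[OF cont 0(2,3)] by metis
  define \<epsilon>0 where "\<epsilon>0 = \<delta> / real DIM('b)"
  have Mc: "continuous_on UNIV (\<lambda>y::'b. complex_of_real (mollifier y))"
    by (intro continuous_intros mollifier_continuous)
  show ?case
  proof (intro exI[of _ \<epsilon>0] conjI allI impI)
    show "0 < \<epsilon>0" using \<delta> by (simp add: \<epsilon>0_def)
    fix \<epsilon> assume \<epsilon>: "0 < \<epsilon> \<and> \<epsilon> \<le> \<epsilon>0"
    let ?Q = "cbox (-One) (One::'b)"
    have "norm (mollify \<epsilon> v x - v x) \<le> \<eta>" for x
    proof -
      have int1: "(\<lambda>y. complex_of_real (mollifier y) * v (x - \<epsilon> *\<^sub>R y)) integrable_on ?Q"
        by (rule conv_integrable[OF Mc cont])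
      have int2: "(\<lambda>y. complex_of_real (mollifier y) * v x) integrable_on ?Q"
        by (intro integrable_continuous continuous_intros mollifier_continuous)
      have mint: "(mollifier has_integral 1) ?Q"
        using integrable_integral[OF integrable_continuous[OF mollifier_continuous]] mollifier_integral by metis
      have "((\<lambda>y. complex_of_real (mollifier y) * v x) has_integral v x) ?Q"
        using has_integral_mult_left[OF has_integral_of_real[OF mint], of "v x"] by simp
      then have "integral ?Q (\<lambda>y. complex_of_real (mollifier y) * v x) = v x"
        by (rule integral_unique)
      then have "mollify \<epsilon> v x - v x =
          integral ?Q (\<lambda>y. complex_of_real (mollifier y) * v (x - \<epsilon> *\<^sub>R y) - complex_of_real (mollifier y) * v x)"
        unfolding conv_def by (subst integral_diff[OF int1 int2]) simp
      also have "norm \<dots> \<le> integral ?Q (\<lambda>y. mollifier y * \<eta>)"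
      proof (rule integral_norm_bound_integral)
        fix y assume y: "y \<in> ?Q"
        have "norm y \<le> (\<Sum>b\<in>Basis. \<bar>y \<bullet> b\<bar>)" by (rule norm_le_l1)
        also have "\<dots> \<le> (\<Sum>b\<in>(Basis::'b set). 1)"
          using y by (intro sum_mono) (auto simp: mem_box abs_le_iff)
        finally have "\<epsilon> * norm y \<le> \<epsilon>0 * real DIM('b)" using \<epsilon> by (intro mult_mono) auto
        then have "norm (v (x - \<epsilon> *\<^sub>R y) - v x) \<le> \<eta>"
          using \<epsilon> by (intro \<delta>(2)) (simp add: \<epsilon>0_def)
        then show "norm (complex_of_real (mollifier y) * v (x - \<epsilon> *\<^sub>R y) - complex_of_real (mollifier y) * v x)
            \<le> mollifier y * \<eta>"
          using mollifier_nonneg[of y]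
          by (simp add: right_diff_distrib[symmetric] norm_mult mult_left_mono)
      qed (intro integrable_diff int1 int2 integrable_continuous continuous_intros mollifier_continuous)+
      also have "\<dots> = \<eta>"
        by (rule integral_unique) (use has_integral_mult_left[OF mint, of \<eta>] in simp)
      finally show ?thesis .
    qed
    then show "C_k_bound 0 0 \<eta> (\<lambda>x. mollify \<epsilon> v x - v x)"
      unfolding C_k_bound_0 using cont by (auto intro!: continuous_on_diff conv_continuous[OF Mc])
  qed
next
  case (Suc k)
  have Mc: "continuous_on UNIV (\<lambda>y::'b. complex_of_real (mollifier y))"
    by (intro continuous_intros mollifier_continuous)
  obtain e where e: "0 < e" "\<And>\<epsilon>. 0 < \<epsilon> \<Longrightarrow> \<epsilon> \<le> e \<Longrightarrow> C_k_bound k 0 \<eta> (\<lambda>x. mollify \<epsilon> v x - v x)"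
    using Suc.IH[of v] Suc.prems C_k_Suc_imp by blast
  have "\<exists>e>0. \<forall>\<epsilon>. 0 < \<epsilon> \<and> \<epsilon> \<le> e \<longrightarrow>
      C_k_bound k 0 \<eta> (\<lambda>x. mollify \<epsilon> (pderivative b v) x - pderivative b v x)" if "b \<in> Basis" for b
  proof (rule Suc.IH)
    show "C_k k (pderivative b v)" using Suc.prems that by simp
    have "supp (pderivative b v) = supp v \<inter> supp (pderivative b v)" using supp_pderivative by blast
    then show "compact (supp (pderivative b v))"
      using compact_Int_closed[OF Suc.prems(2), of "supp (pderivative b v)"] by (simp add: supp_def)
  qed (use Suc.prems in auto)
  then obtain g where g: "\<And>b. b \<in> Basis \<Longrightarrow> 0 < g b" "\<And>b \<epsilon>. b \<in> Basis \<Longrightarrow> 0 < \<epsilon> \<Longrightarrow> \<epsilon> \<le> g b \<Longrightarrow>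
      C_k_bound k 0 \<eta> (\<lambda>x. mollify \<epsilon> (pderivative b v) x - pderivative b v x)"
    by metis
  define \<epsilon>0 where "\<epsilon>0 = Min (insert e (g ` Basis))"
  show ?case
  proof (intro exI[of _ \<epsilon>0] conjI allI impI)
    show "0 < \<epsilon>0" using e g by (simp add: \<epsilon>0_def)
    fix \<epsilon> assume \<epsilon>: "0 < \<epsilon> \<and> \<epsilon> \<le> \<epsilon>0"
    have le: "\<epsilon> \<le> e" "\<And>b. b \<in> Basis \<Longrightarrow> \<epsilon> \<le> g b" using \<epsilon> by (auto simp: \<epsilon>0_def)
    have C: "C_k (Suc k) (mollify \<epsilon> v)" by (rule C_k_conv[OF Mc Suc.prems(1)])
    have "C_k (Suc k) (\<lambda>x. mollify \<epsilon> v x - v x)" by (rule C_k_diff[OF C Suc.prems(1)])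
    moreover have "pderivative b (\<lambda>x. mollify \<epsilon> v x - v x) = (\<lambda>x. mollify \<epsilon> (pderivative b v) x - pderivative b v x)"
      if b: "b \<in> Basis" for b
    proof
      fix x
      have d: "mollify \<epsilon> v differentiable at x" "v differentiable at x" using C Suc.prems by auto
      have "pderivative b (\<lambda>x. mollify \<epsilon> v x - v x) x = pderivative b (mollify \<epsilon> v) x - pderivative b v x"
        using d unfolding frechet_derivative_works
        by (subst pderivative_eq[OF has_derivative_diff]) (auto simp: pderivative_def)
      then show "pderivative b (\<lambda>x. mollify \<epsilon> v x - v x) x = mollify \<epsilon> (pderivative b v) x - pderivative b v x"
        using conv_derivative(2)[OF Mc Suc.prems(1) b] by simp
    qed
    moreover have "norm (mollify \<epsilon> v x - v x) \<le> \<eta>" for x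
      using C_k_bound_norm[OF e(2)] \<epsilon> le by blast
    ultimately show "C_k_bound (Suc k) 0 \<eta> (\<lambda>x. mollify \<epsilon> v x - v x)"
      using g(2) le \<epsilon> by (simp add: C_k_bound_Suc)
  qed
qed

text \<open>Substitution moves the scaled argument to the mollifier, which then takes all the derivatives.\<close>

lemma smooth_mollify:
  fixes v :: "'b::euclidean_space \<Rightarrow> complex"
  assumes v: "continuous_on UNIV v" "compact (supp v)" and \<epsilon>: "0 < \<epsilon>"
  shows "C_k k (mollify \<epsilon> v)"
proof -
  define \<kappa> where "\<kappa> z = complex_of_real (mollifier ((1 / \<epsilon>) *\<^sub>R z))" for z :: 'b
  have \<kappa>: "C_k k \<kappa>"
    using C_k_affine[OF C_k_mollifier, of k "1 / \<epsilon>" 0] by (simp add: \<kappa>_def[abs_def])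
  obtain a b where ab: "supp v \<subseteq> cbox a b"
    using bounded_subset_cbox_symmetric[OF compact_imp_bounded[OF v(2)]] by metis
  have v0: "v z = 0" if "z \<notin> cbox a b" for z
    using that ab closure_subset[of "{x. v x \<noteq> 0}"] by (force simp: supp_def)
  let ?Q = "cbox (-One) (One::'b)"
  let ?c = "complex_of_real ((1 / \<epsilon>) ^ DIM('b))"
  have "mollify \<epsilon> v x = ?c * conv (cbox a b) v 1 \<kappa> x" for x
  proof -
    define f where "f z = v z * \<kappa> (x - 1 *\<^sub>R z)" for z
    have "(f has_integral conv (cbox a b) v 1 \<kappa> x) (cbox a b)"
      unfolding f_def conv_def
      by (intro integrable_integral conv_integrable v C_k_imp_continuous[OF \<kappa>])
    then have f: "(f has_integral conv (cbox a b) v 1 \<kappa> x) UNIV"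
      by (rule has_integral_on_superset) (auto simp: f_def v0)
    have "((\<lambda>y. complex_of_real (mollifier y) * v (x - \<epsilon> *\<^sub>R y)) has_integral mollify \<epsilon> v x) ?Q"
      unfolding conv_def
      by (intro integrable_integral conv_integrable v continuous_intros mollifier_continuous)
    from has_integral_affinity[OF this, of "- (1 / \<epsilon>)" "(1 / \<epsilon>) *\<^sub>R x"]
    have "((\<lambda>z. complex_of_real (mollifier (- (1 / \<epsilon>) *\<^sub>R z + (1 / \<epsilon>) *\<^sub>R x)) *
            v (x - \<epsilon> *\<^sub>R (- (1 / \<epsilon>) *\<^sub>R z + (1 / \<epsilon>) *\<^sub>R x)))
          has_integral (1 / \<bar>- (1 / \<epsilon>)\<bar> ^ DIM('b)) *\<^sub>R mollify \<epsilon> v x)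
        ((\<lambda>z. (1 / - (1 / \<epsilon>)) *\<^sub>R z + - ((1 / - (1 / \<epsilon>)) *\<^sub>R (1 / \<epsilon>) *\<^sub>R x)) ` ?Q)" (is "(?g has_integral ?i) ?S")
      using \<epsilon> by simp
    also have "?g = f"
      using \<epsilon> by (auto simp: f_def \<kappa>_def algebra_simps scaleR_diff_right)
    finally have "(f has_integral ?i) ?S" .
    then have "(f has_integral ?i) UNIV"
    proof (rule has_integral_on_superset)
      fix z assume z: "z \<notin> ?S"
      have "(1 / \<epsilon>) *\<^sub>R (x - z) \<notin> ?Q"
      proof
        assume "(1 / \<epsilon>) *\<^sub>R (x - z) \<in> ?Q"
        then have "(1 / - (1 / \<epsilon>)) *\<^sub>R ((1 / \<epsilon>) *\<^sub>R (x - z)) + - ((1 / - (1 / \<epsilon>)) *\<^sub>R (1 / \<epsilon>) *\<^sub>R x) \<in> ?S"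
          by (rule imageI)
        moreover have "(1 / - (1 / \<epsilon>)) *\<^sub>R ((1 / \<epsilon>) *\<^sub>R (x - z)) + - ((1 / - (1 / \<epsilon>)) *\<^sub>R (1 / \<epsilon>) *\<^sub>R x) = z"
          using \<epsilon> by (simp add: algebra_simps)
        ultimately show False using z by simp
      qed
      then have "mollifier ((1 / \<epsilon>) *\<^sub>R (x - z)) = 0" using mollifier_nonzero by blast
      then show "f z = 0" by (simp add: f_def \<kappa>_def)
    qed auto
    with f have "?i = conv (cbox a b) v 1 \<kappa> x" by (rule has_integral_unique[rotated])
    then show ?thesis using \<epsilon> by (auto simp: scaleR_conv_of_real field_simps power_divide)
  qed
  then have "mollify \<epsilon> v = (\<lambda>x. ?c * conv (cbox a b) v 1 \<kappa> x)" by blast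
  then show ?thesis
    using C_k_linear[OF bounded_linear_mult_right C_k_conv[OF v(1) \<kappa>]] by simp
qed

lemma supp_mollify:
  fixes v :: "'b::euclidean_space \<Rightarrow> complex"
  assumes "compact (supp v)" "0 < \<epsilon>"
  shows "compact (supp (mollify \<epsilon> v))"
proof -
  obtain R where R: "\<And>x. x \<in> supp v \<Longrightarrow> norm x \<le> R"
    using compact_imp_bounded[OF assms(1)] by (auto simp: bounded_iff)
  have out: "v x = 0" if "norm x > R" for x
    using R[of x] that closure_subset[of "{x. v x \<noteq> 0}"] by (force simp: supp_def)
  have "norm x \<le> R + \<epsilon> * real DIM('b)" if "mollify \<epsilon> v x \<noteq> 0" for x
  proof (rule ccontr)
    assume x: "\<not> norm x \<le> R + \<epsilon> * real DIM('b)"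
    have *: "v (x - \<epsilon> *\<^sub>R y) = 0" if y: "y \<in> cbox (-One) One" for y
    proof (rule out)
      have "norm y \<le> (\<Sum>b\<in>Basis. \<bar>y \<bullet> b\<bar>)" by (rule norm_le_l1)
      also have "\<dots> \<le> (\<Sum>b\<in>(Basis::'b set). 1)"
        using y by (intro sum_mono) (auto simp: mem_box abs_le_iff)
      finally have "\<epsilon> * norm y \<le> \<epsilon> * real DIM('b)" using assms by (intro mult_mono) auto
      then have "norm (\<epsilon> *\<^sub>R y) \<le> \<epsilon> * real DIM('b)" using assms by simp
      moreover have "norm x - norm (\<epsilon> *\<^sub>R y) \<le> norm (x - \<epsilon> *\<^sub>R y)" by (rule norm_triangle_ineq2)
      ultimately show "R < norm (x - \<epsilon> *\<^sub>R y)" using x by linarith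
    qed
    have "mollify \<epsilon> v x = integral (cbox (-One) (One::'b)) (\<lambda>y. 0)"
      unfolding conv_def by (rule integral_cong) (simp add: *)
    with that show False by simp
  qed
  then have "{x. mollify \<epsilon> v x \<noteq> 0} \<subseteq> cball 0 (R + \<epsilon> * real DIM('b))" by auto
  then have "bounded {x. mollify \<epsilon> v x \<noteq> 0}" by (rule bounded_subset[OF bounded_cball])
  then show ?thesis by (simp add: supp_def compact_eq_bounded_closed bounded_closure)
qed

lemma schwartz_of_compact_supp:
  fixes u :: "'b::euclidean_space \<Rightarrow> complex"
  assumes "smooth u" "compact (supp u)"
  shows "schwartz u"
  unfolding schwartz_def
proof (intro conjI allI impI assms(1))
  fix l :: nat and bs :: "'b list"
  assume bs: "set bs \<subseteq> Basis"
  have "continuous_on UNIV (iterated_pderivative bs w) \<and> supp (iterated_pderivative bs w) \<subseteq> supp w"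
    if "C_k (length bs) w" for w :: "'b \<Rightarrow> complex"
    using bs that
  proof (induction bs arbitrary: w)
    case (Cons b bs)
    then show ?case using supp_pderivative[of b w] by fastforce
  qed auto
  then have cont: "continuous_on UNIV (iterated_pderivative bs u)"
    and sub: "supp (iterated_pderivative bs u) \<subseteq> supp u"
    using assms(1) by (auto simp: smooth_def)
  let ?f = "\<lambda>x. (1 + norm x) ^ l * norm (iterated_pderivative bs u x)"
  have "bounded (?f ` supp u)"
    using assms(2) cont
    by (intro compact_imp_bounded compact_continuous_image continuous_intros) (auto intro: continuous_on_subset)
  then have "bounded (insert 0 (?f ` supp u))" by simp
  moreover have "range ?f \<subseteq> insert 0 (?f ` supp u)"
  proof (rule image_subsetI)
    fix x
    show "?f x \<in> insert 0 (?f ` supp u)"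
      using sub closure_subset[of "{x. iterated_pderivative bs u x \<noteq> 0}"] by (cases "x \<in> supp u") (auto simp: supp_def)
  qed
  ultimately show "bounded (range ?f)" by (rule bounded_subset)
qed

lemma schwartz_approximation_C_k:
  fixes v :: "'b::euclidean_space \<Rightarrow> complex"
  assumes "C_k k v" "compact (supp v)" "0 < \<eta>"
  obtains u where "schwartz u" "compact (supp u)" "C_k_bound k 0 \<eta> (\<lambda>x. u x - v x)"
proof -
  obtain \<epsilon> where \<epsilon>: "0 < \<epsilon>" "C_k_bound k 0 \<eta> (\<lambda>x. mollify \<epsilon> v x - v x)"
    using mollify_close[OF assms] by blast
  have "smooth (mollify \<epsilon> v)"
    unfolding smooth_def using smooth_mollify[OF C_k_imp_continuous[OF assms(1)] assms(2) \<epsilon>(1)] by blast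
  then show thesis
    using that schwartz_of_compact_supp supp_mollify[OF assms(2) \<epsilon>(1)] \<epsilon>(2) by blast
qed


section \<open>Hausdorff measure\<close>

text \<open>The weight of a set in a covering: the volume of an r-dimensional ball of the same diameter.\<close>

abbreviation hweight :: "nat \<Rightarrow> 'b::metric_space set \<Rightarrow> ennreal" where
  "hweight r U \<equiv> ennreal (unit_ball_vol (real r) * (diameter U / 2) ^ r)"

lemma hausdorff_premeasure_le:
  assumes "A \<subseteq> (\<Union>i. U i)" "\<And>i. bounded (U i)" "\<And>i. diameter (U i) \<le> \<delta>"
  shows "hausdorff_premeasure r \<delta> A \<le> (\<Sum>i. hweight r (U i))"
  unfolding hausdorff_premeasure_def using assms by (intro INF_lower) auto

lemma hausdorff_premeasure_greatest:
  assumes "\<And>U. A \<subseteq> (\<Union>i. U i) \<Longrightarrow> (\<And>i. bounded (U i)) \<Longrightarrow> (\<And>i. diameter (U i) \<le> \<delta>) \<Longrightarrow>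
    c \<le> (\<Sum>i. hweight r (U i))"
  shows "c \<le> hausdorff_premeasure r \<delta> A"
  unfolding hausdorff_premeasure_def using assms by (intro INF_greatest) auto

lemma hausdorff_premeasure_less:
  assumes "hausdorff_premeasure r \<delta> A < c"
  obtains U where "A \<subseteq> (\<Union>i. U i)" "\<And>i. bounded (U i)" "\<And>i. diameter (U i) \<le> \<delta>"
    "(\<Sum>i. hweight r (U i)) < c"
  using assms unfolding hausdorff_premeasure_def INF_less_iff by auto

lemma hausdorff_premeasure_antimono:
  assumes "\<delta> \<le> \<delta>'" shows "hausdorff_premeasure r \<delta>' A \<le> hausdorff_premeasure r \<delta> A"
  using assms by (intro hausdorff_premeasure_greatest hausdorff_premeasure_le) (auto intro: order_trans)

lemma hausdorff_premeasure_mono: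
  "A \<subseteq> B \<Longrightarrow> hausdorff_premeasure r \<delta> A \<le> hausdorff_premeasure r \<delta> B"
  by (intro hausdorff_premeasure_greatest hausdorff_premeasure_le) auto

lemma hausdorff_premeasure_le_outer:
  "0 < \<delta> \<Longrightarrow> hausdorff_premeasure r \<delta> A \<le> hausdorff_outer_measure r A"
  unfolding hausdorff_outer_measure_def by (intro SUP_upper) auto

lemma hausdorff_outer_least:
  "(\<And>\<delta>. 0 < \<delta> \<Longrightarrow> hausdorff_premeasure r \<delta> A \<le> c) \<Longrightarrow> hausdorff_outer_measure r A \<le> c"
  unfolding hausdorff_outer_measure_def by (intro SUP_least) auto

lemma hausdorff_outer_mono: "A \<subseteq> B \<Longrightarrow> hausdorff_outer_measure r A \<le> hausdorff_outer_measure r B"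
  by (intro hausdorff_outer_least)
    (metis hausdorff_premeasure_mono hausdorff_premeasure_le_outer order_trans)

lemma hausdorff_outer_empty: "0 < r \<Longrightarrow> hausdorff_outer_measure r {} = 0"
proof -
  assume r: "0 < r"
  have "hausdorff_outer_measure r ({} :: 'a set) \<le> 0"
  proof (rule hausdorff_outer_least)
    fix \<delta> :: real assume "0 < \<delta>"
    then have "hausdorff_premeasure r \<delta> ({} :: 'a set) \<le> (\<Sum>i::nat. hweight r ({} :: 'a set))"
      by (intro hausdorff_premeasure_le) auto
    then show "hausdorff_premeasure r \<delta> ({} :: 'a set) \<le> 0" using r by (simp add: zero_power)
  qed
  then show ?thesis by simp
qed

lemma hausdorff_premeasure_UN_le:
  "hausdorff_premeasure r \<delta> (\<Union>n. A n) \<le> (\<Sum>n. hausdorff_premeasure r \<delta> (A n))"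
proof (rule ennreal_le_epsilon)
  fix e :: real assume fin: "(\<Sum>n. hausdorff_premeasure r \<delta> (A n)) < top" and e: "0 < e"
  have "\<exists>U. A n \<subseteq> (\<Union>i. U i) \<and> (\<forall>i. bounded (U i)) \<and> (\<forall>i. diameter (U i) \<le> \<delta>) \<and>
      (\<Sum>i. hweight r (U i)) \<le> hausdorff_premeasure r \<delta> (A n) + ennreal (e * (1/2) ^ Suc n)" for n
  proof -
    have "hausdorff_premeasure r \<delta> (A n) \<noteq> top"
      using ennreal_suminf_lessD[OF fin, of n] by simp
    then have "hausdorff_premeasure r \<delta> (A n) < hausdorff_premeasure r \<delta> (A n) + ennreal (e * (1/2) ^ Suc n)"
      using e by (simp add: ennreal_add_left_cancel_less[of _ 0, simplified])
    from hausdorff_premeasure_less[OF this] show ?thesis by (metis less_imp_le)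
  qed
  then obtain U where U: "\<And>n. A n \<subseteq> (\<Union>i. U n i)" "\<And>n i. bounded (U n i)" "\<And>n i. diameter (U n i) \<le> \<delta>"
      "\<And>n. (\<Sum>i. hweight r (U n i)) \<le> hausdorff_premeasure r \<delta> (A n) + ennreal (e * (1/2) ^ Suc n)"
    by metis
  define V where "V k = (case prod_decode k of (n, i) \<Rightarrow> U n i)" for k
  have "hausdorff_premeasure r \<delta> (\<Union>n. A n) \<le> (\<Sum>k. hweight r (V k))"
  proof (rule hausdorff_premeasure_le)
    show "(\<Union>n. A n) \<subseteq> (\<Union>k. V k)"
    proof
      fix x assume "x \<in> (\<Union>n. A n)"
      then obtain n i where "x \<in> U n i" using U(1) by blast
      then have "x \<in> V (prod_encode (n, i))" by (simp add: V_def)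
      then show "x \<in> (\<Union>k. V k)" by blast
    qed
  qed (auto simp: V_def U split: prod.split)
  also have "\<dots> = (\<Sum>n. \<Sum>i. hweight r (U n i))"
    using suminf_ennreal_2dimen[of "\<lambda>n. \<Sum>i. hweight r (U n i)" "\<lambda>(n, i). hweight r (U n i)"]
    by (simp add: V_def case_prod_beta)
  also have "\<dots> \<le> (\<Sum>n. hausdorff_premeasure r \<delta> (A n) + ennreal (e * (1/2) ^ Suc n))"
    by (intro suminf_le U(4)) auto
  also have "\<dots> = (\<Sum>n. hausdorff_premeasure r \<delta> (A n)) + (\<Sum>n. ennreal (e * (1/2) ^ Suc n))"
    by (intro suminf_add[symmetric]) auto
  also have "(\<Sum>n. ennreal (e * (1/2) ^ Suc n)) = ennreal e"
  proof -
    have "(\<lambda>n. e * (1/2) ^ Suc n) sums (e * 1)"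
      by (intro sums_mult power_half_series)
    then show ?thesis using e by (intro suminf_ennreal_eq) auto
  qed
  finally show "hausdorff_premeasure r \<delta> (\<Union>n. A n) \<le> (\<Sum>n. hausdorff_premeasure r \<delta> (A n)) + ennreal e" .
qed

lemma hausdorff_outer_UN_le:
  "hausdorff_outer_measure r (\<Union>n. A n) \<le> (\<Sum>n. hausdorff_outer_measure r (A n))"
proof (rule hausdorff_outer_least)
  fix \<delta> :: real assume "0 < \<delta>"
  have "hausdorff_premeasure r \<delta> (\<Union>n. A n) \<le> (\<Sum>n. hausdorff_premeasure r \<delta> (A n))"
    by (rule hausdorff_premeasure_UN_le)
  also have "\<dots> \<le> (\<Sum>n. hausdorff_outer_measure r (A n))"
    using \<open>0 < \<delta>\<close> by (intro suminf_le hausdorff_premeasure_le_outer) auto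
  finally show "hausdorff_premeasure r \<delta> (\<Union>n. A n) \<le> (\<Sum>n. hausdorff_outer_measure r (A n))" .
qed

lemma hausdorff_outer_Un_le:
  assumes "0 < r"
  shows "hausdorff_outer_measure r (A \<union> B) \<le> hausdorff_outer_measure r A + hausdorff_outer_measure r B"
proof -
  define C where "C n = (if n = 0 then A else if n = 1 then B else {})" for n :: nat
  have "(\<Union>n. C n) = A \<union> B"
  proof
    show "A \<union> B \<subseteq> (\<Union>n. C n)"
    proof
      fix x assume "x \<in> A \<union> B"
      then have "x \<in> C 0 \<or> x \<in> C 1" by (auto simp: C_def)
      then show "x \<in> (\<Union>n. C n)" by blast
    qed
  qed (auto simp: C_def split: if_splits)
  moreover have "(\<Sum>n. hausdorff_outer_measure r (C n)) = (\<Sum>n\<in>{0,1}. hausdorff_outer_measure r (C n))"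
    using assms by (intro suminf_finite) (auto simp: C_def hausdorff_outer_empty)
  ultimately show ?thesis using hausdorff_outer_UN_le[of r C] by (simp add: C_def)
qed

lemma outer_measure_space_hausdorff:
  "0 < r \<Longrightarrow> outer_measure_space UNIV (hausdorff_outer_measure r)"
  by (auto simp: outer_measure_space_def positive_def increasing_def countably_subadditive_def
      hausdorff_outer_empty intro: hausdorff_outer_mono hausdorff_outer_UN_le)

text \<open>
  No set of diameter less than d meets both A and B, so a fine covering of the union splits into a covering of A
  and one of B.
\<close>

lemma hausdorff_outer_separated:
  assumes sep: "\<And>x y. x \<in> A \<Longrightarrow> y \<in> B \<Longrightarrow> d \<le> dist x y" and d: "0 < d" and r: "0 < r"
  shows "hausdorff_outer_measure r A + hausdorff_outer_measure r B \<le> hausdorff_outer_measure r (A \<union> B)"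
proof -
  have le: "hausdorff_premeasure r \<delta> A + hausdorff_premeasure r \<delta> B \<le> hausdorff_premeasure r \<delta> (A \<union> B)"
    if \<delta>: "0 < \<delta>" "\<delta> < d" for \<delta>
  proof (rule hausdorff_premeasure_greatest)
    fix U :: "nat \<Rightarrow> 'a set"
    assume U: "A \<union> B \<subseteq> (\<Union>i. U i)" "\<And>i. bounded (U i)" "\<And>i. diameter (U i) \<le> \<delta>"
    define UA where "UA i = (if U i \<inter> A \<noteq> {} then U i else {})" for i
    define UB where "UB i = (if U i \<inter> B \<noteq> {} then U i else {})" for i
    have "hausdorff_premeasure r \<delta> A \<le> (\<Sum>i. hweight r (UA i))"
    proof (rule hausdorff_premeasure_le)
      show "A \<subseteq> (\<Union>i. UA i)" using U(1) by (fastforce simp: UA_def)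
    qed (use U \<delta> in \<open>auto simp: UA_def\<close>)
    moreover have "hausdorff_premeasure r \<delta> B \<le> (\<Sum>i. hweight r (UB i))"
    proof (rule hausdorff_premeasure_le)
      show "B \<subseteq> (\<Union>i. UB i)" using U(1) by (fastforce simp: UB_def)
    qed (use U \<delta> in \<open>auto simp: UB_def\<close>)
    moreover have "(\<Sum>i. hweight r (UA i)) + (\<Sum>i. hweight r (UB i)) \<le> (\<Sum>i. hweight r (U i))"
    proof -
      have "hweight r (UA i) + hweight r (UB i) \<le> hweight r (U i)" for i
      proof (cases "U i \<inter> A \<noteq> {} \<and> U i \<inter> B \<noteq> {}")
        case True
        then obtain x y where "x \<in> U i" "x \<in> A" "y \<in> U i" "y \<in> B" by blast
        then have "d \<le> dist x y" "dist x y \<le> diameter (U i)"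
          using sep U(2) by (auto intro: diameter_bounded_bound)
        then show ?thesis using U(3)[of i] \<delta> by linarith
      qed (use r in \<open>auto simp: UA_def UB_def zero_power\<close>)
      then show ?thesis
        by (subst suminf_add) (auto intro: suminf_le)
    qed
    ultimately show "hausdorff_premeasure r \<delta> A + hausdorff_premeasure r \<delta> B \<le> (\<Sum>i. hweight r (U i))"
      by (meson add_mono order_trans)
  qed
  have "hausdorff_outer_measure r A + hausdorff_outer_measure r B
      = (SUP \<delta>\<in>{0<..}. hausdorff_premeasure r \<delta> A + hausdorff_premeasure r \<delta> B)"
    unfolding hausdorff_outer_measure_def
  proof (rule SUP_add_directed_ennreal[symmetric])
    fix \<delta> \<delta>' :: real assume "\<delta> \<in> {0<..}" "\<delta>' \<in> {0<..}"
    then show "\<exists>k\<in>{0<..}. hausdorff_premeasure r \<delta> A + hausdorff_premeasure r \<delta>' B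
        \<le> hausdorff_premeasure r k A + hausdorff_premeasure r k B"
      by (intro bexI[of _ "min \<delta> \<delta>'"] add_mono hausdorff_premeasure_antimono) auto
  qed
  also have "\<dots> \<le> hausdorff_outer_measure r (A \<union> B)"
  proof (rule SUP_least)
    fix \<delta> :: real assume \<delta>: "\<delta> \<in> {0<..}"
    let ?k = "min \<delta> (d / 2)"
    have "hausdorff_premeasure r \<delta> A + hausdorff_premeasure r \<delta> B
        \<le> hausdorff_premeasure r ?k A + hausdorff_premeasure r ?k B"
      by (intro add_mono hausdorff_premeasure_antimono) auto
    also have "\<dots> \<le> hausdorff_premeasure r ?k (A \<union> B)" using \<delta> d by (intro le) auto
    also have "\<dots> \<le> hausdorff_outer_measure r (A \<union> B)"
      using \<delta> d by (intro hausdorff_premeasure_le_outer) auto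
    finally show "hausdorff_premeasure r \<delta> A + hausdorff_premeasure r \<delta> B \<le> hausdorff_outer_measure r (A \<union> B)" .
  qed
  finally show ?thesis .
qed

text \<open>
  Caratheodory's criterion: an outer measure that is additive on sets of positive distance makes
  closed sets measurable. The shells R k of points whose distance from C lies between
  \<open>1/(k+2)\<close> and \<open>1/(k+1)\<close> are separated from each other when their indices differ by at
  least 2, so that their measures have a finite sum.
\<close>

lemma hausdorff_outer_closed:
  fixes C :: "'b::metric_space set"
  assumes C: "closed C" "C \<noteq> {}" and r: "0 < r"
  shows "hausdorff_outer_measure r (C \<inter> A) + hausdorff_outer_measure r (A - C) \<le> hausdorff_outer_measure r A"
proof (cases "hausdorff_outer_measure r A = top")
  case False
  let ?H = "hausdorff_outer_measure r :: 'b set \<Rightarrow> ennreal"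
  define B where "B n = {x \<in> A. 1 / real (Suc n) \<le> infdist x C}" for n
  define R where "R n = {x \<in> A. 1 / real (Suc (Suc n)) \<le> infdist x C \<and> infdist x C < 1 / real (Suc n)}" for n
  have R_sep: "1 / real (Suc (Suc m)) - 1 / real (Suc (Suc (Suc m))) \<le> dist x y"
    if "x \<in> R m" "y \<in> R n" "m + 2 \<le> n" for x y m n
  proof -
    have "infdist x C \<le> infdist y C + dist x y" by (rule infdist_triangle)
    moreover have "1 / real (Suc n) \<le> 1 / real (Suc (Suc (Suc m)))"
      using that(3) by (intro divide_left_mono) auto
    ultimately show ?thesis using that(1,2) by (auto simp: R_def)
  qed
  have pos: "0 < 1 / real (Suc (Suc m)) - 1 / real (Suc (Suc (Suc m)))" for m
  proof -
    have "1 / real (Suc (Suc (Suc m))) < 1 / real (Suc (Suc m))"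
      by (intro divide_strict_left_mono) auto
    then show ?thesis by simp
  qed
  have shells: "(\<Sum>i<n. ?H (R (2 * i + c))) \<le> ?H (\<Union>i<n. R (2 * i + c))" for n c
  proof (induction n)
    case (Suc n)
    define U where "U = (\<Union>i<n. R (2 * i + c))"
    define \<delta> where "\<delta> = Min (insert 1 ((\<lambda>i. 1 / real (Suc (Suc (2 * i + c))) - 1 / real (Suc (Suc (Suc (2 * i + c))))) ` {..<n}))"
    have \<delta>: "0 < \<delta>" unfolding \<delta>_def using pos by (subst Min_gr_iff) (auto simp del: of_nat_Suc)
    have "?H U + ?H (R (2 * n + c)) \<le> ?H (U \<union> R (2 * n + c))"
    proof (rule hausdorff_outer_separated[OF _ \<delta> r])
      fix x y assume "x \<in> U" "y \<in> R (2 * n + c)"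
      then obtain i where i: "i < n" "x \<in> R (2 * i + c)" "y \<in> R (2 * n + c)" by (auto simp: U_def)
      have "\<delta> \<le> 1 / real (Suc (Suc (2 * i + c))) - 1 / real (Suc (Suc (Suc (2 * i + c))))"
        unfolding \<delta>_def using i(1) by (intro Min_le) auto
      also have "\<dots> \<le> dist x y" using i by (intro R_sep) auto
      finally show "\<delta> \<le> dist x y" .
    qed
    moreover have "U \<union> R (2 * n + c) = (\<Union>i<Suc n. R (2 * i + c))"
      by (auto simp: U_def lessThan_Suc)
    ultimately have "(\<Sum>i<n. ?H (R (2 * i + c))) + ?H (R (2 * n + c)) \<le> ?H (\<Union>i<Suc n. R (2 * i + c))"
      using add_right_mono[of "\<Sum>i<n. ?H (R (2 * i + c))" "?H U" "?H (R (2 * n + c))"] Suc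
      unfolding U_def by (metis (no_types, lifting) order_trans)
    then show ?case by simp
  qed (use r in \<open>simp add: hausdorff_outer_empty\<close>)
  have le_A: "(\<Sum>i. ?H (R (2 * i + c))) \<le> ?H A" for c
  proof (rule suminf_le_const)
    fix n
    have "?H (\<Union>i<n. R (2 * i + c)) \<le> ?H A" by (rule hausdorff_outer_mono) (auto simp: R_def)
    with shells[of c n] show "(\<Sum>i<n. ?H (R (2 * i + c))) \<le> ?H A" by (rule order_trans)
  qed auto
  have sum_fin: "(\<Sum>i. ?H (R i)) \<noteq> top"
  proof -
    have "(\<Sum>i<n. ?H (R i)) \<le> ?H A + ?H A" for n
    proof -
      have "(\<Sum>i<n. ?H (R i)) \<le> (\<Sum>i<2 * n. ?H (R i))" by (intro sum_mono2) auto
      also have "\<dots> = (\<Sum>i<n. ?H (R (2 * i))) + (\<Sum>i<n. ?H (R (2 * i + 1)))"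
        by (induction n) (auto simp: algebra_simps)
      also have "\<dots> \<le> (\<Sum>i. ?H (R (2 * i))) + (\<Sum>i. ?H (R (2 * i + 1)))"
        by (intro add_mono sum_le_suminf) auto
      also have "\<dots> \<le> ?H A + ?H A" using le_A[of 0] le_A[of 1] by (intro add_mono) auto
      finally show ?thesis .
    qed
    then have "(\<Sum>i. ?H (R i)) \<le> ?H A + ?H A" by (intro suminf_le_const) auto
    then show ?thesis using False by (auto simp: top_unique)
  qed
  have main: "?H (C \<inter> A) + ?H (A - C) \<le> ?H A + (\<Sum>i. ?H (R (i + n)))" for n
  proof -
    have "A - C \<subseteq> B n \<union> (\<Union>i. R (i + n))"
    proof
      fix x assume x: "x \<in> A - C"
      have "0 < infdist x C" using x C infdist_pos_not_in_closed by fastforce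
      then obtain m where m: "1 / real (Suc m) \<le> infdist x C"
        by (metis inverse_eq_divide less_imp_le reals_Archimedean)
      define k where "k = (LEAST m. 1 / real (Suc m) \<le> infdist x C)"
      have k: "1 / real (Suc k) \<le> infdist x C" unfolding k_def using m by (rule LeastI)
      show "x \<in> B n \<union> (\<Union>i. R (i + n))"
      proof (cases "k \<le> n")
        case True
        then have "1 / real (Suc n) \<le> 1 / real (Suc k)" by (intro divide_left_mono) auto
        then show ?thesis using k x by (auto simp: B_def)
      next
        case False
        then obtain i where i: "k = Suc (i + n)" by (metis add.commute less_imp_Suc_add not_le)
        have "\<not> 1 / real (Suc (i + n)) \<le> infdist x C"
          unfolding k_def using not_less_Least[of "i + n" "\<lambda>m. 1 / real (Suc m) \<le> infdist x C"] i
          by (auto simp: k_def)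
        then have "x \<in> R (i + n)" using k x i by (auto simp: R_def)
        then show ?thesis by blast
      qed
    qed
    then have "?H (A - C) \<le> ?H (B n \<union> (\<Union>i. R (i + n)))" by (rule hausdorff_outer_mono)
    also have "\<dots> \<le> ?H (B n) + ?H (\<Union>i. R (i + n))" by (rule hausdorff_outer_Un_le[OF r])
    also have "\<dots> \<le> ?H (B n) + (\<Sum>i. ?H (R (i + n)))" by (intro add_left_mono hausdorff_outer_UN_le)
    finally have "?H (C \<inter> A) + ?H (A - C) \<le> (?H (C \<inter> A) + ?H (B n)) + (\<Sum>i. ?H (R (i + n)))"
      by (simp add: add_left_mono add.assoc)
    also have "?H (C \<inter> A) + ?H (B n) \<le> ?H (C \<inter> A \<union> B n)"
    proof (rule hausdorff_outer_separated[where d = "1 / real (Suc n)"])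
      fix x y assume xy: "x \<in> C \<inter> A" "y \<in> B n"
      then have "infdist y C \<le> dist y x" by (intro infdist_le) auto
      then show "1 / real (Suc n) \<le> dist x y" using xy by (auto simp: B_def dist_commute)
    qed (use r in auto)
    also have "\<dots> \<le> ?H A" by (rule hausdorff_outer_mono) (auto simp: B_def)
    finally show ?thesis by (simp add: add_right_mono)
  qed
  have "(\<lambda>n. \<Sum>i. ?H (R (i + n))) \<longlonglongrightarrow> 0"
  proof -
    obtain h where h: "\<And>i. ?H (R i) = ennreal (h i)" "\<And>i. 0 \<le> h i"
    proof -
      have "\<exists>h. ?H (R i) = ennreal h \<and> 0 \<le> h" for i
        using ennreal_suminf_lessD[of "\<lambda>i. ?H (R i)" top i] sum_fin
        by (metis ennreal_cases less_top top.not_eq_extremum)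
      then show thesis using that by metis
    qed
    have sh: "summable h"
      using sum_fin h by (intro summable_suminf_not_top) auto
    have "(\<Sum>i. ?H (R (i + n))) = ennreal (\<Sum>i. h (i + n))" for n
      unfolding h(1) using h(2) sh by (intro suminf_ennreal2) (auto simp: summable_iff_shift)
    moreover have "(\<lambda>n. \<Sum>i. h (i + n)) \<longlonglongrightarrow> 0"
      using suminf_exist_split2[OF sh] .
    then have "(\<lambda>n. ennreal (\<Sum>i. h (i + n))) \<longlonglongrightarrow> ennreal 0" by (rule tendsto_ennrealI)
    ultimately show ?thesis by simp
  qed
  then have "(\<lambda>n. ?H A + (\<Sum>i. ?H (R (i + n)))) \<longlonglongrightarrow> ?H A + 0" by (intro tendsto_add tendsto_const)
  from LIMSEQ_le_const[OF this] main show ?thesis by auto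
qed simp

lemma lambda_system_hausdorff:
  assumes "0 < r"
  shows "measure_space UNIV (lambda_system UNIV UNIV (hausdorff_outer_measure r)) (hausdorff_outer_measure r)"
proof -
  interpret sigma_algebra UNIV "UNIV :: 'a set set" using sigma_algebra_Pow[of UNIV] by simp
  show ?thesis by (rule caratheodory_lemma[OF outer_measure_space_hausdorff[OF assms]])
qed

lemma
  fixes A :: "'b::metric_space set"
  assumes "0 < r"
  shows sets_hausdorff_measure:
      "sets (hausdorff_measure r :: 'b measure) = lambda_system UNIV UNIV (hausdorff_outer_measure r)"
    and space_hausdorff_measure: "space (hausdorff_measure r :: 'b measure) = UNIV"
    and emeasure_hausdorff_measure:
      "A \<in> sets (hausdorff_measure r) \<Longrightarrow> emeasure (hausdorff_measure r) A = hausdorff_outer_measure r A"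
proof -
  have ms: "measure_space UNIV (lambda_system UNIV UNIV (hausdorff_outer_measure r :: 'b set \<Rightarrow> ennreal))
      (hausdorff_outer_measure r)"
    by (rule lambda_system_hausdorff[OF assms])
  then have sa: "sigma_algebra UNIV (lambda_system UNIV UNIV (hausdorff_outer_measure r :: 'b set \<Rightarrow> ennreal))"
    by (simp add: measure_space_def)
  show s: "sets (hausdorff_measure r :: 'b measure) = lambda_system UNIV UNIV (hausdorff_outer_measure r)"
    unfolding hausdorff_measure_def using sigma_algebra.sets_measure_of_eq[OF sa] by simp
  show "space (hausdorff_measure r :: 'b measure) = UNIV"
    unfolding hausdorff_measure_def by (simp add: space_measure_of_conv)
  assume "A \<in> sets (hausdorff_measure r)"
  then have "A \<in> lambda_system UNIV UNIV (hausdorff_outer_measure r)" by (simp only: s)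
  then show "emeasure (hausdorff_measure r) A = hausdorff_outer_measure r A"
    using ms unfolding hausdorff_measure_def measure_space_def
    by (intro emeasure_measure_of_sigma) auto
qed

lemma borel_sets_hausdorff:
  assumes "0 < r"
  shows "sets borel \<subseteq> sets (hausdorff_measure r)"
proof -
  have "C \<in> sets (hausdorff_measure r)" if C: "closed C" for C :: "'a set"
  proof (cases "C = {}")
    case False
    have "hausdorff_outer_measure r (C \<inter> A) + hausdorff_outer_measure r ((UNIV - C) \<inter> A) = hausdorff_outer_measure r A" for A
    proof (rule antisym)
      have "(UNIV - C) \<inter> A = A - C" by auto
      then show "hausdorff_outer_measure r (C \<inter> A) + hausdorff_outer_measure r ((UNIV - C) \<inter> A) \<le> hausdorff_outer_measure r A"
        using hausdorff_outer_closed[OF C False assms, of A] by simp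
      have "(C \<inter> A) \<union> ((UNIV - C) \<inter> A) = A" by auto
      then show "hausdorff_outer_measure r A \<le> hausdorff_outer_measure r (C \<inter> A) + hausdorff_outer_measure r ((UNIV - C) \<inter> A)"
        using hausdorff_outer_Un_le[OF assms, of "C \<inter> A" "(UNIV - C) \<inter> A"] by simp
    qed
    then show ?thesis by (simp add: sets_hausdorff_measure[OF assms] lambda_system_def)
  qed simp
  then have "sigma_sets UNIV {C :: 'a set. closed C} \<subseteq> sets (hausdorff_measure r)"
    using sets.sigma_sets_subset[of "{C. closed C}" "hausdorff_measure r"]
    by (auto simp: space_hausdorff_measure[OF assms])
  then show ?thesis by (simp add: borel_eq_closed)
qed

text \<open>Sets of outer measure 0 satisfy Caratheodory's condition, whatever their structure.\<close>

lemma hausdorff_null_sets: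
  assumes "0 < r" "hausdorff_outer_measure r Z = 0"
  shows "Z \<in> null_sets (hausdorff_measure r)"
proof -
  have "hausdorff_outer_measure r (Z \<inter> A) + hausdorff_outer_measure r ((UNIV - Z) \<inter> A) = hausdorff_outer_measure r A" for A
  proof -
    have z: "hausdorff_outer_measure r (Z \<inter> A) = 0"
      using hausdorff_outer_mono[of "Z \<inter> A" Z r] assms(2) by simp
    have "hausdorff_outer_measure r A \<le> hausdorff_outer_measure r (Z \<inter> A) + hausdorff_outer_measure r ((UNIV - Z) \<inter> A)"
    proof -
      have "(Z \<inter> A) \<union> ((UNIV - Z) \<inter> A) = A" by auto
      then show ?thesis using hausdorff_outer_Un_le[OF assms(1), of "Z \<inter> A" "(UNIV - Z) \<inter> A"] by simp
    qed
    then show ?thesis using z hausdorff_outer_mono[of "(UNIV - Z) \<inter> A" A r] by (simp add: antisym)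
  qed
  then have "Z \<in> sets (hausdorff_measure r)"
    by (simp add: sets_hausdorff_measure[OF assms(1)] lambda_system_def)
  then show ?thesis using assms by (simp add: null_sets_def emeasure_hausdorff_measure)
qed

text \<open>
  A Lipschitz image of a set has at most a multiple of its Lebesgue measure: cover the set by small
  nonoverlapping cubes, and compare the diameter of the image of each cube with its side.
\<close>

lemma hausdorff_outer_lipschitz_image:
  fixes \<alpha> :: "'a::euclidean_space \<Rightarrow> 'b::euclidean_space"
  assumes lip: "\<And>x y. norm (\<alpha> x - \<alpha> y) \<le> L * norm (x - y)" and L: "0 < L"
    and Z: "bounded Z" "Z \<in> sets lebesgue"
  shows "hausdorff_outer_measure DIM('a) (\<alpha> ` Z)
    \<le> ennreal (unit_ball_vol (real DIM('a)) * (L * real DIM('a)) ^ DIM('a)) * emeasure lebesgue Z"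
    (is "_ \<le> ennreal ?C * _")
proof -
  let ?D = "DIM('a)"
  have C0: "0 \<le> ?C" using L by (intro mult_nonneg_nonneg) auto
  have fin: "emeasure lebesgue Z < top"
    using bounded_set_imp_lmeasurable[OF Z]
    by (simp only: fmeasurable_def mem_Collect_eq infinity_ennreal_def)
  have step: "hausdorff_premeasure ?D \<delta> (\<alpha> ` Z) \<le> ennreal ?C * (emeasure lebesgue Z + ennreal e)"
    if \<delta>: "0 < \<delta>" and e: "0 < e" for \<delta> e :: real
  proof -
    obtain T where T: "open T" "Z \<subseteq> T" "T - Z \<in> lmeasurable" "emeasure lebesgue (T - Z) < ennreal e"
      using sets_lebesgue_outer_open[OF Z(2) e] by metis
    have T_le: "emeasure lebesgue T \<le> emeasure lebesgue Z + ennreal e"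
    proof -
      have "emeasure lebesgue T = emeasure lebesgue (Z \<union> (T - Z))" using T(2) by (simp add: Un_absorb1)
      also have "\<dots> \<le> emeasure lebesgue Z + emeasure lebesgue (T - Z)"
        using Z T by (intro emeasure_subadditive) (auto simp: fmeasurable_def)
      also have "\<dots> \<le> emeasure lebesgue Z + ennreal e" using T(4) by (intro add_left_mono) auto
      finally show ?thesis .
    qed
    obtain \<rho> where \<rho>: "0 < \<rho>" "Z \<subseteq> cbox (- (\<rho> *\<^sub>R One)) (\<rho> *\<^sub>R One)"
    proof -
      obtain B where "0 < B" "\<And>x. x \<in> Z \<Longrightarrow> norm x \<le> B" using Z(1) by (auto simp: bounded_pos)
      moreover have "\<bar>x \<bullet> i\<bar> \<le> norm x" if "i \<in> Basis" for x i :: 'a using that by (rule Basis_le_norm)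
      ultimately have "Z \<subseteq> cbox (- (B *\<^sub>R One)) (B *\<^sub>R One)"
        by (auto simp: mem_box abs_le_iff) (meson abs_le_iff minus_le_iff order_trans)+
      then show thesis using that \<open>0 < B\<close> by blast
    qed
    \<comment> \<open>The gauge keeps the cubes of the covering inside T, and the diameters of their images below
      \<open>\<delta>\<close>.\<close>
    define g where "g x = (if x \<in> T then T \<inter> ball x (\<delta> / (2 * L)) else UNIV)" for x
    have gauge: "gauge g"
      using T(1) \<delta> L by (auto simp: gauge_def g_def)
    have ne: "box (- (\<rho> *\<^sub>R One)) (\<rho> *\<^sub>R One) \<noteq> ({} :: 'a set)"
      using \<rho>(1) by (auto simp: box_ne_empty)
    obtain \<D> where \<D>: "countable \<D>" "\<Union>\<D> \<subseteq> cbox (- (\<rho> *\<^sub>R One)) (\<rho> *\<^sub>R (One :: 'a))"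
      "\<And>K. K \<in> \<D> \<Longrightarrow> interior K \<noteq> {} \<and> (\<exists>c d. K = cbox c d)"
      "pairwise (\<lambda>A B. interior A \<inter> interior B = {}) \<D>"
      "\<And>K. K \<in> \<D> \<Longrightarrow> \<exists>x\<in>Z \<inter> K. K \<subseteq> g x"
      "\<And>u v. cbox u v \<in> \<D> \<Longrightarrow> \<exists>n. \<forall>i\<in>Basis. v \<bullet> i - u \<bullet> i = (\<rho> *\<^sub>R One \<bullet> i - - (\<rho> *\<^sub>R One) \<bullet> i) / 2 ^ n"
      "Z \<subseteq> \<Union>\<D>"
      using covering_lemma[OF \<rho>(2) ne gauge] by metis
    have K_sub: "K \<subseteq> T" and K_dist: "\<And>x y. x \<in> K \<Longrightarrow> y \<in> K \<Longrightarrow> norm (x - y) \<le> \<delta> / L" if K: "K \<in> \<D>" for K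
    proof -
      obtain z where z: "z \<in> Z" "K \<subseteq> g z" using \<D>(5)[OF K] by blast
      then have s: "K \<subseteq> T \<inter> ball z (\<delta> / (2 * L))" using T(2) by (auto simp: g_def split: if_splits)
      then show "K \<subseteq> T" by blast
      fix x y assume "x \<in> K" "y \<in> K"
      then have "dist z x < \<delta> / (2 * L)" "dist z y < \<delta> / (2 * L)" using s by auto
      then have "dist x y < \<delta> / (2 * L) + \<delta> / (2 * L)"
        using dist_triangle[of x y z] dist_commute[of x z] by linarith
      moreover have "\<delta> / (2 * L) + \<delta> / (2 * L) = \<delta> / L" using L by (simp add: field_simps)
      ultimately show "norm (x - y) \<le> \<delta> / L" by (simp only: dist_norm)
    qed
    have weight: "bounded (\<alpha> ` K) \<and> diameter (\<alpha> ` K) \<le> \<delta> \<and> hweight ?D (\<alpha> ` K) \<le> ennreal (?C * measure lebesgue K)"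
      if K: "K \<in> \<D>" for K
    proof -
      obtain u v where uv: "K = cbox u v" "interior K \<noteq> {}" using \<D>(3)[OF K] by blast
      then have ne: "box u v \<noteq> {}" by simp
      obtain n where n: "\<And>i. i \<in> Basis \<Longrightarrow> v \<bullet> i - u \<bullet> i = 2 * \<rho> / 2 ^ n"
        using \<D>(6)[of u v] K uv(1) by auto
      define t where "t = 2 * \<rho> / 2 ^ n"
      have t: "0 < t" using \<rho> by (simp add: t_def)
      have vol: "measure lebesgue K = t ^ ?D"
      proof -
        have "cbox u v \<noteq> {}" using ne box_subset_cbox[of u v] by blast
        then have "measure lebesgue K = (\<Prod>i\<in>Basis. v \<bullet> i - u \<bullet> i)" by (simp add: uv content_cbox_if)
        also have "\<dots> = (\<Prod>i\<in>(Basis::'a set). t)" using n by (intro prod.cong) (auto simp: t_def)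
        finally show ?thesis by simp
      qed
      have dist_le: "norm (x - y) \<le> real ?D * t" if "x \<in> K" "y \<in> K" for x y
      proof -
        have "norm (x - y) \<le> (\<Sum>i\<in>Basis. \<bar>(x - y) \<bullet> i\<bar>)" by (rule norm_le_l1)
        also have "\<dots> \<le> (\<Sum>i\<in>(Basis::'a set). t)"
        proof (rule sum_mono)
          fix i :: 'a assume i: "i \<in> Basis"
          then have "u \<bullet> i \<le> x \<bullet> i" "x \<bullet> i \<le> v \<bullet> i" "u \<bullet> i \<le> y \<bullet> i" "y \<bullet> i \<le> v \<bullet> i"
            using that uv(1) by (auto simp: mem_box)
          then show "\<bar>(x - y) \<bullet> i\<bar> \<le> t" using n[OF i] by (simp add: t_def inner_diff_left)
        qed
        finally show ?thesis by simp
      qed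
      have diam: "diameter (\<alpha> ` K) \<le> L * (real ?D * t)"
      proof (rule diameter_le)
        show "norm (x - y) \<le> L * (real ?D * t)" if xy: "x \<in> \<alpha> ` K" "y \<in> \<alpha> ` K" for x y
        proof -
          obtain x' y' where "x = \<alpha> x'" "y = \<alpha> y'" "x' \<in> K" "y' \<in> K" using xy by blast
          then show ?thesis using lip[of x' y'] dist_le[of x' y'] L
            by (meson less_imp_le mult_left_mono order_trans)
        qed
      qed (use L t in auto)
      have diam2: "diameter (\<alpha> ` K) \<le> \<delta>"
      proof (rule diameter_le)
        show "norm (x - y) \<le> \<delta>" if xy: "x \<in> \<alpha> ` K" "y \<in> \<alpha> ` K" for x y
        proof -
          obtain x' y' where "x = \<alpha> x'" "y = \<alpha> y'" "x' \<in> K" "y' \<in> K" using xy by blast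
          moreover have "L * norm (x' - y') \<le> L * (\<delta> / L)"
            using K_dist[OF K] calculation L by (intro mult_left_mono) auto
          ultimately show ?thesis using lip[of x' y'] L by auto
        qed
      qed (use \<delta> in auto)
      have bdd: "bounded (\<alpha> ` K)"
      proof -
        have "L-lipschitz_on K \<alpha>" using lip L by (auto simp: lipschitz_on_def dist_norm)
        then have "continuous_on K \<alpha>" by (rule lipschitz_on_continuous_on)
        then show ?thesis using uv(1) by (intro compact_imp_bounded compact_continuous_image) auto
      qed
      have "(diameter (\<alpha> ` K) / 2) ^ ?D \<le> (L * real ?D * t) ^ ?D"
        using diam diameter_ge_0[OF bdd] by (intro power_mono) auto
      then have "unit_ball_vol (real ?D) * (diameter (\<alpha> ` K) / 2) ^ ?D \<le> unit_ball_vol (real ?D) * (L * real ?D * t) ^ ?D"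
        by (intro mult_left_mono) auto
      also have "\<dots> = ?C * measure lebesgue K" by (simp add: vol power_mult_distrib)
      finally show ?thesis using bdd diam2 by (auto intro: ennreal_leI)
    qed
    \<comment> \<open>An enumeration of the images, filled up with empty sets, which have weight 0.\<close>
    define U where "U i = (if i \<in> to_nat_on \<D> ` \<D> then \<alpha> ` (from_nat_into \<D> i) else {})" for i
    have "hausdorff_premeasure ?D \<delta> (\<alpha> ` Z) \<le> (\<Sum>i. hweight ?D (U i))"
    proof (rule hausdorff_premeasure_le)
      show "\<alpha> ` Z \<subseteq> (\<Union>i. U i)"
      proof (rule image_subsetI)
        fix x assume "x \<in> Z"
        then obtain K where K: "K \<in> \<D>" "x \<in> K" using \<D>(7) by blast
        then have "\<alpha> x \<in> U (to_nat_on \<D> K)" using \<D>(1) by (auto simp: U_def)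
        then show "\<alpha> x \<in> (\<Union>i. U i)" by blast
      qed
      show "bounded (U i)" "diameter (U i) \<le> \<delta>" for i
        using weight \<delta> \<D>(1) by (auto simp: U_def)
    qed
    also have "\<dots> \<le> ennreal ?C * emeasure lebesgue T"
    proof (rule suminf_le_const)
      fix n
      define F where "F = {K \<in> \<D>. to_nat_on \<D> K < n}"
      have inj: "inj_on (to_nat_on \<D>) \<D>" using \<D>(1) by (rule inj_on_to_nat_on)
      have finF: "finite F"
        by (rule finite_imageD[of "to_nat_on \<D>"])
          (auto simp: F_def intro: finite_subset[of _ "{..<n}"] inj_on_subset[OF inj])
      have "(\<Sum>i<n. hweight ?D (U i)) = (\<Sum>i\<in>to_nat_on \<D> ` F. hweight ?D (U i))"
        by (rule sum.mono_neutral_right) (auto simp: F_def U_def)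
      also have "\<dots> = (\<Sum>K\<in>F. hweight ?D (\<alpha> ` K))"
        using \<D>(1) by (subst sum.reindex) (auto simp: F_def U_def intro!: sum.cong inj_on_subset[OF inj])
      also have "\<dots> \<le> (\<Sum>K\<in>F. ennreal (?C * measure lebesgue K))"
        using weight by (intro sum_mono) (auto simp: F_def)
      also have "\<dots> = ennreal (?C * (\<Sum>K\<in>F. measure lebesgue K))"
        using C0 by (subst sum_ennreal) (auto simp: sum_distrib_left)
      also have "(\<Sum>K\<in>F. measure lebesgue K) = measure lebesgue (\<Union>F)"
      proof (rule measure_negligible_finite_Union[symmetric, OF finF])
        show "K \<in> lmeasurable" if "K \<in> F" for K using \<D>(3)[of K] that by (auto simp: F_def)
        show "pairwise (\<lambda>S T. negligible (S \<inter> T)) F"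
          unfolding pairwise_def
        proof (intro ballI impI)
          fix A B assume AB: "A \<in> F" "B \<in> F" "A \<noteq> B"
          then have "A \<in> \<D>" "B \<in> \<D>" by (auto simp: F_def)
          then obtain a b c d where ab: "A = cbox a b" "B = cbox c d" using \<D>(3) by metis
          have "interior A \<inter> interior B = {}" using \<D>(4) AB by (auto simp: F_def pairwise_def)
          then have "interior (A \<inter> B) = {}" by simp
          then show "negligible (A \<inter> B)" unfolding ab Int_interval interior_cbox negligible_interval by simp
        qed
      qed
      also have "ennreal (?C * measure lebesgue (\<Union>F)) = ennreal ?C * emeasure lebesgue (\<Union>F)"
      proof -
        have "\<Union>F \<in> lmeasurable" using finF \<D>(3) by (intro fmeasurable.finite_Union) (auto simp: F_def)
        then show ?thesis using C0 by (simp add: ennreal_mult emeasure_eq_measure2 emeasure_eq_ennreal_measure fmeasurableD2)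
      qed
      also have "\<dots> \<le> ennreal ?C * emeasure lebesgue T"
        using K_sub T(1) by (intro mult_left_mono emeasure_mono) (auto simp: F_def)
      finally show "(\<Sum>i<n. hweight ?D (U i)) \<le> ennreal ?C * emeasure lebesgue T" .
    qed auto
    also have "\<dots> \<le> ennreal ?C * (emeasure lebesgue Z + ennreal e)" by (intro mult_left_mono T_le) auto
    finally show ?thesis .
  qed
  show ?thesis
  proof (rule hausdorff_outer_least)
    fix \<delta> :: real assume \<delta>: "0 < \<delta>"
    have "(\<lambda>n. ennreal ?C * (emeasure lebesgue Z + ennreal (inverse (real (Suc n)))))
        \<longlonglongrightarrow> ennreal ?C * (emeasure lebesgue Z + ennreal 0)"
      by (intro ennreal_tendsto_cmult tendsto_add tendsto_const tendsto_ennrealI LIMSEQ_inverse_real_of_nat) auto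
    moreover have "hausdorff_premeasure ?D \<delta> (\<alpha> ` Z)
        \<le> ennreal ?C * (emeasure lebesgue Z + ennreal (inverse (real (Suc n))))" for n
      by (rule step[OF \<delta>]) simp
    ultimately have "hausdorff_premeasure ?D \<delta> (\<alpha> ` Z) \<le> ennreal ?C * (emeasure lebesgue Z + ennreal 0)"
      by (intro LIMSEQ_le_const) auto
    then show "hausdorff_premeasure ?D \<delta> (\<alpha> ` Z) \<le> ennreal ?C * emeasure lebesgue Z" by simp
  qed
qed

text \<open>
  A set of diameter t is mapped into a ball of radius \<open>L t\<close>, whose volume is a multiple of its
  weight. So the images of the sets of a covering with small total weight have small total volume.
\<close>

lemma negligible_lipschitz_image_hausdorff_null:
  fixes \<pi> :: "'b::euclidean_space \<Rightarrow> 'a::euclidean_space"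
  assumes lip: "\<And>x y. norm (\<pi> x - \<pi> y) \<le> L * norm (x - y)" and L: "0 < L"
    and Z: "hausdorff_outer_measure DIM('a) Z = 0"
  shows "negligible (\<pi> ` Z)"
  unfolding negligible_outer_le
proof (intro allI impI)
  fix e :: real assume e: "0 < e"
  let ?D = "DIM('a)"
  define e' where "e' = e / (2 * L) ^ ?D"
  have e': "0 < e'" using e L by (simp add: e'_def)
  have "hausdorff_premeasure ?D 1 Z < ennreal e'"
    using hausdorff_premeasure_le_outer[of 1 ?D Z] Z e' by simp
  then obtain U where U: "Z \<subseteq> (\<Union>i. U i)" "\<And>i. bounded (U i)" "\<And>i. diameter (U i) \<le> 1"
    "(\<Sum>i. hweight ?D (U i)) < ennreal e'"
    by (rule hausdorff_premeasure_less) metis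
  define B where "B i = (if U i = {} then {} else cball (\<pi> (SOME x. x \<in> U i)) (L * diameter (U i)))" for i
  have sub: "\<pi> ` U i \<subseteq> B i" for i
  proof (rule image_subsetI)
    fix x assume x: "x \<in> U i"
    then have y: "(SOME x. x \<in> U i) \<in> U i" by (rule someI)
    have "norm (\<pi> (SOME x. x \<in> U i) - \<pi> x) \<le> L * norm ((SOME x. x \<in> U i) - x)" by (rule lip)
    also have "\<dots> \<le> L * diameter (U i)"
      using diameter_bounded_bound[OF U(2) y x] L by (intro mult_left_mono) (auto simp: dist_norm)
    finally show "\<pi> x \<in> B i" using x by (auto simp: B_def dist_norm)
  qed
  have B_le: "emeasure lebesgue (B i) \<le> ennreal ((2 * L) ^ ?D) * hweight ?D (U i)" for i
  proof (cases "U i = {}")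
    case False
    have "emeasure lebesgue (B i) = ennreal (unit_ball_vol (real ?D) * (L * diameter (U i)) ^ ?D)"
      using False L diameter_ge_0[OF U(2)] by (simp add: B_def emeasure_cball)
    also have "\<dots> = ennreal ((2 * L) ^ ?D) * hweight ?D (U i)"
      using L diameter_ge_0[OF U(2)[of i]]
      by (simp add: ennreal_mult[symmetric] power_mult_distrib power_divide)
    finally show ?thesis by simp
  qed (simp add: B_def)
  have B_sets: "B i \<in> sets lebesgue" for i by (auto simp: B_def)
  have "emeasure lebesgue (\<Union>i. B i) \<le> (\<Sum>i. emeasure lebesgue (B i))"
    using B_sets by (intro emeasure_subadditive_countably) auto
  also have "\<dots> \<le> (\<Sum>i. ennreal ((2 * L) ^ ?D) * hweight ?D (U i))" by (intro suminf_le B_le) auto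
  also have "\<dots> \<le> ennreal ((2 * L) ^ ?D) * ennreal e'"
    using U(4) by (simp add: mult_left_mono less_imp_le)
  also have "\<dots> = ennreal e" using L e by (simp add: ennreal_mult[symmetric] e'_def)
  finally have le: "emeasure lebesgue (\<Union>i. B i) \<le> ennreal e" .
  then have "(\<Union>i. B i) \<in> lmeasurable"
    using B_sets le_less_trans[OF le ennreal_less_top] by (intro fmeasurableI) auto
  moreover have "measure lebesgue (\<Union>i. B i) \<le> e"
    unfolding measure_def using e by (intro enn2real_leI le) auto
  moreover have "\<pi> ` Z \<subseteq> (\<Union>i. B i)" using U(1) sub by blast
  ultimately show "\<exists>T. \<pi> ` Z \<subseteq> T \<and> T \<in> lmeasurable \<and> measure lebesgue T \<le> e" by blast
qed


section \<open>Bi-Lipschitz charts\<close>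

definition bilipschitz :: "real \<Rightarrow> ('a::real_normed_vector \<Rightarrow> 'b::real_normed_vector) \<Rightarrow> bool" where
  "bilipschitz L \<alpha> \<longleftrightarrow> 1 \<le> L \<and>
     (\<forall>x y. norm (\<alpha> x - \<alpha> y) \<le> L * norm (x - y) \<and> norm (x - y) \<le> L * norm (\<alpha> x - \<alpha> y))"

lemma bilipschitz_mono: "bilipschitz L \<alpha> \<Longrightarrow> L \<le> L' \<Longrightarrow> bilipschitz L' \<alpha>"
  unfolding bilipschitz_def by (meson mult_right_mono norm_ge_zero order_trans)

lemma bilipschitz_id: "bilipschitz 1 (\<lambda>x. x)"
  by (simp add: bilipschitz_def)

lemma bilipschitz_continuous: "bilipschitz L \<alpha> \<Longrightarrow> continuous_on S \<alpha>"
  by (rule lipschitz_on_continuous_on[of L]) (auto simp: bilipschitz_def lipschitz_on_def dist_norm)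

text \<open>
  The inverse of a Lipschitz diffeomorphism is only known to be expanding at small scale in the
  source. By invariance of domain the image of the unit ball around x contains the ball of radius c
  around \<open>\<Phi> x\<close>; this makes the inverse Lipschitz at scale c in the target, and subdividing
  segments makes it Lipschitz.
\<close>

lemma lipschitz_diffeo_ball:
  fixes \<Phi> :: "'b::euclidean_space \<Rightarrow> 'b"
  assumes cont: "continuous_on UNIV \<Phi>" and inj: "inj \<Phi>" and c: "0 < c"
    and low: "\<And>x y. norm (x - y) \<le> 1 \<Longrightarrow> c * norm (x - y) \<le> norm (\<Phi> x - \<Phi> y)"
  shows "ball (\<Phi> x) c \<subseteq> \<Phi> ` ball x 1"
proof -
  let ?T = "ball (\<Phi> x) c"
  have op: "open (\<Phi> ` ball x 1)"
    using cont inj by (intro invariance_of_domain) (auto intro: continuous_on_subset inj_on_subset)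
  have "compact (\<Phi> ` cball x 1)"
    using cont by (intro compact_continuous_image) (auto intro: continuous_on_subset)
  then have cl: "closed (\<Phi> ` cball x 1)" by (rule compact_imp_closed)
  have sub: "?T \<inter> \<Phi> ` cball x 1 \<subseteq> \<Phi> ` ball x 1"
  proof
    fix v assume "v \<in> ?T \<inter> \<Phi> ` cball x 1"
    then obtain y where y: "v = \<Phi> y" "norm (x - y) \<le> 1" "norm (\<Phi> x - \<Phi> y) < c"
      by (auto simp: dist_norm)
    have "c * norm (x - y) < c * 1" using low[OF y(2)] y(3) by simp
    then have "norm (x - y) < 1" using c by (simp only: mult_less_cancel_left_pos)
    then show "v \<in> \<Phi> ` ball x 1" using y(1) by (auto simp: dist_norm)
  qed
  have "connected ?T" by simp
  moreover have "\<Phi> x \<in> ?T \<inter> \<Phi> ` ball x 1" using c by auto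
  moreover have "\<Phi> ` ball x 1 \<inter> - \<Phi> ` cball x 1 \<inter> ?T = {}" by auto
  moreover have "?T \<subseteq> \<Phi> ` ball x 1 \<union> - \<Phi> ` cball x 1" using sub by blast
  ultimately have "?T \<inter> (- \<Phi> ` cball x 1) = {}"
    using op open_Compl[OF cl] connectedD[of ?T "\<Phi> ` ball x 1" "- \<Phi> ` cball x 1"] by blast
  then show ?thesis using sub by blast
qed

lemma lipschitz_diffeo_bilipschitz:
  fixes \<Phi> :: "'b::euclidean_space \<Rightarrow> 'b"
  assumes "lipschitz_diffeo \<Phi>"
  obtains L where "bilipschitz L \<Phi>"
proof -
  have bij: "bij \<Phi>" using assms by (simp add: lipschitz_diffeo_def)
  obtain M where M: "\<And>b. b \<in> Basis \<Longrightarrow> (M b)-lipschitz_on UNIV (\<lambda>x. \<Phi> x \<bullet> b)"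
    using assms unfolding lipschitz_diffeo_def by metis
  define L1 where "L1 = (\<Sum>b\<in>Basis. M b)"
  have up: "norm (\<Phi> x - \<Phi> y) \<le> L1 * norm (x - y)" for x y
  proof -
    have "norm (\<Phi> x - \<Phi> y) \<le> (\<Sum>b\<in>Basis. \<bar>(\<Phi> x - \<Phi> y) \<bullet> b\<bar>)" by (rule norm_le_l1)
    also have "\<dots> \<le> (\<Sum>b\<in>Basis. M b * norm (x - y))"
    proof (rule sum_mono)
      fix b :: 'b assume "b \<in> Basis"
      from lipschitz_onD[OF M[OF this], of x y]
      show "\<bar>(\<Phi> x - \<Phi> y) \<bullet> b\<bar> \<le> M b * norm (x - y)"
        by (simp add: dist_norm inner_diff_left)
    qed
    finally show ?thesis by (simp add: L1_def sum_distrib_right)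
  qed
  obtain c where c: "0 < c" and low: "\<And>x y. norm (x - y) \<le> 1 \<Longrightarrow> c * norm (x - y) \<le> norm (\<Phi> x - \<Phi> y)"
    using assms unfolding lipschitz_diffeo_def by metis
  have cont: "continuous_on UNIV \<Phi>"
  proof (rule lipschitz_on_continuous_on)
    show "\<bar>L1\<bar>-lipschitz_on UNIV \<Phi>"
      using up by (auto simp: lipschitz_on_def dist_norm intro: order_trans[OF up mult_right_mono])
  qed
  let ?g = "inv \<Phi>"
  have g: "\<Phi> (?g u) = u" for u using bij by (simp add: bij_is_surj surj_f_inv_f)
  have g': "?g (\<Phi> x) = x" for x using bij by (simp add: bij_is_inj)
  have loc: "norm (?g u - ?g v) \<le> (1 / c) * norm (u - v)" if "norm (u - v) < c" for u v
  proof -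
    have "v \<in> ball (\<Phi> (?g u)) c" using that by (simp add: g dist_norm)
    then obtain y where y: "v = \<Phi> y" "norm (?g u - y) \<le> 1"
      using lipschitz_diffeo_ball[OF cont bij_is_inj[OF bij] c low, of "?g u"] by (auto simp: dist_norm)
    then have "c * norm (?g u - y) \<le> norm (u - v)" using low[of "?g u" y] by (simp add: g)
    then show ?thesis using c y(1) by (simp add: g' field_simps)
  qed
  have glob: "norm (?g u - ?g v) \<le> (1 / c) * norm (u - v)" for u v
  proof -
    obtain N :: nat where N: "norm (u - v) / c < real N" using reals_Archimedean2 by blast
    then have N0: "0 < N" using c
      by (metis divide_nonneg_pos gr0I norm_ge_zero not_less of_nat_0)
    define P where "P i = v + (real i / real N) *\<^sub>R (u - v)" for i
    have step: "norm (P (Suc i) - P i) = norm (u - v) / real N" for i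
    proof -
      have "P (Suc i) - P i = (1 / real N) *\<^sub>R (u - v)"
        by (simp add: P_def scaleR_diff_left[symmetric] diff_divide_distrib[symmetric])
      then show ?thesis by simp
    qed
    have "norm (u - v) / real N < c" using N N0 c by (simp add: field_simps)
    then have "norm (?g (P (Suc i)) - ?g (P i)) \<le> (1 / c) * (norm (u - v) / real N)" for i
      using loc[of "P (Suc i)" "P i"] step[of i] by simp
    then have "(\<Sum>i<N. norm (?g (P (Suc i)) - ?g (P i))) \<le> (\<Sum>i<N. (1 / c) * (norm (u - v) / real N))"
      by (intro sum_mono)
    also have "\<dots> = (1 / c) * norm (u - v)" using N0 by simp
    finally have "(\<Sum>i<N. norm (?g (P (Suc i)) - ?g (P i))) \<le> (1 / c) * norm (u - v)" .
    moreover have "?g u - ?g v = (\<Sum>i<N. ?g (P (Suc i)) - ?g (P i))"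
    proof -
      have "P N = u" "P 0 = v" using N0 by (auto simp: P_def)
      then show ?thesis using sum_lessThan_telescope[of "\<lambda>i. ?g (P i)" N] by simp
    qed
    ultimately show ?thesis using norm_sum[of "\<lambda>i. ?g (P (Suc i)) - ?g (P i)" "{..<N}"] by simp
  qed
  define L where "L = max 1 (max L1 (1 / c))"
  have "norm (\<Phi> x - \<Phi> y) \<le> L * norm (x - y)" for x y
    by (rule order_trans[OF up mult_right_mono]) (auto simp: L_def)
  moreover have "norm (x - y) \<le> L * norm (\<Phi> x - \<Phi> y)" for x y
    using order_trans[OF glob[of "\<Phi> x" "\<Phi> y"] mult_right_mono[of "1 / c" L]] by (auto simp: L_def g')
  ultimately have "bilipschitz L \<Phi>" by (simp add: bilipschitz_def L_def)
  then show thesis by (rule that)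
qed

lemma bilipschitz_inv:
  assumes "bilipschitz L \<Phi>" "bij \<Phi>"
  shows "bilipschitz L (inv \<Phi>)"
proof -
  have "\<Phi> (inv \<Phi> u) = u" for u using assms(2) by (simp add: bij_is_surj surj_f_inv_f)
  then show ?thesis using assms(1) unfolding bilipschitz_def by metis
qed

text \<open>\<open>slice \<psi> \<tau>\<close> parametrizes the surface that is parallel to the boundary at height \<open>\<tau>\<close>.\<close>

definition slice :: "('a::euclidean_space \<times> real \<Rightarrow> 'a \<times> real) \<Rightarrow> real \<Rightarrow> 'a \<Rightarrow> 'a \<times> real" where
  "slice \<psi> \<tau> y = inv \<psi> (y, \<tau>)"

lemma bilipschitz_slice:
  assumes "bilipschitz L \<psi>" "bij \<psi>"
  shows "bilipschitz L (slice \<psi> \<tau>)"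
proof -
  have "norm ((x, \<tau>) - (y, \<tau>)) = norm (x - y)" for x y :: 'a by (simp add: norm_Pair)
  then show ?thesis
    using bilipschitz_inv[OF assms] unfolding bilipschitz_def slice_def by metis
qed

lemma lipschitz_atlasD:
  assumes "lipschitz_atlas \<Omega> N K \<psi>" "r \<in> {1..N}"
  shows "\<exists>c \<rho>. K r = ball c \<rho>" "lipschitz_diffeo (\<psi> r)" "bij (\<psi> r)"
    "x \<in> K r \<Longrightarrow> x \<in> \<Omega> \<Longrightarrow> snd (\<psi> r x) > 0"
    "x \<in> K r \<Longrightarrow> x \<in> frontier \<Omega> \<Longrightarrow> snd (\<psi> r x) = 0"
proof -
  have *: "(\<exists>c \<rho>. K r = ball c \<rho>) \<and> K r \<inter> frontier \<Omega> \<noteq> {} \<and> lipschitz_diffeo (\<psi> r) \<and>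
      \<psi> r ` (K r \<inter> \<Omega>) \<subseteq> {x. snd x > 0} \<and> \<psi> r ` (K r \<inter> frontier \<Omega>) \<subseteq> {x. snd x = 0}"
    using assms unfolding lipschitz_atlas_def by blast
  then show "\<exists>c \<rho>. K r = ball c \<rho>" "lipschitz_diffeo (\<psi> r)" "bij (\<psi> r)"
    by (simp_all add: lipschitz_diffeo_def)
  show "snd (\<psi> r x) > 0" if "x \<in> K r" "x \<in> \<Omega>" using * that by blast
  show "snd (\<psi> r x) = 0" if "x \<in> K r" "x \<in> frontier \<Omega>" using * that by blast
qed

lemma chart_image_iff:
  assumes "lipschitz_atlas \<Omega> N K \<psi>" "r \<in> {1..N}"
  shows "y \<in> chart_image \<Omega> K \<psi> r \<longleftrightarrow> slice (\<psi> r) 0 y \<in> frontier \<Omega> \<inter> K r"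
proof -
  have bij: "bij (\<psi> r)" by (rule lipschitz_atlasD[OF assms])
  have "\<psi> r (inv (\<psi> r) (y, 0)) = (y, 0)" using bij by (simp add: bij_is_surj surj_f_inv_f)
  moreover have "inv (\<psi> r) (\<psi> r x) = x" for x using bij by (simp add: bij_is_inj)
  ultimately have "(y, 0) \<in> \<psi> r ` (frontier \<Omega> \<inter> K r) \<longleftrightarrow> inv (\<psi> r) (y, 0) \<in> frontier \<Omega> \<inter> K r"
    by (auto simp: image_iff) (metis IntI)+
  then show ?thesis by (simp add: chart_image_def slice_def)
qed

text \<open>On the boundary the chart is given by its first component, with the slice at height 0 as inverse.\<close>

lemma slice_fst_chart:
  assumes "lipschitz_atlas \<Omega> N K \<psi>" "r \<in> {1..N}" "x \<in> frontier \<Omega> \<inter> K r"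
  shows "slice (\<psi> r) 0 (fst (\<psi> r x)) = x" "fst (\<psi> r x) \<in> chart_image \<Omega> K \<psi> r"
proof -
  have "(fst (\<psi> r x), 0) = \<psi> r x"
    using lipschitz_atlasD(5)[OF assms(1,2)] assms(3) by (metis Int_iff prod.collapse)
  then show 1: "slice (\<psi> r) 0 (fst (\<psi> r x)) = x"
    using lipschitz_atlasD(3)[OF assms(1,2)] by (simp add: slice_def bij_is_inj)
  show "fst (\<psi> r x) \<in> chart_image \<Omega> K \<psi> r"
    using assms 1 by (simp add: chart_image_iff)
qed

text \<open>
  Just above a boundary point all points belong to \<open>\<Omega>\<close>: a small half ball is connected and
  contains no boundary point, and it meets \<open>\<Omega>\<close>.
\<close>

lemma slice_in_domain:
  assumes atlas: "lipschitz_atlas \<Omega> N K \<psi>" and r: "r \<in> {1..N}" and y: "y \<in> chart_image \<Omega> K \<psi> r"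
  obtains t where "0 < t" "\<And>\<tau>. 0 < \<tau> \<Longrightarrow> \<tau> < t \<Longrightarrow> slice (\<psi> r) \<tau> y \<in> \<Omega>"
proof -
  let ?g = "inv (\<psi> r)"
  have bij: "bij (\<psi> r)" by (rule lipschitz_atlasD[OF atlas r])
  obtain L where L: "bilipschitz L (\<psi> r)"
    using lipschitz_diffeo_bilipschitz lipschitz_atlasD(2)[OF atlas r] by blast
  have cg: "continuous_on UNIV ?g" and c\<psi>: "continuous_on UNIV (\<psi> r)"
    using bilipschitz_inv[OF L bij] L by (auto intro: bilipschitz_continuous)
  have x0: "?g (y, 0) \<in> frontier \<Omega>" "?g (y, 0) \<in> K r"
    using y chart_image_iff[OF atlas r] by (auto simp: slice_def)
  have "open (K r)" using lipschitz_atlasD(1)[OF atlas r] by auto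
  then have "open (?g -` K r)" using cg by (simp add: continuous_on_open_vimage)
  then obtain \<rho> where \<rho>: "0 < \<rho>" "ball (y, 0) \<rho> \<subseteq> ?g -` K r"
    using x0(2) unfolding open_contains_ball by blast
  define B where "B = ball (y, 0 :: real) \<rho> \<inter> {z. 0 < snd z}"
  have "convex B"
  proof -
    have "{z :: 'a \<times> real. 0 < snd z} = snd -` {0<..}" by auto
    then show ?thesis
      unfolding B_def by (simp add: convex_Int convex_linear_vimage linear_snd)
  qed
  then have conn: "connected (?g ` B)"
    using cg by (intro connected_continuous_image convex_connected) (auto intro: continuous_on_subset)
  have no: "?g ` B \<inter> frontier \<Omega> = {}"
  proof -
    have "?g z \<notin> frontier \<Omega>" if z: "z \<in> B" for z
    proof
      assume "?g z \<in> frontier \<Omega>"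
      moreover have "?g z \<in> K r" using z \<rho>(2) by (auto simp: B_def)
      ultimately have "snd (\<psi> r (?g z)) = 0" using lipschitz_atlasD(5)[OF atlas r] by blast
      moreover have "\<psi> r (?g z) = z" using bij by (simp add: bij_is_surj surj_f_inv_f)
      ultimately show False using z by (simp add: B_def)
    qed
    then show ?thesis by blast
  qed
  have "?g ` B \<inter> \<Omega> \<noteq> {}"
  proof -
    have op: "open (\<psi> r -` ball (y, 0) \<rho>)" using c\<psi> by (simp add: continuous_on_open_vimage)
    have "\<psi> r (?g (y, 0)) = (y, 0)" using bij by (simp add: bij_is_surj surj_f_inv_f)
    then have "?g (y, 0) \<in> \<psi> r -` ball (y, 0) \<rho>" using \<rho>(1) by simp
    moreover have "?g (y, 0) \<in> closure \<Omega>" using x0(1) by (simp add: frontier_def)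
    ultimately obtain x where x: "x \<in> \<Omega>" "\<psi> r x \<in> ball (y, 0) \<rho>"
      using op by (metis IntE closure_iff_nhds_not_empty ex_in_conv vimageE order_refl)
    have gx: "?g (\<psi> r x) = x" using bij by (simp add: bij_is_inj)
    have "x \<in> K r" using \<rho>(2) x(2) gx by (metis subsetD vimageE)
    then have "0 < snd (\<psi> r x)" using lipschitz_atlasD(4)[OF atlas r] x(1) by blast
    then have "\<psi> r x \<in> B" using x(2) by (simp add: B_def)
    then have "x \<in> ?g ` B" using gx by (metis imageI)
    then show ?thesis using x(1) by blast
  qed
  with conn no have sub: "?g ` B \<subseteq> \<Omega>"
    using connected_Int_frontier[of "?g ` B" \<Omega>] by blast
  show thesis
  proof (rule that[OF \<rho>(1)])
    fix \<tau> :: real assume "0 < \<tau>" "\<tau> < \<rho>"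
    then have "(y, \<tau>) \<in> B" by (simp add: B_def dist_Pair_Pair)
    then show "slice (\<psi> r) \<tau> y \<in> \<Omega>" using sub by (auto simp: slice_def)
  qed
qed

lemma
  assumes atlas: "lipschitz_atlas \<Omega> N K \<psi>" and r: "r \<in> {1..N}"
  shows chart_image_borel: "chart_image \<Omega> K \<psi> r \<in> sets borel"
    and chart_image_bounded: "bounded (chart_image \<Omega> K \<psi> r)"
proof -
  have bij: "bij (\<psi> r)" by (rule lipschitz_atlasD[OF atlas r])
  obtain L where L: "bilipschitz L (\<psi> r)"
    using lipschitz_diffeo_bilipschitz lipschitz_atlasD(2)[OF atlas r] by blast
  have s: "bilipschitz L (slice (\<psi> r) 0)" by (rule bilipschitz_slice[OF L bij])
  have eq: "chart_image \<Omega> K \<psi> r = slice (\<psi> r) 0 -` (frontier \<Omega> \<inter> K r)"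
    by (rule set_eqI) (simp only: chart_image_iff[OF atlas r] vimage_eq)
  obtain c \<rho> where "K r = ball c \<rho>" using lipschitz_atlasD(1)[OF atlas r] by blast
  then have K: "open (K r)" "bounded (K r)" by simp_all
  have meas: "slice (\<psi> r) 0 \<in> borel_measurable borel"
    using bilipschitz_continuous[OF s] by (intro borel_measurable_continuous_onI)
  have "frontier \<Omega> \<inter> K r \<in> sets borel"
    using K(1) by (intro sets.Int borel_closed borel_open frontier_closed)
  from measurable_sets[OF meas this] show "chart_image \<Omega> K \<psi> r \<in> sets borel" by (simp add: eq)
  obtain R where R: "\<And>x. x \<in> K r \<Longrightarrow> norm x \<le> R" using K(2) by (auto simp: bounded_iff)
  have "norm y \<le> L * (R + norm (slice (\<psi> r) 0 0))" if "y \<in> chart_image \<Omega> K \<psi> r" for y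
  proof -
    have L0: "0 \<le> L" using s by (simp add: bilipschitz_def)
    have "norm (y - 0) \<le> L * norm (slice (\<psi> r) 0 y - slice (\<psi> r) 0 0)"
      using s unfolding bilipschitz_def by blast
    also have "\<dots> \<le> L * (R + norm (slice (\<psi> r) 0 0))"
    proof (rule mult_left_mono[OF _ L0])
      have "slice (\<psi> r) 0 y \<in> K r" using that by (simp add: eq)
      then show "norm (slice (\<psi> r) 0 y - slice (\<psi> r) 0 0) \<le> R + norm (slice (\<psi> r) 0 0)"
        using norm_triangle_ineq4[of "slice (\<psi> r) 0 y" "slice (\<psi> r) 0 0"] R by fastforce
    qed
    finally show ?thesis by simp
  qed
  then show "bounded (chart_image \<Omega> K \<psi> r)" unfolding bounded_iff by blast
qed


section \<open>Re-expansion of Lipschitz atoms into smooth atoms\<close>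

lemma cube_iff: "x \<in> cube d j m \<longleftrightarrow> (\<forall>i\<in>Basis. \<bar>2 ^ j * (x \<bullet> i) - m \<bullet> i\<bar> \<le> d)"
proof -
  have "\<bar>x \<bullet> i - m \<bullet> i / 2 ^ j\<bar> \<le> d / 2 ^ j \<longleftrightarrow> \<bar>2 ^ j * (x \<bullet> i) - m \<bullet> i\<bar> \<le> d" for i :: 'a
  proof -
    have "x \<bullet> i - m \<bullet> i / 2 ^ j = (2 ^ j * (x \<bullet> i) - m \<bullet> i) / 2 ^ j" by (simp add: field_simps)
    then show ?thesis by (simp add: abs_divide divide_le_cancel)
  qed
  then show ?thesis by (simp add: cube_def)
qed

lemma norm_le_of_coordinates:
  fixes x :: "'b::euclidean_space"
  assumes "\<And>i. i \<in> Basis \<Longrightarrow> \<bar>x \<bullet> i\<bar> \<le> c"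
  shows "norm x \<le> real DIM('b) * c"
proof -
  have "norm x \<le> (\<Sum>i\<in>Basis. \<bar>x \<bullet> i\<bar>)" by (rule norm_le_l1)
  also have "\<dots> \<le> (\<Sum>i\<in>(Basis::'b set). c)" using assms by (intro sum_mono)
  finally show ?thesis by simp
qed

lemma cube_norm_le:
  fixes x :: "'b::euclidean_space"
  assumes "x \<in> cube d j m"
  shows "norm (2 ^ j *\<^sub>R x - m) \<le> real DIM('b) * d"
  using assms by (intro norm_le_of_coordinates) (auto simp: cube_iff inner_diff_left)

lemma cube_mono: "d \<le> d' \<Longrightarrow> cube d j m \<subseteq> cube d' j m"
  by (force simp: cube_iff)

lemma closed_cube: "closed (cube d j m)"
proof -
  have "cube d j m = (\<Inter>i\<in>Basis. {x. \<bar>x \<bullet> i - m \<bullet> i / 2 ^ j\<bar> \<le> d / 2 ^ j})"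
    by (auto simp: cube_def)
  then show ?thesis by (auto intro!: closed_INT closed_Collect_le continuous_intros)
qed

lemma finite_cubes_meeting:
  fixes S :: "'b::euclidean_space set"
  assumes "bounded S"
  shows "finite (cubes_meeting S j)"
proof -
  obtain R where R: "\<And>x. x \<in> S \<Longrightarrow> norm x \<le> R" using assms by (auto simp: bounded_iff)
  define F where "F = 2 ^ j * \<bar>R\<bar> + real DIM('b)"
  have "cubes_meeting S j \<subseteq> {m \<in> int_lattice. norm (m - 0) \<le> F}"
  proof
    fix m assume "m \<in> cubes_meeting S j"
    then obtain x where x: "m \<in> int_lattice" "x \<in> cube 1 j m" "x \<in> S" by (auto simp: cubes_meeting_def)
    have "norm m \<le> norm (2 ^ j *\<^sub>R x) + norm (2 ^ j *\<^sub>R x - m)"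
      by (metis norm_minus_commute norm_triangle_sub)
    moreover have "norm (2 ^ j *\<^sub>R x) \<le> 2 ^ j * \<bar>R\<bar>" using R[OF x(3)] by (simp add: mult_left_mono)
    moreover have "norm (2 ^ j *\<^sub>R x - m) \<le> real DIM('b)" using cube_norm_le[OF x(2)] by simp
    ultimately have "norm m \<le> F" unfolding F_def by linarith
    then show "m \<in> {m \<in> int_lattice. norm (m - 0) \<le> F}" using x(1) by simp
  qed
  then show ?thesis
    using lattice_points_in_ball(1)[of F 0] by (rule finite_subset) (simp add: F_def)
qed

definition dyadic_bump :: "nat \<Rightarrow> 'b::euclidean_space \<Rightarrow> 'b \<Rightarrow> complex" where
  "dyadic_bump l z x = lattice_bump (2 ^ l *\<^sub>R x - z)"

lemma dyadic_bump_nonzero: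
  "dyadic_bump l z x \<noteq> 0 \<Longrightarrow> i \<in> Basis \<Longrightarrow> \<bar>2 ^ l * (x \<bullet> i) - z \<bullet> i\<bar> < 1"
  unfolding dyadic_bump_def using lattice_bump_nonzero[of "2 ^ l *\<^sub>R x - z" i] by (simp add: inner_diff_left)

lemma dyadic_bump_cube: "dyadic_bump l z x \<noteq> 0 \<Longrightarrow> x \<in> cube 1 l z"
  using dyadic_bump_nonzero[of l z x] by (auto simp: cube_iff intro: less_imp_le)

lemma lattice_bump_nonneg: "lattice_bump x = complex_of_real (norm (lattice_bump x))"
proof -
  have "0 \<le> (\<Prod>b\<in>Basis. hat (x \<bullet> b))" by (intro prod_nonneg ballI hat_nonneg)
  then show ?thesis unfolding lattice_bump_def by (simp only: norm_of_real abs_of_nonneg)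
qed

text \<open>The same constant serves for the bumps of all levels.\<close>

lemma C_k_bound_lattice_bump:
  obtains B where "1 \<le> B" "C_k_bound k 0 B (lattice_bump :: 'b::euclidean_space \<Rightarrow> complex)"
proof -
  have "{x. lattice_bump x \<noteq> 0} \<subseteq> cball (0::'b) (real DIM('b))"
  proof
    fix x :: 'b assume "x \<in> {x. lattice_bump x \<noteq> 0}"
    then have "norm x \<le> real DIM('b) * 1"
      using lattice_bump_nonzero[of x] by (intro norm_le_of_coordinates) (auto intro: less_imp_le)
    then show "x \<in> cball 0 (real DIM('b))" by simp
  qed
  then have "bounded {x::'b. lattice_bump x \<noteq> 0}" by (rule bounded_subset[OF bounded_cball])
  then have "compact (supp (lattice_bump :: 'b \<Rightarrow> complex))"
    by (simp add: supp_def compact_eq_bounded_closed bounded_closure)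
  then obtain A where "C_k_bound k 0 A (lattice_bump :: 'b \<Rightarrow> complex)"
    using C_k_compact_supp_bounded[OF C_k_lattice_bump] by blast
  then have "C_k_bound k 0 (max 1 A) (lattice_bump :: 'b \<Rightarrow> complex)"
    by (rule C_k_bound_mono) auto
  then show thesis by (rule that[rotated]) simp
qed

lemma C_k_bound_dyadic_bump:
  fixes z :: "'b::euclidean_space"
  shows "C_k_bound k 0 B (lattice_bump :: 'b \<Rightarrow> complex) \<Longrightarrow> C_k_bound k l B (dyadic_bump l z)"
  unfolding dyadic_bump_def[abs_def] by (rule C_k_bound_dilation)

lemma sum_dyadic_bump:
  assumes "finite (cubes_meeting S l)" "x \<in> S"
  shows "(\<Sum>z\<in>cubes_meeting S l. dyadic_bump l z x) = 1"
  unfolding dyadic_bump_def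
proof (rule sum_lattice_bump[OF assms(1)])
  fix m assume m: "m \<in> int_lattice" "lattice_bump (2 ^ l *\<^sub>R x - m) \<noteq> 0"
  then have "x \<in> cube 1 l m" using dyadic_bump_cube[of l m x] by (simp add: dyadic_bump_def)
  then show "m \<in> cubes_meeting S l" using m assms(2) by (auto simp: cubes_meeting_def)
qed (auto simp: cubes_meeting_def)

lemma sum_norm_dyadic_bump:
  assumes "finite (cubes_meeting S l)" "x \<in> S"
  shows "(\<Sum>z\<in>cubes_meeting S l. norm (dyadic_bump l z x)) = 1"
proof -
  have "complex_of_real (\<Sum>z\<in>cubes_meeting S l. norm (dyadic_bump l z x)) = (\<Sum>z\<in>cubes_meeting S l. dyadic_bump l z x)"
    unfolding of_real_sum dyadic_bump_def by (intro sum.cong refl lattice_bump_nonneg[symmetric])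
  then show ?thesis using sum_dyadic_bump[OF assms] by (metis of_real_eq_1_iff)
qed

lemma card_le_fibers:
  assumes "finite A" "\<And>w. w \<in> f ` A \<Longrightarrow> card {z \<in> A. f z = w} \<le> N"
  shows "card A \<le> card (f ` A) * N"
proof -
  have "A = (\<Union>w\<in>f ` A. {z \<in> A. f z = w})" by auto
  then have "card A \<le> (\<Sum>w\<in>f ` A. card {z \<in> A. f z = w})"
    using card_UN_le[of "f ` A" "\<lambda>w. {z \<in> A. f z = w}"] assms(1) by simp
  also have "\<dots> \<le> (\<Sum>w\<in>f ` A. N)" using assms(2) by (rule sum_mono)
  finally show ?thesis by simp
qed

text \<open>
  Functions on a set D of parameters y are given as sums of Lipschitz atoms \<open>b\<^bsub>j,m\<^esub>\<close>, localized by
  \<open>\<beta>\<close> in dyadic cubes of one space. They are rewritten as sums of smooth atoms in another space, of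
  which \<open>\<alpha> y\<close> is a point. With \<open>\<beta>\<close> a parametrization of the boundary and \<open>\<alpha>\<close> the
  identity this describes the restriction of a function to the boundary; with the roles of
  \<open>\<alpha>\<close> and \<open>\<beta>\<close> exchanged it describes the extension from the boundary into the domain.
\<close>

locale lipschitz_atoms =
  fixes \<alpha> :: "'v::euclidean_space \<Rightarrow> 'x::euclidean_space" and \<beta> :: "'v \<Rightarrow> 'y::euclidean_space"
    and D :: "'v set" and I :: "nat \<Rightarrow> 'y set" and coef :: "nat \<Rightarrow> 'y \<Rightarrow> complex"
    and b :: "nat \<Rightarrow> 'y \<Rightarrow> 'v \<Rightarrow> complex" and L A :: real
  assumes \<alpha>: "bilipschitz L \<alpha>" and \<beta>: "bilipschitz L \<beta>" and A: "1 \<le> A" and D: "bounded D"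
    and I: "finite (I j)" "I j \<subseteq> int_lattice"
    and b_bound: "m \<in> I j \<Longrightarrow> y \<in> D \<Longrightarrow> norm (b j m y) \<le> A"
    and b_lip: "m \<in> I j \<Longrightarrow> y \<in> D \<Longrightarrow> y' \<in> D \<Longrightarrow> norm (b j m y - b j m y') \<le> A * 2 ^ j * norm (y - y')"
    and b_supp: "m \<in> I j \<Longrightarrow> y \<in> D \<Longrightarrow> b j m y \<noteq> 0 \<Longrightarrow> norm (2 ^ j *\<^sub>R \<beta> y - m) \<le> A"
begin

lemma L: "1 \<le> L" and \<alpha>_le: "norm (\<alpha> y - \<alpha> y') \<le> L * norm (y - y')"
  and \<alpha>_ge: "norm (y - y') \<le> L * norm (\<alpha> y - \<alpha> y')"
  and \<beta>_le: "norm (\<beta> y - \<beta> y') \<le> L * norm (y - y')"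
  and \<beta>_ge: "norm (y - y') \<le> L * norm (\<beta> y - \<beta> y')"
  using \<alpha> \<beta> by (auto simp: bilipschitz_def)

definition level :: "nat \<Rightarrow> 'v \<Rightarrow> complex" where
  "level j y = (\<Sum>m\<in>I j. coef j m * b j m y)"

definition partial :: "nat \<Rightarrow> 'v \<Rightarrow> complex" where
  "partial l y = (\<Sum>j<l. level j y)"

abbreviation cubes :: "nat \<Rightarrow> 'x set" where
  "cubes l \<equiv> cubes_meeting (\<alpha> ` D) l"

text \<open>The centre of the cube will not do: it may have no preimage in D.\<close>

definition pt :: "nat \<Rightarrow> 'x \<Rightarrow> 'v" where
  "pt l z = (SOME y. y \<in> D \<and> \<alpha> y \<in> cube 1 l z)"

lemma pt: "z \<in> cubes l \<Longrightarrow> pt l z \<in> D" "z \<in> cubes l \<Longrightarrow> \<alpha> (pt l z) \<in> cube 1 l z"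
proof -
  assume "z \<in> cubes l"
  then have "\<exists>y. y \<in> D \<and> \<alpha> y \<in> cube 1 l z" by (auto simp: cubes_meeting_def)
  then have "pt l z \<in> D \<and> \<alpha> (pt l z) \<in> cube 1 l z" unfolding pt_def by (rule someI_ex)
  then show "pt l z \<in> D" "\<alpha> (pt l z) \<in> cube 1 l z" by auto
qed

lemma bounded_image: "bounded (\<alpha> ` D)"
proof -
  obtain R where R: "\<And>y. y \<in> D \<Longrightarrow> norm y \<le> R" using D by (auto simp: bounded_iff)
  have "norm (\<alpha> y) \<le> norm (\<alpha> 0) + L * R" if "y \<in> D" for y
  proof -
    have "norm (\<alpha> y - \<alpha> 0) \<le> L * norm (y - 0)" by (rule \<alpha>_le)
    also have "\<dots> \<le> L * R" using R[OF that] L by (intro mult_left_mono) auto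
    finally show ?thesis using norm_triangle_sub[of "\<alpha> y" "\<alpha> 0"] by simp
  qed
  then show ?thesis unfolding bounded_iff by blast
qed

lemma finite_cubes: "finite (cubes l)"
  using finite_cubes_meeting[OF bounded_image] .

text \<open>
  Enlarges the supports of the atoms so far that an atom of level \<open>j \<le> l\<close> whose enlarged
  support does not contain y vanishes at all points of the cubes of level l near y.
\<close>

definition rad :: real where
  "rad = A + 6 * real DIM('x) * L\<^sup>2"

definition near :: "nat \<Rightarrow> 'v \<Rightarrow> real" where
  "near j y = (\<Sum>m\<in>{m \<in> I j. norm (2 ^ j *\<^sub>R \<beta> y - m) \<le> rad}. norm (coef j m))"

lemma near_nonneg: "0 \<le> near j y"
  by (simp add: near_def sum_nonneg)

definition osc :: real where
  "osc = 6 * real DIM('x) * L * A"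

lemma osc_ge: "A \<le> osc"
proof -
  have n: "1 \<le> real DIM('x)" using DIM_positive[where 'a='x] by (simp add: Suc_le_eq)
  have "1 \<le> 6 * real DIM('x)" using n by linarith
  then have "1 * 1 \<le> (6 * real DIM('x)) * L" using L by (intro mult_mono) auto
  then have "1 * A \<le> (6 * real DIM('x) * L) * A" using A by (intro mult_right_mono) auto
  then show ?thesis by (simp add: osc_def)
qed

text \<open>
  Over a distance of about \<open>2\<^sup>-\<^sup>l\<close> an atom of level j varies by
  \<open>2\<^sup>j\<^sup>-\<^sup>l\<close> only, by the Lipschitz condition.
\<close>

lemma level_osc:
  assumes y: "y \<in> D" "y' \<in> D" and jl: "j \<le> l"
    and close: "2 ^ l * norm (\<alpha> y - \<alpha> y') \<le> 6 * real DIM('x)"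
  shows "norm (level j y - level j y') \<le> osc * (1/2) ^ (l - j) * near j y"
proof -
  let ?N = "{m \<in> I j. norm (2 ^ j *\<^sub>R \<beta> y - m) \<le> rad}"
  have yy: "2 ^ l * norm (y - y') \<le> 6 * real DIM('x) * L"
  proof -
    have "2 ^ l * norm (y - y') \<le> 2 ^ l * (L * norm (\<alpha> y - \<alpha> y'))" by (intro mult_left_mono \<alpha>_ge) auto
    also have "\<dots> \<le> L * (6 * real DIM('x))" using close L by (simp add: mult.left_commute mult_left_mono)
    finally show ?thesis by (simp add: mult_ac)
  qed
  have pow: "(2::real) ^ j = 2 ^ l * (1/2) ^ (l - j)"
    using jl by (simp add: power_divide power_diff)
  have yj: "2 ^ j * norm (y - y') \<le> 6 * real DIM('x) * L * (1/2) ^ (l - j)"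
  proof -
    have "2 ^ j * norm (y - y') = (2 ^ l * norm (y - y')) * (1/2) ^ (l - j)" by (simp add: pow)
    also have "\<dots> \<le> (6 * real DIM('x) * L) * (1/2) ^ (l - j)" using yy by (intro mult_right_mono) auto
    finally show ?thesis .
  qed
  have "level j y - level j y' = (\<Sum>m\<in>I j. coef j m * (b j m y - b j m y'))"
    by (simp add: level_def sum_subtractf right_diff_distrib)
  also have "\<dots> = (\<Sum>m\<in>?N. coef j m * (b j m y - b j m y'))"
  proof (rule sum.mono_neutral_right)
    show "\<forall>m\<in>I j - ?N. coef j m * (b j m y - b j m y') = 0"
    proof
      fix m assume m: "m \<in> I j - ?N"
      have far: "rad < norm (2 ^ j *\<^sub>R \<beta> y - m)" using m by auto
      have "A \<le> rad" using L by (simp add: rad_def)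
      then have "b j m y = 0" using b_supp[of m j y] m far y by force
      moreover have "b j m y' = 0"
      proof (rule ccontr)
        assume "b j m y' \<noteq> 0"
        then have 1: "norm (2 ^ j *\<^sub>R \<beta> y' - m) \<le> A" using b_supp[of m j y'] m y by auto
        have "norm (2 ^ j *\<^sub>R \<beta> y - 2 ^ j *\<^sub>R \<beta> y') = 2 ^ j * norm (\<beta> y - \<beta> y')"
          by (simp add: scaleR_diff_right[symmetric])
        also have "\<dots> \<le> 2 ^ j * (L * norm (y - y'))" by (intro mult_left_mono \<beta>_le) auto
        also have "\<dots> = L * (2 ^ j * norm (y - y'))" by simp
        also have "\<dots> \<le> L * (6 * real DIM('x) * L * 1)"
        proof (rule mult_left_mono)
          have "6 * real DIM('x) * L * (1/2) ^ (l - j) \<le> 6 * real DIM('x) * L * 1"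
            using L by (intro mult_left_mono) (auto simp: power_le_one)
          then show "2 ^ j * norm (y - y') \<le> 6 * real DIM('x) * L * 1" using yj by linarith
        qed (use L in auto)
        finally have "norm (2 ^ j *\<^sub>R \<beta> y - 2 ^ j *\<^sub>R \<beta> y') \<le> 6 * real DIM('x) * L\<^sup>2"
          by (simp add: power2_eq_square mult_ac)
        then have "norm (2 ^ j *\<^sub>R \<beta> y - m) \<le> rad"
          using 1 norm_triangle_ineq[of "2 ^ j *\<^sub>R \<beta> y - 2 ^ j *\<^sub>R \<beta> y'" "2 ^ j *\<^sub>R \<beta> y' - m"]
          by (simp add: rad_def)
        with far show False by simp
      qed
      ultimately show "coef j m * (b j m y - b j m y') = 0" by simp
    qed
  qed (use I in auto)
  also have "norm \<dots> \<le> (\<Sum>m\<in>?N. norm (coef j m) * (osc * (1/2) ^ (l - j)))"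
  proof (rule sum_norm_le)
    fix m assume m: "m \<in> ?N"
    then have "norm (b j m y - b j m y') \<le> A * (2 ^ j * norm (y - y'))"
      using b_lip[of m j y y'] y by (simp add: mult.assoc)
    also have "\<dots> \<le> A * (6 * real DIM('x) * L * (1/2) ^ (l - j))"
      using yj A by (intro mult_left_mono) auto
    also have "\<dots> = osc * (1/2) ^ (l - j)" by (simp add: osc_def mult_ac)
    finally show "norm (coef j m * (b j m y - b j m y')) \<le> norm (coef j m) * (osc * (1/2) ^ (l - j))"
      unfolding norm_mult by (intro mult_left_mono) auto
  qed
  also have "\<dots> = osc * (1/2) ^ (l - j) * near j y"
    by (simp add: near_def sum_distrib_left mult_ac)
  finally show ?thesis .
qed

lemma level_bound: "y \<in> D \<Longrightarrow> norm (level j y) \<le> A * near j y"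
proof -
  assume y: "y \<in> D"
  let ?N = "{m \<in> I j. norm (2 ^ j *\<^sub>R \<beta> y - m) \<le> rad}"
  have "level j y = (\<Sum>m\<in>?N. coef j m * b j m y)"
    unfolding level_def
  proof (rule sum.mono_neutral_right)
    show "\<forall>m\<in>I j - ?N. coef j m * b j m y = 0"
    proof
      fix m assume m: "m \<in> I j - ?N"
      have "A \<le> rad" using L by (simp add: rad_def)
      then have "b j m y = 0" using b_supp[of m j y] m y by force
      then show "coef j m * b j m y = 0" by simp
    qed
  qed (use I in auto)
  also have "norm \<dots> \<le> (\<Sum>m\<in>?N. norm (coef j m) * A)"
    using b_bound y by (intro sum_norm_le) (auto simp: norm_mult intro!: mult_left_mono)
  also have "\<dots> = A * near j y" by (simp add: near_def sum_distrib_left mult_ac)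
  finally show ?thesis .
qed

text \<open>
  Bounds the variation of a partial sum over a cube of level l, and thereby the coefficients of the new atoms.
\<close>

definition size :: "nat \<Rightarrow> 'v \<Rightarrow> real" where
  "size l y = (\<Sum>j\<le>l. (1/2) ^ (l - j) * near j y)"

lemma size_nonneg: "0 \<le> size l y"
  by (auto simp: size_def intro!: sum_nonneg mult_nonneg_nonneg near_nonneg)

text \<open>The oscillations of the levels up to l add up to \<open>size\<close>.\<close>

lemma partial_osc:
  assumes y: "y \<in> D" "y' \<in> D" and close: "2 ^ l * norm (\<alpha> y - \<alpha> y') \<le> 6 * real DIM('x)"
  shows "norm (partial (Suc l) y - partial l y') \<le> osc * size l y"
    and "norm (partial (Suc l) y - partial (Suc l) y') \<le> osc * size l y"
proof -
  have osc0: "0 \<le> osc" using osc_ge A by simp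
  have le: "norm (\<Sum>j<l. level j y - level j y') \<le> (\<Sum>j<l. osc * (1/2) ^ (l - j) * near j y)"
    using level_osc[OF y _ close] by (intro sum_norm_le) auto
  have s: "osc * size l y = osc * near l y + (\<Sum>j<l. osc * (1/2) ^ (l - j) * near j y)"
    by (simp add: size_def lessThan_Suc_atMost[symmetric] distrib_left sum_distrib_left mult_ac)
  have "partial (Suc l) y - partial l y' = level l y + (\<Sum>j<l. level j y - level j y')"
    by (simp add: partial_def sum_subtractf)
  also have "norm \<dots> \<le> A * near l y + (\<Sum>j<l. osc * (1/2) ^ (l - j) * near j y)"
    by (rule norm_triangle_mono[OF level_bound[OF y(1)] le])
  also have "A * near l y \<le> osc * near l y" by (intro mult_right_mono osc_ge near_nonneg)
  finally show "norm (partial (Suc l) y - partial l y') \<le> osc * size l y" unfolding s by simp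
  have "partial (Suc l) y - partial (Suc l) y' = (level l y - level l y') + (\<Sum>j<l. level j y - level j y')"
    by (simp add: partial_def sum_subtractf)
  also have "norm \<dots> \<le> osc * (1/2) ^ (l - l) * near l y + (\<Sum>j<l. osc * (1/2) ^ (l - j) * near j y)"
    by (rule norm_triangle_mono[OF level_osc[OF y order_refl close] le])
  finally show "norm (partial (Suc l) y - partial (Suc l) y') \<le> osc * size l y" unfolding s by simp
qed

lemma cube_close:
  fixes x x' z :: 'x
  assumes "x \<in> cube 1 l z" "x' \<in> cube 1 l z"
  shows "2 ^ l * norm (x - x') \<le> 6 * real DIM('x)"
proof -
  have "norm (2 ^ l *\<^sub>R (x - x')) \<le> real DIM('x) * 2"
  proof (rule norm_le_of_coordinates)
    fix i :: 'x assume i: "i \<in> Basis"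
    then have "\<bar>2 ^ l * (x \<bullet> i) - z \<bullet> i\<bar> \<le> 1" "\<bar>2 ^ l * (x' \<bullet> i) - z \<bullet> i\<bar> \<le> 1"
      using assms by (auto simp: cube_iff)
    then show "\<bar>2 ^ l *\<^sub>R (x - x') \<bullet> i\<bar> \<le> 2" by (simp add: inner_diff_left right_diff_distrib)
  qed
  then show ?thesis by simp
qed

definition parents :: "nat \<Rightarrow> 'x \<Rightarrow> 'x set" where
  "parents l z = {z' \<in> cubes l. cube 1 l z' \<inter> cube 1 (Suc l) z \<noteq> {}}"

lemma parents_close:
  assumes z: "z \<in> cubes (Suc l)" "z' \<in> parents l z"
  shows "2 ^ Suc l * norm (\<alpha> (pt (Suc l) z) - \<alpha> (pt l z')) \<le> 6 * real DIM('x)"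
proof -
  obtain w where w: "w \<in> cube 1 l z'" "w \<in> cube 1 (Suc l) z" using z by (auto simp: parents_def)
  have z': "z' \<in> cubes l" using z by (simp add: parents_def)
  let ?x = "\<alpha> (pt (Suc l) z)" and ?x' = "\<alpha> (pt l z')"
  have "norm (2 ^ Suc l *\<^sub>R (?x - ?x')) \<le> real DIM('x) * 6"
  proof (rule norm_le_of_coordinates)
    fix i :: 'x assume i: "i \<in> Basis"
    have "\<bar>2 ^ Suc l * (?x \<bullet> i) - z \<bullet> i\<bar> \<le> 1" "\<bar>2 ^ Suc l * (w \<bullet> i) - z \<bullet> i\<bar> \<le> 1"
        "\<bar>2 ^ l * (?x' \<bullet> i) - z' \<bullet> i\<bar> \<le> 1" "\<bar>2 ^ l * (w \<bullet> i) - z' \<bullet> i\<bar> \<le> 1"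
      using pt(2)[OF z(1)] pt(2)[OF z'] w i unfolding cube_iff by blast+
    then show "\<bar>2 ^ Suc l *\<^sub>R (?x - ?x') \<bullet> i\<bar> \<le> 6" by (simp add: inner_diff_left right_diff_distrib)
  qed
  then show ?thesis by simp
qed

text \<open>
  The cube of level l + 1 has centre \<open>2\<^bsup>-l\<^esup> (z/2)\<close>, so a cube of level l that meets
  it has an index within 3/2 of \<open>z/2\<close>.
\<close>

lemma card_parents: "finite (parents l z)" "real (card (parents l z)) \<le> 4 ^ DIM('x)"
proof -
  show fin: "finite (parents l z)" using finite_cubes by (simp add: parents_def)
  have sub: "parents l z \<subseteq> {m \<in> int_lattice. \<forall>i\<in>Basis. \<bar>m \<bullet> i - ((1/2) *\<^sub>R z) \<bullet> i\<bar> \<le> 3/2}"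
  proof
    fix z' assume z': "z' \<in> parents l z"
    then obtain w where w: "w \<in> cube 1 l z'" "w \<in> cube 1 (Suc l) z" by (auto simp: parents_def)
    have "\<bar>z' \<bullet> i - ((1/2) *\<^sub>R z) \<bullet> i\<bar> \<le> 3/2" if i: "i \<in> Basis" for i
    proof -
      have "\<bar>2 ^ l * (w \<bullet> i) - z' \<bullet> i\<bar> \<le> 1" "\<bar>2 ^ Suc l * (w \<bullet> i) - z \<bullet> i\<bar> \<le> 1"
        using w i unfolding cube_iff by blast+
      then show ?thesis unfolding power_Suc inner_scaleR_left mult.assoc by linarith
    qed
    then show "z' \<in> {m \<in> int_lattice. \<forall>i\<in>Basis. \<bar>m \<bullet> i - ((1/2) *\<^sub>R z) \<bullet> i\<bar> \<le> 3/2}"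
      using z' by (auto simp: parents_def cubes_meeting_def)
  qed
  have "real (card (parents l z)) \<le> (2 * (3/2) + 1) ^ DIM('x)"
    using card_mono[OF lattice_points_near(1) sub] lattice_points_near(2)[of "3/2" "(1/2) *\<^sub>R z"]
    by simp
  then show "real (card (parents l z)) \<le> 4 ^ DIM('x)" by simp
qed

text \<open>
  The quasi-interpolant of \<open>P\<close> at scale \<open>2\<^sup>-\<^sup>l\<close> is \<open>\<Sum>\<^sub>z P (pt l z) \<theta>\<^bsub>l,z\<^esub>\<close>. The term of level l is
  the interpolant of the partial sum up to level l at scale l minus the interpolant of the partial
  sum up to level l - 1 at scale l - 1; multiplied out with the two partitions of unity, it is a
  combination of differences of nearby values. The sum over l telescopes.
\<close>

fun piece :: "nat \<Rightarrow> 'x \<Rightarrow> 'x \<Rightarrow> complex" where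
  "piece 0 z x = partial 1 (pt 0 z) * dyadic_bump 0 z x"
| "piece (Suc l) z x = (\<Sum>z'\<in>parents l z.
     (partial (Suc (Suc l)) (pt (Suc l) z) - partial (Suc l) (pt l z')) *
     (dyadic_bump (Suc l) z x * dyadic_bump l z' x))"

definition interpolant :: "nat \<Rightarrow> (('v \<Rightarrow> complex) \<Rightarrow> 'x \<Rightarrow> complex)" where
  "interpolant l P x = (\<Sum>z\<in>cubes l. P (pt l z) * dyadic_bump l z x)"

lemma sum_piece_Suc:
  assumes "x \<in> \<alpha> ` D"
  shows "(\<Sum>z\<in>cubes (Suc l). piece (Suc l) z x)
    = interpolant (Suc l) (partial (Suc (Suc l))) x - interpolant l (partial (Suc l)) x"
proof -
  let ?P = "partial (Suc (Suc l))" and ?Q = "partial (Suc l)"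
  have "piece (Suc l) z x = (\<Sum>z'\<in>cubes l. (?P (pt (Suc l) z) - ?Q (pt l z')) *
     (dyadic_bump (Suc l) z x * dyadic_bump l z' x))" for z
    unfolding piece.simps
  proof (rule sum.mono_neutral_left[OF finite_cubes])
    show "\<forall>z'\<in>cubes l - parents l z. (?P (pt (Suc l) z) - ?Q (pt l z')) *
        (dyadic_bump (Suc l) z x * dyadic_bump l z' x) = 0"
    proof
      fix z' assume z': "z' \<in> cubes l - parents l z"
      then have "\<not> (x \<in> cube 1 l z' \<and> x \<in> cube 1 (Suc l) z)" by (auto simp: parents_def)
      then have "dyadic_bump (Suc l) z x = 0 \<or> dyadic_bump l z' x = 0" using dyadic_bump_cube by blast
      then show "(?P (pt (Suc l) z) - ?Q (pt l z')) * (dyadic_bump (Suc l) z x * dyadic_bump l z' x) = 0"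
        by auto
    qed
  qed (auto simp: parents_def)
  moreover have "(\<Sum>z'\<in>cubes l. (a - q z') * (c * t z')) = c * (a * (\<Sum>z'\<in>cubes l. t z') - (\<Sum>z'\<in>cubes l. q z' * t z'))"
    for a c :: complex and q t :: "'x \<Rightarrow> complex"
    unfolding sum_distrib_left sum_subtractf[symmetric] by (intro sum.cong refl) (simp add: algebra_simps)
  ultimately have "piece (Suc l) z x = dyadic_bump (Suc l) z x *
      (?P (pt (Suc l) z) * (\<Sum>z'\<in>cubes l. dyadic_bump l z' x) - interpolant l ?Q x)" for z
    unfolding interpolant_def by metis
  then have "piece (Suc l) z x = ?P (pt (Suc l) z) * dyadic_bump (Suc l) z x
      - dyadic_bump (Suc l) z x * interpolant l ?Q x" for z
    using sum_dyadic_bump[OF finite_cubes assms] by (simp add: algebra_simps)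
  then have "(\<Sum>z\<in>cubes (Suc l). piece (Suc l) z x)
      = interpolant (Suc l) ?P x - (\<Sum>z\<in>cubes (Suc l). dyadic_bump (Suc l) z x) * interpolant l ?Q x"
    by (simp add: interpolant_def[of "Suc l"] sum_subtractf sum_distrib_right)
  then show ?thesis using sum_dyadic_bump[OF finite_cubes assms] by simp
qed

lemma sum_pieces:
  assumes "x \<in> \<alpha> ` D"
  shows "(\<Sum>l<Suc J. \<Sum>z\<in>cubes l. piece l z x) = interpolant J (partial (Suc J)) x"
proof (induction J)
  case 0
  then show ?case by (simp add: interpolant_def)
next
  case (Suc J)
  then show ?case using sum_piece_Suc[OF assms, of J] by (simp only: sum.lessThan_Suc) simp
qed

text \<open>The interpolant at \<open>\<alpha> y\<close> is a mean of values at sample points near y.\<close>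

lemma interpolant_close:
  assumes y: "y \<in> D"
  shows "norm (interpolant l (partial (Suc l)) (\<alpha> y) - partial (Suc l) y) \<le> osc * size l y"
proof -
  have x: "\<alpha> y \<in> \<alpha> ` D" using y by simp
  have "interpolant l (partial (Suc l)) (\<alpha> y) - partial (Suc l) y
      = (\<Sum>z\<in>cubes l. (partial (Suc l) (pt l z) - partial (Suc l) y) * dyadic_bump l z (\<alpha> y))"
    using sum_dyadic_bump[OF finite_cubes x, of l]
    by (simp add: interpolant_def left_diff_distrib sum_subtractf sum_distrib_left[symmetric])
  also have "norm \<dots> \<le> (\<Sum>z\<in>cubes l. (osc * size l y) * norm (dyadic_bump l z (\<alpha> y)))"
  proof (rule sum_norm_le)
    fix z assume z: "z \<in> cubes l"
    show "norm ((partial (Suc l) (pt l z) - partial (Suc l) y) * dyadic_bump l z (\<alpha> y))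
        \<le> (osc * size l y) * norm (dyadic_bump l z (\<alpha> y))"
    proof (cases "dyadic_bump l z (\<alpha> y) = 0")
      case False
      then have "2 ^ l * norm (\<alpha> y - \<alpha> (pt l z)) \<le> 6 * real DIM('x)"
        using pt(2)[OF z] dyadic_bump_cube by (intro cube_close) auto
      from partial_osc(2)[OF y pt(1)[OF z] this] show ?thesis
        by (simp add: norm_mult norm_minus_commute mult_right_mono)
    qed simp
  qed
  also have "\<dots> = osc * size l y"
    using sum_norm_dyadic_bump[OF finite_cubes x, of l] by (simp add: sum_distrib_left[symmetric])
  finally show ?thesis .
qed

lemma piece_zero_of_bump: "dyadic_bump l z x = 0 \<Longrightarrow> piece l z x = 0"
  by (cases l) auto

lemma piece_supp: "piece l z x \<noteq> 0 \<Longrightarrow> x \<in> cube 1 l z"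
  using piece_zero_of_bump dyadic_bump_cube by blast

text \<open>
  Derivatives of products of bumps are of the right order, and the factors in front of them are differences of
  nearby values of partial sums.
\<close>

lemma piece_bound:
  assumes B: "C_k_bound k 0 B (lattice_bump :: 'x \<Rightarrow> complex)" "1 \<le> B" and z: "z \<in> cubes l"
  shows "C_k_bound k l (4 ^ DIM('x) * (2 ^ k * B * B) * osc * size l (pt l z)) (piece l z)"
proof (cases l)
  case 0
  have A0: "0 \<le> A" using A by simp
  have osc0: "0 \<le> osc" using osc_ge A by simp
  have "norm (partial 1 (pt 0 z)) \<le> A * near 0 (pt 0 z)"
    using level_bound[OF pt(1)] z 0 by (simp add: partial_def)
  also have "\<dots> \<le> osc * near 0 (pt 0 z)" by (intro mult_right_mono osc_ge near_nonneg)
  also have "\<dots> = osc * size 0 (pt 0 z)" by (simp add: size_def)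
  finally have le: "norm (partial 1 (pt 0 z)) \<le> osc * size 0 (pt 0 z)" .
  have "C_k_bound k 0 (norm (partial 1 (pt 0 z)) * B) (piece 0 z)"
    unfolding piece.simps[abs_def] by (intro C_k_bound_cmult C_k_bound_dyadic_bump B)
  moreover have "norm (partial 1 (pt 0 z)) * B \<le> 4 ^ DIM('x) * (2 ^ k * B * B) * osc * size 0 (pt 0 z)"
  proof -
    have "B \<le> 1 * (1 * B * B)" using B by simp
    also have "\<dots> \<le> 4 ^ DIM('x) * (2 ^ k * B * B)" using B by (intro mult_mono) auto
    finally have "norm (partial 1 (pt 0 z)) * B \<le> (osc * size 0 (pt 0 z)) * (4 ^ DIM('x) * (2 ^ k * B * B))"
      using le osc0 size_nonneg B by (intro mult_mono mult_nonneg_nonneg) auto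
    then show ?thesis by (simp add: mult_ac)
  qed
  ultimately show ?thesis using 0 by (auto intro: C_k_bound_mono)
next
  case (Suc i)
  have osc0: "0 \<le> osc" using osc_ge A by simp
  let ?U = "osc * size (Suc i) (pt (Suc i) z)"
  have "C_k_bound k (Suc i) (\<Sum>z'\<in>parents i z. ?U * (2 ^ k * B * B)) (piece (Suc i) z)"
    unfolding piece.simps[abs_def]
  proof (rule C_k_bound_sum)
    fix z' assume z': "z' \<in> parents i z"
    have zc: "z \<in> cubes (Suc i)" using z Suc by simp
    have z'c: "z' \<in> cubes i" using z' by (simp add: parents_def)
    have le: "norm (partial (Suc (Suc i)) (pt (Suc i) z) - partial (Suc i) (pt i z')) \<le> ?U"
      using partial_osc(1)[OF pt(1)[OF zc] pt(1)[OF z'c] parents_close[OF zc z']] .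
    have "C_k_bound k (Suc i) B (dyadic_bump i z')"
      using C_k_bound_dyadic_bump[OF B(1), of i z'] by (rule C_k_bound_mono) auto
    then have "C_k_bound k (Suc i)
        (norm (partial (Suc (Suc i)) (pt (Suc i) z) - partial (Suc i) (pt i z')) * (2 ^ k * B * B))
        (\<lambda>x. (partial (Suc (Suc i)) (pt (Suc i) z) - partial (Suc i) (pt i z')) *
          (dyadic_bump (Suc i) z x * dyadic_bump i z' x))"
      by (intro C_k_bound_cmult C_k_bound_mult C_k_bound_dyadic_bump B)
    then show "C_k_bound k (Suc i) (?U * (2 ^ k * B * B))
        (\<lambda>x. (partial (Suc (Suc i)) (pt (Suc i) z) - partial (Suc i) (pt i z')) *
          (dyadic_bump (Suc i) z x * dyadic_bump i z' x))"
      by (rule C_k_bound_mono) (use le B in \<open>auto intro!: mult_right_mono\<close>)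
  qed
  moreover have "(\<Sum>z'\<in>parents i z. ?U * (2 ^ k * B * B)) \<le> 4 ^ DIM('x) * (2 ^ k * B * B) * osc * size (Suc i) (pt (Suc i) z)"
  proof -
    have "(\<Sum>z'\<in>parents i z. ?U * (2 ^ k * B * B)) = real (card (parents i z)) * (?U * (2 ^ k * B * B))" by simp
    also have "\<dots> \<le> 4 ^ DIM('x) * (?U * (2 ^ k * B * B))"
      using osc0 size_nonneg B by (intro mult_right_mono card_parents(2) mult_nonneg_nonneg) auto
    finally show ?thesis by (simp add: mult_ac)
  qed
  ultimately show ?thesis using Suc by (auto intro: C_k_bound_mono)
qed

text \<open>
  Counting: the points \<open>\<alpha> y\<close> for which \<open>\<beta> y\<close> lies near a given cube of side \<open>2\<^sup>-\<^sup>j\<close> are covered by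
  about \<open>2\<^bsup>(l-j)D\<^esup>\<close> cubes of side \<open>2\<^sup>-\<^sup>l\<close>, where D is the dimension of the space of parameters.
\<close>

lemma card_near_cubes:
  obtains C where "0 < C" "\<And>j l m. j \<le> l \<Longrightarrow>
    real (card {z \<in> cubes l. norm (2 ^ j *\<^sub>R \<beta> (pt l z) - m) \<le> rad}) \<le> C * (2 ^ (l - j)) ^ DIM('v)"
proof -
  define F where "F = 2 * real DIM('x) + 2 * real DIM('v) * L"
  define E where "E = 2 * (real DIM('v) + 2 * rad * L) + 1"
  define NF where "NF = nat \<lceil>(2 * F + 1) ^ DIM('x)\<rceil>"
  have rad0: "0 \<le> rad" using A L by (simp add: rad_def)
  have F0: "0 \<le> F" using L by (simp add: F_def)
  have E1: "1 \<le> E" using L rad0 by (simp add: E_def)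
  define C where "C = E ^ DIM('v) * (real NF + 1)"
  show thesis
  proof (rule that[of C])
    show "0 < C" using E1 by (simp add: C_def)
    fix j l :: nat and m :: 'y
    assume jl: "j \<le> l"
    let ?S = "{z \<in> cubes l. norm (2 ^ j *\<^sub>R \<beta> (pt l z) - m) \<le> rad}"
    \<comment> \<open>The sample points are rounded to the lattice \<open>2\<^bsup>-l\<^esup> \<int>\<^sup>D\<close> of the space of parameters. Boundedly many
      cubes share a rounded point, and the rounded points lie in one ball.\<close>
    define w where "w z = (\<Sum>i\<in>Basis. real_of_int \<lfloor>2 ^ l * (pt l z \<bullet> i)\<rfloor> *\<^sub>R i)" for z
    have w_inner: "w z \<bullet> i = real_of_int \<lfloor>2 ^ l * (pt l z \<bullet> i)\<rfloor>" if "i \<in> Basis" for z i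
      using that by (simp add: w_def inner_sum_left inner_Basis if_distrib cong: if_cong)
    have w_lattice: "w z \<in> int_lattice" for z by (simp add: int_lattice_def w_inner)
    have w_close: "norm (2 ^ l *\<^sub>R pt l z - w z) \<le> real DIM('v)" for z
    proof -
      have "norm (2 ^ l *\<^sub>R pt l z - w z) \<le> real DIM('v) * 1"
      proof (rule norm_le_of_coordinates)
        fix i :: 'v assume "i \<in> Basis"
        then show "\<bar>(2 ^ l *\<^sub>R pt l z - w z) \<bullet> i\<bar> \<le> 1"
          by (simp add: inner_diff_left w_inner) linarith
      qed
      then show ?thesis by simp
    qed
    have finS: "finite ?S" using finite_cubes by simp
    have fibers: "card {z \<in> ?S. w z = v} \<le> NF" if v: "v \<in> w ` ?S" for v
    proof -
      obtain z0 where z0: "z0 \<in> ?S" "w z0 = v" using v by blast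
      have sub: "{z \<in> ?S. w z = v} \<subseteq> {z \<in> int_lattice. norm (z - z0) \<le> F}"
      proof
        fix z assume "z \<in> {z \<in> ?S. w z = v}"
        then have z: "z \<in> cubes l" "w z = w z0" using z0 by auto
        have z0c: "z0 \<in> cubes l" using z0 by simp
        have "norm (2 ^ l *\<^sub>R pt l z - 2 ^ l *\<^sub>R pt l z0) \<le> 2 * real DIM('v)"
          using norm_triangle_ineq4[of "2 ^ l *\<^sub>R pt l z - w z" "2 ^ l *\<^sub>R pt l z0 - w z0"]
            w_close[of z] w_close[of z0] z(2) by simp
        then have p: "2 ^ l * norm (pt l z - pt l z0) \<le> 2 * real DIM('v)"
          by (simp add: scaleR_diff_right[symmetric])
        have "norm (2 ^ l *\<^sub>R \<alpha> (pt l z) - 2 ^ l *\<^sub>R \<alpha> (pt l z0)) = 2 ^ l * norm (\<alpha> (pt l z) - \<alpha> (pt l z0))"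
          by (simp add: scaleR_diff_right[symmetric])
        also have "\<dots> \<le> 2 ^ l * (L * norm (pt l z - pt l z0))" by (intro mult_left_mono \<alpha>_le) auto
        also have "\<dots> = L * (2 ^ l * norm (pt l z - pt l z0))" by simp
        also have "\<dots> \<le> L * (2 * real DIM('v))" using p L by (intro mult_left_mono) auto
        finally have a: "norm (2 ^ l *\<^sub>R \<alpha> (pt l z) - 2 ^ l *\<^sub>R \<alpha> (pt l z0)) \<le> 2 * real DIM('v) * L"
          by (simp add: mult_ac)
        have q: "norm (2 ^ l *\<^sub>R \<alpha> (pt l z) - z) \<le> real DIM('x)" "norm (2 ^ l *\<^sub>R \<alpha> (pt l z0) - z0) \<le> real DIM('x)"
          using cube_norm_le[OF pt(2)[OF z(1)]] cube_norm_le[OF pt(2)[OF z0c]] by auto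
        have "z - z0 = (2 ^ l *\<^sub>R \<alpha> (pt l z) - 2 ^ l *\<^sub>R \<alpha> (pt l z0)) - (2 ^ l *\<^sub>R \<alpha> (pt l z) - z) + (2 ^ l *\<^sub>R \<alpha> (pt l z0) - z0)"
          by simp
        also have "norm \<dots> \<le> F"
          unfolding F_def using a q
          by (intro order_trans[OF norm_triangle_ineq] order_trans[OF add_mono[OF norm_triangle_ineq4 order_refl]]) simp
        finally show "z \<in> {z \<in> int_lattice. norm (z - z0) \<le> F}" using z by (simp add: cubes_meeting_def)
      qed
      have "real (card {z \<in> ?S. w z = v}) \<le> (2 * F + 1) ^ DIM('x)"
        using card_mono[OF lattice_points_in_ball(1)[OF F0] sub] lattice_points_in_ball(2)[OF F0, of z0] by simp
      then show ?thesis unfolding NF_def by linarith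
    qed
    have "card ?S \<le> card (w ` ?S) * NF" by (rule card_le_fibers[OF finS fibers])
    moreover have "real (card (w ` ?S)) \<le> E ^ DIM('v) * (2 ^ (l - j)) ^ DIM('v)"
    proof (cases "?S = {}")
      case True
      then show ?thesis using E1 by (simp only: image_empty card.empty) simp
    next
      case False
      then obtain z0 where z0: "z0 \<in> ?S" by blast
      define R where "R = 2 ^ (l - j) * (real DIM('v) + 2 * rad * L)"
      have R0: "0 \<le> R" using rad0 L by (simp add: R_def)
      have sub: "w ` ?S \<subseteq> {v \<in> int_lattice. norm (v - 2 ^ l *\<^sub>R pt l z0) \<le> R}"
      proof (rule image_subsetI)
        fix z assume z: "z \<in> ?S"
        have "norm (2 ^ j *\<^sub>R \<beta> (pt l z) - 2 ^ j *\<^sub>R \<beta> (pt l z0)) \<le> 2 * rad"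
          using norm_triangle_ineq4[of "2 ^ j *\<^sub>R \<beta> (pt l z) - m" "2 ^ j *\<^sub>R \<beta> (pt l z0) - m"] z z0 by simp
        then have p: "2 ^ j * norm (\<beta> (pt l z) - \<beta> (pt l z0)) \<le> 2 * rad" by (simp add: scaleR_diff_right[symmetric])
        have "norm (2 ^ l *\<^sub>R pt l z - 2 ^ l *\<^sub>R pt l z0) = 2 ^ (l - j) * (2 ^ j * norm (pt l z - pt l z0))"
          using jl by (simp add: scaleR_diff_right[symmetric] power_add[symmetric])
        also have "\<dots> \<le> 2 ^ (l - j) * (2 ^ j * (L * norm (\<beta> (pt l z) - \<beta> (pt l z0))))"
          by (intro mult_left_mono \<beta>_ge) auto
        also have "\<dots> = 2 ^ (l - j) * (L * (2 ^ j * norm (\<beta> (pt l z) - \<beta> (pt l z0))))" by simp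
        also have "\<dots> \<le> 2 ^ (l - j) * (L * (2 * rad))" using p L by (intro mult_left_mono) auto
        finally have a: "norm (2 ^ l *\<^sub>R pt l z - 2 ^ l *\<^sub>R pt l z0) \<le> 2 ^ (l - j) * (2 * rad * L)"
          by (simp add: mult_ac)
        have "norm (w z - 2 ^ l *\<^sub>R pt l z0) \<le> norm (2 ^ l *\<^sub>R pt l z - 2 ^ l *\<^sub>R pt l z0) + norm (2 ^ l *\<^sub>R pt l z - w z)"
          using norm_triangle_ineq4[of "2 ^ l *\<^sub>R pt l z - 2 ^ l *\<^sub>R pt l z0" "2 ^ l *\<^sub>R pt l z - w z"] by simp
        also have "\<dots> \<le> 2 ^ (l - j) * (2 * rad * L) + 1 * real DIM('v)" using a w_close[of z] by simp
        also have "\<dots> \<le> 2 ^ (l - j) * (2 * rad * L) + 2 ^ (l - j) * real DIM('v)"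
          by (intro add_left_mono mult_right_mono) auto
        finally show "w z \<in> {v \<in> int_lattice. norm (v - 2 ^ l *\<^sub>R pt l z0) \<le> R}"
          using w_lattice by (simp add: R_def distrib_left)
      qed
      have "real (card (w ` ?S)) \<le> (2 * R + 1) ^ DIM('v)"
        using card_mono[OF lattice_points_in_ball(1)[OF R0] sub] lattice_points_in_ball(2)[OF R0, of "2 ^ l *\<^sub>R pt l z0"] by simp
      also have "\<dots> \<le> (E * 2 ^ (l - j)) ^ DIM('v)"
      proof (rule power_mono)
        have "2 * R + 1 \<le> 2 * R + 2 ^ (l - j)" by simp
        then show "2 * R + 1 \<le> E * 2 ^ (l - j)" by (simp add: R_def E_def algebra_simps)
      qed (use R0 in simp)
      finally show ?thesis by (simp add: power_mult_distrib)
    qed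
    ultimately have "real (card ?S) \<le> (E ^ DIM('v) * (2 ^ (l - j)) ^ DIM('v)) * real NF"
    proof -
      assume le: "card ?S \<le> card (w ` ?S) * NF" "real (card (w ` ?S)) \<le> E ^ DIM('v) * (2 ^ (l - j)) ^ DIM('v)"
      have "real (card ?S) \<le> real (card (w ` ?S)) * real NF"
        using le(1) by (simp only: of_nat_mult[symmetric] of_nat_le_iff)
      also have "\<dots> \<le> (E ^ DIM('v) * (2 ^ (l - j)) ^ DIM('v)) * real NF"
        using le(2) by (rule mult_right_mono) simp
      finally show ?thesis .
    qed
    also have "\<dots> \<le> C * (2 ^ (l - j)) ^ DIM('v)"
      using E1 by (simp add: C_def algebra_simps)
    finally show "real (card ?S) \<le> C * (2 ^ (l - j)) ^ DIM('v)" .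
  qed
qed

end


section \<open>Norm estimates for sums of atoms\<close>

lemma ell_norm_mono_neutral:
  assumes "0 < p" "finite I" "finite J" "\<And>i. i \<in> J - I \<Longrightarrow> u i = 0"
  shows "ell_norm p J u \<le> ell_norm p I u"
proof (cases "p = top")
  case True
  have "u i \<le> (SUP i\<in>I. u i)" if "i \<in> J" for i
    using assms(4)[of i] that by (cases "i \<in> I") (auto intro: SUP_upper)
  then show ?thesis using True by (auto simp: ell_norm_def intro!: SUP_least)
next
  case False
  have "(\<Sum>i\<in>J. epow (u i) (enn2real p)) = (\<Sum>i\<in>J \<inter> I. epow (u i) (enn2real p))"
    using assms by (intro sum.mono_neutral_right) auto
  also have "\<dots> \<le> (\<Sum>i\<in>I. epow (u i) (enn2real p))"
    using assms by (intro sum_mono2) auto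
  finally show ?thesis
    using False assms by (auto simp: ell_norm_def intro!: epow_mono)
qed

lemma ell_norm_cmult:
  assumes "0 < p" "finite I" "0 \<le> c"
  shows "ell_norm p I (\<lambda>i. ennreal c * u i) \<le> ennreal c * ell_norm p I u"
  using qnorm_cmult_le[OF assms(1), of u "count_space I" "ennreal c"] assms(2)
  by (simp add: ell_norm_finite)

text \<open>
  Each point has boundedly many lattice points in its neighbourhood. M is a measure on a surface or the counting
  measure on a set of cubes.
\<close>

lemma qnorm_near_le:
  fixes \<gamma> :: "'m \<Rightarrow> 'y::euclidean_space"
  assumes p: "0 < p" and \<rho>: "0 \<le> \<rho>"
  obtains K where "0 < K" "\<And>M (\<gamma> :: 'm \<Rightarrow> 'y) I coef j B.
    finite I \<Longrightarrow> I \<subseteq> int_lattice \<Longrightarrow> 0 < B \<Longrightarrow>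
    (\<forall>m\<in>I. {x \<in> space M. norm (2 ^ j *\<^sub>R \<gamma> x - m) \<le> \<rho>} \<in> sets M \<and>
       emeasure M {x \<in> space M. norm (2 ^ j *\<^sub>R \<gamma> x - m) \<le> \<rho>} \<le> ennreal B) \<Longrightarrow>
    qnorm p M (\<lambda>x. \<Sum>m\<in>{m \<in> I. norm (2 ^ j *\<^sub>R \<gamma> x - m) \<le> \<rho>}. ennreal (norm (coef m :: complex)))
      \<le> ennreal (K * B powr enn2real (1 / p)) * ell_norm p I (\<lambda>m. ennreal (norm (coef m)))"
proof -
  define N where "N = nat \<lceil>(2 * \<rho> + 1) ^ DIM('y)\<rceil>"
  show thesis
  proof (rule that[of "real N + 1"])
    fix M and \<gamma> :: "'m \<Rightarrow> 'y" and I and coef :: "'y \<Rightarrow> complex" and j B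
    assume I: "finite I" "I \<subseteq> int_lattice" and B: "(0::real) < B"
      and *: "\<forall>m\<in>I. {x \<in> space M. norm (2 ^ j *\<^sub>R \<gamma> x - m) \<le> \<rho>} \<in> sets M \<and>
       emeasure M {x \<in> space M. norm (2 ^ j *\<^sub>R \<gamma> x - m) \<le> \<rho>} \<le> ennreal B"
    have "qnorm p M (\<lambda>x. \<Sum>m\<in>{m \<in> I. norm (2 ^ j *\<^sub>R \<gamma> x - m) \<le> \<rho>}. ennreal (norm (coef m)))
      \<le> ennreal (real N * B powr enn2real (1 / p)) * ell_norm p I (\<lambda>m. ennreal (norm (coef m)))"
    proof (rule qnorm_overlap_le[OF p I(1)])
      fix x
      have sub: "{m \<in> I. norm (2 ^ j *\<^sub>R \<gamma> x - m) \<le> \<rho>} \<subseteq> {m \<in> int_lattice. norm (m - 2 ^ j *\<^sub>R \<gamma> x) \<le> \<rho>}"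
        using I by (auto simp: norm_minus_commute)
      have "real (card {m \<in> I. norm (2 ^ j *\<^sub>R \<gamma> x - m) \<le> \<rho>}) \<le> (2 * \<rho> + 1) ^ DIM('y)"
        using card_mono[OF lattice_points_in_ball(1)[OF \<rho>] sub] lattice_points_in_ball(2)[OF \<rho>, of "2 ^ j *\<^sub>R \<gamma> x"]
        by linarith
      then show "card {m \<in> I. norm (2 ^ j *\<^sub>R \<gamma> x - m) \<le> \<rho>} \<le> N" unfolding N_def by linarith
    qed (use * B in auto)
    also have "\<dots> \<le> ennreal ((real N + 1) * B powr enn2real (1 / p)) * ell_norm p I (\<lambda>m. ennreal (norm (coef m)))"
      by (intro mult_right_mono ennreal_leI) auto
    finally show "qnorm p M (\<lambda>x. \<Sum>m\<in>{m \<in> I. norm (2 ^ j *\<^sub>R \<gamma> x - m) \<le> \<rho>}. ennreal (norm (coef m)))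
      \<le> ennreal ((real N + 1) * B powr enn2real (1 / p)) * ell_norm p I (\<lambda>m. ennreal (norm (coef m)))" .
  qed simp
qed

lemma qnorm_shift_le:
  assumes "0 < q"
  shows "qnorm q (count_space UNIV) (\<lambda>l::nat. if k \<le> l then t (l - k) else 0) \<le> qnorm q (count_space UNIV) t"
proof (cases "q = top")
  case True
  have "(if k \<le> l then t (l - k) else 0) \<le> (SUP i. t i)" for l by (auto intro: SUP_upper)
  then have "(SUP l. if k \<le> l then t (l - k) else 0) \<le> (SUP i. t i)" by (rule SUP_least)
  then show ?thesis unfolding qnorm_def if_P[OF True] esssup_count_space .
next
  case False
  let ?Q = "enn2real q"
  have eq: "epow (if k \<le> l then t (l - k) else 0) ?Q = (if k \<le> l then epow (t (l - k)) ?Q else 0)" for l by simp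
  have sum_eq: "(\<Sum>l<n. if k \<le> l then f (l - k) else 0) = (\<Sum>i<n - k. f i)" for n and f :: "nat \<Rightarrow> ennreal"
    by (induction n) (auto simp: Suc_diff_le)
  have "(\<Sum>l. if k \<le> l then epow (t (l - k)) ?Q else 0) \<le> (\<Sum>i. epow (t i) ?Q)"
  proof (rule suminf_le_const)
    fix n
    show "(\<Sum>l<n. if k \<le> l then epow (t (l - k)) ?Q else 0) \<le> (\<Sum>i. epow (t i) ?Q)"
      unfolding sum_eq[of "\<lambda>i. epow (t i) ?Q"] by (intro sum_le_suminf) auto
  qed auto
  then show ?thesis
    using False assms by (auto simp: qnorm_def nn_integral_count_space_nat eq intro!: epow_mono)
qed

context lipschitz_atoms
begin

lemma ennreal_near: "ennreal (near j y) = (\<Sum>m\<in>{m \<in> I j. norm (2 ^ j *\<^sub>R \<beta> y - m) \<le> rad}. ennreal (norm (coef j m)))"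
  by (simp add: near_def sum_ennreal)

text \<open>
  A discrete Hardy inequality. Put \<open>k = l - j\<close>. A cube of level j has about \<open>2\<^bsup>kD\<^esup>\<close> cubes of level l
  nearby, where D is the dimension of the parameters; this costs the factor \<open>2\<^bsup>kD/p\<^esup>\<close> and is
  compensated by the weights up to \<open>2\<^bsup>ks\<^esup>\<close>. With the factor \<open>2\<^sup>-\<^sup>k\<close> in \<open>size\<close> there remains
  \<open>2\<^bsup>-k(1-s)\<^esup>\<close>, a convergent geometric series of shifted sequences. Half of the decay is spent on
  the sum over k in the norm of index p, the other half on the one in the norm of index q.
\<close>

lemma size_norm:
  fixes s :: real
  assumes p: "0 < p" and q: "0 < q" and s: "s < 1"
  defines "\<sigma> \<equiv> s - real DIM('v) * enn2real (1 / p)"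
  assumes fin: "ell_norm q UNIV (\<lambda>j. ennreal (2 powr (real j * \<sigma>)) * ell_norm p (I j) (\<lambda>m. ennreal (norm (coef j m)))) < top"
  shows "ell_norm q UNIV (\<lambda>l. ennreal (2 powr (real l * \<sigma>)) * ell_norm p (cubes l) (\<lambda>z. ennreal (size l (pt l z)))) < top"
proof -
  let ?\<pi> = "enn2real (1 / p)"
  define t where "t j = ennreal (2 powr (real j * \<sigma>)) * ell_norm p (I j) (\<lambda>m. ennreal (norm (coef j m)))" for j
  define \<delta> where "\<delta> = (1 - s) / 2"
  have \<delta>: "0 < \<delta>" using s by (simp add: \<delta>_def)
  have rad0: "0 \<le> rad" using A L by (simp add: rad_def)
  obtain C where C: "0 < C" and card_le: "\<And>j l m. j \<le> l \<Longrightarrow>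
    real (card {z \<in> cubes l. norm (2 ^ j *\<^sub>R \<beta> (pt l z) - m) \<le> rad}) \<le> C * (2 ^ (l - j)) ^ DIM('v)"
    by (rule card_near_cubes) (rule that)
  obtain K where K: "0 < K" and K_le: "\<And>M (\<gamma> :: 'x \<Rightarrow> 'y) I coef j B.
    finite I \<Longrightarrow> I \<subseteq> int_lattice \<Longrightarrow> 0 < B \<Longrightarrow>
    (\<forall>m\<in>I. {x \<in> space M. norm (2 ^ j *\<^sub>R \<gamma> x - m) \<le> rad} \<in> sets M \<and>
       emeasure M {x \<in> space M. norm (2 ^ j *\<^sub>R \<gamma> x - m) \<le> rad} \<le> ennreal B) \<Longrightarrow>
    qnorm p M (\<lambda>x. \<Sum>m\<in>{m \<in> I. norm (2 ^ j *\<^sub>R \<gamma> x - m) \<le> rad}. ennreal (norm (coef m :: complex)))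
      \<le> ennreal (K * B powr enn2real (1 / p)) * ell_norm p I (\<lambda>m. ennreal (norm (coef m)))"
    by (rule qnorm_near_le[OF p rad0]) (rule that)
  define K1 where "K1 = K * C powr ?\<pi>"
  have K1: "0 < K1" using K C by (simp add: K1_def)
  have near_le: "qnorm p (count_space (cubes l)) (\<lambda>z. ennreal ((1/2) ^ k * near (l - k) (pt l z)))
      \<le> ennreal (K1 * 2 powr (- (real l * \<sigma>)) * 2 powr - (real k * (2 * \<delta>))) * t (l - k)" if kl: "k \<le> l" for k l
  proof -
    define B where "B = C * (2 ^ k) ^ DIM('v)"
    have B: "0 < B" using C by (simp add: B_def)
    have "qnorm p (count_space (cubes l)) (\<lambda>z. ennreal (near (l - k) (pt l z)))
        \<le> ennreal (K * B powr ?\<pi>) * ell_norm p (I (l - k)) (\<lambda>m. ennreal (norm (coef (l - k) m)))"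
      unfolding ennreal_near
    proof (rule K_le[OF I(1) I(2) B], intro ballI conjI)
      fix m assume "m \<in> I (l - k)"
      let ?S = "{z \<in> space (count_space (cubes l)). norm (2 ^ (l - k) *\<^sub>R \<beta> (pt l z) - m) \<le> rad}"
      show "?S \<in> sets (count_space (cubes l))" by auto
      have "emeasure (count_space (cubes l)) ?S = of_nat (card ?S)"
        using finite_cubes by (subst emeasure_count_space_finite) auto
      also have "\<dots> \<le> ennreal B"
        using card_le[of "l - k" l m] kl by (simp add: B_def ennreal_of_nat_eq_real_of_nat ennreal_leI)
      finally show "emeasure (count_space (cubes l)) ?S \<le> ennreal B" .
    qed
    then have "ennreal ((1/2) ^ k) * qnorm p (count_space (cubes l)) (\<lambda>z. ennreal (near (l - k) (pt l z)))
        \<le> ennreal ((1/2) ^ k) * (ennreal (K * B powr ?\<pi>) * ell_norm p (I (l - k)) (\<lambda>m. ennreal (norm (coef (l - k) m))))"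
      by (rule mult_left_mono) simp
    also have "\<dots> = ennreal (K1 * 2 powr (- (real l * \<sigma>)) * 2 powr - (real k * (2 * \<delta>))) * t (l - k)"
    proof -
      have "(1/2) ^ k * (K * B powr ?\<pi>)
          = K1 * 2 powr (- (real l * \<sigma>)) * 2 powr - (real k * (2 * \<delta>)) * 2 powr (real (l - k) * \<sigma>)"
      proof -
        have 1: "(1/2::real) ^ k = 2 powr (- real k)"
          by (simp add: powr_minus powr_realpow power_one_over inverse_eq_divide)
        have "(2 ^ k) ^ DIM('v) = (2::real) powr (real k * real DIM('v))"
        proof -
          have "(2 ^ k) ^ DIM('v) = (2::real) ^ (k * DIM('v))" by (simp add: power_mult)
          also have "\<dots> = 2 powr real (k * DIM('v))" by (rule powr_realpow[symmetric]) simp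
          finally show ?thesis by simp
        qed
        then have 2: "B powr ?\<pi> = C powr ?\<pi> * 2 powr (real k * real DIM('v) * ?\<pi>)"
          using C by (simp add: B_def powr_mult powr_powr)
        have e: "- real k + real k * real DIM('v) * ?\<pi> = - (real l * \<sigma>) + - (real k * (2 * \<delta>)) + real (l - k) * \<sigma>"
        proof -
          have s_eq: "s = 1 - 2 * \<delta>" by (simp add: \<delta>_def field_simps)
          show ?thesis using kl unfolding \<sigma>_def s_eq by (simp add: of_nat_diff algebra_simps)
        qed
        have "(1/2) ^ k * (K * B powr ?\<pi>) = K1 * (2 powr (- real k) * 2 powr (real k * real DIM('v) * ?\<pi>))"
          by (simp only: 1 2 K1_def mult_ac)
        also have "\<dots> = K1 * 2 powr (- (real l * \<sigma>) + - (real k * (2 * \<delta>)) + real (l - k) * \<sigma>)"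
          by (simp only: powr_add[symmetric] e)
        also have "\<dots> = K1 * 2 powr (- (real l * \<sigma>)) * 2 powr - (real k * (2 * \<delta>)) * 2 powr (real (l - k) * \<sigma>)"
          by (simp only: powr_add mult.assoc)
        finally show ?thesis .
      qed
      then show ?thesis
        using K K1 by (simp add: t_def mult.assoc[symmetric] ennreal_mult[symmetric])
    qed
    finally show ?thesis
      using qnorm_cmult_le[OF p, of "\<lambda>z. ennreal (near (l - k) (pt l z))" "count_space (cubes l)" "ennreal ((1/2) ^ k)"]
      by (simp add: ennreal_mult near_nonneg)
  qed
  define v where "v k l = (if k \<le> l then ennreal (2 powr - (real k * \<delta>)) * t (l - k) else 0)" for k l :: nat
  obtain C1 where C1: "C1 > 0" and C1_le: "\<And>M (u :: nat \<Rightarrow> 'x \<Rightarrow> ennreal) T.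
    (\<forall>k. u k \<in> borel_measurable M) \<Longrightarrow>
    (\<forall>k. qnorm p M (u k) \<le> ennreal (2 powr - (real k * \<delta>)) * T) \<Longrightarrow>
    qnorm p M (\<lambda>x. \<Sum>k. u k x) \<le> ennreal C1 * T"
    by (rule qnorm_geometric_suminf[OF p \<delta>]) (rule that)
  obtain C2 where C2: "C2 > 0" and C2_le: "\<And>M (u :: nat \<Rightarrow> nat \<Rightarrow> ennreal) T.
    (\<forall>k. u k \<in> borel_measurable M) \<Longrightarrow>
    (\<forall>k. qnorm q M (u k) \<le> ennreal (2 powr - (real k * \<delta>)) * T) \<Longrightarrow>
    qnorm q M (\<lambda>x. \<Sum>k. u k x) \<le> ennreal C2 * T"
    by (rule qnorm_geometric_suminf[OF q \<delta>]) (rule that)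
  have level_le: "ennreal (2 powr (real l * \<sigma>)) * ell_norm p (cubes l) (\<lambda>z. ennreal (size l (pt l z)))
      \<le> ennreal (C1 * K1) * (\<Sum>k. v k l)" for l
  proof -
    define u where "u k z = (if k \<le> l then ennreal ((1/2) ^ k * near (l - k) (pt l z)) else 0)" for k z
    let ?T = "ennreal (K1 * 2 powr (- (real l * \<sigma>))) * (\<Sum>k. v k l)"
    have u_eq: "(\<Sum>k. u k z) = ennreal (size l (pt l z))" for z
    proof -
      have "(\<Sum>k. u k z) = (\<Sum>k\<le>l. u k z)" by (rule suminf_finite) (auto simp: u_def)
      also have "\<dots> = (\<Sum>k\<le>l. ennreal ((1/2) ^ k * near (l - k) (pt l z)))" by (simp add: u_def)
      also have "\<dots> = ennreal (\<Sum>k\<le>l. (1/2) ^ k * near (l - k) (pt l z))"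
        by (intro sum_ennreal) (simp add: near_nonneg)
      also have "(\<Sum>k\<le>l. (1/2) ^ k * near (l - k) (pt l z)) = (\<Sum>j\<le>l. (1/2) ^ (l - j) * near j (pt l z))"
        by (rule sum.reindex_bij_witness[of _ "\<lambda>j. l - j" "\<lambda>j. l - j"]) auto
      finally show ?thesis by (simp add: size_def)
    qed
    have zero: "qnorm p M (\<lambda>x. 0) = 0" for M :: "'x measure"
      using qnorm_cmult_le[OF p, of "\<lambda>x. 0" M 0] by simp
    have "qnorm p (count_space (cubes l)) (\<lambda>z. \<Sum>k. u k z) \<le> ennreal C1 * ?T"
    proof (intro C1_le allI)
      fix k
      show "qnorm p (count_space (cubes l)) (u k) \<le> ennreal (2 powr - (real k * \<delta>)) * ?T"
      proof (cases "k \<le> l")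
        case True
        have "qnorm p (count_space (cubes l)) (u k)
            \<le> ennreal (K1 * 2 powr (- (real l * \<sigma>)) * 2 powr - (real k * (2 * \<delta>))) * t (l - k)"
          using near_le[OF True] True by (simp add: u_def[abs_def])
        also have "\<dots> = ennreal (2 powr - (real k * \<delta>)) * (ennreal (K1 * 2 powr (- (real l * \<sigma>))) * v k l)"
        proof -
          have "2 powr - (real k * (2 * \<delta>)) = 2 powr - (real k * \<delta>) * 2 powr - (real k * \<delta>)"
            by (simp only: powr_add[symmetric]) (simp add: algebra_simps)
          then show ?thesis using True K1 by (simp add: v_def ennreal_mult mult_ac)
        qed
        also have "v k l \<le> (\<Sum>k. v k l)" using sum_le_suminf[of "\<lambda>k. v k l" "{k}"] by simp
        finally show ?thesis by (simp add: mult_left_mono)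
      next
        case False
        then have "u k = (\<lambda>z. 0)" by (auto simp: u_def)
        then show ?thesis by (simp add: zero)
      qed
    qed simp
    then have "ennreal (2 powr (real l * \<sigma>)) * ell_norm p (cubes l) (\<lambda>z. ennreal (size l (pt l z)))
        \<le> ennreal (2 powr (real l * \<sigma>)) * (ennreal C1 * ?T)"
      using finite_cubes by (simp add: u_eq ell_norm_finite mult_left_mono)
    also have "\<dots> = ennreal (C1 * K1) * (\<Sum>k. v k l)"
    proof -
      have "2 powr (real l * \<sigma>) * (C1 * (K1 * 2 powr (- (real l * \<sigma>)))) = C1 * K1"
        by (simp add: powr_minus field_simps)
      then have "ennreal (C1 * K1) = ennreal (2 powr (real l * \<sigma>) * (C1 * (K1 * 2 powr (- (real l * \<sigma>)))))"
        by (simp only:)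
      then show ?thesis
        using C1 K1 by (simp add: ennreal_mult mult.assoc)
    qed
    finally show ?thesis .
  qed
  have "ell_norm q UNIV (\<lambda>l. ennreal (2 powr (real l * \<sigma>)) * ell_norm p (cubes l) (\<lambda>z. ennreal (size l (pt l z))))
      \<le> qnorm q (count_space UNIV) (\<lambda>l. ennreal (C1 * K1) * (\<Sum>k. v k l))"
    unfolding ell_norm_nat using level_le by (intro qnorm_mono_AE[OF q] AE_I2) auto
  also have "\<dots> \<le> ennreal (C1 * K1) * qnorm q (count_space UNIV) (\<lambda>l. \<Sum>k. v k l)"
    by (rule qnorm_cmult_le[OF q]) simp
  also have "\<dots> \<le> ennreal (C1 * K1) * (ennreal C2 * qnorm q (count_space UNIV) t)"
  proof (intro mult_left_mono C2_le allI)
    fix k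
    have "v k = (\<lambda>l. ennreal (2 powr - (real k * \<delta>)) * (if k \<le> l then t (l - k) else 0))"
      by (auto simp: v_def)
    then have "qnorm q (count_space UNIV) (v k)
        \<le> ennreal (2 powr - (real k * \<delta>)) * qnorm q (count_space UNIV) (\<lambda>l. if k \<le> l then t (l - k) else 0)"
      using qnorm_cmult_le[OF q, of "\<lambda>l. if k \<le> l then t (l - k) else 0" "count_space UNIV"] by simp
    also have "\<dots> \<le> ennreal (2 powr - (real k * \<delta>)) * qnorm q (count_space UNIV) t"
      by (intro mult_left_mono qnorm_shift_le q) auto
    finally show "qnorm q (count_space UNIV) (v k) \<le> ennreal (2 powr - (real k * \<delta>)) * qnorm q (count_space UNIV) t" .
  qed auto
  also have "\<dots> < top"
    using fin by (simp add: ell_norm_nat t_def[abs_def, symmetric] ennreal_mult_less_top)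
  finally show ?thesis .
qed

text \<open>
  The new atoms are the pieces of the telescoping series, divided by their bounds. Where the bound is 0 the
  piece vanishes, and so the convention for the inverse of 0 gives the right value.
\<close>

theorem reexpansion:
  fixes s d :: real
  assumes p: "0 < p" and q: "0 < q" and s: "s < 1" and d: "1 \<le> d"
    and fin: "ell_norm q UNIV (\<lambda>j. ennreal (2 powr (real j * (s - real DIM('v) * enn2real (1 / p)))) *
      ell_norm p (I j) (\<lambda>m. ennreal (norm (coef j m)))) < top"
  obtains c a where
    "\<And>l z. atom d k l z (a l z)"
    "\<And>l z. z \<notin> cubes l \<Longrightarrow> c l z = 0"
    "\<And>l z x. a l z x \<noteq> 0 \<Longrightarrow> dyadic_bump l z x \<noteq> 0"
    "\<And>J y. y \<in> D \<Longrightarrow>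
      norm ((\<Sum>l<Suc J. \<Sum>z\<in>cubes l. c l z * a l z (\<alpha> y)) - partial (Suc J) y) \<le> osc * size J y"
    "ell_norm q UNIV (\<lambda>l. ennreal (2 powr (real l * (s - real DIM('v) * enn2real (1 / p)))) *
      ell_norm p (cubes l) (\<lambda>z. ennreal (norm (c l z)))) < top"
proof -
  obtain B where B: "1 \<le> B" "C_k_bound k 0 B (lattice_bump :: 'x \<Rightarrow> complex)"
    by (rule C_k_bound_lattice_bump)
  define C where "C = 4 ^ DIM('x) * (2 ^ k * B * B) * osc"
  have C: "0 < C" using B osc_ge A by (simp add: C_def)
  define c where "c l z = (if z \<in> cubes l then complex_of_real (C * size l (pt l z)) else 0)" for l z
  define a where "a l z = (if z \<in> cubes l then (\<lambda>x. inverse (c l z) * piece l z x) else (\<lambda>x. 0))" for l z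
  have bound: "C_k_bound k l (C * size l (pt l z)) (piece l z)" if "z \<in> cubes l" for l z
    using piece_bound[OF B(2,1) that] by (simp add: C_def)
  have ca: "c l z * a l z x = piece l z x" if z: "z \<in> cubes l" for l z x
  proof (cases "c l z = 0")
    case True
    then have "C * size l (pt l z) = 0" using z unfolding c_def by (simp only: if_True of_real_eq_0_iff)
    then have "norm (piece l z x) \<le> 0" using C_k_bound_norm[OF bound[OF z]] by metis
    then show ?thesis using True by simp
  qed (simp add: a_def z)
  show thesis
  proof (rule that[of a c])
    fix l and z :: 'x
    show "atom d k l z (a l z)"
      unfolding atom_iff
    proof
      show "C_k_bound k l 1 (a l z)"
      proof (cases "z \<in> cubes l")
        case True
        have "C_k_bound k l (norm (inverse (c l z)) * (C * size l (pt l z))) (\<lambda>x. inverse (c l z) * piece l z x)"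
          by (rule C_k_bound_cmult[OF bound[OF True]])
        moreover have "norm (inverse (c l z)) * (C * size l (pt l z)) \<le> 1"
        proof -
          have nc: "norm (c l z) = C * size l (pt l z)"
            using C size_nonneg[of l "pt l z"] True by (simp add: c_def norm_mult)
          have "inverse x * x \<le> 1" for x :: real by (cases "x = 0") auto
          then show ?thesis unfolding norm_inverse nc .
        qed
        ultimately show ?thesis using True by (auto simp: a_def intro: C_k_bound_mono)
      qed (simp add: a_def C_k_bound_const_0)
      show "supp (a l z) \<subseteq> cube d l z"
        using piece_supp[of l z] cube_mono[OF d, of l z]
        by (subst supp_subset_iff[OF closed_cube]) (auto simp: a_def)
    qed
    show "a l z x \<noteq> 0 \<Longrightarrow> dyadic_bump l z x \<noteq> 0" for x
      using piece_zero_of_bump[of l z x] by (auto simp: a_def split: if_splits)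
    show "z \<notin> cubes l \<Longrightarrow> c l z = 0" by (simp add: c_def)
  next
    fix J y assume y: "y \<in> D"
    have "(\<Sum>l<Suc J. \<Sum>z\<in>cubes l. c l z * a l z (\<alpha> y)) = (\<Sum>l<Suc J. \<Sum>z\<in>cubes l. piece l z (\<alpha> y))"
      by (intro sum.cong refl ca)
    also have "\<dots> = interpolant J (partial (Suc J)) (\<alpha> y)" using y by (intro sum_pieces) auto
    finally show "norm ((\<Sum>l<Suc J. \<Sum>z\<in>cubes l. c l z * a l z (\<alpha> y)) - partial (Suc J) y) \<le> osc * size J y"
      using interpolant_close[OF y] by simp
  next
    let ?\<sigma> = "s - real DIM('v) * enn2real (1 / p)"
    have "ell_norm p (cubes l) (\<lambda>z. ennreal (norm (c l z)))
        \<le> ennreal C * ell_norm p (cubes l) (\<lambda>z. ennreal (size l (pt l z)))" for l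
    proof -
      have "ell_norm p (cubes l) (\<lambda>z. ennreal (norm (c l z)))
          = ell_norm p (cubes l) (\<lambda>z. ennreal C * ennreal (size l (pt l z)))"
        unfolding ell_norm_finite[OF finite_cubes]
        by (intro qnorm_cong_AE[OF p] AE_I2)
          (use C size_nonneg in \<open>auto simp: c_def norm_mult ennreal_mult\<close>)
      also have "\<dots> \<le> ennreal C * ell_norm p (cubes l) (\<lambda>z. ennreal (size l (pt l z)))"
        using C by (intro ell_norm_cmult p finite_cubes) auto
      finally show ?thesis .
    qed
    then have le: "ennreal (2 powr (real l * ?\<sigma>)) * ell_norm p (cubes l) (\<lambda>z. ennreal (norm (c l z)))
        \<le> ennreal C * (ennreal (2 powr (real l * ?\<sigma>)) * ell_norm p (cubes l) (\<lambda>z. ennreal (size l (pt l z))))" for l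
      by (subst mult.left_commute) (intro mult_left_mono, auto)
    have "ell_norm q UNIV (\<lambda>l. ennreal (2 powr (real l * ?\<sigma>)) * ell_norm p (cubes l) (\<lambda>z. ennreal (norm (c l z))))
        \<le> qnorm q (count_space UNIV) (\<lambda>l. ennreal C * (ennreal (2 powr (real l * ?\<sigma>)) * ell_norm p (cubes l) (\<lambda>z. ennreal (size l (pt l z)))))"
      unfolding ell_norm_nat using le by (intro qnorm_mono_AE[OF q] AE_I2) auto
    also have "\<dots> \<le> ennreal C * ell_norm q UNIV (\<lambda>l. ennreal (2 powr (real l * ?\<sigma>)) * ell_norm p (cubes l) (\<lambda>z. ennreal (size l (pt l z))))"
      unfolding ell_norm_nat by (rule qnorm_cmult_le[OF q]) simp
    also have "\<dots> < top" using size_norm[OF p q s fin] by (simp add: ennreal_mult_less_top)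
    finally show "ell_norm q UNIV (\<lambda>l. ennreal (2 powr (real l * ?\<sigma>)) * ell_norm p (cubes l) (\<lambda>z. ennreal (norm (c l z)))) < top" .
  qed
qed

text \<open>A convolution of a summable sequence with a geometric one tends to 0.\<close>

lemma size_tendsto_0:
  assumes "summable (\<lambda>j. near j y)"
  shows "(\<lambda>J. size J y) \<longlonglongrightarrow> 0"
proof -
  have "summable (\<lambda>k. \<Sum>i\<le>k. near i y * (1/2) ^ (k - i))"
    using assms near_nonneg by (intro summable_Cauchy_product) (auto simp: summable_geometric)
  then show ?thesis by (intro summable_LIMSEQ_zero) (simp add: size_def mult.commute)
qed

end


section \<open>Sums of atoms on the boundary and on parallel surfaces\<close>

text \<open>
  The balls are taken in the target of \<open>\<gamma>\<close>; D plays the role of the dimension of M.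
\<close>

definition upper_regular ::
  "'m measure \<Rightarrow> ('m \<Rightarrow> 'y::euclidean_space) \<Rightarrow> nat \<Rightarrow> real \<Rightarrow> bool" where
  "upper_regular M \<gamma> D C \<longleftrightarrow> 0 < C \<and> \<gamma> \<in> borel_measurable M \<and>
     (\<forall>c r. 0 < r \<longrightarrow> emeasure M {x \<in> space M. norm (\<gamma> x - c) \<le> r} \<le> ennreal (C * r ^ D))"

lemma upper_regular_lebesgue:
  fixes \<gamma> :: "'v::euclidean_space \<Rightarrow> 'y::euclidean_space"
  assumes \<gamma>: "bilipschitz L \<gamma>" and S: "S \<in> sets lebesgue"
  shows "upper_regular (lebesgue_on S) \<gamma> DIM('v) (unit_ball_vol (real DIM('v)) * (2 * L) ^ DIM('v))"
proof -
  have L: "1 \<le> L" using \<gamma> by (simp add: bilipschitz_def)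
  have meas: "\<gamma> \<in> borel_measurable (lebesgue_on S)"
  proof -
    have "\<gamma> \<in> borel_measurable borel"
      by (rule borel_measurable_continuous_onI[OF bilipschitz_continuous[OF \<gamma>]])
    then have "\<gamma> \<in> borel_measurable lebesgue" by (intro measurable_completion) simp
    then show ?thesis by (rule measurable_restrict_space1)
  qed
  have "emeasure (lebesgue_on S) {x \<in> space (lebesgue_on S). norm (\<gamma> x - c) \<le> r}
      \<le> ennreal (unit_ball_vol (real DIM('v)) * (2 * L) ^ DIM('v) * r ^ DIM('v))" if r: "0 < r" for c r
  proof (cases "{x \<in> space (lebesgue_on S). norm (\<gamma> x - c) \<le> r} = {}")
    case False
    then obtain x0 where x0: "x0 \<in> S" "norm (\<gamma> x0 - c) \<le> r" by auto
    have sub: "{x \<in> space (lebesgue_on S). norm (\<gamma> x - c) \<le> r} \<subseteq> cball x0 (2 * L * r)"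
    proof
      fix x assume "x \<in> {x \<in> space (lebesgue_on S). norm (\<gamma> x - c) \<le> r}"
      then have x: "norm (\<gamma> x - c) \<le> r" by simp
      have "norm (x0 - x) \<le> L * norm (\<gamma> x0 - \<gamma> x)" using \<gamma> by (simp add: bilipschitz_def)
      also have "\<dots> \<le> L * (2 * r)"
        using x x0 L norm_triangle_ineq4[of "\<gamma> x0 - c" "\<gamma> x - c"] by (intro mult_left_mono) auto
      finally show "x \<in> cball x0 (2 * L * r)" by (simp add: dist_norm mult_ac)
    qed
    have set1: "{x \<in> space (lebesgue_on S). norm (\<gamma> x - c) \<le> r} \<in> sets (lebesgue_on S)"
      using meas by measurable
    then have set2: "{x \<in> space (lebesgue_on S). norm (\<gamma> x - c) \<le> r} \<in> sets lebesgue"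
      using S by (simp add: sets_restrict_space_iff)
    have "emeasure (lebesgue_on S) {x \<in> space (lebesgue_on S). norm (\<gamma> x - c) \<le> r}
        = emeasure lebesgue {x \<in> space (lebesgue_on S). norm (\<gamma> x - c) \<le> r}"
      using S by (intro emeasure_restrict_space) auto
    also have "\<dots> \<le> emeasure lebesgue (cball x0 (2 * L * r))" using sub by (intro emeasure_mono) auto
    also have "\<dots> = ennreal (unit_ball_vol (real DIM('v)) * (2 * L * r) ^ DIM('v))"
      using L r by (simp add: emeasure_cball)
    finally show ?thesis by (simp add: power_mult_distrib mult.assoc)
  next
    case True
    then show ?thesis by (simp only: emeasure_empty zero_le)
  qed
  then show ?thesis using meas L by (simp add: upper_regular_def)
qed

definition lev :: "'y::euclidean_space set \<Rightarrow> (nat \<Rightarrow> 'y \<Rightarrow> complex) \<Rightarrow> (nat \<Rightarrow> 'y \<Rightarrow> 'y \<Rightarrow> complex) \<Rightarrow>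
    nat \<Rightarrow> 'y \<Rightarrow> complex" where
  "lev S coef a j x = (\<Sum>m\<in>cubes_meeting S j. coef j m * a j m x)"

text \<open>
  The majorant depends on the coefficients only; the estimates of a representation are estimates
  of majorants.
\<close>

definition majorant :: "'y::euclidean_space set \<Rightarrow> (nat \<Rightarrow> 'y \<Rightarrow> complex) \<Rightarrow> real \<Rightarrow> nat \<Rightarrow> 'y \<Rightarrow> ennreal" where
  "majorant S coef \<rho> j x = (\<Sum>m\<in>{m \<in> cubes_meeting S j. norm (2 ^ j *\<^sub>R x - m) \<le> \<rho>}. ennreal (norm (coef j m)))"

lemma atomic_representation_iff:
  assumes "bounded S"
  shows "atomic_representation d k p S f coef a \<longleftrightarrow>
    (\<forall>j. \<forall>m\<in>cubes_meeting S j. atom d k j m (a j m)) \<and>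
    (\<lambda>J. lp_norm p (lebesgue_on S) (\<lambda>x. f x - (\<Sum>j<J. lev S coef a j x))) \<longlonglongrightarrow> 0"
  unfolding atomic_representation_def lev_def using finite_cubes_meeting[OF assms] by simp

lemma atomD:
  assumes "atom d k j m a"
  shows "C_k_bound k j 1 a" "C_k k a" "continuous_on UNIV a" "norm (a x) \<le> 1" "a x \<noteq> 0 \<Longrightarrow> x \<in> cube d j m"
proof -
  show 1: "C_k_bound k j 1 a" using assms by (simp add: atom_iff)
  then show "C_k k a" "continuous_on UNIV a" "norm (a x) \<le> 1"
    by (auto dest: C_k_bound_C_k C_k_bound_norm intro: C_k_imp_continuous)
  show "a x \<noteq> 0 \<Longrightarrow> x \<in> cube d j m"
    using assms by (simp add: atom_iff supp_subset_iff[OF closed_cube])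
qed

lemma lev_le_majorant:
  fixes S :: "'y::euclidean_space set"
  assumes S: "bounded S" and a: "\<And>m. m \<in> cubes_meeting S j \<Longrightarrow> atom d k j m (a j m)"
    and \<rho>: "real DIM('y) * d \<le> \<rho>"
  shows "ennreal (norm (lev S coef a j x)) \<le> majorant S coef \<rho> j x"
proof -
  let ?N = "{m \<in> cubes_meeting S j. norm (2 ^ j *\<^sub>R x - m) \<le> \<rho>}"
  have "lev S coef a j x = (\<Sum>m\<in>?N. coef j m * a j m x)"
    unfolding lev_def
  proof (rule sum.mono_neutral_right)
    show "\<forall>m\<in>cubes_meeting S j - ?N. coef j m * a j m x = 0"
    proof
      fix m assume m: "m \<in> cubes_meeting S j - ?N"
      have "a j m x = 0"
      proof (rule ccontr)
        assume "a j m x \<noteq> 0"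
        then have "norm (2 ^ j *\<^sub>R x - m) \<le> real DIM('y) * d"
          using m by (intro cube_norm_le atomD(5)[OF a]) auto
        then show False using m \<rho> by auto
      qed
      then show "coef j m * a j m x = 0" by simp
    qed
  qed (use finite_cubes_meeting[OF S] in auto)
  also have "norm \<dots> \<le> (\<Sum>m\<in>?N. norm (coef j m))"
  proof (rule sum_norm_le)
    fix m assume "m \<in> ?N"
    then have "norm (a j m x) \<le> 1" using atomD(4)[OF a] by auto
    then show "norm (coef j m * a j m x) \<le> norm (coef j m)"
      unfolding norm_mult by (intro mult_left_le) auto
  qed
  finally show ?thesis unfolding majorant_def by (subst sum_ennreal) (auto intro: ennreal_leI)
qed

lemma lev_continuous:
  assumes "\<And>m. m \<in> cubes_meeting S j \<Longrightarrow> atom d k j m (a j m)"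
  shows "continuous_on UNIV (lev S coef a j)"
  unfolding lev_def[abs_def] using assms
  by (intro continuous_on_sum continuous_on_mult_left atomD(3)) auto

lemma C_k_lev:
  assumes "\<And>m. m \<in> cubes_meeting S j \<Longrightarrow> atom d k j m (a j m)"
  shows "C_k k (lev S coef a j)"
  unfolding lev_def[abs_def] using assms
  by (intro C_k_sum C_k_linear[OF bounded_linear_mult_right] atomD(2)) auto

lemma majorant_measurable:
  assumes "bounded S" and [measurable]: "\<gamma> \<in> borel_measurable M"
  shows "(\<lambda>x. majorant S coef \<rho> j (\<gamma> x)) \<in> borel_measurable M"
proof -
  have "majorant S coef \<rho> j (\<gamma> x)
      = (\<Sum>m\<in>cubes_meeting S j. if norm (2 ^ j *\<^sub>R \<gamma> x - m) \<le> \<rho> then ennreal (norm (coef j m)) else 0)" for x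
    unfolding majorant_def by (rule sum.inter_filter[OF finite_cubes_meeting[OF assms(1)]])
  then show ?thesis by simp
qed

lemma ell_norm_le_b_norm:
  fixes S :: "'y::euclidean_space set"
  assumes "0 < q"
  shows "ell_norm p (cubes_meeting S j) (\<lambda>m. ennreal (norm (coef j m)))
    \<le> ennreal (2 powr - (real j * (s - real DIM('y) * enn2real (1 / p)))) * b_norm s p q S coef"
proof -
  let ?e = "real j * (s - real DIM('y) * enn2real (1 / p))"
  have "ennreal (2 powr ?e) * ell_norm p (cubes_meeting S j) (\<lambda>m. ennreal (norm (coef j m))) \<le> b_norm s p q S coef"
    unfolding b_norm_def
    using ell_norm_le_ell_norm_UNIV[OF assms, of "\<lambda>j. ennreal (2 powr (real j * (s - real DIM('y) * enn2real (1 / p)))) *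
          ell_norm p (cubes_meeting S j) (\<lambda>m. ennreal (norm (coef j m)))" j] .
  then have "ennreal (2 powr - ?e) * (ennreal (2 powr ?e) * ell_norm p (cubes_meeting S j) (\<lambda>m. ennreal (norm (coef j m))))
      \<le> ennreal (2 powr - ?e) * b_norm s p q S coef"
    by (rule mult_left_mono) simp
  then show ?thesis
    by (simp add: mult.assoc[symmetric] ennreal_mult[symmetric] powr_add[symmetric])
qed

text \<open>
  The balls of radius \<open>\<rho> 2\<^sup>-\<^sup>j\<close> have measure at most \<open>C \<rho>\<^sup>D 2\<^bsup>-jD\<^esup>\<close>, which contributes the factor
  \<open>2\<^bsup>-jD/p\<^esup>\<close> to the norm, against the \<open>2\<^bsup>jn/p\<^esup>\<close> in the weights of the sequence space. For
  \<open>D = n - 1\<close> this is the loss of \<open>1/p\<close> in the smoothness of traces.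
\<close>

lemma majorant_qnorm:
  assumes p: "0 < p" and \<rho>: "0 < \<rho>" and C: "0 < C"
  obtains K where "0 < K" "\<And>M (\<gamma> :: 'm \<Rightarrow> 'y::euclidean_space) S coef s q j.
    upper_regular M \<gamma> D C \<Longrightarrow> bounded S \<Longrightarrow> 0 < q \<Longrightarrow>
    qnorm p M (\<lambda>x. majorant S coef \<rho> j (\<gamma> x))
      \<le> ennreal (2 powr - (real j * (s - (real DIM('y) - real D) * enn2real (1 / p)))) * (ennreal K * b_norm s p q S coef)"
proof -
  let ?\<pi> = "enn2real (1 / p)"
  obtain K0 where K0: "0 < K0" and K0_le: "\<And>M (\<gamma> :: 'm \<Rightarrow> 'y) I coef j B.
    finite I \<Longrightarrow> I \<subseteq> int_lattice \<Longrightarrow> 0 < B \<Longrightarrow>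
    (\<forall>m\<in>I. {x \<in> space M. norm (2 ^ j *\<^sub>R \<gamma> x - m) \<le> \<rho>} \<in> sets M \<and>
       emeasure M {x \<in> space M. norm (2 ^ j *\<^sub>R \<gamma> x - m) \<le> \<rho>} \<le> ennreal B) \<Longrightarrow>
    qnorm p M (\<lambda>x. \<Sum>m\<in>{m \<in> I. norm (2 ^ j *\<^sub>R \<gamma> x - m) \<le> \<rho>}. ennreal (norm (coef m :: complex)))
      \<le> ennreal (K0 * B powr enn2real (1 / p)) * ell_norm p I (\<lambda>m. ennreal (norm (coef m)))"
    by (rule qnorm_near_le[OF p less_imp_le[OF \<rho>]]) (rule that)
  define K where "K = K0 * (C * \<rho> ^ D) powr ?\<pi>"
  show thesis
  proof (rule that[of K])
    show "0 < K" using K0 C \<rho> by (simp add: K_def)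
    fix M and \<gamma> :: "'m \<Rightarrow> 'y" and S :: "'y set" and coef and s :: real and q and j :: nat
    assume reg: "upper_regular M \<gamma> D C" and S: "bounded S" and q: "(0::ennreal) < q"
    have \<gamma> [measurable]: "\<gamma> \<in> borel_measurable M" using reg by (simp add: upper_regular_def)
    define B where "B = C * (\<rho> / 2 ^ j) ^ D"
    have "qnorm p M (\<lambda>x. majorant S coef \<rho> j (\<gamma> x))
        \<le> ennreal (K0 * B powr ?\<pi>) * ell_norm p (cubes_meeting S j) (\<lambda>m. ennreal (norm (coef j m)))"
      unfolding majorant_def
    proof (rule K0_le, safe intro!: finite_cubes_meeting S)
      show "0 < B" using C \<rho> by (simp add: B_def)
      fix m assume "m \<in> cubes_meeting S j"
      show "{x \<in> space M. norm (2 ^ j *\<^sub>R \<gamma> x - m) \<le> \<rho>} \<in> sets M" by measurable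
      have "norm (2 ^ j *\<^sub>R \<gamma> x - m) \<le> \<rho> \<longleftrightarrow> norm (\<gamma> x - (1 / 2 ^ j) *\<^sub>R m) \<le> \<rho> / 2 ^ j" for x
      proof -
        have "2 ^ j *\<^sub>R \<gamma> x - m = 2 ^ j *\<^sub>R (\<gamma> x - (1 / 2 ^ j) *\<^sub>R m)" by (simp add: scaleR_diff_right)
        then have "norm (2 ^ j *\<^sub>R \<gamma> x - m) = 2 ^ j * norm (\<gamma> x - (1 / 2 ^ j) *\<^sub>R m)" by (simp only: norm_scaleR) simp
        then show ?thesis by (simp add: field_simps)
      qed
      then show "emeasure M {x \<in> space M. norm (2 ^ j *\<^sub>R \<gamma> x - m) \<le> \<rho>} \<le> ennreal B"
        using reg \<rho> unfolding upper_regular_def B_def by simp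
    qed (auto simp: cubes_meeting_def)
    also have "\<dots> \<le> ennreal (K0 * B powr ?\<pi>) *
        (ennreal (2 powr - (real j * (s - real DIM('y) * ?\<pi>))) * b_norm s p q S coef)"
      by (intro mult_left_mono ell_norm_le_b_norm q) auto
    also have "\<dots> = ennreal (2 powr - (real j * (s - (real DIM('y) - real D) * ?\<pi>))) * (ennreal K * b_norm s p q S coef)"
    proof -
      have "((2::real) ^ j) ^ D = 2 powr (real j * real D)"
        using powr_realpow[of 2 "j * D"] by (simp add: power_mult)
      then have "B = (C * \<rho> ^ D) * 2 powr - (real j * real D)"
        unfolding B_def power_divide by (simp add: powr_minus divide_inverse)
      then have "B powr ?\<pi> = (C * \<rho> ^ D) powr ?\<pi> * 2 powr (- (real j * real D) * ?\<pi>)"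
        using C \<rho> by (simp add: powr_mult powr_powr)
      then have "K0 * B powr ?\<pi> * 2 powr - (real j * (s - real DIM('y) * ?\<pi>))
          = K * (2 powr (- (real j * real D) * ?\<pi>) * 2 powr - (real j * (s - real DIM('y) * ?\<pi>)))"
        by (simp add: K_def)
      also have "\<dots> = K * 2 powr (- (real j * real D) * ?\<pi> + - (real j * (s - real DIM('y) * ?\<pi>)))"
        by (simp only: powr_add)
      also have "- (real j * real D) * ?\<pi> + - (real j * (s - real DIM('y) * ?\<pi>))
          = - (real j * (s - (real DIM('y) - real D) * ?\<pi>))"
        by (simp add: algebra_simps)
      finally have "K0 * B powr ?\<pi> * 2 powr - (real j * (s - real DIM('y) * ?\<pi>))
          = 2 powr - (real j * (s - (real DIM('y) - real D) * ?\<pi>)) * K"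
        by (simp only: mult.commute)
      then have "ennreal (K0 * B powr ?\<pi> * 2 powr - (real j * (s - real DIM('y) * ?\<pi>)))
          = ennreal (2 powr - (real j * (s - (real DIM('y) - real D) * ?\<pi>)) * K)"
        by (rule arg_cong)
      then show ?thesis
        using K0 \<open>0 < K\<close> by (simp add: ennreal_mult mult.assoc[symmetric])
    qed
    finally show "qnorm p M (\<lambda>x. majorant S coef \<rho> j (\<gamma> x))
      \<le> ennreal (2 powr - (real j * (s - (real DIM('y) - real D) * ?\<pi>))) * (ennreal K * b_norm s p q S coef)" .
  qed
qed

lemma lev_series:
  assumes p: "0 < p" and d: "0 < d" and C: "0 < C"
    and \<sigma>: "0 < s - (real DIM('y) - real D) * enn2real (1 / p)"
  obtains K where "0 < K" "\<And>M (\<gamma> :: 'm \<Rightarrow> 'y::euclidean_space) S coef a q k J.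
    upper_regular M \<gamma> D C \<Longrightarrow> bounded S \<Longrightarrow> 0 < q \<Longrightarrow> b_norm s p q S coef < top \<Longrightarrow>
    (\<forall>j. \<forall>m\<in>cubes_meeting S j. atom d k j m (a j m)) \<Longrightarrow>
    (AE x in M. summable (\<lambda>j. norm (lev S coef a j (\<gamma> x)))) \<and>
    lp_norm p M (\<lambda>x. (\<Sum>j. lev S coef a j (\<gamma> x)) - (\<Sum>j<J. lev S coef a j (\<gamma> x)))
      \<le> ennreal (K * 2 powr - (real J * (s - (real DIM('y) - real D) * enn2real (1 / p)))) * b_norm s p q S coef"
proof -
  let ?\<sigma> = "s - (real DIM('y) - real D) * enn2real (1 / p)"
  define \<rho> where "\<rho> = real DIM('y) * d"
  have \<rho>: "0 < \<rho>" using d by (simp add: \<rho>_def)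
  obtain K where K: "0 < K" and K_le: "\<And>M (\<gamma> :: 'm \<Rightarrow> 'y) S coef s q j.
    upper_regular M \<gamma> D C \<Longrightarrow> bounded S \<Longrightarrow> 0 < q \<Longrightarrow>
    qnorm p M (\<lambda>x. majorant S coef \<rho> j (\<gamma> x))
      \<le> ennreal (2 powr - (real j * (s - (real DIM('y) - real D) * enn2real (1 / p)))) * (ennreal K * b_norm s p q S coef)"
    by (rule majorant_qnorm[OF p \<rho> C]) (rule that)
  obtain C' where C': "0 < C'" and C'_le: "\<And>M (H :: nat \<Rightarrow> 'm \<Rightarrow> complex) V T J.
    (\<forall>j. H j \<in> borel_measurable M) \<Longrightarrow> (\<forall>j. V j \<in> borel_measurable M) \<Longrightarrow>
    (\<forall>j. \<forall>x\<in>space M. ennreal (norm (H j x)) \<le> V j x) \<Longrightarrow>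
    (\<forall>j. qnorm p M (V j) \<le> ennreal (2 powr - (real j * ?\<sigma>)) * T) \<Longrightarrow> T < top \<Longrightarrow>
    (AE x in M. summable (\<lambda>j. norm (H j x))) \<and>
    lp_norm p M (\<lambda>x. (\<Sum>j. H j x) - (\<Sum>j<J. H j x))
            \<le> ennreal (C' * 2 powr - (real J * ?\<sigma>)) * T"
    by (rule lp_norm_suminf_le[OF p \<sigma>]) (rule that)
  show thesis
  proof (rule that[of "C' * K"])
    show "0 < C' * K" using K C' by simp
    fix M and \<gamma> :: "'m \<Rightarrow> 'y" and S :: "'y set" and coef a q k J
    assume reg: "upper_regular M \<gamma> D C" and S: "bounded S" and q: "(0::ennreal) < q"
      and b: "b_norm s p q S coef < top"
      and a: "\<forall>j. \<forall>m\<in>cubes_meeting S j. atom d k j m (a j m)"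
    have \<gamma> [measurable]: "\<gamma> \<in> borel_measurable M" using reg by (simp add: upper_regular_def)
    have "(AE x in M. summable (\<lambda>j. norm (lev S coef a j (\<gamma> x)))) \<and>
      lp_norm p M (\<lambda>x. (\<Sum>j. lev S coef a j (\<gamma> x)) - (\<Sum>j<J. lev S coef a j (\<gamma> x)))
        \<le> ennreal (C' * 2 powr - (real J * ?\<sigma>)) * (ennreal K * b_norm s p q S coef)"
    proof (rule C'_le, safe)
      fix j
      have "continuous_on UNIV (lev S coef a j)" using a by (intro lev_continuous[where d=d and k=k]) auto
      then have [measurable]: "lev S coef a j \<in> borel_measurable borel" by (rule borel_measurable_continuous_onI)
      show "(\<lambda>x. lev S coef a j (\<gamma> x)) \<in> borel_measurable M" by measurable
      show "(\<lambda>x. majorant S coef \<rho> j (\<gamma> x)) \<in> borel_measurable M" by (rule majorant_measurable[OF S \<gamma>])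
      show "qnorm p M (\<lambda>x. majorant S coef \<rho> j (\<gamma> x)) \<le> ennreal (2 powr - (real j * ?\<sigma>)) * (ennreal K * b_norm s p q S coef)"
        by (rule K_le[OF reg S q])
      show "ennreal (norm (lev S coef a j (\<gamma> x))) \<le> majorant S coef \<rho> j (\<gamma> x)" for x
        using a by (intro lev_le_majorant[OF S, where d=d and k=k]) (auto simp: \<rho>_def)
    next
      show "ennreal K * b_norm s p q S coef < top" using b by (simp add: ennreal_mult_less_top)
    qed
    then show "(AE x in M. summable (\<lambda>j. norm (lev S coef a j (\<gamma> x)))) \<and>
      lp_norm p M (\<lambda>x. (\<Sum>j. lev S coef a j (\<gamma> x)) - (\<Sum>j<J. lev S coef a j (\<gamma> x)))
        \<le> ennreal (C' * K * 2 powr - (real J * ?\<sigma>)) * b_norm s p q S coef"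
      using C' K by (simp add: ennreal_mult mult_ac)
  qed
qed


section \<open>Null sets of the surface measure\<close>

lemma surface_measure_sets:
  fixes \<Omega> :: "('a::euclidean_space \<times> real) set"
  shows "frontier \<Omega> \<in> sets (hausdorff_measure DIM('a))" "space (surface_measure (frontier \<Omega>)) = frontier \<Omega>"
    "f \<in> borel_measurable borel \<Longrightarrow> f \<in> borel_measurable (surface_measure (frontier \<Omega>))"
proof -
  have D: "DIM('a \<times> real) - 1 = DIM('a)" by simp
  have sp: "space (hausdorff_measure DIM('a) :: ('a \<times> real) measure) = UNIV"
    by (rule space_hausdorff_measure) simp
  have sub: "sets borel \<subseteq> sets (hausdorff_measure DIM('a) :: ('a \<times> real) measure)"
    by (rule borel_sets_hausdorff) simp
  then show "frontier \<Omega> \<in> sets (hausdorff_measure DIM('a))"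
    using borel_closed[OF frontier_closed[of \<Omega>]] by blast
  show "space (surface_measure (frontier \<Omega>)) = frontier \<Omega>"
    unfolding surface_measure_def D by (simp add: space_restrict_space sp)
  assume "f \<in> borel_measurable borel"
  then have "f \<in> borel_measurable (hausdorff_measure DIM('a) :: ('a \<times> real) measure)"
    using sub sp by (auto simp: measurable_def)
  then show "f \<in> borel_measurable (surface_measure (frontier \<Omega>))"
    unfolding surface_measure_def D by (rule measurable_restrict_space1)
qed

text \<open>
  The surface measure is complete, so almost everywhere statements concern arbitrary sets of Hausdorff outer
  measure 0.
\<close>

lemma AE_surface_iff:
  fixes \<Omega> :: "('a::euclidean_space \<times> real) set"
  shows "(AE x in surface_measure (frontier \<Omega>). P x) \<longleftrightarrow>
    hausdorff_outer_measure DIM('a) {x \<in> frontier \<Omega>. \<not> P x} = 0"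
proof -
  have D: "DIM('a \<times> real) - 1 = DIM('a)" by simp
  let ?H = "hausdorff_measure DIM('a) :: ('a \<times> real) measure"
  have sp: "space ?H = UNIV" by (rule space_hausdorff_measure) simp
  have "(AE x in surface_measure (frontier \<Omega>). P x) \<longleftrightarrow> (AE x in ?H. x \<in> frontier \<Omega> \<longrightarrow> P x)"
    unfolding surface_measure_def D
    by (rule AE_restrict_space_iff) (simp add: sp surface_measure_sets(1))
  also have "\<dots> \<longleftrightarrow> hausdorff_outer_measure DIM('a) {x \<in> frontier \<Omega>. \<not> P x} = 0"
  proof
    assume "AE x in ?H. x \<in> frontier \<Omega> \<longrightarrow> P x"
    then obtain N where N: "N \<in> null_sets ?H" "{x \<in> frontier \<Omega>. \<not> P x} \<subseteq> N"
      unfolding eventually_ae_filter sp by auto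
    have "hausdorff_outer_measure DIM('a) N = 0"
      using N(1) emeasure_hausdorff_measure[of "DIM('a)" N] by (auto simp: null_sets_def)
    then show "hausdorff_outer_measure DIM('a) {x \<in> frontier \<Omega>. \<not> P x} = 0"
      using hausdorff_outer_mono[OF N(2), of "DIM('a)"] by simp
  next
    assume "hausdorff_outer_measure DIM('a) {x \<in> frontier \<Omega>. \<not> P x} = 0"
    then have "{x \<in> frontier \<Omega>. \<not> P x} \<in> null_sets ?H" by (intro hausdorff_null_sets) auto
    then show "AE x in ?H. x \<in> frontier \<Omega> \<longrightarrow> P x" by (rule AE_I') (auto simp: sp)
  qed
  finally show ?thesis .
qed

lemma AE_lebesgue_on_iff_negligible:
  assumes "S \<in> sets lebesgue"
  shows "(AE x in lebesgue_on S. P x) \<longleftrightarrow> negligible {x \<in> S. \<not> P x}"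
proof -
  have "(AE x in lebesgue_on S. P x) \<longleftrightarrow> (AE x in lebesgue. x \<in> S \<longrightarrow> P x)"
    using assms by (intro AE_restrict_space_iff) auto
  also have "\<dots> \<longleftrightarrow> negligible {x \<in> S. \<not> P x}"
  proof
    assume "AE x in lebesgue. x \<in> S \<longrightarrow> P x"
    then obtain N where "N \<in> null_sets lebesgue" "{x \<in> S. \<not> P x} \<subseteq> N"
      unfolding eventually_ae_filter by auto
    then show "negligible {x \<in> S. \<not> P x}"
      using negligible_subset negligible_iff_null_sets by blast
  next
    assume "negligible {x \<in> S. \<not> P x}"
    then have "{x \<in> S. \<not> P x} \<in> null_sets lebesgue" by (simp only: negligible_iff_null_sets)
    then show "AE x in lebesgue. x \<in> S \<longrightarrow> P x" by (rule AE_I') auto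
  qed
  finally show ?thesis .
qed

context
  fixes \<Omega> :: "('a::euclidean_space \<times> real) set" and N K \<psi>
  assumes atlas: "lipschitz_atlas \<Omega> N K \<psi>"
begin

lemma chart_bilipschitz:
  assumes r: "r \<in> {1..N}"
  shows "\<exists>L. bilipschitz L (\<psi> r) \<and> (\<forall>\<tau>. bilipschitz L (slice (\<psi> r) \<tau>))"
proof -
  obtain L where L: "bilipschitz L (\<psi> r)"
    using lipschitz_diffeo_bilipschitz lipschitz_atlasD(2)[OF atlas r] by blast
  show ?thesis using L bilipschitz_slice[OF L lipschitz_atlasD(3)[OF atlas r]] by blast
qed

lemma chart_image_lebesgue: "r \<in> {1..N} \<Longrightarrow> chart_image \<Omega> K \<psi> r \<in> sets lebesgue"
  using chart_image_borel[OF atlas] by (simp add: sets_completionI_sets)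

text \<open>Lipschitz images of null sets of the chart domain are null sets of the surface.\<close>

lemma AE_surface_of_chart:
  assumes r: "r \<in> {1..N}" and ae: "AE y in lebesgue_on (chart_image \<Omega> K \<psi> r). P (slice (\<psi> r) 0 y)"
  shows "AE x in surface_measure (frontier \<Omega>). x \<in> K r \<longrightarrow> P x"
proof -
  let ?W = "chart_image \<Omega> K \<psi> r" and ?Z = "{y \<in> chart_image \<Omega> K \<psi> r. \<not> P (slice (\<psi> r) 0 y)}"
  obtain L where L: "bilipschitz L (slice (\<psi> r) 0)" using chart_bilipschitz[OF r] by blast
  have neg: "negligible ?Z" using iffD1[OF AE_lebesgue_on_iff_negligible[OF chart_image_lebesgue[OF r]] ae] .
  have bdd: "bounded ?Z" using chart_image_bounded[OF atlas r] by (rule bounded_subset) auto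
  have null: "?Z \<in> null_sets lebesgue" using neg by (simp only: negligible_iff_null_sets)
  have "hausdorff_outer_measure DIM('a) (slice (\<psi> r) 0 ` ?Z)
      \<le> ennreal (unit_ball_vol (real DIM('a)) * (L * real DIM('a)) ^ DIM('a)) * emeasure lebesgue ?Z"
  proof (rule hausdorff_outer_lipschitz_image[OF _ _ bdd])
    show "norm (slice (\<psi> r) 0 x - slice (\<psi> r) 0 y) \<le> L * norm (x - y)" for x y
      using L by (simp add: bilipschitz_def)
    show "0 < L" using L by (simp add: bilipschitz_def)
    show "?Z \<in> sets lebesgue" using null by auto
  qed
  also have "emeasure lebesgue ?Z = 0" using null by auto
  finally have z: "hausdorff_outer_measure DIM('a) (slice (\<psi> r) 0 ` ?Z) = 0" by simp
  have "{x \<in> frontier \<Omega>. \<not> (x \<in> K r \<longrightarrow> P x)} \<subseteq> slice (\<psi> r) 0 ` ?Z"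
  proof
    fix x assume x: "x \<in> {x \<in> frontier \<Omega>. \<not> (x \<in> K r \<longrightarrow> P x)}"
    then have "x = slice (\<psi> r) 0 (fst (\<psi> r x))" "fst (\<psi> r x) \<in> ?W"
      using slice_fst_chart[OF atlas r, of x] by auto
    then show "x \<in> slice (\<psi> r) 0 ` ?Z" using x by (intro image_eqI[of x _ "fst (\<psi> r x)"]) auto
  qed
  from hausdorff_outer_mono[OF this, of "DIM('a)"] z show ?thesis unfolding AE_surface_iff by simp
qed

text \<open>
  Conversely, the first component of the chart is Lipschitz and maps null sets of the surface to null sets.
\<close>

lemma AE_chart_of_surface:
  assumes r: "r \<in> {1..N}" and ae: "AE x in surface_measure (frontier \<Omega>). P x"
  shows "AE y in lebesgue_on (chart_image \<Omega> K \<psi> r). P (slice (\<psi> r) 0 y)"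
proof -
  let ?W = "chart_image \<Omega> K \<psi> r"
  obtain L where L: "bilipschitz L (\<psi> r)" using chart_bilipschitz[OF r] by blast
  have "negligible ((\<lambda>x. fst (\<psi> r x)) ` {x \<in> frontier \<Omega>. \<not> P x})"
  proof (rule negligible_lipschitz_image_hausdorff_null)
    show "norm (fst (\<psi> r x) - fst (\<psi> r y)) \<le> L * norm (x - y)" for x y
    proof -
      have "norm (fst (\<psi> r x) - fst (\<psi> r y)) \<le> norm (\<psi> r x - \<psi> r y)"
        using dist_fst_le[of "\<psi> r x" "\<psi> r y"] by (simp only: dist_norm)
      also have "\<dots> \<le> L * norm (x - y)" using L unfolding bilipschitz_def by blast
      finally show ?thesis .
    qed
    show "0 < L" using L by (simp add: bilipschitz_def)
    show "hausdorff_outer_measure DIM('a) {x \<in> frontier \<Omega>. \<not> P x} = 0" using ae by (simp add: AE_surface_iff)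
  qed
  moreover have "{y \<in> ?W. \<not> P (slice (\<psi> r) 0 y)} \<subseteq> (\<lambda>x. fst (\<psi> r x)) ` {x \<in> frontier \<Omega>. \<not> P x}"
  proof
    fix y assume y: "y \<in> {y \<in> ?W. \<not> P (slice (\<psi> r) 0 y)}"
    then have "slice (\<psi> r) 0 y \<in> frontier \<Omega>" using chart_image_iff[OF atlas r] by auto
    moreover have "fst (\<psi> r (slice (\<psi> r) 0 y)) = y"
      using lipschitz_atlasD(3)[OF atlas r] by (simp add: slice_def bij_is_surj surj_f_inv_f)
    ultimately show "y \<in> (\<lambda>x. fst (\<psi> r x)) ` {x \<in> frontier \<Omega>. \<not> P x}"
      using y by (intro image_eqI[of _ _ "slice (\<psi> r) 0 y"]) auto
  qed
  ultimately have "negligible {y \<in> ?W. \<not> P (slice (\<psi> r) 0 y)}" by (rule negligible_subset)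
  then show ?thesis by (rule iffD2[OF AE_lebesgue_on_iff_negligible[OF chart_image_lebesgue[OF r]]])
qed

text \<open>
  A ball meets the boundary in the union of its parts in the finitely many charts, each of which is a Lipschitz
  image of a set of diameter comparable to the radius.
\<close>

lemma surface_upper_regular:
  obtains C where "upper_regular (surface_measure (frontier \<Omega>)) (\<lambda>x. x) DIM('a) C"
proof -
  have D: "DIM('a \<times> real) - 1 = DIM('a)" by simp
  let ?D = "DIM('a)" and ?M = "surface_measure (frontier \<Omega>)" and ?V = "unit_ball_vol (real DIM('a))"
  have "\<forall>r\<in>{1..N}. \<exists>L. bilipschitz L (slice (\<psi> r) 0)"
    using chart_bilipschitz by blast
  then have "\<exists>L. \<forall>r\<in>{1..N}. bilipschitz (L r) (slice (\<psi> r) 0)" by (rule bchoice)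
  then obtain L where L: "\<And>r. r \<in> {1..N} \<Longrightarrow> bilipschitz (L r) (slice (\<psi> r) 0)" by blast
  define c1 where "c1 r = ?V * (L r * real ?D) ^ ?D" for r
  define c2 where "c2 r = ?V * (2 * L r) ^ ?D" for r
  have L1: "1 \<le> L r" if "r \<in> {1..N}" for r using L[OF that] by (simp add: bilipschitz_def)
  have c: "0 \<le> c1 r" "0 \<le> c2 r" if "r \<in> {1..N}" for r
    using L1[OF that] by (auto simp: c1_def c2_def)
  have meas: "(\<lambda>x. x) \<in> borel_measurable ?M" by (rule surface_measure_sets(3)) simp
  have "emeasure ?M {x \<in> space ?M. norm (x - x0) \<le> \<rho>} \<le> ennreal ((1 + (\<Sum>r=1..N. c1 r * c2 r)) * \<rho> ^ ?D)"
    if \<rho>: "0 < \<rho>" for x0 \<rho>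
  proof -
    let ?B = "{x \<in> space ?M. norm (x - x0) \<le> \<rho>}"
    have sB: "?B \<in> sets ?M" using meas by measurable
    have "emeasure ?M ?B = emeasure (hausdorff_measure ?D) ?B"
      unfolding surface_measure_def D
      by (rule emeasure_restrict_space)
        (use surface_measure_sets(1)[of \<Omega>] surface_measure_sets(2)[of \<Omega>] in \<open>auto simp: space_hausdorff_measure surface_measure_def\<close>)
    also have "\<dots> = hausdorff_outer_measure ?D ?B"
    proof (rule emeasure_hausdorff_measure)
      show "?B \<in> sets (hausdorff_measure ?D)"
        using sB surface_measure_sets(1)[of \<Omega>] unfolding surface_measure_def D
        by (subst (asm) sets_restrict_space_iff) (auto simp: space_hausdorff_measure)
    qed simp
    also have "\<dots> \<le> hausdorff_outer_measure ?D (\<Union>r\<in>{1..N}. slice (\<psi> r) 0 ` {y \<in> chart_image \<Omega> K \<psi> r. norm (slice (\<psi> r) 0 y - x0) \<le> \<rho>})"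
    proof (rule hausdorff_outer_mono, rule subsetI)
      fix x assume x: "x \<in> ?B"
      then have xf: "x \<in> frontier \<Omega>" by (simp add: surface_measure_sets)
      then obtain r where r: "r \<in> {1..N}" "x \<in> K r" using atlas unfolding lipschitz_atlas_def by blast
      have "x = slice (\<psi> r) 0 (fst (\<psi> r x))" "fst (\<psi> r x) \<in> chart_image \<Omega> K \<psi> r"
        using slice_fst_chart[OF atlas r(1), of x] xf r(2) by auto
      then show "x \<in> (\<Union>r\<in>{1..N}. slice (\<psi> r) 0 ` {y \<in> chart_image \<Omega> K \<psi> r. norm (slice (\<psi> r) 0 y - x0) \<le> \<rho>})"
        using x r(1) by (intro UN_I[of r] image_eqI[of x _ "fst (\<psi> r x)"]) auto
    qed
    also have "\<dots> \<le> (\<Sum>r\<in>{1..N}. hausdorff_outer_measure ?D (slice (\<psi> r) 0 ` {y \<in> chart_image \<Omega> K \<psi> r. norm (slice (\<psi> r) 0 y - x0) \<le> \<rho>}))"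
    proof -
      have "hausdorff_outer_measure ?D (\<Union>r\<in>R. U r) \<le> (\<Sum>r\<in>R. hausdorff_outer_measure ?D (U r))"
        if "finite R" for R :: "nat set" and U :: "nat \<Rightarrow> ('a \<times> real) set"
        using that
      proof (induction R rule: finite_induct)
        case (insert r R)
        have "hausdorff_outer_measure ?D (U r \<union> (\<Union>r\<in>R. U r)) \<le> hausdorff_outer_measure ?D (U r) + hausdorff_outer_measure ?D (\<Union>r\<in>R. U r)"
          by (rule hausdorff_outer_Un_le) simp
        also have "\<dots> \<le> hausdorff_outer_measure ?D (U r) + (\<Sum>r\<in>R. hausdorff_outer_measure ?D (U r))"
          by (intro add_left_mono insert.IH)
        finally show ?case using insert.hyps by simp
      qed (simp add: hausdorff_outer_empty)
      then show ?thesis by simp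
    qed
    also have "\<dots> \<le> (\<Sum>r\<in>{1..N}. ennreal (c1 r * c2 r * \<rho> ^ ?D))"
    proof (rule sum_mono)
      fix r assume r: "r \<in> {1..N}"
      let ?W = "chart_image \<Omega> K \<psi> r"
      let ?Y = "{y \<in> ?W. norm (slice (\<psi> r) 0 y - x0) \<le> \<rho>}"
      have reg: "upper_regular (lebesgue_on ?W) (slice (\<psi> r) 0) ?D (c2 r)"
        unfolding c2_def by (rule upper_regular_lebesgue[OF L[OF r] chart_image_lebesgue[OF r]])
      then have m: "slice (\<psi> r) 0 \<in> borel_measurable (lebesgue_on ?W)" by (simp add: upper_regular_def)
      have "{y \<in> space (lebesgue_on ?W). norm (slice (\<psi> r) 0 y - x0) \<le> \<rho>} \<in> sets (lebesgue_on ?W)"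
        using m by measurable
      then have Y: "?Y \<in> sets lebesgue"
        using chart_image_lebesgue[OF r] by (simp add: sets_restrict_space_iff)
      have "hausdorff_outer_measure ?D (slice (\<psi> r) 0 ` ?Y) \<le> ennreal (c1 r) * emeasure lebesgue ?Y"
        unfolding c1_def
      proof (rule hausdorff_outer_lipschitz_image)
        show "norm (slice (\<psi> r) 0 x - slice (\<psi> r) 0 y) \<le> L r * norm (x - y)" for x y
          using L[OF r] by (simp add: bilipschitz_def)
        show "0 < L r" using L1[OF r] by simp
        show "bounded ?Y" using chart_image_bounded[OF atlas r] by (rule bounded_subset) auto
        show "?Y \<in> sets lebesgue" by (rule Y)
      qed
      also have "emeasure lebesgue ?Y = emeasure (lebesgue_on ?W) {y \<in> space (lebesgue_on ?W). norm (slice (\<psi> r) 0 y - x0) \<le> \<rho>}"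
        using chart_image_lebesgue[OF r] by (subst emeasure_restrict_space) auto
      also have "ennreal (c1 r) * \<dots> \<le> ennreal (c1 r) * ennreal (c2 r * \<rho> ^ ?D)"
        using reg[unfolded upper_regular_def] \<rho> by (intro mult_left_mono) (blast, simp)
      also have "\<dots> = ennreal (c1 r * c2 r * \<rho> ^ ?D)"
        using c[OF r] \<rho> by (simp add: ennreal_mult[symmetric] mult.assoc)
      finally show "hausdorff_outer_measure ?D (slice (\<psi> r) 0 ` ?Y) \<le> ennreal (c1 r * c2 r * \<rho> ^ ?D)" .
    qed
    also have "\<dots> = ennreal ((\<Sum>r=1..N. c1 r * c2 r) * \<rho> ^ ?D)"
      using c \<rho> by (subst sum_ennreal) (auto simp: sum_distrib_right intro!: mult_nonneg_nonneg)
    also have "\<dots> \<le> ennreal ((1 + (\<Sum>r=1..N. c1 r * c2 r)) * \<rho> ^ ?D)"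
      using \<rho> by (intro ennreal_leI mult_right_mono) auto
    finally show ?thesis .
  qed
  moreover have "0 < 1 + (\<Sum>r=1..N. c1 r * c2 r)"
    using c by (intro add_pos_nonneg sum_nonneg mult_nonneg_nonneg) auto
  ultimately have "upper_regular ?M (\<lambda>x. x) ?D (1 + (\<Sum>r=1..N. c1 r * c2 r))"
    using meas by (simp add: upper_regular_def)
  then show thesis by (rule that)
qed

end


section \<open>Representations and their sums\<close>

lemma borel_measurable_lebesgue_on_AE:
  fixes f h :: "'y::euclidean_space \<Rightarrow> complex"
  assumes S: "S \<in> sets lebesgue" and h: "h \<in> borel_measurable (lebesgue_on S)"
    and ae: "AE x in lebesgue_on S. f x = h x"
  shows "f \<in> borel_measurable (lebesgue_on S)"
proof (rule measurableI)
  fix B :: "complex set" assume B: "B \<in> sets borel"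
  let ?Z = "{x \<in> S. f x \<noteq> h x}"
  have neg: "negligible ?Z" using iffD1[OF AE_lebesgue_on_iff_negligible[OF S] ae] .
  have "h -` B \<inter> space (lebesgue_on S) \<in> sets (lebesgue_on S)" by (rule measurable_sets[OF h B])
  then have hB: "h -` B \<inter> S \<in> sets lebesgue" using S by (simp add: sets_restrict_space_iff)
  have "negligible (f -` B \<inter> ?Z)" using neg by (rule negligible_subset) auto
  then have 1: "f -` B \<inter> ?Z \<in> sets lebesgue" by (rule negligible_imp_sets)
  have "f -` B \<inter> S = (h -` B \<inter> S - ?Z) \<union> (f -` B \<inter> ?Z)" by auto
  also have "\<dots> \<in> sets lebesgue" using hB 1 negligible_imp_sets[OF neg] by auto
  finally show "f -` B \<inter> space (lebesgue_on S) \<in> sets (lebesgue_on S)"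
    using S by (simp add: sets_restrict_space_iff)
qed simp

lemma lev_borel_measurable:
  assumes "\<forall>j. \<forall>m\<in>cubes_meeting S j. atom d k j m (a j m)"
  shows "lev S coef a j \<in> borel_measurable borel"
  using assms by (intro borel_measurable_continuous_onI lev_continuous[where d=d and k=k]) auto

lemma lev_sum_borel_measurable:
  assumes "\<forall>j. \<forall>m\<in>cubes_meeting S j. atom d k j m (a j m)"
  shows "(\<lambda>x. \<Sum>j. lev S coef a j x) \<in> borel_measurable borel"
  using lev_borel_measurable[OF assms] by (intro borel_measurable_suminf)

lemma borel_measurable_lebesgue_on:
  "f \<in> borel_measurable borel \<Longrightarrow> f \<in> borel_measurable (lebesgue_on S)"
  by (intro measurable_restrict_space1 measurable_completion) simp

lemma lev_series_lebesgue:
  fixes S :: "'y::euclidean_space set"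
  assumes p: "0 < p" and q: "0 < q" and s: "0 < s" and d: "0 < d"
    and S: "bounded S" "S \<in> sets lebesgue"
    and a: "\<forall>j. \<forall>m\<in>cubes_meeting S j. atom d k j m (a j m)"
    and b: "b_norm s p q S coef < top"
  shows "AE x in lebesgue_on S. summable (\<lambda>j. norm (lev S coef a j x))"
    and "(\<lambda>J. lp_norm p (lebesgue_on S) (\<lambda>x. (\<Sum>j. lev S coef a j x) - (\<Sum>j<J. lev S coef a j x))) \<longlonglongrightarrow> 0"
    and "lp_norm p (lebesgue_on S) (\<lambda>x. \<Sum>j. lev S coef a j x) < top"
proof -
  let ?C = "unit_ball_vol (real DIM('y)) * (2 * 1) ^ DIM('y)"
  have C: "0 < ?C" by simp
  have reg: "upper_regular (lebesgue_on S) (\<lambda>x. x) DIM('y) ?C"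
    by (rule upper_regular_lebesgue[OF bilipschitz_id S(2)])
  have s': "0 < s - (real DIM('y) - real DIM('y)) * enn2real (1 / p)" using s by simp
  obtain K where K: "0 < K" and K_le: "\<And>M (\<gamma> :: 'y \<Rightarrow> 'y) S coef a q k J.
    upper_regular M \<gamma> DIM('y) ?C \<Longrightarrow> bounded S \<Longrightarrow> 0 < q \<Longrightarrow> b_norm s p q S coef < top \<Longrightarrow>
    (\<forall>j. \<forall>m\<in>cubes_meeting S j. atom d k j m (a j m)) \<Longrightarrow>
    (AE x in M. summable (\<lambda>j. norm (lev S coef a j (\<gamma> x)))) \<and>
    lp_norm p M (\<lambda>x. (\<Sum>j. lev S coef a j (\<gamma> x)) - (\<Sum>j<J. lev S coef a j (\<gamma> x)))
      \<le> ennreal (K * 2 powr - (real J * (s - (real DIM('y) - real DIM('y)) * enn2real (1 / p)))) * b_norm s p q S coef"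
    by (rule lev_series[OF p d C s']) (rule that)
  note main = K_le[OF reg S(1) q b a]
  show "AE x in lebesgue_on S. summable (\<lambda>j. norm (lev S coef a j x))" using main by blast
  show "lp_norm p (lebesgue_on S) (\<lambda>x. \<Sum>j. lev S coef a j x) < top"
  proof -
    have "lp_norm p (lebesgue_on S) (\<lambda>x. \<Sum>j. lev S coef a j x) \<le> ennreal (K * 2 powr - 0) * b_norm s p q S coef"
      using main[of 0] by simp
    also have "\<dots> < top" using b by (simp add: ennreal_mult_less_top)
    finally show ?thesis .
  qed
  have lim: "(\<lambda>J. ennreal (K * 2 powr - (real J * s)) * b_norm s p q S coef) \<longlonglongrightarrow> ennreal (K * 0) * b_norm s p q S coef"
  proof (rule tendsto_mult_ennreal)
    have "(\<lambda>J. 2 powr - (real J * s)) \<longlonglongrightarrow> 0"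
    proof -
      have "(\<lambda>J. (2 powr - s) ^ J :: real) \<longlonglongrightarrow> 0" using s by (intro LIMSEQ_realpow_zero) (auto simp: powr_less_one)
      moreover have "(2 powr - s) ^ J = (2::real) powr - (real J * s)" for J
        by (simp add: powr_realpow[symmetric] powr_powr mult.commute)
      ultimately show ?thesis by simp
    qed
    then show "(\<lambda>J. ennreal (K * 2 powr - (real J * s))) \<longlonglongrightarrow> ennreal (K * 0)"
      by (intro tendsto_ennrealI tendsto_mult tendsto_const)
  qed (use b in auto)
  show "(\<lambda>J. lp_norm p (lebesgue_on S) (\<lambda>x. (\<Sum>j. lev S coef a j x) - (\<Sum>j<J. lev S coef a j x))) \<longlonglongrightarrow> 0"
    by (rule tendsto_sandwich[OF _ _ tendsto_const lim[simplified]])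
      (use main in \<open>auto intro!: always_eventually\<close>)
qed

text \<open>Both the partial sums in \<open>L\<^sub>p\<close> and the pointwise sums identify the limit.\<close>

lemma representation_AE:
  fixes S :: "'y::euclidean_space set"
  assumes "0 < p" "0 < q" "0 < s" "0 < d" and S: "bounded S" "S \<in> sets lebesgue"
    and f: "f \<in> borel_measurable (lebesgue_on S)"
    and rep: "atomic_representation d k p S f coef a" and b: "b_norm s p q S coef < top"
  shows "AE x in lebesgue_on S. f x = (\<Sum>j. lev S coef a j x)"
proof -
  have a: "\<forall>j. \<forall>m\<in>cubes_meeting S j. atom d k j m (a j m)"
    and lim: "(\<lambda>J. lp_norm p (lebesgue_on S) (\<lambda>x. f x - (\<Sum>j<J. lev S coef a j x))) \<longlonglongrightarrow> 0"
    using rep by (auto simp: atomic_representation_iff[OF S(1)])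
  show ?thesis
  proof (rule AE_eq_of_lp_limits[OF assms(1) f _ _ lim])
    show "(\<lambda>x. \<Sum>j. lev S coef a j x) \<in> borel_measurable (lebesgue_on S)"
      by (rule borel_measurable_lebesgue_on[OF lev_sum_borel_measurable[OF a]])
    show "(\<lambda>x. \<Sum>j<J. lev S coef a j x) \<in> borel_measurable (lebesgue_on S)" for J
      using lev_borel_measurable[OF a] by (intro borel_measurable_lebesgue_on borel_measurable_sum)
    show "(\<lambda>J. lp_norm p (lebesgue_on S) (\<lambda>x. (\<Sum>j. lev S coef a j x) - (\<Sum>j<J. lev S coef a j x))) \<longlonglongrightarrow> 0"
      by (rule lev_series_lebesgue(2)[OF assms(1-4) S a b])
  qed
qed

lemma lp_norm_cong_AE:
  assumes "0 < p" "AE x in M. f x = g x" "f \<in> borel_measurable M" "g \<in> borel_measurable M"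
  shows "lp_norm p M f = lp_norm p M g"
  unfolding lp_norm_eq_qnorm using assms
  by (intro qnorm_cong_AE) (auto elim: eventually_mono)

text \<open>
  In a representation it suffices to know the sum almost everywhere: the norm of the coefficients enforces the
  convergence in \<open>L\<^sub>p\<close>.
\<close>

lemma besov_of_AE:
  fixes S :: "'y::euclidean_space set"
  assumes "0 < p" "0 < q" "0 < s" "0 < d" and S: "bounded S" "S \<in> sets lebesgue"
    and a: "\<forall>j. \<forall>m\<in>cubes_meeting S j. atom d k j m (a j m)"
    and b: "b_norm s p q S coef < top"
    and f: "AE x in lebesgue_on S. f x = (\<Sum>j. lev S coef a j x)"
  shows "f \<in> besov d k s p q S" "atomic_representation d k p S f coef a" "f \<in> borel_measurable (lebesgue_on S)"
proof -
  have m: "(\<lambda>x. \<Sum>j. lev S coef a j x) \<in> borel_measurable (lebesgue_on S)"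
    by (rule borel_measurable_lebesgue_on[OF lev_sum_borel_measurable[OF a]])
  have mJ: "(\<lambda>x. \<Sum>j<J. lev S coef a j x) \<in> borel_measurable (lebesgue_on S)" for J
    using lev_borel_measurable[OF a] by (intro borel_measurable_lebesgue_on borel_measurable_sum)
  show fm: "f \<in> borel_measurable (lebesgue_on S)" by (rule borel_measurable_lebesgue_on_AE[OF S(2) m f])
  have "lp_norm p (lebesgue_on S) f < top"
    using lp_norm_cong_AE[OF assms(1) f fm m] lev_series_lebesgue(3)[OF assms(1-4) S a b] by simp
  moreover have eq: "lp_norm p (lebesgue_on S) (\<lambda>x. f x - (\<Sum>j<J. lev S coef a j x))
      = lp_norm p (lebesgue_on S) (\<lambda>x. (\<Sum>j. lev S coef a j x) - (\<Sum>j<J. lev S coef a j x))" for J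
    using f fm m mJ by (intro lp_norm_cong_AE[OF assms(1)]) (auto elim: eventually_mono)
  then show rep: "atomic_representation d k p S f coef a"
    using a lev_series_lebesgue(2)[OF assms(1-4) S a b] by (simp add: atomic_representation_iff[OF S(1)])
  ultimately show "f \<in> besov d k s p q S"
    using fm b by (auto simp: besov_def lp_space_def)
qed


section \<open>Independence of the trace from the representation\<close>

lemma AE_small_witness:
  assumes "AE \<tau> in lborel. P \<tau>" "0 < (e::real)"
  obtains \<tau> where "0 < \<tau>" "\<tau> < e" "P \<tau>"
proof -
  have "\<not> (\<forall>\<tau>\<in>{0<..<e}. \<not> P \<tau>)"
  proof
    assume "\<forall>\<tau>\<in>{0<..<e}. \<not> P \<tau>"
    then have "AE \<tau> in lborel. \<tau> \<notin> {0<..<e}" using assms(1) by (auto elim!: eventually_mono)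
    then have "{0<..<e} \<in> null_sets lborel" by (subst (asm) AE_iff_null_sets[symmetric]) auto
    then show False using assms(2) by (simp add: null_sets_def)
  qed
  then show thesis using that by auto
qed

context
  fixes \<Omega> :: "('a::euclidean_space \<times> real) set" and N K \<psi>
  assumes atlas: "lipschitz_atlas \<Omega> N K \<psi>" and dom: "open \<Omega>" "bounded \<Omega>"
begin

text \<open>
  By Fubini, the representation of u holds on almost every surface that is parallel to the
  boundary. On these surfaces the tails of the series are small in \<open>L\<^sub>p\<close>, uniformly in the height;
  since u and the level functions are continuous, Fatou's lemma carries the estimate over to height
  zero.
\<close>

lemma trace_consistent:
  fixes F :: "nat \<Rightarrow> 'a \<times> real \<Rightarrow> complex" and V :: "nat \<Rightarrow> 'a \<times> real \<Rightarrow> ennreal"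
  assumes r: "r \<in> {1..N}" and p: "0 < p" "p \<noteq> top" and \<sigma>: "0 < \<sigma>" and T: "T < top"
    and F: "\<And>j. continuous_on UNIV (F j)" and u: "continuous_on UNIV u"
    and V: "\<And>j x. ennreal (norm (F j x)) \<le> V j x"
    and Vm: "\<And>j \<tau>. (\<lambda>y. V j (slice (\<psi> r) \<tau> y)) \<in> borel_measurable (lebesgue_on (chart_image \<Omega> K \<psi> r))"
    and Vle: "\<And>j \<tau>. qnorm p (lebesgue_on (chart_image \<Omega> K \<psi> r)) (\<lambda>y. V j (slice (\<psi> r) \<tau> y))
      \<le> ennreal (2 powr - (real j * \<sigma>)) * T"
    and ae: "AE x in lebesgue_on \<Omega>. summable (\<lambda>j. norm (F j x)) \<and> u x = (\<Sum>j. F j x)"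
  shows "AE y in lebesgue_on (chart_image \<Omega> K \<psi> r). u (slice (\<psi> r) 0 y) = (\<Sum>j. F j (slice (\<psi> r) 0 y))"
proof -
  let ?W = "chart_image \<Omega> K \<psi> r" and ?sl = "slice (\<psi> r)"
  let ?M = "lebesgue_on ?W"
  have W: "?W \<in> sets lebesgue" by (rule chart_image_lebesgue[OF atlas r])
  obtain L where L: "bilipschitz L (\<psi> r)" "\<And>\<tau>. bilipschitz L (?sl \<tau>)" using chart_bilipschitz[OF atlas r] by blast
  have bij: "bij (\<psi> r)" by (rule lipschitz_atlasD(3)[OF atlas r])
  define P where "P x \<longleftrightarrow> summable (\<lambda>j. norm (F j x)) \<and> u x = (\<Sum>j. F j x)" for x
  \<comment> \<open>The components of the chart are swapped below: Fubini's theorem gives a statement for almost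
    every first component, and this has to be the height.\<close>
  define Z where "Z = {x \<in> \<Omega>. \<not> P x}"
  have \<Omega>: "\<Omega> \<in> sets lebesgue" using dom(1) by simp
  have "negligible Z" using iffD1[OF AE_lebesgue_on_iff_negligible[OF \<Omega>] ae] by (simp add: Z_def P_def)
  moreover have "\<exists>T B. open T \<and> x \<in> T \<and> (\<forall>y\<in>Z \<inter> T. norm (prod.swap (\<psi> r y) - prod.swap (\<psi> r x)) \<le> B * norm (y - x))" for x
  proof (intro exI[of _ UNIV] exI[of _ L] conjI ballI)
    fix y
    have "norm (prod.swap (\<psi> r y) - prod.swap (\<psi> r x)) = norm (\<psi> r y - \<psi> r x)"
      by (cases "\<psi> r y"; cases "\<psi> r x") (simp add: norm_Pair add.commute)
    also have "\<dots> \<le> L * norm (y - x)" using L(1) unfolding bilipschitz_def by blast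
    finally show "norm (prod.swap (\<psi> r y) - prod.swap (\<psi> r x)) \<le> L * norm (y - x)" .
  qed auto
  ultimately have "negligible ((\<lambda>x. prod.swap (\<psi> r x)) ` Z)"
    by (intro negligible_locally_Lipschitz_image) auto
  then have "(\<lambda>x. prod.swap (\<psi> r x)) ` Z \<in> null_sets lebesgue" by (simp only: negligible_iff_null_sets)
  then have "AE z in lebesgue. z \<notin> (\<lambda>x. prod.swap (\<psi> r x)) ` Z" by (rule AE_not_in)
  then have "AE z in lborel. z \<notin> (\<lambda>x. prod.swap (\<psi> r x)) ` Z" by (simp add: AE_completion_iff)
  then have "AE z in (lborel :: real measure) \<Otimes>\<^sub>M (lborel :: 'a measure). z \<notin> (\<lambda>x. prod.swap (\<psi> r x)) ` Z"
    unfolding lborel_prod .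
  then have fub: "AE \<tau> in lborel. AE y in lborel. (\<tau>, y) \<notin> (\<lambda>x. prod.swap (\<psi> r x)) ` Z"
    using lborel_pair.AE_pair by fastforce
  define \<tau> where "\<tau> i = (SOME t. 0 < t \<and> t < inverse (real (Suc i)) \<and>
      (AE y in lborel. (t, y) \<notin> (\<lambda>x. prod.swap (\<psi> r x)) ` Z))" for i
  have \<tau>: "0 < \<tau> i" "\<tau> i < inverse (real (Suc i))" "AE y in lborel. (\<tau> i, y) \<notin> (\<lambda>x. prod.swap (\<psi> r x)) ` Z" for i
  proof -
    have "\<exists>t. 0 < t \<and> t < inverse (real (Suc i)) \<and> (AE y in lborel. (t, y) \<notin> (\<lambda>x. prod.swap (\<psi> r x)) ` Z)"
      by (rule AE_small_witness[OF fub, of "inverse (real (Suc i))"]) auto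
    then have "0 < \<tau> i \<and> \<tau> i < inverse (real (Suc i)) \<and> (AE y in lborel. (\<tau> i, y) \<notin> (\<lambda>x. prod.swap (\<psi> r x)) ` Z)"
      unfolding \<tau>_def by (rule someI_ex)
    then show "0 < \<tau> i" "\<tau> i < inverse (real (Suc i))" "AE y in lborel. (\<tau> i, y) \<notin> (\<lambda>x. prod.swap (\<psi> r x)) ` Z" by auto
  qed
  have \<tau>0: "\<tau> \<longlonglongrightarrow> 0"
    by (rule tendsto_sandwich[OF _ _ tendsto_const LIMSEQ_inverse_real_of_nat])
      (use \<tau> in \<open>auto intro!: always_eventually less_imp_le\<close>)
  have good: "AE y in ?M. \<forall>i. ?sl (\<tau> i) y \<in> \<Omega> \<longrightarrow> P (?sl (\<tau> i) y)"
  proof -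
    have "AE y in ?M. (\<tau> i, y) \<notin> (\<lambda>x. prod.swap (\<psi> r x)) ` Z" for i
    proof -
      have "AE y in lebesgue. (\<tau> i, y) \<notin> (\<lambda>x. prod.swap (\<psi> r x)) ` Z" using \<tau>(3)[of i] by (rule AE_completion)
      then show ?thesis using W by (subst AE_restrict_space_iff) auto
    qed
    then have "AE y in ?M. \<forall>i. (\<tau> i, y) \<notin> (\<lambda>x. prod.swap (\<psi> r x)) ` Z" by (simp add: AE_all_countable)
    then show ?thesis
    proof eventually_elim
      case (elim y)
      have "P (?sl (\<tau> i) y)" if "?sl (\<tau> i) y \<in> \<Omega>" for i
      proof (rule ccontr)
        assume "\<not> P (?sl (\<tau> i) y)"
        then have "?sl (\<tau> i) y \<in> Z" using that by (simp add: Z_def)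
        moreover have "prod.swap (\<psi> r (?sl (\<tau> i) y)) = (\<tau> i, y)"
          using bij by (simp add: slice_def bij_is_surj surj_f_inv_f)
        ultimately show False using elim by (metis imageI)
      qed
      then show ?case by blast
    qed
  qed
  obtain C1 where C1: "C1 > 0" and C1_le: "\<And>M (u :: nat \<Rightarrow> 'a \<Rightarrow> ennreal) T.
    (\<forall>k. u k \<in> borel_measurable M) \<Longrightarrow>
    (\<forall>k. qnorm p M (u k) \<le> ennreal (2 powr - (real k * \<sigma>)) * T) \<Longrightarrow>
    qnorm p M (\<lambda>x. \<Sum>k. u k x) \<le> ennreal C1 * T"
    by (rule qnorm_geometric_suminf[OF p(1) \<sigma>]) (rule that)
  have tail: "qnorm p ?M (\<lambda>y. \<Sum>k. V (J + k) (?sl t y)) \<le> ennreal (C1 * 2 powr - (real J * \<sigma>)) * T" for J t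
  proof -
    have "qnorm p ?M (\<lambda>y. \<Sum>k. V (J + k) (?sl t y)) \<le> ennreal C1 * (ennreal (2 powr - (real J * \<sigma>)) * T)"
    proof (intro C1_le allI Vm)
      fix k
      have "2 powr - (real (J + k) * \<sigma>) = 2 powr - (real k * \<sigma>) * 2 powr - (real J * \<sigma>)"
        by (simp only: powr_add[symmetric]) (simp add: algebra_simps)
      then show "qnorm p ?M (\<lambda>y. V (J + k) (?sl t y)) \<le> ennreal (2 powr - (real k * \<sigma>)) * (ennreal (2 powr - (real J * \<sigma>)) * T)"
        using Vle[of "J + k" t] by (simp add: ennreal_mult mult.assoc)
    qed
    then show ?thesis using C1 by (simp add: ennreal_mult mult.assoc)
  qed
  have slm: "?sl t \<in> borel_measurable ?M" for t
    by (intro borel_measurable_lebesgue_on borel_measurable_continuous_onI bilipschitz_continuous[OF L(2)])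
  have Fm [measurable]: "F j \<in> borel_measurable borel" for j by (rule borel_measurable_continuous_onI[OF F])
  have um [measurable]: "u \<in> borel_measurable borel" by (rule borel_measurable_continuous_onI[OF u])
  have Fsm: "(\<lambda>y. F j (?sl t y)) \<in> borel_measurable ?M" for j t
    by (rule measurable_compose[OF slm Fm])
  have usm: "(\<lambda>y. u (?sl t y)) \<in> borel_measurable ?M" for t
    by (rule measurable_compose[OF slm um])
  have diff: "lp_norm p ?M (\<lambda>y. u (?sl 0 y) - (\<Sum>j<J. F j (?sl 0 y))) \<le> ennreal (C1 * 2 powr - (real J * \<sigma>)) * T" for J
  proof -
    define e where "e x = norm (u x - (\<Sum>j<J. F j x))" for x
    have ec: "continuous_on UNIV e" unfolding e_def by (intro continuous_intros u F)
    \<comment> \<open>For each y the slices of small height lie in \<open>\<Omega>\<close>, so the value 0 occurs only for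
      finitely many i.\<close>
    define R where "R i y = (if ?sl (\<tau> i) y \<in> \<Omega> then e (?sl (\<tau> i) y) else 0)" for i y
    have "qnorm p ?M (\<lambda>y. ennreal (e (?sl 0 y))) \<le> ennreal (C1 * 2 powr - (real J * \<sigma>)) * T"
    proof (rule qnorm_Fatou[OF p, where r = R])
      show Rm: "R i \<in> borel_measurable ?M" for i
      proof -
        have [measurable]: "\<Omega> \<in> sets borel" using dom(1) by simp
        have [measurable]: "e \<in> borel_measurable borel" by (rule borel_measurable_continuous_onI[OF ec])
        then have "(\<lambda>x. if x \<in> \<Omega> then e x else 0) \<in> borel_measurable borel" by measurable
        from measurable_compose[OF slm this] show ?thesis unfolding R_def .
      qed
      show "0 \<le> R i y" for i y by (simp add: R_def e_def)
      show "AE y in ?M. (\<lambda>i. R i y) \<longlonglongrightarrow> e (?sl 0 y)"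
      proof (rule AE_I2)
        fix y assume "y \<in> space ?M"
        then have y: "y \<in> ?W" by simp
        obtain t where t: "0 < t" "\<And>\<tau>. 0 < \<tau> \<Longrightarrow> \<tau> < t \<Longrightarrow> ?sl \<tau> y \<in> \<Omega>"
          by (rule slice_in_domain[OF atlas r y]) (rule that)
        have pair: "(\<lambda>i. (y, \<tau> i)) \<longlonglongrightarrow> (y, 0)" by (rule tendsto_Pair[OF tendsto_const \<tau>0])
        have "continuous_on UNIV (inv (\<psi> r))"
          by (rule bilipschitz_continuous[OF bilipschitz_inv[OF L(1) bij]])
        then have "isCont (inv (\<psi> r)) (y, 0)" by (simp only: continuous_on_eq_continuous_at[OF open_UNIV] UNIV_I ball_UNIV)
        from isCont_tendsto_compose[OF this pair]
        have inner: "(\<lambda>i. ?sl (\<tau> i) y) \<longlonglongrightarrow> ?sl 0 y" unfolding slice_def .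
        have "isCont e (?sl 0 y)" using ec by (simp only: continuous_on_eq_continuous_at[OF open_UNIV] UNIV_I ball_UNIV)
        from isCont_tendsto_compose[OF this inner]
        have "(\<lambda>i. e (?sl (\<tau> i) y)) \<longlonglongrightarrow> e (?sl 0 y)" .
        moreover have "\<forall>\<^sub>F i in sequentially. e (?sl (\<tau> i) y) = R i y"
          using order_tendstoD(2)[OF \<tau>0 t(1)] by eventually_elim (use t \<tau>(1) in \<open>auto simp: R_def\<close>)
        ultimately show "(\<lambda>i. R i y) \<longlonglongrightarrow> e (?sl 0 y)" by (rule Lim_transform_eventually)
      qed
      fix i
      have "AE y in ?M. ennreal (R i y) \<le> (\<Sum>k. V (J + k) (?sl (\<tau> i) y))"
        using good
      proof eventually_elim
        case (elim y)
        show ?case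
        proof (cases "?sl (\<tau> i) y \<in> \<Omega>")
          case True
          let ?x = "?sl (\<tau> i) y"
          have s: "summable (\<lambda>j. norm (F j ?x))" and ux: "u ?x = (\<Sum>j. F j ?x)" using elim True by (auto simp: P_def)
          have sJ: "summable (\<lambda>k. norm (F (k + J) ?x))" using s by (rule summable_ignore_initial_segment)
          have "u ?x - (\<Sum>j<J. F j ?x) = (\<Sum>k. F (k + J) ?x)"
            using suminf_split_initial_segment[OF summable_norm_cancel[OF s], of J] ux by simp
          then have "R i y \<le> (\<Sum>k. norm (F (k + J) ?x))"
            using summable_norm[OF sJ] True by (simp add: R_def e_def)
          then have "ennreal (R i y) \<le> ennreal (\<Sum>k. norm (F (k + J) ?x))" by (rule ennreal_leI)
          also have "\<dots> = (\<Sum>k. ennreal (norm (F (k + J) ?x)))" using sJ by (intro suminf_ennreal2[symmetric]) auto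
          also have "\<dots> \<le> (\<Sum>k. V (J + k) ?x)" using V by (intro suminf_le) (auto simp: add.commute)
          finally show ?thesis .
        qed (simp add: R_def)
      qed
      then have "qnorm p ?M (\<lambda>y. ennreal (R i y)) \<le> qnorm p ?M (\<lambda>y. \<Sum>k. V (J + k) (?sl (\<tau> i) y))"
        using Rm by (intro qnorm_mono_AE p) auto
      then show "qnorm p ?M (\<lambda>y. ennreal (R i y)) \<le> ennreal (C1 * 2 powr - (real J * \<sigma>)) * T"
        using tail by (rule order_trans)
    qed
    then show ?thesis by (simp add: lp_norm_eq_qnorm e_def)
  qed
  obtain C2 where C2: "0 < C2" and C2_le: "\<And>M (H :: nat \<Rightarrow> 'a \<Rightarrow> complex) V T J.
    (\<forall>j. H j \<in> borel_measurable M) \<Longrightarrow> (\<forall>j. V j \<in> borel_measurable M) \<Longrightarrow>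
    (\<forall>j. \<forall>x\<in>space M. ennreal (norm (H j x)) \<le> V j x) \<Longrightarrow>
    (\<forall>j. qnorm p M (V j) \<le> ennreal (2 powr - (real j * \<sigma>)) * T) \<Longrightarrow> T < top \<Longrightarrow>
    (AE x in M. summable (\<lambda>j. norm (H j x))) \<and>
    lp_norm p M (\<lambda>x. (\<Sum>j. H j x) - (\<Sum>j<J. H j x))
            \<le> ennreal (C2 * 2 powr - (real J * \<sigma>)) * T"
    by (rule lp_norm_suminf_le[OF p(1) \<sigma>]) (rule that)
  have diff2: "lp_norm p ?M (\<lambda>y. (\<Sum>j. F j (?sl 0 y)) - (\<Sum>j<J. F j (?sl 0 y))) \<le> ennreal (C2 * 2 powr - (real J * \<sigma>)) * T" for J
    using C2_le[of "\<lambda>j y. F j (?sl 0 y)" ?M "\<lambda>j y. V j (?sl 0 y)" T J] Fsm Vm V Vle T by blast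
  have lim: "(\<lambda>J. ennreal (c * 2 powr - (real J * \<sigma>)) * T) \<longlonglongrightarrow> 0" for c
  proof -
    have "(\<lambda>J. (2 powr - \<sigma>) ^ J :: real) \<longlonglongrightarrow> 0" using \<sigma> by (intro LIMSEQ_realpow_zero) (auto simp: powr_less_one)
    moreover have "(2 powr - \<sigma>) ^ J = (2::real) powr - (real J * \<sigma>)" for J
      by (simp add: powr_realpow[symmetric] powr_powr mult.commute)
    ultimately have "(\<lambda>J. 2 powr - (real J * \<sigma>)) \<longlonglongrightarrow> 0" by simp
    then have "(\<lambda>J. ennreal (c * 2 powr - (real J * \<sigma>))) \<longlonglongrightarrow> ennreal (c * 0)"
      by (intro tendsto_ennrealI tendsto_mult tendsto_const)
    then have "(\<lambda>J. ennreal (c * 2 powr - (real J * \<sigma>)) * T) \<longlonglongrightarrow> ennreal (c * 0) * T"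
      using T by (intro tendsto_mult_ennreal tendsto_const) auto
    then show ?thesis by simp
  qed
  show ?thesis
  proof (rule AE_eq_of_lp_limits[OF p(1)])
    show "(\<lambda>J. lp_norm p ?M (\<lambda>y. u (?sl 0 y) - (\<Sum>j<J. F j (?sl 0 y)))) \<longlonglongrightarrow> 0"
      by (rule tendsto_sandwich[OF _ _ tendsto_const lim[of C1]]) (use diff in \<open>auto intro!: always_eventually\<close>)
    show "(\<lambda>J. lp_norm p ?M (\<lambda>y. (\<Sum>j. F j (?sl 0 y)) - (\<Sum>j<J. F j (?sl 0 y)))) \<longlonglongrightarrow> 0"
      by (rule tendsto_sandwich[OF _ _ tendsto_const lim[of C2]]) (use diff2 in \<open>auto intro!: always_eventually\<close>)
    show "(\<lambda>y. u (?sl 0 y)) \<in> borel_measurable ?M" by (rule usm)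
    show "(\<lambda>y. \<Sum>j. F j (?sl 0 y)) \<in> borel_measurable ?M" by (intro borel_measurable_suminf Fsm)
    show "(\<lambda>y. \<Sum>j<J. F j (?sl 0 y)) \<in> borel_measurable ?M" for J by (intro borel_measurable_sum Fsm)
  qed
qed

end


section \<open>Traces of atomic series\<close>

lemma tendsto_epow_0:
  assumes "(u \<longlongrightarrow> 0) F" "0 < r"
  shows "((\<lambda>x. epow (u x) r) \<longlongrightarrow> 0) F"
proof (rule order_tendstoI)
  fix e :: ennreal assume "0 < e"
  then have "0 < epow e (1 / r)" using epow_eq_0_iff[of e "1 / r"] by (simp add: zero_less_iff_neq_zero)
  from order_tendstoD(2)[OF assms(1) this]
  show "\<forall>\<^sub>F x in F. epow (u x) r < e"
  proof eventually_elim
    case (elim x)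
    then show ?case using epow_le_iff[OF assms(2), of e "u x"] by (simp add: not_le[symmetric])
  qed
qed simp

lemma ell_norm_nat_mono:
  assumes "0 < q" "\<And>j. u j \<le> v j"
  shows "ell_norm q UNIV u \<le> ell_norm q UNIV (v :: nat \<Rightarrow> ennreal)"
  unfolding ell_norm_nat
  using assms by (intro qnorm_mono_AE) (auto simp: AE_count_space)

lemma b_norm_mono_smoothness:
  assumes "0 < q" "t \<le> s"
  shows "b_norm t p q S coef \<le> b_norm s p q S coef"
  unfolding b_norm_def
  using assms by (intro ell_norm_nat_mono mult_right_mono ennreal_leI powr_mono mult_left_mono) auto

lemma besov_norm_mono_smoothness:
  assumes "0 < q" "t \<le> s"
  shows "besov_norm d k t p q S f \<le> besov_norm d k s p q S f"
  unfolding besov_norm_def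
  using b_norm_mono_smoothness[OF assms] by (intro Inf_mono) blast

text \<open>
  A loss of smoothness, however small, makes up for any change of the index q; this reduces \<open>q =
  \<infinity>\<close> to \<open>q = 1\<close>.
\<close>

lemma b_norm_lower_smoothness_finite:
  assumes q: "0 < q" and e: "0 < e" and fin: "b_norm s p q S (coef :: nat \<Rightarrow> 'y::euclidean_space \<Rightarrow> complex) < top"
  shows "b_norm (s - e) p 1 S coef < top"
proof -
  obtain C where C: "C > 0" "(\<Sum>k. ennreal (2 powr - (real k * e))) = ennreal C"
    using suminf_powr_ennreal[OF e] by blast
  define E where "E j = ell_norm p (cubes_meeting S j) (\<lambda>m. ennreal (norm (coef j m)))" for j
  have le: "ennreal (2 powr (real j * (s - e - real DIM('y) * enn2real (1 / p)))) * E j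
      \<le> ennreal (2 powr - (real j * e)) * b_norm s p q S coef" for j
  proof -
    have "2 powr (real j * (s - e - real DIM('y) * enn2real (1 / p)))
      = 2 powr - (real j * e) * 2 powr (real j * (s - real DIM('y) * enn2real (1 / p)))"
      by (simp only: powr_add[symmetric]) (simp add: algebra_simps)
    then have "ennreal (2 powr (real j * (s - e - real DIM('y) * enn2real (1 / p)))) * E j
      = ennreal (2 powr - (real j * e)) * (ennreal (2 powr (real j * (s - real DIM('y) * enn2real (1 / p)))) * E j)"
      by (simp add: ennreal_mult mult.assoc)
    also have "\<dots> \<le> ennreal (2 powr - (real j * e)) * b_norm s p q S coef"
      unfolding b_norm_def E_def by (intro mult_left_mono ell_norm_le_ell_norm_UNIV[OF q]) auto
    finally show ?thesis .
  qed
  have "b_norm (s - e) p 1 S coef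
      = epow (\<integral>\<^sup>+j. epow (ennreal (2 powr (real j * (s - e - real DIM('y) * enn2real (1 / p)))) * E j) 1 \<partial>count_space UNIV) 1"
    by (simp add: b_norm_def ell_norm_nat qnorm_def E_def)
  also have "\<dots> = (\<Sum>j. ennreal (2 powr (real j * (s - e - real DIM('y) * enn2real (1 / p)))) * E j)"
  proof -
    have 1: "epow x 1 = x" for x using epow_epow_inverse[of 1 x] epow_inverse_epow[of 1 x]
      by (cases x) (auto simp: epow_def)
    show ?thesis by (simp add: 1 nn_integral_count_space_nat)
  qed
  also have "\<dots> \<le> (\<Sum>j. ennreal (2 powr - (real j * e)) * b_norm s p q S coef)"
    by (intro suminf_le le) auto
  also have "\<dots> = ennreal C * b_norm s p q S coef" using C(2) by simp
  also have "\<dots> < top" using fin by (simp add: ennreal_mult_less_top)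
  finally show ?thesis .
qed

text \<open>
  The working form of \<open>g = Tr f\<close>: one atomic series represents f in the domain and g on the
  boundary.
\<close>

definition trace_expansion ::
  "real \<Rightarrow> nat \<Rightarrow> real \<Rightarrow> ennreal \<Rightarrow> ennreal \<Rightarrow> 'b::euclidean_space set \<Rightarrow> (nat \<Rightarrow> 'b \<Rightarrow> complex) \<Rightarrow>
   (nat \<Rightarrow> 'b \<Rightarrow> 'b \<Rightarrow> complex) \<Rightarrow> ('b \<Rightarrow> complex) \<Rightarrow> ('b \<Rightarrow> complex) \<Rightarrow> bool" where
  "trace_expansion d k s p q \<Omega> coef a f g \<longleftrightarrow>
     (\<forall>j. \<forall>m\<in>cubes_meeting \<Omega> j. atom d k j m (a j m)) \<and> b_norm s p q \<Omega> coef < top \<and>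
     g \<in> borel_measurable (surface_measure (frontier \<Omega>)) \<and>
     (AE x in lebesgue_on \<Omega>. f x = (\<Sum>j. lev \<Omega> coef a j x)) \<and>
     (AE x in surface_measure (frontier \<Omega>). g x = (\<Sum>j. lev \<Omega> coef a j x))"

lemma trace_expansionD:
  assumes "trace_expansion d k s p q \<Omega> coef a f g"
  shows "\<forall>j. \<forall>m\<in>cubes_meeting \<Omega> j. atom d k j m (a j m)" "b_norm s p q \<Omega> coef < top"
    "g \<in> borel_measurable (surface_measure (frontier \<Omega>))"
    "AE x in lebesgue_on \<Omega>. f x = (\<Sum>j. lev \<Omega> coef a j x)"
    "AE x in surface_measure (frontier \<Omega>). g x = (\<Sum>j. lev \<Omega> coef a j x)"
  using assms unfolding trace_expansion_def by blast+

lemma schwartz_continuous: "schwartz u \<Longrightarrow> continuous_on UNIV u"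
  using C_k_imp_continuous[of 0] unfolding schwartz_def smooth_def by blast

context
  fixes \<Omega> :: "('a::euclidean_space \<times> real) set" and N K \<psi>
  assumes atlas: "lipschitz_atlas \<Omega> N K \<psi>" and dom: "open \<Omega>" "bounded \<Omega>"
begin

lemma AE_surface_of_charts:
  assumes "\<And>r. r \<in> {1..N} \<Longrightarrow> AE y in lebesgue_on (chart_image \<Omega> K \<psi> r). P (slice (\<psi> r) 0 y)"
  shows "AE x in surface_measure (frontier \<Omega>). P x"
proof -
  have "AE x in surface_measure (frontier \<Omega>). \<forall>r\<in>{1..N}. x \<in> K r \<longrightarrow> P x"
    using AE_surface_of_chart[OF atlas _ assms] by (intro AE_finite_allI) auto
  moreover have "AE x in surface_measure (frontier \<Omega>). x \<in> frontier \<Omega>"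
    by (rule AE_I2) (simp add: surface_measure_sets(2))
  ultimately show ?thesis
  proof eventually_elim
    case (elim x)
    have "frontier \<Omega> \<subseteq> (\<Union>j\<in>{1..N}. K j)" using atlas unfolding lipschitz_atlas_def by blast
    then show ?case using elim by blast
  qed
qed

lemma surface_series:
  assumes p: "0 < p" and d: "0 < d" and s: "enn2real (1 / p) < s"
  obtains C where "0 < C" "\<And>coef a q k. 0 < q \<Longrightarrow> b_norm s p q \<Omega> coef < top \<Longrightarrow>
    (\<forall>j. \<forall>m\<in>cubes_meeting \<Omega> j. atom d k j m (a j m)) \<Longrightarrow>
    (AE x in surface_measure (frontier \<Omega>). summable (\<lambda>j. norm (lev \<Omega> coef a j x))) \<and>
    lp_norm p (surface_measure (frontier \<Omega>)) (\<lambda>x. \<Sum>j. lev \<Omega> coef a j x) \<le> ennreal C * b_norm s p q \<Omega> coef"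
proof -
  let ?S = "surface_measure (frontier \<Omega>)"
  obtain C0 where C0: "upper_regular ?S (\<lambda>x. x) DIM('a) C0" by (rule surface_upper_regular[OF atlas]) (rule that)
  have C0p: "0 < C0" using C0 unfolding upper_regular_def by blast
  have \<sigma>: "0 < s - (real DIM('a \<times> real) - real DIM('a)) * enn2real (1 / p)" using s by simp
  obtain C where C: "0 < C" and C_le: "\<And>M (\<gamma> :: 'a \<times> real \<Rightarrow> 'a \<times> real) S coef a q k J.
    upper_regular M \<gamma> DIM('a) C0 \<Longrightarrow> bounded S \<Longrightarrow> 0 < q \<Longrightarrow> b_norm s p q S coef < top \<Longrightarrow>
    (\<forall>j. \<forall>m\<in>cubes_meeting S j. atom d k j m (a j m)) \<Longrightarrow>
    (AE x in M. summable (\<lambda>j. norm (lev S coef a j (\<gamma> x)))) \<and>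
    lp_norm p M (\<lambda>x. (\<Sum>j. lev S coef a j (\<gamma> x)) - (\<Sum>j<J. lev S coef a j (\<gamma> x)))
      \<le> ennreal (C * 2 powr - (real J * (s - (real DIM('a \<times> real) - real DIM('a)) * enn2real (1 / p)))) * b_norm s p q S coef"
    by (rule lev_series[OF p d C0p \<sigma>]) (rule that)
  show thesis
  proof (rule that[OF C])
    fix coef a q k
    assume "(0::ennreal) < q" "b_norm s p q \<Omega> coef < top" "\<forall>j. \<forall>m\<in>cubes_meeting \<Omega> j. atom d k j m (a j m)"
    from C_le[OF C0 dom(2) this, of 0]
    show "(AE x in ?S. summable (\<lambda>j. norm (lev \<Omega> coef a j x))) \<and>
      lp_norm p ?S (\<lambda>x. \<Sum>j. lev \<Omega> coef a j x) \<le> ennreal C * b_norm s p q \<Omega> coef" by simp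
  qed
qed

text \<open>
  Adding an expansion of f and a representation of \<open>u - f\<close> gives a series for the continuous
  function u, which by \<open>trace_consistent\<close> converges to u on the boundary as well. There \<open>u - g\<close> is
  therefore the sum of the second series alone.
\<close>

lemma trace_estimate:
  assumes p: "0 < p" "p \<noteq> top" and q: "0 < q" and d: "0 < d" and s: "enn2real (1 / p) < s"
  obtains C where "0 < C" "\<And>coef a f g u coef' a'.
    trace_expansion d k s p q \<Omega> coef a f g \<Longrightarrow> continuous_on UNIV u \<Longrightarrow>
    atomic_representation d k p \<Omega> (\<lambda>x. u x - f x) coef' a' \<Longrightarrow>
    lp_norm p (surface_measure (frontier \<Omega>)) (\<lambda>x. u x - g x) \<le> ennreal C * b_norm s p q \<Omega> coef'"
proof -
  let ?S = "surface_measure (frontier \<Omega>)"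
  have \<Omega>: "\<Omega> \<in> sets lebesgue" using dom(1) by simp
  have s0: "0 < s" using s enn2real_nonneg[of "1 / p"] by linarith
  define \<sigma> where "\<sigma> = s - (real DIM('a \<times> real) - real DIM('a)) * enn2real (1 / p)"
  have \<sigma>: "0 < \<sigma>" using s by (simp add: \<sigma>_def)
  obtain C where C: "0 < C" and C_le: "\<And>coef a q k. 0 < q \<Longrightarrow> b_norm s p q \<Omega> coef < top \<Longrightarrow>
    (\<forall>j. \<forall>m\<in>cubes_meeting \<Omega> j. atom d k j m (a j m)) \<Longrightarrow>
    (AE x in surface_measure (frontier \<Omega>). summable (\<lambda>j. norm (lev \<Omega> coef a j x))) \<and>
    lp_norm p (surface_measure (frontier \<Omega>)) (\<lambda>x. \<Sum>j. lev \<Omega> coef a j x) \<le> ennreal C * b_norm s p q \<Omega> coef"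
    by (rule surface_series[OF p(1) d s]) (rule that)
  define \<rho> where "\<rho> = real DIM('a \<times> real) * d"
  have \<rho>: "0 < \<rho>" using d by (simp add: \<rho>_def)
  have main: "lp_norm p ?S (\<lambda>x. u x - g x) \<le> ennreal C * b_norm s p q \<Omega> coef'"
    if ex: "trace_expansion d k s p q \<Omega> coef a f g" and u: "continuous_on UNIV u"
      and rep: "atomic_representation d k p \<Omega> (\<lambda>x. u x - f x) coef' a'" for coef a f g u coef' a'
  proof (cases "b_norm s p q \<Omega> coef' = top")
    case True
    then show ?thesis using C by (simp add: ennreal_mult_top)
  next
    case False
    then have b': "b_norm s p q \<Omega> coef' < top" by (simp add: less_top)
    note a = trace_expansionD(1)[OF ex] and b = trace_expansionD(2)[OF ex]
    have a': "\<forall>j. \<forall>m\<in>cubes_meeting \<Omega> j. atom d k j m (a' j m)"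
      using rep unfolding atomic_representation_iff[OF dom(2)] by blast
    have um: "u \<in> borel_measurable borel" by (rule borel_measurable_continuous_onI[OF u])
    have fm: "f \<in> borel_measurable (lebesgue_on \<Omega>)"
      by (rule besov_of_AE(3)[OF p(1) q s0 d dom(2) \<Omega> a b trace_expansionD(4)[OF ex]])
    have uf: "AE x in lebesgue_on \<Omega>. u x - f x = (\<Sum>j. lev \<Omega> coef' a' j x)"
      by (rule representation_AE[OF p(1) q s0 d dom(2) \<Omega> _ rep b'])
        (intro borel_measurable_diff borel_measurable_lebesgue_on um fm)
    define F where "F j x = lev \<Omega> coef a j x + lev \<Omega> coef' a' j x" for j x
    define V where "V j x = majorant \<Omega> coef \<rho> j x + majorant \<Omega> coef' \<rho> j x" for j x
    have Fc: "continuous_on UNIV (F j)" for j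
      unfolding F_def using a a' by (intro continuous_on_add lev_continuous) auto
    have FV: "ennreal (norm (F j x)) \<le> V j x" for j x
    proof -
      have "ennreal (norm (F j x)) \<le> ennreal (norm (lev \<Omega> coef a j x)) + ennreal (norm (lev \<Omega> coef' a' j x))"
        unfolding F_def by (simp only: ennreal_plus[symmetric] norm_ge_zero) (intro ennreal_leI norm_triangle_ineq)
      also have "\<dots> \<le> V j x"
        unfolding V_def using a a' by (intro add_mono lev_le_majorant[OF dom(2)]) (auto simp: \<rho>_def)
      finally show ?thesis .
    qed
    have ae: "AE x in lebesgue_on \<Omega>. summable (\<lambda>j. norm (F j x)) \<and> u x = (\<Sum>j. F j x)"
      using uf trace_expansionD(4)[OF ex] lev_series_lebesgue(1)[OF p(1) q s0 d dom(2) \<Omega> a b]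
        lev_series_lebesgue(1)[OF p(1) q s0 d dom(2) \<Omega> a' b']
    proof eventually_elim
      case (elim x)
      have "summable (\<lambda>j. norm (F j x))"
        by (rule summable_comparison_test'[OF summable_add[OF elim(3,4)], of 0]) (simp add: F_def norm_triangle_ineq)
      moreover have "u x = (\<Sum>j. F j x)"
        unfolding F_def suminf_add[OF summable_norm_cancel[OF elim(3)] summable_norm_cancel[OF elim(4)], symmetric]
        using elim(1,2) by (metis diff_add_cancel add.commute)
      ultimately show ?case by blast
    qed
    have ueq: "AE x in ?S. u x = (\<Sum>j. F j x)"
    proof (rule AE_surface_of_charts)
      fix r assume r: "r \<in> {1..N}"
      let ?W = "chart_image \<Omega> K \<psi> r"
      obtain L where L: "bilipschitz L (\<psi> r)" "\<And>\<tau>. bilipschitz L (slice (\<psi> r) \<tau>)"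
        using chart_bilipschitz[OF atlas r] by blast
      define C1 where "C1 = unit_ball_vol (real DIM('a)) * (2 * L) ^ DIM('a)"
      have reg: "upper_regular (lebesgue_on ?W) (slice (\<psi> r) \<tau>) DIM('a) C1" for \<tau>
        unfolding C1_def by (rule upper_regular_lebesgue[OF L(2) chart_image_lebesgue[OF atlas r]])
      have C1: "0 < C1" using reg[unfolded upper_regular_def] by blast
      obtain C2 where C2: "0 < C2" and C2_le: "\<And>M (\<gamma> :: 'a \<Rightarrow> 'a \<times> real) S coef s q j.
        upper_regular M \<gamma> DIM('a) C1 \<Longrightarrow> bounded S \<Longrightarrow> 0 < q \<Longrightarrow>
        qnorm p M (\<lambda>x. majorant S coef \<rho> j (\<gamma> x))
          \<le> ennreal (2 powr - (real j * (s - (real DIM('a \<times> real) - real DIM('a)) * enn2real (1 / p)))) * (ennreal C2 * b_norm s p q S coef)"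
        by (rule majorant_qnorm[OF p(1) \<rho> C1]) (rule that)
      obtain C3 where C3: "0 < C3" and C3_le: "\<And>M (u :: 'a \<Rightarrow> ennreal) v.
        u \<in> borel_measurable M \<Longrightarrow> v \<in> borel_measurable M \<Longrightarrow>
        qnorm p M (\<lambda>x. u x + v x) \<le> ennreal C3 * (qnorm p M u + qnorm p M v)"
        by (rule qnorm_add_le[OF p(1)]) (rule that)
      have slm: "slice (\<psi> r) \<tau> \<in> borel_measurable (lebesgue_on ?W)" for \<tau>
        using reg[of \<tau>] unfolding upper_regular_def by blast
      define T where "T = ennreal C3 * (ennreal C2 * b_norm s p q \<Omega> coef + ennreal C2 * b_norm s p q \<Omega> coef')"
      show "AE y in lebesgue_on ?W. u (slice (\<psi> r) 0 y) = (\<Sum>j. F j (slice (\<psi> r) 0 y))"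
      proof (rule trace_consistent[OF atlas dom r p \<sigma> _ Fc u FV _ _ ae])
        show "T < top" using b b' by (simp add: T_def ennreal_mult_less_top)
        fix j \<tau>
        have le: "qnorm p (lebesgue_on ?W) (\<lambda>y. majorant \<Omega> cf \<rho> j (slice (\<psi> r) \<tau> y))
          \<le> ennreal (2 powr - (real j * \<sigma>)) * (ennreal C2 * b_norm s p q \<Omega> cf)" for cf
          unfolding \<sigma>_def by (rule C2_le[OF reg dom(2) q])
        show "(\<lambda>y. V j (slice (\<psi> r) \<tau> y)) \<in> borel_measurable (lebesgue_on ?W)"
          unfolding V_def by (intro borel_measurable_add majorant_measurable dom slm)
        have "qnorm p (lebesgue_on ?W) (\<lambda>y. V j (slice (\<psi> r) \<tau> y))
          \<le> ennreal C3 * (ennreal (2 powr - (real j * \<sigma>)) * (ennreal C2 * b_norm s p q \<Omega> coef)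
            + ennreal (2 powr - (real j * \<sigma>)) * (ennreal C2 * b_norm s p q \<Omega> coef'))"
          unfolding V_def
          by (rule order_trans[OF C3_le[OF majorant_measurable[OF dom(2) slm] majorant_measurable[OF dom(2) slm]]],
              intro mult_left_mono add_mono le) simp
        also have "\<dots> = ennreal (2 powr - (real j * \<sigma>)) * T"
          by (simp add: T_def distrib_left mult_ac)
        finally show "qnorm p (lebesgue_on ?W) (\<lambda>y. V j (slice (\<psi> r) \<tau> y)) \<le> ennreal (2 powr - (real j * \<sigma>)) * T" .
      qed
    qed
    have "AE x in ?S. u x - g x = (\<Sum>j. lev \<Omega> coef' a' j x)"
      using ueq trace_expansionD(5)[OF ex] conjunct1[OF C_le[OF q b a]] conjunct1[OF C_le[OF q b' a']]
    proof eventually_elim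
      case (elim x)
      have "u x = (\<Sum>j. lev \<Omega> coef a j x) + (\<Sum>j. lev \<Omega> coef' a' j x)"
        using elim(1) suminf_add[OF summable_norm_cancel[OF elim(3)] summable_norm_cancel[OF elim(4)]] by (simp add: F_def)
      then show ?case using elim(2) by simp
    qed
    then have "lp_norm p ?S (\<lambda>x. u x - g x) = lp_norm p ?S (\<lambda>x. \<Sum>j. lev \<Omega> coef' a' j x)"
    proof (rule lp_norm_cong_AE[OF p(1)])
      show "(\<lambda>x. u x - g x) \<in> borel_measurable ?S"
        by (intro borel_measurable_diff surface_measure_sets(3) um trace_expansionD(3)[OF ex])
      show "(\<lambda>x. \<Sum>j. lev \<Omega> coef' a' j x) \<in> borel_measurable ?S"
        by (intro surface_measure_sets(3) lev_sum_borel_measurable[OF a'])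
    qed
    also have "\<dots> \<le> ennreal C * b_norm s p q \<Omega> coef'"
      by (rule conjunct2[OF C_le[OF q b' a']])
    finally show ?thesis .
  qed
  show thesis by (rule that[OF C main])
qed

lemma trace_limit:
  assumes p: "0 < p" "p \<noteq> top" and q: "0 < q" and d: "0 < d" and s: "enn2real (1 / p) < s"
    and ex: "trace_expansion d k s p q \<Omega> coef a f g"
    and u: "schwartz_approximation d k s p q \<Omega> f u"
  shows "(\<lambda>i. lp_norm p (surface_measure (frontier \<Omega>)) (\<lambda>x. u i x - g x)) \<longlonglongrightarrow> 0"
proof -
  obtain C where C: "0 < C" and C_le: "\<And>coef a f g u coef' a'.
    trace_expansion d k s p q \<Omega> coef a f g \<Longrightarrow> continuous_on UNIV u \<Longrightarrow>
    atomic_representation d k p \<Omega> (\<lambda>x. u x - f x) coef' a' \<Longrightarrow>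
    lp_norm p (surface_measure (frontier \<Omega>)) (\<lambda>x. u x - g x) \<le> ennreal C * b_norm s p q \<Omega> coef'"
    by (rule trace_estimate[OF p q d s]) (rule that)
  have le: "lp_norm p (surface_measure (frontier \<Omega>)) (\<lambda>x. u i x - g x) \<le> ennreal C * besov_norm d k s p q \<Omega> (\<lambda>x. u i x - f x)" for i
  proof -
    let ?X = "lp_norm p (surface_measure (frontier \<Omega>)) (\<lambda>x. u i x - g x)"
    have cancel: "ennreal (1 / C) * (ennreal C * y) = y" "ennreal C * (ennreal (1 / C) * y) = y" for y
      using C by (simp_all add: mult.assoc[symmetric] ennreal_mult[symmetric])
    have "continuous_on UNIV (u i)" using u unfolding schwartz_approximation_def by (blast intro: schwartz_continuous)
    then have "ennreal (1 / C) * ?X \<le> besov_norm d k s p q \<Omega> (\<lambda>x. u i x - f x)"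
      unfolding besov_norm_def
    proof (intro Inf_greatest)
      fix y assume cu: "continuous_on UNIV (u i)"
        and "y \<in> {b_norm s p q \<Omega> coef |coef a. atomic_representation d k p \<Omega> (\<lambda>x. u i x - f x) coef a}"
      then obtain coef' a' where y: "y = b_norm s p q \<Omega> coef'" "atomic_representation d k p \<Omega> (\<lambda>x. u i x - f x) coef' a'" by blast
      show "ennreal (1 / C) * ?X \<le> y"
        using mult_left_mono[OF C_le[OF ex cu y(2)], of "ennreal (1 / C)"] y(1) cancel(1) by simp
    qed
    from mult_left_mono[OF this, of "ennreal C"] show ?thesis by (simp add: cancel)
  qed
  have "(\<lambda>i. ennreal C * besov_norm d k s p q \<Omega> (\<lambda>x. u i x - f x)) \<longlonglongrightarrow> ennreal C * 0"
    using u unfolding schwartz_approximation_def by (intro tendsto_mult_ennreal tendsto_const) auto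
  then have lim: "(\<lambda>i. ennreal C * besov_norm d k s p q \<Omega> (\<lambda>x. u i x - f x)) \<longlonglongrightarrow> 0" by simp
  show ?thesis
    by (rule tendsto_sandwich[OF _ _ tendsto_const lim]) (use le in \<open>auto intro!: always_eventually\<close>)
qed

end


section \<open>Approximation by Schwartz functions\<close>

lemma supp_lev:
  fixes S :: "'y::euclidean_space set"
  assumes S: "bounded S" and a: "\<forall>j. \<forall>m\<in>cubes_meeting S j. atom d k j m (a j m)"
  shows "compact (supp (\<lambda>x. \<Sum>j<J. lev S coef a j x))"
proof -
  let ?B = "\<Union>j<J. \<Union>m\<in>cubes_meeting S j. cube d j m"
  have bc: "bounded (cube d j m)" for j and m :: 'y
  proof -
    have "norm x \<le> norm (m /\<^sub>R 2 ^ j) + real DIM('y) * d / 2 ^ j" if "x \<in> cube d j m" for x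
    proof -
      have "2 ^ j * norm (x - m /\<^sub>R 2 ^ j) = norm (2 ^ j *\<^sub>R (x - m /\<^sub>R 2 ^ j))" by simp
      also have "\<dots> = norm (2 ^ j *\<^sub>R x - m)" by (simp only: scaleR_diff_right) simp
      also have "\<dots> \<le> real DIM('y) * d" by (rule cube_norm_le[OF that])
      finally have "norm (x - m /\<^sub>R 2 ^ j) \<le> real DIM('y) * d / 2 ^ j"
        by (simp only: pos_le_divide_eq zero_less_power zero_less_numeral mult.commute)
      then show ?thesis using norm_triangle_sub[of x "m /\<^sub>R 2 ^ j"] by linarith
    qed
    then show ?thesis unfolding bounded_iff by blast
  qed
  have bB: "bounded ?B" using finite_cubes_meeting[OF S] bc by (intro bounded_UN finite_lessThan ballI) auto
  have "{x. (\<Sum>j<J. lev S coef a j x) \<noteq> 0} \<subseteq> ?B"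
  proof
    fix x assume "x \<in> {x. (\<Sum>j<J. lev S coef a j x) \<noteq> 0}"
    then have "(\<Sum>j<J. lev S coef a j x) \<noteq> 0" by simp
    then obtain j where j: "j < J" "lev S coef a j x \<noteq> 0" by (meson lessThan_iff sum.neutral)
    then obtain m where m: "m \<in> cubes_meeting S j" "coef j m * a j m x \<noteq> 0"
      unfolding lev_def by (meson sum.neutral)
    then have "x \<in> cube d j m" using a atomD(5) by (metis mult_zero_right)
    then show "x \<in> ?B" using j m by blast
  qed
  then show ?thesis using bB unfolding supp_def compact_eq_bounded_closed
    by (meson bounded_closure bounded_subset closed_closure)
qed

text \<open>
  A function that is small in \<open>C\<^sup>k\<close>, cut into pieces by the bumps of level 0, is a sum of
  atoms with small coefficients.
\<close>

lemma C_k_bound_normalized_product: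
  assumes "C_k_bound k 0 B (lattice_bump :: 'y::euclidean_space \<Rightarrow> complex)" "0 < B"
    and w: "C_k_bound k 0 \<eta> w" "0 < \<eta>" and d: "1 \<le> d"
  shows "atom d k 0 m (\<lambda>x :: 'y. complex_of_real (1 / (2 ^ k * B * \<eta>)) * (dyadic_bump 0 m x * w x))"
proof -
  have "C_k_bound k 0 (2 ^ k * B * \<eta>) (\<lambda>x. dyadic_bump 0 m x * w x)"
    by (rule C_k_bound_mult[OF C_k_bound_dyadic_bump[OF assms(1)] w(1)])
  from C_k_bound_cmult[OF this, of "complex_of_real (1 / (2 ^ k * B * \<eta>))"]
  have "C_k_bound k 0 1 (\<lambda>x. complex_of_real (1 / (2 ^ k * B * \<eta>)) * (dyadic_bump 0 m x * w x))"
    using assms by (simp add: norm_divide norm_mult norm_power)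
  moreover have "supp (\<lambda>x. complex_of_real (1 / (2 ^ k * B * \<eta>)) * (dyadic_bump 0 m x * w x)) \<subseteq> cube d 0 m"
    unfolding supp_subset_iff[OF closed_cube]
    using dyadic_bump_cube[of 0 m] cube_mono[OF d] by fastforce
  ultimately show ?thesis unfolding atom_iff by blast
qed

text \<open>
  A partial sum of the series is of class \<open>C\<^sup>k\<close> with compact support; it is replaced by a Schwartz
  function close to it in \<open>C\<^sup>k\<close>. The difference is a sum of atoms of level 0 with small coefficients,
  and what remains is the tail of the series, which is small in the Besov norm as q is finite.
\<close>

lemma schwartz_approximation_exists:
  fixes S :: "'y::euclidean_space set"
  assumes p: "0 < p" and q: "0 < q" "q \<noteq> top" and s: "0 < s" and d: "1 \<le> d"
    and S: "bounded S" "S \<in> sets lebesgue"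
    and a: "\<forall>j. \<forall>m\<in>cubes_meeting S j. atom d k j m (a j m)" and b: "b_norm s p q S coef < top"
    and f: "AE x in lebesgue_on S. f x = (\<Sum>j. lev S coef a j x)"
  shows "\<exists>u. schwartz_approximation d k s p q S f u"
proof -
  have d0: "0 < d" using d by simp
  define SJ where "SJ i x = (\<Sum>j<Suc i. lev S coef a j x)" for i x
  have SJ_C: "C_k k (SJ i)" for i unfolding SJ_def using a by (intro C_k_sum C_k_lev) auto
  define \<eta> where "\<eta> i = inverse (real (Suc i))" for i
  have \<eta>: "0 < \<eta> i" for i by (simp add: \<eta>_def)
  have "\<exists>u. schwartz u \<and> C_k_bound k 0 (\<eta> i) (\<lambda>x. u x - SJ i x)" for i
    using schwartz_approximation_C_k[OF SJ_C _ \<eta>, of i i] supp_lev[OF S(1) a] unfolding SJ_def by blast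
  then obtain u where u: "\<And>i. schwartz (u i)" "\<And>i. C_k_bound k 0 (\<eta> i) (\<lambda>x. u i x - SJ i x)" by metis
  obtain B where B: "1 \<le> B" "C_k_bound k 0 B (lattice_bump :: 'y \<Rightarrow> complex)"
    by (rule C_k_bound_lattice_bump) (rule that)
  \<comment> \<open>The i-th approximation replaces the levels 0, ..., i. So the tail starts at a level of at least 1
    and leaves level 0 free for the difference of u i and the partial sum.\<close>
  define c' where "c' i j m = (if j = 0 then complex_of_real (2 ^ k * B * \<eta> i)
    else if Suc i \<le> j then - coef j m else 0)" for i j and m :: 'y
  define a' where "a' i j m x = (if j = 0 then complex_of_real (1 / (2 ^ k * B * \<eta> i)) * (dyadic_bump 0 m x * (u i x - SJ i x))
    else a j m x)" for i j m x
  have a': "\<forall>j. \<forall>m\<in>cubes_meeting S j. atom d k j m (a' i j m)" for i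
  proof (intro allI ballI)
    fix j m assume m: "m \<in> cubes_meeting S j"
    show "atom d k j m (a' i j m)"
    proof (cases "j = 0")
      case True
      then show ?thesis
        using C_k_bound_normalized_product[OF B(2) _ u(2) \<eta> d] B(1) by (simp add: a'_def[abs_def])
    next
      case False
      then show ?thesis using a m by (simp add: a'_def[abs_def])
    qed
  qed
  have lev0: "lev S (c' i) (a' i) 0 x = u i x - SJ i x" if x: "x \<in> S" for i x
  proof -
    have "lev S (c' i) (a' i) 0 x = (\<Sum>m\<in>cubes_meeting S 0. dyadic_bump 0 m x * (u i x - SJ i x))"
      using B(1) \<eta>[of i] unfolding lev_def c'_def a'_def by (intro sum.cong refl) (simp add: field_simps)
    also have "\<dots> = u i x - SJ i x"
      using sum_dyadic_bump[OF finite_cubes_meeting[OF S(1)] x] by (simp add: sum_distrib_right[symmetric])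
    finally show ?thesis .
  qed
  have lev1: "lev S (c' i) (a' i) j x = (if Suc i \<le> j then - lev S coef a j x else 0)" if "j \<noteq> 0" for i j x
    using that unfolding lev_def c'_def a'_def by (auto simp: sum_negf)
  have diff: "AE x in lebesgue_on S. u i x - f x = (\<Sum>j. lev S (c' i) (a' i) j x)" for i
  proof -
    have "AE x in lebesgue_on S. x \<in> S" by (rule AE_I2) simp
    then show ?thesis using f lev_series_lebesgue(1)[OF p q(1) s d0 S a b]
    proof eventually_elim
      case (elim x)
      have sm: "summable (\<lambda>j. lev S coef a j x)" by (rule summable_norm_cancel[OF elim(3)])
      have "(\<lambda>j. if j = 0 then u i x - SJ i x else 0) sums (u i x - SJ i x)"
        using sums_If_finite[of "\<lambda>j. j = 0" "\<lambda>j. u i x - SJ i x"] by simp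
      moreover have "(\<lambda>j. if j < Suc i then lev S coef a j x else 0) sums SJ i x"
        using sums_If_finite_set[of "{..<Suc i}" "\<lambda>j. lev S coef a j x"] unfolding SJ_def by simp
      moreover have "(\<lambda>j. lev S coef a j x) sums f x" using summable_sums[OF sm] elim(2) by simp
      ultimately have "(\<lambda>j. (if j = 0 then u i x - SJ i x else 0) + (if j < Suc i then lev S coef a j x else 0) - lev S coef a j x)
        sums (u i x - SJ i x + SJ i x - f x)" by (intro sums_add sums_diff)
      moreover have "(if j = 0 then u i x - SJ i x else 0) + (if j < Suc i then lev S coef a j x else 0) - lev S coef a j x
        = lev S (c' i) (a' i) j x" for j
        using lev0[OF elim(1)] lev1[of j i x] by (cases "j = 0") auto
      ultimately show ?case by (simp add: sums_iff)
    qed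
  qed
  define t where "t j = ennreal (2 powr (real j * (s - real DIM('y) * enn2real (1 / p)))) *
    ell_norm p (cubes_meeting S j) (\<lambda>m. ennreal (norm (coef j m)))" for j
  define t' where "t' i j = ennreal (2 powr (real j * (s - real DIM('y) * enn2real (1 / p)))) *
    ell_norm p (cubes_meeting S j) (\<lambda>m. ennreal (norm (c' i j m)))" for i j
  let ?q = "enn2real q"
  have qp: "0 < ?q" by (rule enn2real_index_pos[OF q])
  define E where "E = ell_norm p (cubes_meeting S 0) (\<lambda>m. 1)"
  have E: "E < top"
  proof (cases "p = top")
    case True
    have "(SUP m\<in>cubes_meeting S 0. 1 :: ennreal) \<le> 1" by (rule SUP_least) simp
    then have "E \<le> 1" using True by (simp add: E_def ell_norm_def)
    then show ?thesis using ennreal_one_less_top by (rule le_less_trans)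
  next
    case False
    have "epow 1 (enn2real p) = 1" using epow_ennreal[of 1 "enn2real p"] by simp
    then show ?thesis using False finite_cubes_meeting[OF S(1), of 0]
      unfolding E_def ell_norm_finite[OF finite_cubes_meeting[OF S(1)]] qnorm_def
      by (simp add: epow_less_top_iff nn_integral_count_space_finite of_nat_less_top)
  qed
  have t'0: "t' i 0 \<le> ennreal (2 ^ k * B * \<eta> i) * E" for i
  proof -
    have "t' i 0 = ell_norm p (cubes_meeting S 0) (\<lambda>m. ennreal (2 ^ k * B * \<eta> i) * 1)"
      using B(1) \<eta>[of i] by (simp add: t'_def c'_def norm_mult norm_power)
    also have "\<dots> \<le> ennreal (2 ^ k * B * \<eta> i) * E"
      unfolding E_def using B(1) \<eta>[of i] by (intro ell_norm_cmult[OF p finite_cubes_meeting[OF S(1)]]) simp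
    finally show ?thesis .
  qed
  have t'1: "t' i j = (if Suc i \<le> j then t j else 0)" if "j \<noteq> 0" for i j
  proof -
    have "ell_norm p (cubes_meeting S j) (\<lambda>m. 0) = 0"
      using ell_norm_cmult[OF p finite_cubes_meeting[OF S(1)], of 0 j "\<lambda>m. 0"] by simp
    then show ?thesis using that by (simp add: t'_def t_def c'_def)
  qed
  have fin: "(\<Sum>j. epow (t j) ?q) < top"
  proof -
    have "epow (\<Sum>j. epow (t j) ?q) (1 / ?q) < top"
      using b q(2) by (simp add: b_norm_def ell_norm_nat qnorm_def t_def nn_integral_count_space_nat)
    then show ?thesis by (simp add: epow_less_top_iff)
  qed
  have t'0_lim: "(\<lambda>i. t' i 0) \<longlonglongrightarrow> 0"
  proof -
    have "(\<lambda>i. ennreal (2 ^ k * B * \<eta> i) * E) \<longlonglongrightarrow> ennreal (2 ^ k * B * 0) * E"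
      unfolding \<eta>_def using E
      by (intro tendsto_mult_ennreal tendsto_ennrealI tendsto_mult tendsto_const LIMSEQ_inverse_real_of_nat) auto
    then have lim: "(\<lambda>i. ennreal (2 ^ k * B * \<eta> i) * E) \<longlonglongrightarrow> 0" by simp
    show ?thesis
      by (rule tendsto_sandwich[OF _ _ tendsto_const lim]) (use t'0 in \<open>auto intro!: always_eventually\<close>)
  qed
  have bn: "b_norm s p q S (c' i) = epow (\<integral>\<^sup>+j. epow (t' i j) ?q \<partial>count_space UNIV) (1 / ?q)" for i
    using q(2) by (simp add: b_norm_def ell_norm_nat qnorm_def t'_def)
  have t'_le: "epow (t' i j) ?q \<le> epow (t j) ?q + (if j = 0 then epow (ennreal (2 ^ k * B * 1) * E) ?q else 0)" for i j
  proof (cases "j = 0")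
    case True
    have "\<eta> i \<le> 1" by (simp add: \<eta>_def inverse_eq_divide)
    then have "2 ^ k * B * \<eta> i \<le> 2 ^ k * B * 1" using B(1) by (intro mult_left_mono) auto
    then have "t' i 0 \<le> ennreal (2 ^ k * B * 1) * E"
      using t'0[of i] by (meson ennreal_leI mult_right_mono order_trans zero_le)
    then have "epow (t' i 0) ?q \<le> epow (ennreal (2 ^ k * B * 1) * E) ?q" using qp by (intro epow_mono) auto
    then show ?thesis using True by (simp add: add_increasing)
  next
    case False
    then show ?thesis using t'1[OF False, of i] by simp
  qed
  have W: "(\<integral>\<^sup>+j. (epow (t j) ?q + (if j = 0 then epow (ennreal (2 ^ k * B * 1) * E) ?q else 0)) \<partial>count_space UNIV) < top"
  proof -
    have "(\<Sum>j. (if j = 0 then epow (ennreal (2 ^ k * B * 1) * E) ?q else 0) :: ennreal) = epow (ennreal (2 ^ k * B * 1) * E) ?q"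
      using suminf_finite[of "{0}" "\<lambda>j::nat. (if j = 0 then epow (ennreal (2 ^ k * B * 1) * E) ?q else 0)"] by simp
    moreover have "epow (ennreal (2 ^ k * B * 1) * E) ?q < top"
      using E by (simp add: epow_less_top_iff ennreal_mult_less_top)
    ultimately show ?thesis using fin
      by (subst nn_integral_add) (auto simp: nn_integral_count_space_nat)
  qed
  have "(\<lambda>i. \<integral>\<^sup>+j. epow (t' i j) ?q \<partial>count_space UNIV) \<longlonglongrightarrow> (\<integral>\<^sup>+j. 0 \<partial>count_space (UNIV :: nat set))"
  proof (rule nn_integral_dominated_convergence[where w = "\<lambda>j. epow (t j) ?q + (if j = 0 then epow (ennreal (2 ^ k * B * 1) * E) ?q else 0)"])
    show "AE j in count_space UNIV. (\<lambda>i. epow (t' i j) ?q) \<longlonglongrightarrow> 0"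
    proof (rule AE_I2)
      fix j :: nat
      show "(\<lambda>i. epow (t' i j) ?q) \<longlonglongrightarrow> 0"
      proof (cases "j = 0")
        case True
        then show ?thesis using tendsto_epow_0[OF t'0_lim qp] by simp
      next
        case False
        have "\<forall>\<^sub>F i in sequentially. 0 = epow (t' i j) ?q"
          using eventually_ge_at_top[of j] by eventually_elim (simp add: t'1[OF False])
        then show ?thesis by (rule Lim_transform_eventually[OF tendsto_const])
      qed
    qed
  qed (use t'_le W in \<open>auto simp: AE_count_space\<close>)
  then have "(\<lambda>i. \<integral>\<^sup>+j. epow (t' i j) ?q \<partial>count_space UNIV) \<longlonglongrightarrow> 0" by simp
  then have bl: "(\<lambda>i. b_norm s p q S (c' i)) \<longlonglongrightarrow> 0"
    unfolding bn using qp by (intro tendsto_epow_0) auto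
  have b'fin: "b_norm s p q S (c' i) < top" for i
  proof -
    have "(\<integral>\<^sup>+j. epow (t' i j) ?q \<partial>count_space UNIV) < top"
      by (rule le_less_trans[OF nn_integral_mono W]) (use t'_le in auto)
    then show ?thesis unfolding bn epow_less_top_iff .
  qed
  have "besov_norm d k s p q S (\<lambda>x. u i x - f x) \<le> b_norm s p q S (c' i)" for i
    using besov_of_AE(2)[OF p q(1) s d0 S a' b'fin diff, of i] unfolding besov_norm_def by (intro Inf_lower) blast
  then have "(\<lambda>i. besov_norm d k s p q S (\<lambda>x. u i x - f x)) \<longlonglongrightarrow> 0"
    by (intro tendsto_sandwich[OF _ _ tendsto_const bl]) (auto intro!: always_eventually)
  then show ?thesis using u(1) unfolding schwartz_approximation_def by blast
qed


section \<open>Existence, uniqueness and sums of traces\<close>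

text \<open>
  For \<open>p = \<infinity>\<close> the series converges uniformly: the estimate of the majorant at a single
  point, a space of dimension 0, decays geometrically.
\<close>

lemma bounded_coefficients_continuous:
  fixes S :: "'y::euclidean_space set"
  assumes q: "0 < q" and s: "0 < s" and d: "0 < d" and S: "bounded S"
    and a: "\<forall>j. \<forall>m\<in>cubes_meeting S j. atom d k j m (a j m)" and b: "b_norm s top q S coef < top"
  shows "continuous_on UNIV (\<lambda>x. \<Sum>j. lev S coef a j x)"
proof -
  define \<rho> where "\<rho> = real DIM('y) * d"
  have \<rho>: "0 < \<rho>" using d by (simp add: \<rho>_def)
  have index: "(0::ennreal) < top" "(0::real) < 1" by simp_all
  obtain K where K: "0 < K" and K_le: "\<And>M (\<gamma> :: unit \<Rightarrow> 'y) S coef s q j.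
    upper_regular M \<gamma> 0 1 \<Longrightarrow> bounded S \<Longrightarrow> 0 < q \<Longrightarrow>
    qnorm top M (\<lambda>x. majorant S coef \<rho> j (\<gamma> x))
      \<le> ennreal (2 powr - (real j * (s - (real DIM('y) - real 0) * enn2real (1 / top)))) * (ennreal K * b_norm s top q S coef)"
    by (rule majorant_qnorm[OF index(1) \<rho> index(2)]) (rule that)
  define T where "T = enn2real (ennreal K * b_norm s top q S coef)"
  have T: "ennreal T = ennreal K * b_norm s top q S coef" "0 \<le> T"
    using b by (simp_all add: T_def ennreal_mult_less_top)
  have bound: "norm (lev S coef a j x) \<le> 2 powr - (real j * s) * T" for j x
  proof -
    have "upper_regular (count_space (UNIV :: unit set)) (\<lambda>_. x) 0 1"
      unfolding upper_regular_def by (auto simp: emeasure_count_space_finite card_UNIV_unit intro!: order_trans[OF of_nat_mono[OF card_mono]])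
    from K_le[OF this S q, of coef j s]
    have "majorant S coef \<rho> j x \<le> ennreal (2 powr - (real j * s)) * ennreal T"
      by (simp add: qnorm_def esssup_count_space T(1))
    moreover have "ennreal (norm (lev S coef a j x)) \<le> majorant S coef \<rho> j x"
      using a by (intro lev_le_majorant[OF S]) (auto simp: \<rho>_def)
    ultimately have "ennreal (norm (lev S coef a j x)) \<le> ennreal (2 powr - (real j * s) * T)"
      using T(2) by (simp add: ennreal_mult)
    then show ?thesis using T(2) by (simp add: ennreal_le_iff)
  qed
  have "2 powr - (real j * s) * T = T * (2 powr - s) ^ j" for j
    by (simp add: powr_realpow[symmetric] powr_powr mult.commute)
  moreover have "summable (\<lambda>j. T * (2 powr - s) ^ j)"
    using s by (intro summable_mult summable_geometric) (auto simp: powr_less_one)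
  ultimately have sm: "summable (\<lambda>j. 2 powr - (real j * s) * T)" by (simp only:)
  have "uniform_limit UNIV (\<lambda>n x. \<Sum>j<n. lev S coef a j x) (\<lambda>x. \<Sum>j. lev S coef a j x) sequentially"
    by (rule Weierstrass_m_test[OF _ sm]) (rule bound)
  then show ?thesis
  proof (rule uniform_limit_theorem[rotated])
    show "\<forall>\<^sub>F n in sequentially. continuous_on UNIV (\<lambda>x. \<Sum>j<n. lev S coef a j x)"
      using a by (intro always_eventually allI continuous_on_sum lev_continuous) auto
  qed simp
qed

text \<open>
  Two atoms at the same cube are combined into one, with the sum of the absolute values of their coefficients as
  coefficient.
\<close>

lemma trace_expansion_add:
  fixes \<Omega> :: "('a::euclidean_space \<times> real) set"
  assumes p: "0 < p" and q: "0 < q" and d: "0 < d"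
    and atlas: "lipschitz_atlas \<Omega> N K \<psi>" and dom: "open \<Omega>" "bounded \<Omega>" and s: "enn2real (1 / p) < s"
    and ex: "trace_expansion d k s p q \<Omega> c a f g" and ex': "trace_expansion d k s p q \<Omega> c' a' f' g'"
  shows "\<exists>c'' a''. trace_expansion d k s p q \<Omega> c'' a'' (\<lambda>x. f x + f' x) (\<lambda>x. g x + g' x)"
proof -
  have \<Omega>: "\<Omega> \<in> sets lebesgue" using dom(1) by simp
  have "0 < s" using s enn2real_nonneg[of "1 / p"] by linarith
  note A = trace_expansionD(1)[OF ex] and A' = trace_expansionD(1)[OF ex']
  note b = trace_expansionD(2)[OF ex] and b' = trace_expansionD(2)[OF ex']
  define n where "n j m = norm (c j m) + norm (c' j m)" for j m
  define c'' where "c'' j m = complex_of_real (n j m)" for j m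
  have norm_c'': "norm (c'' j m) = n j m" for j m unfolding c''_def norm_of_real n_def by simp
  \<comment> \<open>If the coefficient \<open>c'' j m\<close> is 0, both old coefficients are 0, and division by 0 gives the
    atom 0.\<close>
  define a'' where "a'' j m x = (c j m / c'' j m) * a j m x + (c' j m / c'' j m) * a' j m x" for j m x
  have A'': "\<forall>j. \<forall>m\<in>cubes_meeting \<Omega> j. atom d k j m (a'' j m)"
  proof (intro allI ballI)
    fix j m assume m: "m \<in> cubes_meeting \<Omega> j"
    have "norm (c j m / c'' j m) * 1 + norm (c' j m / c'' j m) * 1 = n j m / n j m"
      by (simp only: norm_divide norm_c'' add_divide_distrib[symmetric] mult_1_right) (simp only: n_def)
    also have "\<dots> \<le> 1" by simp
    finally have "C_k_bound k j 1 (a'' j m)"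
      unfolding a''_def
      using C_k_bound_mono[OF C_k_bound_add[OF C_k_bound_cmult C_k_bound_cmult], of k j 1 "a j m" 1 "a' j m" "c j m / c'' j m" "c' j m / c'' j m" 1 j k]
        A A' m atomD(1) by blast
    moreover have "supp (a'' j m) \<subseteq> cube d j m"
      unfolding supp_subset_iff[OF closed_cube]
    proof (intro allI impI)
      fix x assume "a'' j m x \<noteq> 0"
      then have "a j m x \<noteq> 0 \<or> a' j m x \<noteq> 0" by (auto simp: a''_def)
      then show "x \<in> cube d j m" using A A' m atomD(5) by metis
    qed
    ultimately show "atom d k j m (a'' j m)" unfolding atom_iff by blast
  qed
  have lev'': "lev \<Omega> c'' a'' j x = lev \<Omega> c a j x + lev \<Omega> c' a' j x" for j x
  proof -
    have "c'' j m * a'' j m x = c j m * a j m x + c' j m * a' j m x" for m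
    proof (cases "n j m = 0")
      case True
      then have "c j m = 0" "c' j m = 0" unfolding n_def by (smt (verit) norm_ge_zero norm_eq_zero)+
      then show ?thesis using True by (simp add: c''_def)
    next
      case False
      then show ?thesis by (simp add: c''_def a''_def distrib_left)
    qed
    then show ?thesis unfolding lev_def by (simp add: sum.distrib)
  qed
  have b'': "b_norm s p q \<Omega> c'' < top"
  proof -
    let ?w = "\<lambda>j. ennreal (2 powr (real j * (s - real DIM('a \<times> real) * enn2real (1 / p))))"
    let ?E = "\<lambda>c j. ell_norm p (cubes_meeting \<Omega> j) (\<lambda>m. ennreal (norm (c j m)))"
    obtain C1 where C1: "0 < C1" and C1_le: "\<And>M (u :: 'a \<times> real \<Rightarrow> ennreal) v.
        u \<in> borel_measurable M \<Longrightarrow> v \<in> borel_measurable M \<Longrightarrow>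
        qnorm p M (\<lambda>x. u x + v x) \<le> ennreal C1 * (qnorm p M u + qnorm p M v)"
      by (rule qnorm_add_le[OF p]) (rule that)
    obtain C2 where C2: "0 < C2" and C2_le: "\<And>M (u :: nat \<Rightarrow> ennreal) v.
        u \<in> borel_measurable M \<Longrightarrow> v \<in> borel_measurable M \<Longrightarrow>
        qnorm q M (\<lambda>x. u x + v x) \<le> ennreal C2 * (qnorm q M u + qnorm q M v)"
      by (rule qnorm_add_le[OF q]) (rule that)
    have le: "?w j * ?E c'' j \<le> ennreal C1 * (?w j * ?E c j + ?w j * ?E c' j)" for j
    proof -
      have "?E c'' j = ell_norm p (cubes_meeting \<Omega> j) (\<lambda>m. ennreal (norm (c j m)) + ennreal (norm (c' j m)))"
        by (simp only: norm_c'') (simp only: n_def ennreal_plus norm_ge_zero)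
      also have "\<dots> \<le> ennreal C1 * (?E c j + ?E c' j)"
        unfolding ell_norm_finite[OF finite_cubes_meeting[OF dom(2)]] by (intro C1_le) auto
      finally have "?w j * ?E c'' j \<le> ?w j * (ennreal C1 * (?E c j + ?E c' j))" by (rule mult_left_mono) simp
      then show ?thesis by (simp add: distrib_left mult_ac)
    qed
    have "b_norm s p q \<Omega> c'' \<le> qnorm q (count_space UNIV) (\<lambda>j. ennreal C1 * (?w j * ?E c j + ?w j * ?E c' j))"
      unfolding b_norm_def ell_norm_nat using le by (intro qnorm_mono_AE q) (auto simp: AE_count_space)
    also have "\<dots> \<le> ennreal C1 * qnorm q (count_space UNIV) (\<lambda>j. ?w j * ?E c j + ?w j * ?E c' j)"
      by (rule qnorm_cmult_le[OF q]) simp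
    also have "\<dots> \<le> ennreal C1 * (ennreal C2 * (b_norm s p q \<Omega> c + b_norm s p q \<Omega> c'))"
      unfolding b_norm_def ell_norm_nat by (intro mult_left_mono C2_le) auto
    also have "\<dots> < top" using b b' by (simp add: ennreal_mult_less_top)
    finally show ?thesis .
  qed
  obtain C where C: "0 < C" and C_le: "\<And>coef a q k. 0 < q \<Longrightarrow> b_norm s p q \<Omega> coef < top \<Longrightarrow>
    (\<forall>j. \<forall>m\<in>cubes_meeting \<Omega> j. atom d k j m (a j m)) \<Longrightarrow>
    (AE x in surface_measure (frontier \<Omega>). summable (\<lambda>j. norm (lev \<Omega> coef a j x))) \<and>
    lp_norm p (surface_measure (frontier \<Omega>)) (\<lambda>x. \<Sum>j. lev \<Omega> coef a j x) \<le> ennreal C * b_norm s p q \<Omega> coef"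
    by (rule surface_series[OF atlas dom p d s]) (rule that)
  have "AE x in lebesgue_on \<Omega>. f x + f' x = (\<Sum>j. lev \<Omega> c'' a'' j x)"
    using trace_expansionD(4)[OF ex] trace_expansionD(4)[OF ex'] lev_series_lebesgue(1)[OF p q \<open>0 < s\<close> d dom(2) \<Omega> A b]
      lev_series_lebesgue(1)[OF p q \<open>0 < s\<close> d dom(2) \<Omega> A' b']
  proof eventually_elim
    case (elim x)
    then show ?case using suminf_add[OF summable_norm_cancel summable_norm_cancel] by (simp add: lev'')
  qed
  moreover have "AE x in surface_measure (frontier \<Omega>). g x + g' x = (\<Sum>j. lev \<Omega> c'' a'' j x)"
    using trace_expansionD(5)[OF ex] trace_expansionD(5)[OF ex'] conjunct1[OF C_le[OF q b A]]
      conjunct1[OF C_le[OF q b' A']]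
  proof eventually_elim
    case (elim x)
    then show ?case using suminf_add[OF summable_norm_cancel summable_norm_cancel] by (simp add: lev'')
  qed
  moreover have "(\<lambda>x. g x + g' x) \<in> borel_measurable (surface_measure (frontier \<Omega>))"
    by (intro borel_measurable_add trace_expansionD(3)[OF ex] trace_expansionD(3)[OF ex'])
  ultimately show ?thesis using A'' b'' unfolding trace_expansion_def by blast
qed

context
  fixes \<Omega> :: "('a::euclidean_space \<times> real) set" and N K \<psi>
  assumes atlas: "lipschitz_atlas \<Omega> N K \<psi>" and dom: "open \<Omega>" "bounded \<Omega>"
begin

lemma trace_by_completion_expansion:
  assumes p: "0 < p" "p \<noteq> top" and q: "0 < q" "q \<noteq> top" and d: "1 \<le> d" and s: "enn2real (1 / p) < s"
    and ex: "trace_expansion d k s p q \<Omega> coef a f g"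
  shows "trace_by_completion d k s p q \<Omega> f g"
proof -
  have \<Omega>: "\<Omega> \<in> sets lebesgue" using dom(1) by simp
  have s0: "0 < s" using s enn2real_nonneg[of "1 / p"] by linarith
  have d0: "0 < d" using d by simp
  have "\<exists>u. schwartz_approximation d k s p q \<Omega> f u"
    by (rule schwartz_approximation_exists[OF p(1) q s0 d dom(2) \<Omega> trace_expansionD(1,2,4)[OF ex]])
  moreover have "\<forall>u. schwartz_approximation d k s p q \<Omega> f u \<longrightarrow>
        (\<lambda>i. lp_norm p (surface_measure (frontier \<Omega>)) (\<lambda>x. u i x - g x)) \<longlonglongrightarrow> 0"
    using trace_limit[OF atlas dom p q(1) d0 s ex] by blast
  ultimately show ?thesis unfolding trace_by_completion_def by blast
qed

lemma has_trace_of_expansion: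
  assumes p: "0 < p" and q: "0 < q" and d: "1 \<le> d" and s: "enn2real (1 / p) < s"
    and ex: "trace_expansion d k s p q \<Omega> coef a f g"
  shows "has_trace d k s p q \<Omega> f g"
proof -
  have \<Omega>: "\<Omega> \<in> sets lebesgue" using dom(1) by simp
  have s0: "0 < s" using s enn2real_nonneg[of "1 / p"] by linarith
  have d0: "0 < d" using d by simp
  note ex_simps = trace_expansionD[OF ex]
  have fB: "f \<in> besov d k s p q \<Omega>"
    by (rule besov_of_AE(1)[OF p q s0 d0 dom(2) \<Omega> ex_simps(1,2,4)])
  let ?S = "surface_measure (frontier \<Omega>)"
  have gL: "g \<in> lp_space p ?S"
  proof -
    obtain C where C: "0 < C" and C_le: "\<And>coef a q k. 0 < q \<Longrightarrow> b_norm s p q \<Omega> coef < top \<Longrightarrow>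
      (\<forall>j. \<forall>m\<in>cubes_meeting \<Omega> j. atom d k j m (a j m)) \<Longrightarrow>
      (AE x in surface_measure (frontier \<Omega>). summable (\<lambda>j. norm (lev \<Omega> coef a j x))) \<and>
      lp_norm p (surface_measure (frontier \<Omega>)) (\<lambda>x. \<Sum>j. lev \<Omega> coef a j x) \<le> ennreal C * b_norm s p q \<Omega> coef"
      by (rule surface_series[OF atlas dom p d0 s]) (rule that)
    have "lp_norm p ?S g = lp_norm p ?S (\<lambda>x. \<Sum>j. lev \<Omega> coef a j x)"
      by (rule lp_norm_cong_AE[OF p ex_simps(5,3) surface_measure_sets(3)[OF lev_sum_borel_measurable[OF ex_simps(1)]]])
    also have "\<dots> \<le> ennreal C * b_norm s p q \<Omega> coef"
      by (rule conjunct2[OF C_le[OF q ex_simps(2,1)]])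
    also have "\<dots> < top" using ex_simps(2) by (simp add: ennreal_mult_less_top)
    finally show ?thesis using ex_simps(3) unfolding lp_space_def by blast
  qed
  consider "p = top" | "p \<noteq> top" "q = top" | "p \<noteq> top" "q \<noteq> top" by blast
  then show ?thesis
  proof cases
    case 1
    have "continuous_on UNIV (\<lambda>x. \<Sum>j. lev \<Omega> coef a j x)"
      by (rule bounded_coefficients_continuous[OF q s0 d0 dom(2) ex_simps(1) ex_simps(2)[unfolded 1]])
    then have "continuous_on (closure \<Omega>) (\<lambda>x. \<Sum>j. lev \<Omega> coef a j x)" by (rule continuous_on_subset) simp
    then have "pointwise_trace \<Omega> f g" using ex_simps(4,5) unfolding pointwise_trace_def by blast
    then show ?thesis using fB gL 1 unfolding has_trace_def by simp
  next
    case 2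
    define \<epsilon> where "\<epsilon> = (s - enn2real (1 / p)) / 2"
    have \<epsilon>: "0 < \<epsilon>" "enn2real (1 / p) < s - \<epsilon>" using s by (simp_all add: \<epsilon>_def field_simps)
    have "trace_expansion d k (s - \<epsilon>) p 1 \<Omega> coef a f g"
      using ex b_norm_lower_smoothness_finite[OF q \<epsilon>(1) ex_simps(2)] unfolding trace_expansion_def by blast
    then have "trace_by_completion d k (s - \<epsilon>) p 1 \<Omega> f g"
      by (intro trace_by_completion_expansion[OF p 2(1) _ _ d \<epsilon>(2)]) auto
    then show ?thesis using fB gL 2 \<epsilon> unfolding has_trace_def by auto
  next
    case 3
    then show ?thesis using fB gL trace_by_completion_expansion[OF p 3(1) q 3(2) d s ex] unfolding has_trace_def by simp
  qed
qed

lemma trace_expansion_of_besov: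
  assumes "0 < p" "0 < q" "0 < s" "0 < d" and f: "f \<in> besov d k s p q \<Omega>"
  obtains coef a where "trace_expansion d k s p q \<Omega> coef a f (\<lambda>x. \<Sum>j. lev \<Omega> coef a j x)"
proof -
  have \<Omega>: "\<Omega> \<in> sets lebesgue" using dom(1) by simp
  obtain coef a where r: "atomic_representation d k p \<Omega> f coef a" "b_norm s p q \<Omega> coef < top"
    using f unfolding besov_def by blast
  have A: "\<forall>j. \<forall>m\<in>cubes_meeting \<Omega> j. atom d k j m (a j m)"
    using r(1) unfolding atomic_representation_iff[OF dom(2)] by blast
  have fm: "f \<in> borel_measurable (lebesgue_on \<Omega>)" using f unfolding besov_def lp_space_def by blast
  have "trace_expansion d k s p q \<Omega> coef a f (\<lambda>x. \<Sum>j. lev \<Omega> coef a j x)"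
    unfolding trace_expansion_def
    using A r(2) representation_AE[OF assms(1-4) dom(2) \<Omega> fm r] surface_measure_sets(3)[OF lev_sum_borel_measurable[OF A]] by simp
  then show thesis by (rule that)
qed

lemma completion_limits_unique:
  assumes p: "0 < p" and u: "\<forall>i. schwartz (u i)"
    and g: "g \<in> lp_space p (surface_measure (frontier \<Omega>))" "g' \<in> lp_space p (surface_measure (frontier \<Omega>))"
    and lim: "(\<lambda>i. lp_norm p (surface_measure (frontier \<Omega>)) (\<lambda>x. u i x - g x)) \<longlonglongrightarrow> 0"
      "(\<lambda>i. lp_norm p (surface_measure (frontier \<Omega>)) (\<lambda>x. u i x - g' x)) \<longlonglongrightarrow> 0"
  shows "AE x in surface_measure (frontier \<Omega>). g x = g' x"
proof (rule AE_eq_of_lp_limits[OF p])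
  show "u i \<in> borel_measurable (surface_measure (frontier \<Omega>))" for i
    using u by (intro surface_measure_sets(3) borel_measurable_continuous_onI schwartz_continuous) blast
qed (use g lim in \<open>auto simp: lp_space_def lp_norm_minus_commute[of _ _ g] lp_norm_minus_commute[of _ _ g']\<close>)

text \<open>
  For \<open>p = \<infinity>\<close> two continuous representatives agree on the open set
  \<open>\<Omega>\<close>, hence on its closure. For \<open>q = \<infinity>\<close> the two traces may come from
  different \<open>\<epsilon>\<close>; the approximating sequence for the smaller one serves for both.
\<close>

lemma has_trace_unique:
  assumes p: "0 < p" and g: "has_trace d k s p q \<Omega> f g" and g': "has_trace d k s p q \<Omega> f g'"
  shows "AE x in surface_measure (frontier \<Omega>). g x = g' x"
proof -
  let ?S = "surface_measure (frontier \<Omega>)"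
  have L: "g \<in> lp_space p ?S" "g' \<in> lp_space p ?S" using g g' unfolding has_trace_def by blast+
  consider "p = top" | "p \<noteq> top" "q = top" | "p \<noteq> top" "q \<noteq> top" by blast
  then show ?thesis
  proof cases
    case 1
    then obtain F F' where F: "continuous_on (closure \<Omega>) F" "AE x in lebesgue_on \<Omega>. f x = F x" "AE x in ?S. g x = F x"
      and F': "continuous_on (closure \<Omega>) F'" "AE x in lebesgue_on \<Omega>. f x = F' x" "AE x in ?S. g' x = F' x"
      using g g' unfolding has_trace_def pointwise_trace_def by auto
    have \<Omega>: "\<Omega> \<in> sets lebesgue" using dom(1) by simp
    have "AE x in lebesgue_on \<Omega>. F x = F' x" using F(2) F'(2) by eventually_elim simp
    then have neg: "negligible {x \<in> \<Omega>. F x \<noteq> F' x}"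
      using iffD1[OF AE_lebesgue_on_iff_negligible[OF \<Omega>]] by blast
    have cont: "continuous_on (closure \<Omega>) (\<lambda>x. F x - F' x)" by (intro continuous_on_diff F F')
    have "open {x \<in> \<Omega>. F x \<noteq> F' x}"
    proof -
      have "continuous_on \<Omega> (\<lambda>x. F x - F' x)" using cont closure_subset by (rule continuous_on_subset)
      from continuous_open_preimage[OF this dom(1) open_Compl[OF closed_singleton[of 0]]]
      have "open (\<Omega> \<inter> (\<lambda>x. F x - F' x) -` (- {0}))" .
      moreover have "\<Omega> \<inter> (\<lambda>x. F x - F' x) -` (- {0}) = {x \<in> \<Omega>. F x \<noteq> F' x}" by auto
      ultimately show ?thesis by simp
    qed
    then have "{x \<in> \<Omega>. F x \<noteq> F' x} = {}" using neg open_not_negligible by blast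
    then have zero: "F x - F' x = 0" if "x \<in> \<Omega>" for x using that unfolding right_minus_eq by blast
    have "F x - F' x = 0" if "x \<in> closure \<Omega>" for x
      by (rule continuous_constant_on_closure[OF cont zero that])
    then have eq: "F x = F' x" if "x \<in> frontier \<Omega>" for x
      using that unfolding frontier_def by (metis DiffD1 right_minus_eq)
    have "AE x in ?S. x \<in> frontier \<Omega>" by (rule AE_I2) (simp add: surface_measure_sets(2))
    then show ?thesis using F(3) F'(3) by eventually_elim (simp add: eq)
  next
    case 2
    then obtain \<epsilon> \<epsilon>' where e: "trace_by_completion d k (s - \<epsilon>) p 1 \<Omega> f g" "trace_by_completion d k (s - \<epsilon>') p 1 \<Omega> f g'"
      using g g' unfolding has_trace_def by auto
    have mono: "schwartz_approximation d k t p 1 \<Omega> f u" if "schwartz_approximation d k t' p 1 \<Omega> f u" "t \<le> t'" for t t' u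
    proof -
      have lim: "(\<lambda>i. besov_norm d k t' p 1 \<Omega> (\<lambda>x. u i x - f x)) \<longlonglongrightarrow> 0"
        using that(1) unfolding schwartz_approximation_def by blast
      have "(\<lambda>i. besov_norm d k t p 1 \<Omega> (\<lambda>x. u i x - f x)) \<longlonglongrightarrow> 0"
        by (rule tendsto_sandwich[OF _ _ tendsto_const lim])
          (use that(2) in \<open>auto intro!: always_eventually besov_norm_mono_smoothness\<close>)
      then show ?thesis using that(1) unfolding schwartz_approximation_def by blast
    qed
    have "\<exists>u. schwartz_approximation d k (s - \<epsilon>) p 1 \<Omega> f u \<and> schwartz_approximation d k (s - \<epsilon>') p 1 \<Omega> f u"
    proof (cases "\<epsilon> \<le> \<epsilon>'")
      case True
      obtain u where "schwartz_approximation d k (s - \<epsilon>) p 1 \<Omega> f u" using e(1) unfolding trace_by_completion_def by blast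
      then show ?thesis using mono[of "s - \<epsilon>" u "s - \<epsilon>'"] True by auto
    next
      case False
      obtain u where "schwartz_approximation d k (s - \<epsilon>') p 1 \<Omega> f u" using e(2) unfolding trace_by_completion_def by blast
      then show ?thesis using mono[of "s - \<epsilon>'" u "s - \<epsilon>"] False by auto
    qed
    then obtain u where u: "schwartz_approximation d k (s - \<epsilon>) p 1 \<Omega> f u" "schwartz_approximation d k (s - \<epsilon>') p 1 \<Omega> f u" by blast
    have "\<forall>i. schwartz (u i)" using u(1) unfolding schwartz_approximation_def by blast
    then show ?thesis
      using completion_limits_unique[OF p _ L, of u] u e unfolding trace_by_completion_def by blast
  next
    case 3
    then have e: "trace_by_completion d k s p q \<Omega> f g" "trace_by_completion d k s p q \<Omega> f g'"
      using g g' unfolding has_trace_def by auto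
    then obtain u where u: "schwartz_approximation d k s p q \<Omega> f u" unfolding trace_by_completion_def by blast
    have "\<forall>i. schwartz (u i)" using u unfolding schwartz_approximation_def by blast
    then show ?thesis
      using completion_limits_unique[OF p _ L, of u] u e unfolding trace_by_completion_def by blast
  qed
qed

end


section \<open>Transport of atomic series between the boundary and the plane\<close>

lemma majorant_summable_AE:
  fixes \<gamma> :: "'m \<Rightarrow> 'y::euclidean_space"
  assumes p: "0 < p" and q: "0 < q" and \<rho>: "0 < \<rho>" and reg: "upper_regular M \<gamma> D C" and S: "bounded S"
    and \<sigma>: "0 < s - (real DIM('y) - real D) * enn2real (1 / p)" and b: "b_norm s p q S coef < top"
  shows "AE x in M. (\<Sum>j. majorant S coef \<rho> j (\<gamma> x)) < top"
proof -
  have C: "0 < C" and \<gamma>: "\<gamma> \<in> borel_measurable M" using reg unfolding upper_regular_def by blast+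
  obtain K where K: "0 < K" and K_le: "\<And>M (\<gamma> :: 'm \<Rightarrow> 'y) S coef s q j.
    upper_regular M \<gamma> D C \<Longrightarrow> bounded S \<Longrightarrow> 0 < q \<Longrightarrow>
    qnorm p M (\<lambda>x. majorant S coef \<rho> j (\<gamma> x))
      \<le> ennreal (2 powr - (real j * (s - (real DIM('y) - real D) * enn2real (1 / p)))) * (ennreal K * b_norm s p q S coef)"
    by (rule majorant_qnorm[OF p \<rho> C]) (rule that)
  obtain C1 where C1: "C1 > 0" and C1_le: "\<And>M (u :: nat \<Rightarrow> 'm \<Rightarrow> ennreal) T.
    (\<forall>k. u k \<in> borel_measurable M) \<Longrightarrow>
    (\<forall>k. qnorm p M (u k) \<le> ennreal (2 powr - (real k * (s - (real DIM('y) - real D) * enn2real (1 / p)))) * T) \<Longrightarrow>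
    qnorm p M (\<lambda>x. \<Sum>k. u k x) \<le> ennreal C1 * T"
    by (rule qnorm_geometric_suminf[OF p \<sigma>]) (rule that)
  note meas = majorant_measurable[OF S \<gamma>]
  have "qnorm p M (\<lambda>x. \<Sum>j. majorant S coef \<rho> j (\<gamma> x)) \<le> ennreal C1 * (ennreal K * b_norm s p q S coef)"
    by (intro C1_le allI meas K_le reg S q)
  also have "\<dots> < top" using b by (simp add: ennreal_mult_less_top)
  finally show ?thesis by (rule AE_of_qnorm_less_top[OF p, rotated]) (intro borel_measurable_suminf_order meas)
qed

text \<open>
  The re-expansion for atoms \<open>a0\<close> composed with \<open>\<beta>\<close> and multiplied by a Lipschitz function
  \<open>\<eta>\<close>, such as a function of the partition of unity. The indices of smoothness are written so that
  they come out as \<open>s\<close> in a space with the dimension of the parameters, and as \<open>s + 1/p\<close> in a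
  space of one dimension more.
\<close>

lemma transported_series:
  fixes \<alpha> :: "'v::euclidean_space \<Rightarrow> 'x::euclidean_space" and \<beta> :: "'v \<Rightarrow> 'y::euclidean_space"
    and \<eta> :: "'v \<Rightarrow> real"
  assumes p: "0 < p" and q: "0 < q" and s: "0 < s" "s < 1" and d: "1 \<le> d" and d0: "0 < d0" and k0: "1 \<le> k0"
    and \<alpha>: "bilipschitz L \<alpha>" and \<beta>: "bilipschitz L \<beta>" and W: "bounded W" "W \<in> sets lebesgue" and S: "bounded S"
    and M: "0 \<le> M" and \<eta>_bound: "\<And>y. y \<in> W \<Longrightarrow> \<bar>\<eta> y\<bar> \<le> M"
    and \<eta>_lip: "\<And>y y'. y \<in> W \<Longrightarrow> y' \<in> W \<Longrightarrow> \<bar>\<eta> y - \<eta> y'\<bar> \<le> M * norm (y - y')"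
    and a0: "\<forall>j. \<forall>m\<in>cubes_meeting S j. atom d0 k0 j m (a0 j m)"
    and b: "b_norm (s + (real DIM('y) - real DIM('v)) * enn2real (1 / p)) p q S coef < top"
  obtains c a where
    "\<forall>l z. atom d k l z (a l z)" "\<forall>l z. z \<notin> cubes_meeting (\<alpha> ` W) l \<longrightarrow> c l z = 0"
    "\<forall>l z x. a l z x \<noteq> 0 \<longrightarrow> dyadic_bump l z x \<noteq> 0"
    "b_norm (s + (real DIM('x) - real DIM('v)) * enn2real (1 / p)) p q (\<alpha> ` W) c < top"
    "AE y in lebesgue_on W. (\<lambda>l. lev (\<alpha> ` W) c a l (\<alpha> y)) sums (complex_of_real (\<eta> y) * (\<Sum>j. lev S coef a0 j (\<beta> y)))"
proof -
  let ?n = "real DIM('y)"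
  \<comment> \<open>One constant for the bounds, the Lipschitz constants and the localization of the atoms.\<close>
  define A where "A = 1 + M + M * ?n * L + ?n * d0"
  have L: "1 \<le> L" using \<alpha> unfolding bilipschitz_def by blast
  have nn: "0 \<le> M * ?n * L" "0 \<le> ?n * d0" using M L d0 by simp_all
  define b' where "b' j m y = complex_of_real (\<eta> y) * a0 j m (\<beta> y)" for j m y
  interpret E: lipschitz_atoms \<alpha> \<beta> W "\<lambda>j. cubes_meeting S j" coef b' L A
  proof
    show "bilipschitz L \<alpha>" "bilipschitz L \<beta>" "bounded W" using \<alpha> \<beta> W(1) by blast+
    show "1 \<le> A" using M nn by (simp add: A_def)
    fix j
    show "finite (cubes_meeting S j)" by (rule finite_cubes_meeting[OF S])
    show "cubes_meeting S j \<subseteq> int_lattice" by (auto simp: cubes_meeting_def)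
    fix m y assume m: "m \<in> cubes_meeting S j" and y: "y \<in> W"
    note at = atomD[OF a0[rule_format, OF m]]
    have "norm (b' j m y) \<le> M * 1"
      unfolding b'_def norm_mult norm_of_real using \<eta>_bound[OF y] at(4) M by (intro mult_mono) auto
    then show "norm (b' j m y) \<le> A" using nn by (simp add: A_def)
    show "norm (2 ^ j *\<^sub>R \<beta> y - m) \<le> A" if "b' j m y \<noteq> 0"
    proof -
      have "\<beta> y \<in> cube d0 j m" using that at(5) by (auto simp: b'_def)
      then have "norm (2 ^ j *\<^sub>R \<beta> y - m) \<le> ?n * d0" by (rule cube_norm_le)
      then show ?thesis using nn M by (simp add: A_def)
    qed
    fix y' assume y': "y' \<in> W"
    have "b' j m y - b' j m y' = complex_of_real (\<eta> y) * (a0 j m (\<beta> y) - a0 j m (\<beta> y')) + complex_of_real (\<eta> y - \<eta> y') * a0 j m (\<beta> y')"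
      by (simp add: b'_def algebra_simps)
    then have "norm (b' j m y - b' j m y') \<le> \<bar>\<eta> y\<bar> * norm (a0 j m (\<beta> y) - a0 j m (\<beta> y')) + \<bar>\<eta> y - \<eta> y'\<bar> * norm (a0 j m (\<beta> y'))"
      using norm_triangle_ineq by (metis norm_mult norm_of_real)
    also have "\<dots> \<le> M * (?n * 1 * 2 ^ j * (L * norm (y - y'))) + (M * norm (y - y')) * 1"
    proof (intro add_mono mult_mono)
      have "norm (\<beta> y - \<beta> y') \<le> L * norm (y - y')" using \<beta> unfolding bilipschitz_def by blast
      then have "?n * 1 * 2 ^ j * norm (\<beta> y - \<beta> y') \<le> ?n * 1 * 2 ^ j * (L * norm (y - y'))" by (intro mult_left_mono) auto
      then show "norm (a0 j m (\<beta> y) - a0 j m (\<beta> y')) \<le> ?n * 1 * 2 ^ j * (L * norm (y - y'))"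
        using C_k_bound_lipschitz[OF at(1) k0, of "\<beta> y" "\<beta> y'"] by linarith
    qed (use \<eta>_bound[OF y] \<eta>_lip[OF y y'] at(4) M in auto)
    also have "\<dots> \<le> M * (?n * 1 * 2 ^ j * (L * norm (y - y'))) + M * (2 ^ j * norm (y - y'))"
      using M by (simp add: mult_left_mono mult_le_cancel_right1)
    also have "\<dots> = (M * ?n * L + M) * (2 ^ j * norm (y - y'))" by (simp add: algebra_simps)
    also have "\<dots> \<le> A * (2 ^ j * norm (y - y'))" using nn by (intro mult_right_mono) (auto simp: A_def)
    finally show "norm (b' j m y - b' j m y') \<le> A * 2 ^ j * norm (y - y')" by (simp add: mult.assoc)
  qed
  have fin: "ell_norm q UNIV (\<lambda>j. ennreal (2 powr (real j * (s - real DIM('v) * enn2real (1 / p)))) *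
      ell_norm p (cubes_meeting S j) (\<lambda>m. ennreal (norm (coef j m)))) < top"
    using b unfolding b_norm_def by (simp add: algebra_simps)
  obtain c a where ca: "\<And>l z. atom d k l z (a l z)" "\<And>l z. z \<notin> E.cubes l \<Longrightarrow> c l z = 0"
    "\<And>l z x. a l z x \<noteq> 0 \<Longrightarrow> dyadic_bump l z x \<noteq> 0"
    "\<And>J y. y \<in> W \<Longrightarrow>
      norm ((\<Sum>l<Suc J. \<Sum>z\<in>E.cubes l. c l z * a l z (\<alpha> y)) - E.partial (Suc J) y) \<le> E.osc * E.size J y"
    "ell_norm q UNIV (\<lambda>l. ennreal (2 powr (real l * (s - real DIM('v) * enn2real (1 / p)))) *
      ell_norm p (E.cubes l) (\<lambda>z. ennreal (norm (c l z)))) < top"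
    by (rule E.reexpansion[OF p q s(2) d fin]) (rule that)
  have bc: "b_norm (s + (real DIM('x) - real DIM('v)) * enn2real (1 / p)) p q (\<alpha> ` W) c < top"
    using ca(5) unfolding b_norm_def by (simp add: algebra_simps)
  have rad: "0 < E.rad" using E.A by (simp add: E.rad_def add_pos_nonneg)
  have "AE y in lebesgue_on W. (\<Sum>j. majorant S coef E.rad j (\<beta> y)) < top"
    using s(1) by (intro majorant_summable_AE[OF p q rad upper_regular_lebesgue[OF \<beta> W(2)] S _ b]) simp
  moreover have "AE y in lebesgue_on W. y \<in> W" by (rule AE_I2) simp
  ultimately have "AE y in lebesgue_on W. (\<lambda>l. lev (\<alpha> ` W) c a l (\<alpha> y)) sums (complex_of_real (\<eta> y) * (\<Sum>j. lev S coef a0 j (\<beta> y)))"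
  proof eventually_elim
    case (elim y)
    have "(\<Sum>j. ennreal (E.near j y)) \<noteq> top" using elim(1) unfolding E.ennreal_near majorant_def by simp
    then have near: "summable (\<lambda>j. E.near j y)" by (rule summable_suminf_not_top[rotated]) (rule E.near_nonneg)
    have lvl: "E.level j y = complex_of_real (\<eta> y) * lev S coef a0 j (\<beta> y)" for j
      unfolding E.level_def lev_def b'_def by (simp add: sum_distrib_left mult_ac)
    have sl: "summable (\<lambda>j. E.level j y)"
      by (rule summable_comparison_test'[OF summable_mult[OF near, of A], of 0]) (rule E.level_bound[OF elim(2)])
    have "(\<Sum>j. E.level j y) = complex_of_real (\<eta> y) * (\<Sum>j. lev S coef a0 j (\<beta> y))"
    proof (cases "\<eta> y = 0")
      case True
      then show ?thesis by (simp add: lvl)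
    next
      case False
      then have "summable (\<lambda>j. lev S coef a0 j (\<beta> y))" using sl unfolding lvl by (simp add: summable_cmult_iff)
      then show ?thesis unfolding lvl by (rule suminf_mult)
    qed
    moreover have "(\<lambda>J. E.partial (Suc J) y) \<longlonglongrightarrow> (\<Sum>j. E.level j y)"
      unfolding E.partial_def using summable_LIMSEQ[OF sl] by (rule LIMSEQ_Suc)
    moreover have "(\<lambda>J. (\<Sum>l<Suc J. lev (\<alpha> ` W) c a l (\<alpha> y)) - E.partial (Suc J) y) \<longlonglongrightarrow> 0"
    proof (rule Lim_null_comparison)
      show "\<forall>\<^sub>F J in sequentially. norm ((\<Sum>l<Suc J. lev (\<alpha> ` W) c a l (\<alpha> y)) - E.partial (Suc J) y) \<le> E.osc * E.size J y"
        unfolding lev_def by (intro always_eventually allI ca(4) elim(2))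
      show "(\<lambda>J. E.osc * E.size J y) \<longlonglongrightarrow> 0"
        using tendsto_mult_left[OF E.size_tendsto_0[OF near], of E.osc] by simp
    qed
    ultimately have "(\<lambda>J. (\<Sum>l<Suc J. lev (\<alpha> ` W) c a l (\<alpha> y))) \<longlonglongrightarrow> complex_of_real (\<eta> y) * (\<Sum>j. lev S coef a0 j (\<beta> y))"
      using Lim_transform by fastforce
    then show ?case unfolding sums_def by (rule LIMSEQ_imp_Suc)
  qed
  then show thesis using that[of a c] ca(1-3) bc by blast
qed

text \<open>
  Where a bump does not vanish, its cube contains a neighbourhood; so at points of the closure of T
  only cubes that meet T contribute.
\<close>

lemma lev_change_set:
  fixes S T :: "'x::euclidean_space set"
  assumes S: "bounded S" and T: "bounded T"
    and c: "\<forall>l z. z \<notin> cubes_meeting S l \<longrightarrow> c l z = 0"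
    and a: "\<forall>l z x. a l z x \<noteq> 0 \<longrightarrow> dyadic_bump l z x \<noteq> 0" and x: "x \<in> closure T"
  shows "lev S c a l x = lev T c a l x"
proof -
  let ?U = "cubes_meeting S l \<union> cubes_meeting T l"
  have fin: "finite ?U" using finite_cubes_meeting S T by blast
  have "lev S c a l x = (\<Sum>z\<in>?U. c l z * a l z x)"
    unfolding lev_def using fin c by (intro sum.mono_neutral_left) auto
  also have "\<dots> = lev T c a l x"
    unfolding lev_def
  proof (intro sum.mono_neutral_right fin ballI)
    fix z assume z: "z \<in> ?U - cubes_meeting T l"
    show "c l z * a l z x = 0"
    proof (rule ccontr)
      assume "c l z * a l z x \<noteq> 0"
      then have bump: "dyadic_bump l z x \<noteq> 0" using a by auto
      let ?V = "\<Inter>i\<in>Basis. {x'. \<bar>2 ^ l * (x' \<bullet> i) - z \<bullet> i\<bar> < 1}"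
      have "open ?V" by (intro open_INT finite_Basis ballI open_Collect_less continuous_intros)
      moreover have "x \<in> ?V" using dyadic_bump_nonzero[OF bump] by blast
      ultimately have "?V \<inter> T \<noteq> {}" using open_Int_closure_eq_empty[of ?V T] x by blast
      then obtain x' where "x' \<in> ?V" "x' \<in> T" by blast
      then have "x' \<in> cube 1 l z \<inter> T" by (force simp: cube_iff)
      moreover have "z \<in> int_lattice" using z by (auto simp: cubes_meeting_def)
      ultimately show False using z by (auto simp: cubes_meeting_def)
    qed
  qed blast
  finally show ?thesis .
qed

lemma b_norm_change_set:
  assumes p: "0 < p" and q: "0 < q" and S: "bounded S" and T: "bounded T"
    and c: "\<forall>l z. z \<notin> cubes_meeting S l \<longrightarrow> c l z = 0"
  shows "b_norm s p q T c \<le> b_norm s p q S c"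
  unfolding b_norm_def
  using c by (intro ell_norm_nat_mono q mult_left_mono ell_norm_mono_neutral p finite_cubes_meeting S T) auto

text \<open>The sum of the bumps of a fine level at the cubes that meet X.\<close>

lemma cutoff_function:
  fixes X U :: "'x::euclidean_space set"
  assumes X: "compact X" "X \<subseteq> U" and U: "open U" "bounded U"
  obtains \<zeta> :: "'x \<Rightarrow> complex" and B where "0 < B" "C_k_bound k 0 B \<zeta>"
    "\<forall>x\<in>X. \<zeta> x = 1" "\<forall>x. \<zeta> x \<noteq> 0 \<longrightarrow> x \<in> U"
proof -
  let ?n = "real DIM('x)"
  obtain e where e: "0 < e" "(\<Union>x\<in>X. ball x e) \<subseteq> U"
    by (rule compact_subset_open_imp_ball_epsilon_subset[OF X(1) U(1) X(2)]) (rule that)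
  obtain l :: nat where l: "2 * ?n / e < 2 ^ l" using real_arch_pow[of 2 "2 * ?n / e"] by auto
  define \<zeta> :: "'x \<Rightarrow> complex" where "\<zeta> x = (\<Sum>z\<in>cubes_meeting X l. dyadic_bump l z x)" for x
  have bX: "bounded X" using X(1) by (rule compact_imp_bounded)
  have U_of: "x \<in> U" if nz: "\<zeta> x \<noteq> 0" for x
  proof -
    obtain z where z: "z \<in> cubes_meeting X l" "dyadic_bump l z x \<noteq> 0"
      using nz unfolding \<zeta>_def by (rule sum.not_neutral_contains_not_neutral)
    obtain x' where x': "x' \<in> cube 1 l z" "x' \<in> X" using z(1) by (auto simp: cubes_meeting_def)
    have "norm (2 ^ l *\<^sub>R x - z) \<le> ?n" "norm (2 ^ l *\<^sub>R x' - z) \<le> ?n"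
      using cube_norm_le[OF dyadic_bump_cube[OF z(2)]] cube_norm_le[OF x'(1)] by simp_all
    then have "norm ((2 ^ l *\<^sub>R x' - z) - (2 ^ l *\<^sub>R x - z)) \<le> 2 * ?n"
      using norm_triangle_ineq4[of "2 ^ l *\<^sub>R x' - z" "2 ^ l *\<^sub>R x - z"] by linarith
    moreover have "(2 ^ l *\<^sub>R x' - z) - (2 ^ l *\<^sub>R x - z) = 2 ^ l *\<^sub>R (x' - x)" by (simp add: scaleR_diff_right)
    ultimately have "2 ^ l * norm (x' - x) \<le> 2 * ?n" by simp
    also have "\<dots> < 2 ^ l * e" using l e(1) by (simp add: pos_divide_less_eq)
    finally have "dist x' x < e" by (simp add: dist_norm)
    then have "x \<in> ball x' e" by simp
    then show ?thesis using e(2) x'(2) by blast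
  qed
  have "bounded {x. \<zeta> x \<noteq> 0}" using U(2) by (rule bounded_subset) (use U_of in blast)
  then have cs: "compact (supp \<zeta>)" by (simp add: supp_def compact_eq_bounded_closed bounded_closure)
  have Ck: "C_k k \<zeta>"
  proof -
    obtain B where "1 \<le> B" "C_k_bound k 0 B (lattice_bump :: 'x \<Rightarrow> complex)" by (rule C_k_bound_lattice_bump) (rule that)
    then show ?thesis unfolding \<zeta>_def by (intro C_k_sum C_k_bound_C_k[OF C_k_bound_dyadic_bump])
  qed
  obtain B where B: "0 < B" "C_k_bound k 0 B \<zeta>" by (rule C_k_compact_supp_bounded[OF Ck cs]) (rule that)
  have "\<forall>x\<in>X. \<zeta> x = 1" unfolding \<zeta>_def using sum_dyadic_bump[OF finite_cubes_meeting[OF bX]] by blast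
  then show thesis using that[OF B] U_of by blast
qed

lemma trace_expansion_0:
  fixes \<Omega> :: "('a::euclidean_space \<times> real) set"
  assumes p: "0 < p" and q: "0 < q" and "bounded \<Omega>"
  shows "trace_expansion d k s p q \<Omega> (\<lambda>_ _. 0) (\<lambda>_ _ _. 0) (\<lambda>_. 0) (\<lambda>_. 0)"
proof -
  have "ell_norm p (cubes_meeting \<Omega> j) (\<lambda>_. 0) = 0" for j
    using ell_norm_cmult[OF p finite_cubes_meeting[OF assms(3)], of 0 j "\<lambda>m. 0"] by simp
  moreover have "ell_norm q UNIV (\<lambda>j::nat. 0) \<le> 0"
    unfolding ell_norm_nat using qnorm_cmult_le[OF q, of "\<lambda>j. 0" "count_space UNIV" 0] by simp
  ultimately have "b_norm s p q \<Omega> (\<lambda>_ _. 0) < top" by (simp add: b_norm_def)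
  moreover have "atom d k j m (\<lambda>_. 0)" for j and m :: "'a \<times> real"
    unfolding atom_iff using C_k_bound_const_0[of 1] by (simp add: supp_def)
  ultimately show ?thesis unfolding trace_expansion_def lev_def by simp
qed


section \<open>The trace theorem\<close>

context
  fixes \<Omega> :: "('a::euclidean_space \<times> real) set" and N K \<psi> and \<phi> :: "nat \<Rightarrow> 'a \<times> real \<Rightarrow> real"
  assumes atlas: "lipschitz_atlas \<Omega> N K \<psi>" and dom: "open \<Omega>" "bounded \<Omega>"
    and unity: "resolution_of_unity \<Omega> N K \<phi>"
begin

lemma unityD:
  assumes "r \<le> N"
  shows "smooth (\<phi> r)" "supp (\<phi> r) \<subseteq> K r"
proof -
  have "\<forall>j\<le>N. smooth (\<phi> j) \<and> (\<forall>x. \<phi> j x \<ge> 0) \<and> supp (\<phi> j) \<subseteq> K j"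
    using unity unfolding resolution_of_unity_def by (elim conjE)
  then show "smooth (\<phi> r)" "supp (\<phi> r) \<subseteq> K r" using assms by simp_all
qed

lemma chart_domain:
  assumes "r \<in> {1..N}"
  shows "open (K r)" "bounded (K r)" "compact (supp (\<phi> r))"
proof -
  obtain c \<rho> where K: "K r = ball c \<rho>" using lipschitz_atlasD(1)[OF atlas assms] by blast
  then show "open (K r)" "bounded (K r)" by simp_all
  then have "bounded (supp (\<phi> r))" using unityD(2)[of r] assms by (auto intro: bounded_subset)
  then show "compact (supp (\<phi> r))" by (simp add: supp_def compact_eq_bounded_closed)
qed

lemma supp_nonzero: "\<phi> r x \<noteq> 0 \<Longrightarrow> x \<in> supp (\<phi> r)"
  unfolding supp_def by (rule subsetD[OF closure_subset]) simp

text \<open>The function \<open>\<phi> 0\<close> is supported inside \<open>\<Omega>\<close>.\<close>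

lemma sum_unity:
  assumes "x \<in> frontier \<Omega>"
  shows "(\<Sum>r\<in>{1..N}. \<phi> r x) = 1"
proof -
  have "x \<in> closure \<Omega>" "x \<notin> \<Omega>" using assms dom(1) by (auto simp: frontier_def interior_open)
  moreover have "supp (\<phi> 0) \<subseteq> \<Omega>"
    using unityD(2)[of 0] unity closure_subset[of "K 0"] unfolding resolution_of_unity_def by fastforce
  ultimately have z: "\<phi> 0 x = 0" using supp_nonzero[of 0 x] by blast
  have t: "(\<Sum>r\<le>N. \<phi> r x) = 1"
    using unity unfolding resolution_of_unity_def by (elim conjE) (rule bspec[OF _ \<open>x \<in> closure \<Omega>\<close>])
  have e: "(\<Sum>r\<le>N. \<phi> r x) = \<phi> 0 x + (\<Sum>r\<in>{1..N}. \<phi> r x)"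
    by (simp only: atMost_atLeast0 sum.atLeast_Suc_atMost[OF le0] One_nat_def)
  show ?thesis using t unfolding e z by (simp only: add_0_left)
qed

text \<open>
  A trace is the sum on the boundary of an atomic series in the domain; its local part is this series in a
  chart, multiplied by \<open>\<phi> r\<close>.
\<close>

lemma trace_in_besov_boundary:
  assumes p: "0 < p" and q: "0 < q" and s: "0 < s" "s < 1" and d: "1 \<le> d" and d': "1 \<le> d'" and k: "1 \<le> k"
    and tr: "has_trace d k (s + enn2real (1 / p)) p q \<Omega> f g"
  shows "g \<in> besov_boundary d' k' s p q \<Omega> N K \<psi> \<phi>"
proof -
  let ?S = "surface_measure (frontier \<Omega>)" and ?s = "s + enn2real (1 / p)"
  have s': "0 < ?s" "enn2real (1 / p) < ?s" using s by (simp_all add: add_pos_nonneg)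
  have d0: "0 < d" "0 < d'" using d d' by simp_all
  have gL: "g \<in> lp_space p ?S" and f: "f \<in> besov d k ?s p q \<Omega>" using tr unfolding has_trace_def by blast+
  obtain coef a where ex: "trace_expansion d k ?s p q \<Omega> coef a f (\<lambda>x. \<Sum>j. lev \<Omega> coef a j x)"
    by (rule trace_expansion_of_besov[OF atlas dom p q s'(1) d0(1) f]) (rule that)
  have g_eq: "AE x in ?S. g x = (\<Sum>j. lev \<Omega> coef a j x)"
    by (rule has_trace_unique[OF atlas dom p tr has_trace_of_expansion[OF atlas dom p q d s'(2) ex]])
  have "local_part \<psi> \<phi> g r \<in> besov d' k' s p q (chart_image \<Omega> K \<psi> r)" if r: "r \<in> {1..N}" for r
  proof -
    let ?W = "chart_image \<Omega> K \<psi> r" and ?sl = "slice (\<psi> r) 0"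
    have W: "bounded ?W" "?W \<in> sets lebesgue" using chart_image_bounded[OF atlas r] chart_image_lebesgue[OF atlas r] by blast+
    obtain L where L: "bilipschitz L (\<psi> r)" "\<And>\<tau>. bilipschitz L (slice (\<psi> r) \<tau>)" using chart_bilipschitz[OF atlas r] by blast
    have L1: "1 \<le> L" using L(1) unfolding bilipschitz_def by blast
    have "C_k 1 (\<phi> r)" using unityD(1)[of r] r unfolding smooth_def by auto
    then obtain A where A: "0 < A" "C_k_bound 1 0 A (\<phi> r)"
      by (rule C_k_compact_supp_bounded[OF _ chart_domain(3)[OF r]]) (rule that)
    define M where "M = A + real DIM('a \<times> real) * A * L"
    have M: "0 \<le> real DIM('a \<times> real) * A * L" using A L1 by simp
    have M0: "0 \<le> M" using M A(1) by (simp add: M_def)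
    have bound: "\<bar>\<phi> r (?sl y)\<bar> \<le> M" for y using C_k_bound_norm[OF A(2), of "?sl y"] M by (simp add: M_def)
    have lip: "\<bar>\<phi> r (?sl y) - \<phi> r (?sl y')\<bar> \<le> M * norm (y - y')" for y y'
    proof -
      have "\<bar>\<phi> r (?sl y) - \<phi> r (?sl y')\<bar> \<le> real DIM('a \<times> real) * A * norm (?sl y - ?sl y')"
        using C_k_bound_lipschitz[OF A(2), of "?sl y" "?sl y'"] by simp
      also have "\<dots> \<le> real DIM('a \<times> real) * A * (L * norm (y - y'))"
        using L(2)[of 0] A(1) unfolding bilipschitz_def by (intro mult_left_mono) (blast, simp)
      also have "\<dots> \<le> M * norm (y - y')"
        unfolding M_def mult.assoc[symmetric] using A(1) by (intro mult_right_mono) auto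
      finally show ?thesis .
    qed
    have b: "b_norm (s + (real DIM('a \<times> real) - real DIM('a)) * enn2real (1 / p)) p q \<Omega> coef < top"
      using trace_expansionD(2)[OF ex] by simp
    obtain c a' where ca: "\<forall>l z. atom d' k' l z (a' l z)" "\<forall>l z. z \<notin> cubes_meeting ((\<lambda>y. y) ` ?W) l \<longrightarrow> c l z = 0"
      "\<forall>l z x. a' l z x \<noteq> 0 \<longrightarrow> dyadic_bump l z x \<noteq> 0"
      "b_norm (s + (real DIM('a) - real DIM('a)) * enn2real (1 / p)) p q ((\<lambda>y. y) ` ?W) c < top"
      "AE y in lebesgue_on ?W. (\<lambda>l. lev ((\<lambda>y. y) ` ?W) c a' l y) sums (complex_of_real (\<phi> r (?sl y)) * (\<Sum>j. lev \<Omega> coef a j (?sl y)))"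
      by (rule transported_series[OF p q s d' d0(1) k bilipschitz_mono[OF bilipschitz_id L1] L(2) W dom(2) M0 bound lip
            trace_expansionD(1)[OF ex] b]) (rule that)
    have "AE y in lebesgue_on ?W. g (?sl y) = (\<Sum>j. lev \<Omega> coef a j (?sl y))" by (rule AE_chart_of_surface[OF atlas r g_eq])
    then have "AE y in lebesgue_on ?W. local_part \<psi> \<phi> g r y = (\<Sum>l. lev ?W c a' l y)"
      using ca(5)
    proof eventually_elim
      case (elim y)
      have "local_part \<psi> \<phi> g r y = complex_of_real (\<phi> r (?sl y)) * g (?sl y)" by (simp add: local_part_def slice_def Let_def)
      then show ?case using elim by (simp add: sums_iff)
    qed
    then show ?thesis
      using ca(1,4) by (intro besov_of_AE(1)[OF p q s(1) d0(2) W]) auto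
  qed
  then show ?thesis using gL unfolding besov_boundary_def by blast
qed

text \<open>
  A representation of the local part is transported from the chart domain to \<open>\<real>\<^sup>n\<close>. The new atoms
  may reach parts of the boundary outside \<open>K r\<close>, where the chart says nothing about their sum. A
  smooth cutoff \<open>\<zeta>\<close> that is 1 on the support of \<open>\<phi> r\<close> removes them there; up to a constant, products
  of atoms with \<open>\<zeta>\<close> are atoms.
\<close>

lemma local_extension:
  assumes p: "0 < p" and q: "0 < q" and s: "0 < s" "s < 1" and d: "1 \<le> d" and d': "1 \<le> d'" and k': "1 \<le> k'"
    and g: "g \<in> besov_boundary d' k' s p q \<Omega> N K \<psi> \<phi>" and r: "r \<in> {1..N}"
  shows "\<exists>f c a. trace_expansion d k (s + enn2real (1 / p)) p q \<Omega> c a f (\<lambda>x. complex_of_real (\<phi> r x) * g x)"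
proof -
  let ?S = "surface_measure (frontier \<Omega>)" and ?s = "s + enn2real (1 / p)"
  let ?W = "chart_image \<Omega> K \<psi> r" and ?sl = "slice (\<psi> r) 0"
  have d0: "0 < d" "0 < d'" using d d' by simp_all
  have W: "bounded ?W" "?W \<in> sets lebesgue" using chart_image_bounded[OF atlas r] chart_image_lebesgue[OF atlas r] by blast+
  obtain L where L: "bilipschitz L (\<psi> r)" "\<And>\<tau>. bilipschitz L (slice (\<psi> r) \<tau>)" using chart_bilipschitz[OF atlas r] by blast
  have L1: "1 \<le> L" using L(1) unfolding bilipschitz_def by blast
  have gm: "g \<in> borel_measurable ?S" using g unfolding besov_boundary_def lp_space_def by blast
  have loc: "local_part \<psi> \<phi> g r \<in> besov d' k' s p q ?W" using g r unfolding besov_boundary_def by blast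
  then obtain coef a0 where rep: "atomic_representation d' k' p ?W (local_part \<psi> \<phi> g r) coef a0" and b0: "b_norm s p q ?W coef < top"
    unfolding besov_def by blast
  have a0: "\<forall>j. \<forall>m\<in>cubes_meeting ?W j. atom d' k' j m (a0 j m)"
    using rep unfolding atomic_representation_iff[OF W(1)] by blast
  have locm: "local_part \<psi> \<phi> g r \<in> borel_measurable (lebesgue_on ?W)" using loc unfolding besov_def lp_space_def by blast
  have loc_eq: "AE y in lebesgue_on ?W. local_part \<psi> \<phi> g r y = (\<Sum>j. lev ?W coef a0 j y)"
    by (rule representation_AE[OF p q s(1) d0(2) W locm rep b0])
  let ?X = "?sl ` ?W"
  have b: "b_norm (s + (real DIM('a) - real DIM('a)) * enn2real (1 / p)) p q ?W coef < top" using b0 by simp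
  have one: "0 \<le> (1::real)" "\<And>y. \<bar>1::real\<bar> \<le> 1" "\<And>y y' :: 'a. \<bar>(1::real) - 1\<bar> \<le> 1 * norm (y - y')" by simp_all
  obtain c a where ca: "\<forall>l z. atom d k l z (a l z)" "\<forall>l z. z \<notin> cubes_meeting ?X l \<longrightarrow> c l z = 0"
    "\<forall>l z x. a l z x \<noteq> 0 \<longrightarrow> dyadic_bump l z x \<noteq> 0"
    "b_norm (s + (real DIM('a \<times> real) - real DIM('a)) * enn2real (1 / p)) p q ?X c < top"
    "AE y in lebesgue_on ?W. (\<lambda>l. lev ?X c a l (?sl y)) sums (complex_of_real 1 * (\<Sum>j. lev ?W coef a0 j y))"
    by (rule transported_series[OF p q s d d0(2) k' L(2)[of 0] bilipschitz_mono[OF bilipschitz_id L1] W W(1) one a0 b]) (rule that)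
  have sub: "?X \<subseteq> frontier \<Omega>" using chart_image_iff[OF atlas r] by blast
  have "compact (frontier \<Omega>)" using dom(2) by (rule compact_frontier_bounded)
  then have X: "bounded ?X" using sub compact_imp_bounded bounded_subset by blast
  have fcl: "frontier \<Omega> \<subseteq> closure \<Omega>" by (auto simp: frontier_def)
  obtain \<zeta> :: "'a \<times> real \<Rightarrow> complex" and B where \<zeta>: "0 < B" "C_k_bound k 0 B \<zeta>"
      "\<forall>x\<in>supp (\<phi> r). \<zeta> x = 1" "\<forall>x. \<zeta> x \<noteq> 0 \<longrightarrow> x \<in> K r"
    by (rule cutoff_function[OF chart_domain(3)[OF r] _ chart_domain(1,2)[OF r]]) (use unityD(2) r in auto)
  \<comment> \<open>The product rule costs \<open>2\<^sup>k\<close>, the cutoff B.\<close>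
  define R where "R = 2 ^ k * B"
  have R: "0 < R" using \<zeta>(1) by (simp add: R_def)
  define c' where "c' l z = complex_of_real R * c l z" for l z
  define a' where "a' l z x = complex_of_real (1 / R) * (\<zeta> x * a l z x)" for l z x
  have a': "atom d k l z (a' l z)" for l z
  proof -
    note at = atomD[OF ca(1)[rule_format, of l z]]
    have "C_k_bound k l (2 ^ k * B * 1) (\<lambda>x. \<zeta> x * a l z x)"
      by (rule C_k_bound_mult[OF C_k_bound_mono[OF \<zeta>(2) order_refl _ order_refl] at(1)]) simp
    from C_k_bound_cmult[OF this, of "complex_of_real (1 / R)"]
    have "C_k_bound k l 1 (a' l z)" unfolding a'_def using \<zeta>(1) by (simp add: R_def norm_divide norm_mult norm_power)
    moreover have "supp (a' l z) \<subseteq> cube d l z"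
      unfolding supp_subset_iff[OF closed_cube] a'_def using at(5) by auto
    ultimately show ?thesis unfolding atom_iff by blast
  qed
  have lev': "lev \<Omega> c' a' l x = \<zeta> x * lev ?X c a l x" if "x \<in> frontier \<Omega>" for l x
  proof -
    have "c' l z * a' l z x = \<zeta> x * (c l z * a l z x)" for z using R by (simp add: c'_def a'_def)
    then have "lev \<Omega> c' a' l x = \<zeta> x * lev \<Omega> c a l x" unfolding lev_def sum_distrib_left by (simp only:)
    moreover have "x \<in> closure \<Omega>" using fcl that by blast
    ultimately show ?thesis using lev_change_set[OF X dom(2) ca(2,3), of x l] by (simp only:)
  qed
  have "b_norm ?s p q \<Omega> c \<le> b_norm ?s p q ?X c" by (rule b_norm_change_set[OF p q X dom(2) ca(2)])
  then have bc: "b_norm ?s p q \<Omega> c < top" using ca(4) by simp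
  have bc': "b_norm ?s p q \<Omega> c' < top"
  proof -
    let ?w = "\<lambda>j. ennreal (2 powr (real j * (?s - real DIM('a \<times> real) * enn2real (1 / p))))"
    have "?w j * ell_norm p (cubes_meeting \<Omega> j) (\<lambda>m. ennreal (norm (c' j m)))
      \<le> ennreal R * (?w j * ell_norm p (cubes_meeting \<Omega> j) (\<lambda>m. ennreal (norm (c j m))))" for j
    proof -
      have "ell_norm p (cubes_meeting \<Omega> j) (\<lambda>m. ennreal (norm (c' j m)))
        = ell_norm p (cubes_meeting \<Omega> j) (\<lambda>m. ennreal R * ennreal (norm (c j m)))"
        using R by (simp add: c'_def norm_mult ennreal_mult)
      also have "\<dots> \<le> ennreal R * ell_norm p (cubes_meeting \<Omega> j) (\<lambda>m. ennreal (norm (c j m)))"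
        using R by (intro ell_norm_cmult[OF p finite_cubes_meeting[OF dom(2)]]) simp
      finally have "?w j * ell_norm p (cubes_meeting \<Omega> j) (\<lambda>m. ennreal (norm (c' j m)))
        \<le> ?w j * (ennreal R * ell_norm p (cubes_meeting \<Omega> j) (\<lambda>m. ennreal (norm (c j m))))" by (rule mult_left_mono) simp
      then show ?thesis by (simp only: mult.left_commute)
    qed
    then have "b_norm ?s p q \<Omega> c' \<le> ell_norm q UNIV (\<lambda>j. ennreal R * (?w j * ell_norm p (cubes_meeting \<Omega> j) (\<lambda>m. ennreal (norm (c j m)))))"
      unfolding b_norm_def by (intro ell_norm_nat_mono q)
    also have "\<dots> \<le> ennreal R * b_norm ?s p q \<Omega> c"
      unfolding b_norm_def ell_norm_nat by (intro qnorm_cmult_le q) simp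
    also have "\<dots> < top" using bc by (simp add: ennreal_mult_less_top)
    finally show ?thesis .
  qed
  have "AE y in lebesgue_on ?W. (\<lambda>l. lev ?X c a l (?sl y)) sums (complex_of_real (\<phi> r (?sl y)) * g (?sl y))"
    using ca(5) loc_eq
  proof eventually_elim
    case (elim y)
    have "local_part \<psi> \<phi> g r y = complex_of_real (\<phi> r (?sl y)) * g (?sl y)" by (simp add: local_part_def slice_def Let_def)
    then show ?case using elim by simp
  qed
  then have "AE x in ?S. x \<in> K r \<longrightarrow> (\<lambda>l. lev ?X c a l x) sums (complex_of_real (\<phi> r x) * g x)"
    by (rule AE_surface_of_chart[OF atlas r])
  moreover have "AE x in ?S. x \<in> frontier \<Omega>" by (rule AE_I2) (simp add: surface_measure_sets(2))
  ultimately have "AE x in ?S. complex_of_real (\<phi> r x) * g x = (\<Sum>l. lev \<Omega> c' a' l x)"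
  proof eventually_elim
    case (elim x)
    show ?case
    proof (cases "x \<in> K r")
      case True
      then have "(\<lambda>l. \<zeta> x * lev ?X c a l x) sums (\<zeta> x * (complex_of_real (\<phi> r x) * g x))"
        using elim(1) by (intro sums_mult) blast
      moreover have "\<zeta> x * (complex_of_real (\<phi> r x) * g x) = complex_of_real (\<phi> r x) * g x"
        using \<zeta>(3) supp_nonzero[of r x] by auto
      ultimately show ?thesis unfolding lev'[OF elim(2)] by (simp add: sums_iff)
    next
      case False
      have "\<zeta> x = 0" using \<zeta>(4) False by blast
      moreover have "\<phi> r x = 0" using supp_nonzero[of r x] unityD(2)[of r] r False by auto
      ultimately show ?thesis unfolding lev'[OF elim(2)] by simp
    qed
  qed
  moreover have "(\<lambda>x. complex_of_real (\<phi> r x) * g x) \<in> borel_measurable ?S"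
  proof -
    have "C_k 0 (\<phi> r)" using unityD(1)[of r] r unfolding smooth_def by auto
    then have "continuous_on UNIV (\<lambda>x. complex_of_real (\<phi> r x))"
      by (intro continuous_on_of_real C_k_imp_continuous)
    then have "(\<lambda>x. complex_of_real (\<phi> r x)) \<in> borel_measurable ?S"
      by (intro surface_measure_sets(3) borel_measurable_continuous_onI)
    then show ?thesis using gm by (rule borel_measurable_times)
  qed
  moreover have "AE x in lebesgue_on \<Omega>. (\<Sum>l. lev \<Omega> c' a' l x) = (\<Sum>l. lev \<Omega> c' a' l x)" by simp
  ultimately have "trace_expansion d k ?s p q \<Omega> c' a' (\<lambda>x. \<Sum>l. lev \<Omega> c' a' l x) (\<lambda>x. complex_of_real (\<phi> r x) * g x)"
    using a' bc' unfolding trace_expansion_def by blast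
  then show ?thesis by blast
qed

lemma trace_extension:
  assumes p: "0 < p" and q: "0 < q" and s: "0 < s" "s < 1" and d: "1 \<le> d" and d': "1 \<le> d'" and k': "1 \<le> k'"
    and g: "g \<in> besov_boundary d' k' s p q \<Omega> N K \<psi> \<phi>"
  shows "\<exists>f. has_trace d k (s + enn2real (1 / p)) p q \<Omega> f g"
proof -
  let ?S = "surface_measure (frontier \<Omega>)" and ?s = "s + enn2real (1 / p)"
  have s': "0 < ?s" "enn2real (1 / p) < ?s" using s by (simp_all add: add_pos_nonneg)
  have d0: "0 < d" using d by simp
  have "\<exists>f c a. trace_expansion d k ?s p q \<Omega> c a f (\<lambda>x. \<Sum>r\<in>{1..n}. complex_of_real (\<phi> r x) * g x)" if "n \<le> N" for n
    using that
  proof (induction n)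
    case 0
    then show ?case using trace_expansion_0[OF p q dom(2)] by (simp, blast)
  next
    case (Suc n)
    obtain f c a where 1: "trace_expansion d k ?s p q \<Omega> c a f (\<lambda>x. \<Sum>r\<in>{1..n}. complex_of_real (\<phi> r x) * g x)"
      using Suc by auto
    obtain f' c' a' where 2: "trace_expansion d k ?s p q \<Omega> c' a' f' (\<lambda>x. complex_of_real (\<phi> (Suc n) x) * g x)"
      using local_extension[OF p q s d d' k' g, of "Suc n" k] Suc.prems by auto
    have "(\<lambda>x. \<Sum>r\<in>{1..Suc n}. complex_of_real (\<phi> r x) * g x)
      = (\<lambda>x. (\<Sum>r\<in>{1..n}. complex_of_real (\<phi> r x) * g x) + complex_of_real (\<phi> (Suc n) x) * g x)"
      by (rule ext) simp
    then show ?case using trace_expansion_add[OF p q d0 atlas dom s'(2) 1 2] by (simp only:) blast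
  qed
  then obtain f c a where ex: "trace_expansion d k ?s p q \<Omega> c a f (\<lambda>x. \<Sum>r\<in>{1..N}. complex_of_real (\<phi> r x) * g x)" by blast
  have "AE x in ?S. x \<in> frontier \<Omega>" by (rule AE_I2) (simp add: surface_measure_sets(2))
  then have "AE x in ?S. g x = (\<Sum>j. lev \<Omega> c a j x)"
    using trace_expansionD(5)[OF ex]
  proof eventually_elim
    case (elim x)
    have "(\<Sum>r\<in>{1..N}. complex_of_real (\<phi> r x) * g x) = complex_of_real (\<Sum>r\<in>{1..N}. \<phi> r x) * g x"
      by (simp add: sum_distrib_right)
    then show ?case using elim(2) unfolding sum_unity[OF elim(1)] by (simp only: of_real_1 mult_1_left)
  qed
  moreover have "g \<in> borel_measurable ?S" using g unfolding besov_boundary_def lp_space_def by blast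
  ultimately have "trace_expansion d k ?s p q \<Omega> c a f g" using ex unfolding trace_expansion_def by blast
  then show ?thesis using has_trace_of_expansion[OF atlas dom p q d s'(2)] by blast
qed

end


theorem theorem4p11:
  fixes \<Omega> :: "('a::euclidean_space \<times> real) set"
    and K :: "nat \<Rightarrow> ('a \<times> real) set"
    and \<psi> :: "nat \<Rightarrow> 'a \<times> real \<Rightarrow> 'a \<times> real"
    and \<phi> :: "nat \<Rightarrow> 'a \<times> real \<Rightarrow> real"
    and N k k' :: nat
    and s d d' :: real
    and p q :: ennreal
  assumes "bounded_lipschitz_domain \<Omega>"
    and "lipschitz_atlas \<Omega> N K \<psi>"
    and "resolution_of_unity \<Omega> N K \<phi>"
    and "0 < s" and "s < 1"
    and "0 < p" and "0 < q"
    and "1 < d" and "int k \<ge> 1 + \<lfloor>s + enn2real (1 / p)\<rfloor>"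
    and "1 < d'" and "int k' \<ge> 1 + \<lfloor>s\<rfloor>"
  shows "trace_image_eq d k (s + enn2real (1 / p)) p q \<Omega>
           (besov_boundary d' k' s p q \<Omega> N K \<psi> \<phi>)"
proof -
  have dom: "open \<Omega>" "bounded \<Omega>" using assms(1) unfolding bounded_lipschitz_domain_def by blast+
  have "0 \<le> \<lfloor>s + enn2real (1 / p)\<rfloor>" "0 \<le> \<lfloor>s\<rfloor>" using assms(4) by simp_all
  then have k: "1 \<le> k" "1 \<le> k'" using assms(9,11) by linarith+
  have d: "1 \<le> d" "0 < d" "1 \<le> d'" using assms(8,10) by simp_all
  let ?s = "s + enn2real (1 / p)"
  have s: "0 < ?s" "enn2real (1 / p) < ?s" using assms(4) by (simp_all add: add_pos_nonneg)
  show ?thesis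
    unfolding trace_image_eq_def
  proof (intro conjI ballI allI impI)
    fix f assume "f \<in> besov d k ?s p q \<Omega>"
    then obtain coef a where "trace_expansion d k ?s p q \<Omega> coef a f (\<lambda>x. \<Sum>j. lev \<Omega> coef a j x)"
      by (rule trace_expansion_of_besov[OF assms(2) dom assms(6,7) s(1) d(2)]) (rule that)
    then show "\<exists>g. has_trace d k ?s p q \<Omega> f g"
      using has_trace_of_expansion[OF assms(2) dom assms(6,7) d(1) s(2)] by blast
  next
    fix f g g' assume "has_trace d k ?s p q \<Omega> f g \<and> has_trace d k ?s p q \<Omega> f g'"
    then show "AE x in surface_measure (frontier \<Omega>). g x = g' x"
      using has_trace_unique[OF assms(2) dom assms(6)] by blast
  next
    show "{g. \<exists>f\<in>besov d k ?s p q \<Omega>. has_trace d k ?s p q \<Omega> f g} = besov_boundary d' k' s p q \<Omega> N K \<psi> \<phi>"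
    proof (intro equalityI subsetI)
      fix g assume "g \<in> {g. \<exists>f\<in>besov d k ?s p q \<Omega>. has_trace d k ?s p q \<Omega> f g}"
      then obtain f where "has_trace d k ?s p q \<Omega> f g" by blast
      then show "g \<in> besov_boundary d' k' s p q \<Omega> N K \<psi> \<phi>"
        by (rule trace_in_besov_boundary[OF assms(2) dom assms(3,6,7,4,5) d(1,3) k(1)])
    next
      fix g assume "g \<in> besov_boundary d' k' s p q \<Omega> N K \<psi> \<phi>"
      then obtain f where f: "has_trace d k ?s p q \<Omega> f g"
        using trace_extension[OF assms(2) dom assms(3,6,7,4,5) d(1,3) k(2)] by blast
      then have "f \<in> besov d k ?s p q \<Omega>" unfolding has_trace_def by blast
      then show "g \<in> {g. \<exists>f\<in>besov d k ?s p q \<Omega>. has_trace d k ?s p q \<Omega> f g}" using f by blast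
    qed
  qed
qed

end
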